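(* Let $(\pi,V)$ be an irreducible admissible genuine supercuspidal representation of $\overline{S}$, let $\{l^\xi\}_{\xi\in k(\pi)}$ be a fixed family of nonzero $\psi^\xi$-Whittaker functionals on $V$, and fix a complete set $R$ of representatives of $k(\pi)/(k^\times)^2$. Let $v\in V$ and let $\mu$ be a character of $k^\times$. Then for every $\xi\in k(\pi)$ and every $s\in\mathbb{C}$, $$Z(s,\mu,l^\xi,\pi(w)v)=\frac14\sum_{\eta\in R}|\eta|\,\Gamma^{\xi,\eta}_{\pi,\mu}(s)\,Z(1-s,\mu^{-1},l^\eta,v).$$
   Context: Let $k$ be a non-archimedean local field of characteristic $0$ with ring of integers $O$, maximal ideal $P$, uniformizer $\varpi$, residue field of odd cardinality $q$, and normalized absolute value $|\cdot|$ ($|\varpi|=q^{-1}$). Fix a nontrivial additive character $\psi$ of $k$ trivial on $O$ and nontrivial on $P^{-1}$; $dx$ is the self-dual Haar measure on $k$ (so $\mathrm{vol}(O)=1$) and $d^\times x=dx/|x|$. For $\xi\in k^\times$ put $\psi^\xi(a)=\psi(\xi a)$. Let $(a,b)$ denote the Hilbert symbol of $k$. For $g=\begin{pmatrix}a&b\\c&d\end{pmatrix}\in S=\mathrm{SL}_2(k)$ put $\chi(g)=c$ if $c\neq0$ and $\chi(g)=d$ if $c=0$, and $\{g,h\}=\big(\chi(gh)/\chi(g),\chi(gh)/\chi(h)\big)$. The metaplectic cover $\overline{S}$ is the set of pairs $[g,\epsilon]$, $g\in S$, $\epsilon\in\{\pm1\}$, with product $[g,\epsilon_1][h,\epsilon_2]=[gh,\{g,h\}\epsilon_1\epsilon_2]$.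 Write $n(x)=[\begin{pmatrix}1&x\\0&1\end{pmatrix},1]$, $\underline{x}=[\begin{pmatrix}x&0\\0&x^{-1}\end{pmatrix},1]$ ($x\in k^\times$), $w=[\begin{pmatrix}0&-1\\1&0\end{pmatrix},1]$, $e$ the identity. The Weil constant $\alpha_\psi(a)$ ($a\in k^\times$) is defined by $\int_k\hat\Phi(x)\psi(ax^2)dx=|a|^{-1/2}\alpha_\psi(a)\int_k\Phi(x)\psi(-a^{-1}x^2)dx$ for all $\Phi\in C_c^\infty(k)$, where $\hat\Phi(y)=\int_k\Phi(x)\psi(-2yx)dx$; set $\chi_\psi(a)=\alpha_\psi(1)/\alpha_\psi(a)$. A representation $\pi$ of $\overline{S}$ is genuine if $\pi([1,-1])=-\mathrm{id}$; it is supercuspidal if for each $v\in V$ there is $n\in\mathbb{Z}$ with $\int_{P^n}\pi(n(x))v\,dx=0$. A $\psi^\xi$-Whittaker functional is a linear form $l$ on $V$ with $l(\pi(n(a))v)=\psi(\xi a)l(v)$ for all $a\in k$, $v\in V$; such functionals are unique up to scalars. $k(\pi)$ is the set of $\xi\in k^\times$ admitting a nonzero $\psi^\xi$-Whittaker functional (a union of square classes). Put $W^\xi_v(g)=l^\xi(\pi(g)v)$. Bessel function: for $\xi,\eta\in k(\pi)$ and $x\in k^\times$ it is known that $\lim_{n\to\infty}\int_{P^{-n}}W^\xi_v(\underline{x}w\,n(y))\psi(-\eta y)dy$ exists for every $v\in V$ and defines a $\psi^\eta$-Whittaker functional; $J^{\xi,\eta}_\pi(\underline{x}w)\in\mathbb{C}$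 is the unique number with this limit equal to $J^{\xi,\eta}_\pi(\underline{x}w)\,W^\eta_v(e)$ for all $v$. For a character $\mu$ of $k^\times$, the gamma factor is $$\Gamma^{\xi,\eta}_{\pi,\mu}(s)=\lim_{n,m\to\infty}2\int_{P^{-n}\setminus P^m}J^{\xi,\eta}_\pi(\underline{x}w)\chi_\psi(x)\mu(x)|x|^{s-1/2}d^\times x$$ (the limit exists for all $s$). The local zeta function is $$Z(s,\mu,l^\xi,v)=2\int_{k^\times}W^\xi_v(\underline{x})\chi_\psi(x)\mu(x)|x|^{s-1/2}d^\times x$$ (absolutely convergent for all $s\in\mathbb{C}$). *)

theory Defs
  imports "HOL-Analysis.Analysis" "HOL-Algebra.Group"
begin

section \<open>Non-archimedean local fields\<close>

class nonarch_field = field + metric_space +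
  fixes nabs :: "'a \<Rightarrow> real"
  assumes dist_nabs: "dist x y = nabs (x - y)"
    and nabs_mult: "nabs (x * y) = nabs x * nabs y"
    and nabs_add: "nabs (x + y) \<le> max (nabs x) (nabs y)"

definition (in nonarch_field) ring_of_integers :: "'a set" where
  "ring_of_integers = {x. nabs x \<le> 1}"

definition (in nonarch_field) maximal_ideal :: "'a set" where
  "maximal_ideal = {x. nabs x < 1}"

definition (in nonarch_field) residue_card :: "'a itself \<Rightarrow> nat" where
  "residue_card _ = card ((ring_of_integers :: 'a set) //
     {(x, y). x \<in> ring_of_integers \<and> y \<in> ring_of_integers \<and> x - y \<in> maximal_ideal})"

definition (in nonarch_field) uniformizer :: "'a \<Rightarrow> bool" where
  "uniformizer p \<longleftrightarrow> p \<noteq> 0 \<and> maximal_ideal = (\<lambda>x. p * x) ` ring_of_integers"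

text \<open>Existence of a uniformizer excludes the trivial absolute value; compactness of the ring of
  integers is local compactness (hence completeness and finiteness of the residue field); and
  \<open>nabs\<close> is the normalized absolute value.  The characteristic is not restricted here.\<close>

class nonarch_local_field = nonarch_field +
  assumes compact_ring_of_integers: "compact (ring_of_integers :: 'a set)"
    and normalized_uniformizer:
      "\<exists>p::'a. uniformizer p \<and> nabs p = 1 / real (residue_card TYPE('a))"

text \<open>The fractional ideal \<open>P\<^sup>n\<close>, for any integer \<open>n\<close>; note \<open>\<bar>p\<bar> = 1/q\<close> for a uniformizer \<open>p\<close>.\<close>

definition frac_ideal :: "int \<Rightarrow> 'k::nonarch_local_field set" where
  "frac_ideal n = {x. nabs x \<le> real (residue_card TYPE('k)) powi (- n)}"

definition additive_character :: "('k::nonarch_local_field \<Rightarrow> complex) \<Rightarrow> bool" where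
  "additive_character \<psi> \<longleftrightarrow>
     continuous_on UNIV \<psi> \<and> (\<forall>x. norm (\<psi> x) = 1) \<and> (\<forall>x y. \<psi> (x + y) = \<psi> x * \<psi> y)"

text \<open>Characters of the multiplicative group are not required to be unitary.\<close>

definition mult_character :: "('k::nonarch_local_field \<Rightarrow> complex) \<Rightarrow> bool" where
  "mult_character \<mu> \<longleftrightarrow> continuous_on (- {0}) \<mu> \<and> (\<forall>x. x \<noteq> 0 \<longrightarrow> \<mu> x \<noteq> 0) \<and>
     (\<forall>x y. x \<noteq> 0 \<longrightarrow> y \<noteq> 0 \<longrightarrow> \<mu> (x * y) = \<mu> x * \<mu> y)"

definition hilbert_symbol :: "'k::nonarch_local_field \<Rightarrow> 'k \<Rightarrow> int" where
  "hilbert_symbol a b =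
     (if \<exists>x y z. (x, y, z) \<noteq> (0, 0, 0) \<and> z\<^sup>2 = a * x\<^sup>2 + b * y\<^sup>2 then 1 else - 1)"


section \<open>Haar measure, Fourier transform, Weil constant\<close>

definition schwartz_bruhat :: "('k::nonarch_local_field \<Rightarrow> complex) set" where
  "schwartz_bruhat = {\<Phi>. (\<forall>x. \<forall>\<^sub>F y in nhds x. \<Phi> y = \<Phi> x) \<and> compact (closure {x. \<Phi> x \<noteq> 0})}"

definition fourier ::
  "('k \<Rightarrow> complex) \<Rightarrow> 'k measure \<Rightarrow> ('k::nonarch_local_field \<Rightarrow> complex) \<Rightarrow> 'k \<Rightarrow> complex" where
  "fourier \<psi> dx \<Phi> y = (LINT x|dx. \<Phi> x * \<psi> (- (2 * y * x)))"

definition haar_measure :: "'k::nonarch_local_field measure \<Rightarrow> bool" where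
  "haar_measure dx \<longleftrightarrow> sets dx = sets borel \<and> emeasure dx UNIV \<noteq> 0 \<and>
     (\<forall>K. compact K \<longrightarrow> emeasure dx K < \<infinity>) \<and>
     (\<forall>a. \<forall>A\<in>sets borel. emeasure dx ((\<lambda>x. a + x) ` A) = emeasure dx A)"

definition self_dual_haar_measure ::
  "('k \<Rightarrow> complex) \<Rightarrow> 'k::nonarch_local_field measure \<Rightarrow> bool" where
  "self_dual_haar_measure \<psi> dx \<longleftrightarrow> haar_measure dx \<and>
     (\<forall>\<Phi>\<in>schwartz_bruhat. \<forall>x. fourier \<psi> dx (fourier \<psi> dx \<Phi>) x = \<Phi> (- x))"

definition mult_measure :: "'k::nonarch_local_field measure \<Rightarrow> 'k measure" where
  "mult_measure dx = density dx (\<lambda>x. ennreal (1 / nabs x))"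

definition weil_constant ::
  "('k \<Rightarrow> complex) \<Rightarrow> 'k::nonarch_local_field measure \<Rightarrow> 'k \<Rightarrow> complex" where
  "weil_constant \<psi> dx a = (THE c. \<forall>\<Phi>\<in>schwartz_bruhat.
     (LINT x|dx. fourier \<psi> dx \<Phi> x * \<psi> (a * x\<^sup>2)) =
     of_real (nabs a powr (- 1 / 2)) * c * (LINT x|dx. \<Phi> x * \<psi> (- (inverse a * x\<^sup>2))))"

definition chi_psi ::
  "('k \<Rightarrow> complex) \<Rightarrow> 'k::nonarch_local_field measure \<Rightarrow> 'k \<Rightarrow> complex" where
  "chi_psi \<psi> dx a = weil_constant \<psi> dx 1 / weil_constant \<psi> dx a"


section \<open>The metaplectic cover of SL(2)\<close>

type_synonym 'k mp = "('k^2^2) \<times> int"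

definition mat2 :: "'k \<Rightarrow> 'k \<Rightarrow> 'k \<Rightarrow> 'k \<Rightarrow> 'k::nonarch_local_field^2^2" where
  "mat2 a b c d = vector [vector [a, b], vector [c, d]]"

definition kubota_chi :: "'k::nonarch_local_field^2^2 \<Rightarrow> 'k" where
  "kubota_chi g = (if g $ 2 $ 1 \<noteq> 0 then g $ 2 $ 1 else g $ 2 $ 2)"

definition kubota_cocycle :: "'k::nonarch_local_field^2^2 \<Rightarrow> 'k^2^2 \<Rightarrow> int" where
  "kubota_cocycle g h = hilbert_symbol (kubota_chi (g ** h) / kubota_chi g)
                                       (kubota_chi (g ** h) / kubota_chi h)"

definition Mp :: "'k::nonarch_local_field mp monoid" where
  "Mp = \<lparr> carrier = {g. det g = 1} \<times> {1, - 1},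
          mult = (\<lambda>(g, a) (h, b). (g ** h, kubota_cocycle g h * a * b)),
          one = (mat 1, 1) \<rparr>"

definition unip :: "'k::nonarch_local_field \<Rightarrow> 'k mp" where
  "unip x = (mat2 1 x 0 1, 1)"

definition torus :: "'k::nonarch_local_field \<Rightarrow> 'k mp" where
  "torus x = (mat2 x 0 0 (inverse x), 1)"

definition weyl :: "'k::nonarch_local_field mp" where
  "weyl = (mat2 0 (- 1) 1 0, 1)"

text \<open>Topology of the cover: for odd \<open>q\<close> the section \<open>g \<mapsto> (g, 1)\<close> is a homomorphism on the
  congruence subgroups of level \<open>n \<ge> 1\<close>, and the images of these form a neighbourhood basis of the
  identity.  A subgroup is open iff it contains one of them.\<close>

definition congruence_subgroup :: "nat \<Rightarrow> ('k::nonarch_local_field^2^2) set" where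
  "congruence_subgroup n =
     {g. det g = 1 \<and> (\<forall>i j. g $ i $ j - mat 1 $ i $ j \<in> frac_ideal (int n))}"

definition open_subgroup_Mp :: "'k::nonarch_local_field mp set \<Rightarrow> bool" where
  "open_subgroup_Mp H \<longleftrightarrow> subgroup H Mp \<and> (\<exists>n. \<forall>g\<in>congruence_subgroup n. (g, 1) \<in> H)"


section \<open>Representations\<close>

text \<open>The representation space is the type \<open>'v\<close> with complex scalar multiplication \<open>smul\<close>.\<close>

definition representation_Mp ::
  "(complex \<Rightarrow> 'v::ab_group_add \<Rightarrow> 'v) \<Rightarrow> ('k::nonarch_local_field mp \<Rightarrow> 'v \<Rightarrow> 'v) \<Rightarrow> bool" where
  "representation_Mp smul \<pi> \<longleftrightarrow> vector_space smul \<and>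
     (\<forall>g\<in>carrier Mp. Vector_Spaces.linear smul smul (\<pi> g)) \<and>
     \<pi> \<one>\<^bsub>Mp\<^esub> = id \<and>
     (\<forall>g\<in>carrier Mp. \<forall>h\<in>carrier Mp. \<pi> (g \<otimes>\<^bsub>Mp\<^esub> h) = \<pi> g \<circ> \<pi> h)"

definition fixed_vectors :: "('k mp \<Rightarrow> 'v \<Rightarrow> 'v) \<Rightarrow> 'k mp set \<Rightarrow> 'v set" where
  "fixed_vectors \<pi> H = {v. \<forall>h\<in>H. \<pi> h v = v}"

definition admissible_Mp ::
  "(complex \<Rightarrow> 'v::ab_group_add \<Rightarrow> 'v) \<Rightarrow> ('k::nonarch_local_field mp \<Rightarrow> 'v \<Rightarrow> 'v) \<Rightarrow> bool" where
  "admissible_Mp smul \<pi> \<longleftrightarrow>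
     (\<forall>v. \<exists>H. open_subgroup_Mp H \<and> v \<in> fixed_vectors \<pi> H) \<and>
     (\<forall>H. open_subgroup_Mp H \<longrightarrow>
        (\<exists>B. finite B \<and> fixed_vectors \<pi> H \<subseteq> module.span smul B))"

definition irreducible_Mp ::
  "(complex \<Rightarrow> 'v::ab_group_add \<Rightarrow> 'v) \<Rightarrow> ('k::nonarch_local_field mp \<Rightarrow> 'v \<Rightarrow> 'v) \<Rightarrow> bool" where
  "irreducible_Mp smul \<pi> \<longleftrightarrow> (\<exists>v::'v. v \<noteq> 0) \<and>
     (\<forall>W. module.subspace smul W \<and> (\<forall>g\<in>carrier Mp. \<pi> g ` W \<subseteq> W) \<longrightarrow> W = {0} \<or> W = UNIV)"

definition genuine_Mp :: "('k::nonarch_local_field mp \<Rightarrow> 'v::ab_group_add \<Rightarrow> 'v) \<Rightarrow> bool" where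
  "genuine_Mp \<pi> \<longleftrightarrow> (\<forall>v. \<pi> (mat 1, - 1) v = - v)"

text \<open>Integral over \<open>A\<close> of a \<open>'v\<close>-valued function with finitely many values on \<open>A\<close> (cf.
  \<open>simple_bochner_integral\<close>).  It is used for \<open>x \<mapsto> \<pi> (unip x) v\<close> on the compact sets \<open>P\<^sup>n\<close>, where
  smoothness of \<open>\<pi>\<close> makes this function locally constant, so finitely valued.\<close>

definition simple_integral ::
  "(complex \<Rightarrow> 'v::ab_group_add \<Rightarrow> 'v) \<Rightarrow> 'k measure \<Rightarrow> 'k set \<Rightarrow> ('k \<Rightarrow> 'v) \<Rightarrow> 'v" where
  "simple_integral smul dx A f =
     (\<Sum>u\<in>f ` A. smul (of_real (measure dx {x \<in> A. f x = u})) u)"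

definition supercuspidal_Mp ::
  "'k measure \<Rightarrow> (complex \<Rightarrow> 'v::ab_group_add \<Rightarrow> 'v) \<Rightarrow>
   ('k::nonarch_local_field mp \<Rightarrow> 'v \<Rightarrow> 'v) \<Rightarrow> bool" where
  "supercuspidal_Mp dx smul \<pi> \<longleftrightarrow>
     (\<forall>v. \<exists>n. simple_integral smul dx (frac_ideal n) (\<lambda>x. \<pi> (unip x) v) = 0)"


section \<open>Whittaker functionals, Bessel functions, gamma factors, zeta functions\<close>

definition whittaker_functional ::
  "('k \<Rightarrow> complex) \<Rightarrow> (complex \<Rightarrow> 'v::ab_group_add \<Rightarrow> 'v) \<Rightarrow>
   ('k::nonarch_local_field mp \<Rightarrow> 'v \<Rightarrow> 'v) \<Rightarrow> 'k \<Rightarrow> ('v \<Rightarrow> complex) \<Rightarrow> bool" where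
  "whittaker_functional \<psi> smul \<pi> \<xi> l \<longleftrightarrow> Vector_Spaces.linear smul (*) l \<and>
     (\<forall>a v. l (\<pi> (unip a) v) = \<psi> (\<xi> * a) * l v)"

definition whittaker_support ::
  "('k \<Rightarrow> complex) \<Rightarrow> (complex \<Rightarrow> 'v::ab_group_add \<Rightarrow> 'v) \<Rightarrow>
   ('k::nonarch_local_field mp \<Rightarrow> 'v \<Rightarrow> 'v) \<Rightarrow> 'k set" where
  "whittaker_support \<psi> smul \<pi> =
     {\<xi>. \<xi> \<noteq> 0 \<and> (\<exists>l. whittaker_functional \<psi> smul \<pi> \<xi> l \<and> (\<exists>v. l v \<noteq> 0))}"

definition square_class_representatives :: "'k::nonarch_local_field set \<Rightarrow> 'k set \<Rightarrow> bool" where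
  "square_class_representatives R X \<longleftrightarrow>
     R \<subseteq> X \<and> (\<forall>\<xi>\<in>X. \<exists>!\<eta>. \<eta> \<in> R \<and> (\<exists>a. a \<noteq> 0 \<and> \<xi> = \<eta> * a\<^sup>2))"

definition whittaker_function ::
  "('k mp \<Rightarrow> 'v \<Rightarrow> 'v) \<Rightarrow> ('v \<Rightarrow> complex) \<Rightarrow> 'v \<Rightarrow> 'k mp \<Rightarrow> complex" where
  "whittaker_function \<pi> l v g = l (\<pi> g v)"

text \<open>For \<open>bessel\<close> and \<open>gamma_factor\<close>, \<open>l\<close> is the whole family \<open>\<xi> \<mapsto> l\<^sup>\<xi>\<close>; for \<open>zeta_integral\<close> it
  is a single functional. \<open>bessel \<psi> dx \<pi> l \<xi> \<eta> x\<close> is the value of the Bessel function at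
  \<open>torus x \<otimes> weyl\<close>.\<close>

definition bessel ::
  "('k \<Rightarrow> complex) \<Rightarrow> 'k measure \<Rightarrow> ('k::nonarch_local_field mp \<Rightarrow> 'v \<Rightarrow> 'v) \<Rightarrow>
   ('k \<Rightarrow> 'v \<Rightarrow> complex) \<Rightarrow> 'k \<Rightarrow> 'k \<Rightarrow> 'k \<Rightarrow> complex" where
  "bessel \<psi> dx \<pi> l \<xi> \<eta> x = (THE c. \<forall>v.
     (\<lambda>n. LINT y:frac_ideal (- int n)|dx.
        whittaker_function \<pi> (l \<xi>) v (torus x \<otimes>\<^bsub>Mp\<^esub> weyl \<otimes>\<^bsub>Mp\<^esub> unip y) * \<psi> (- (\<eta> * y)))
     \<longlonglongrightarrow> c * whittaker_function \<pi> (l \<eta>) v \<one>\<^bsub>Mp\<^esub>)"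

definition gamma_factor ::
  "('k \<Rightarrow> complex) \<Rightarrow> 'k measure \<Rightarrow> ('k::nonarch_local_field mp \<Rightarrow> 'v \<Rightarrow> 'v) \<Rightarrow>
   ('k \<Rightarrow> 'v \<Rightarrow> complex) \<Rightarrow> 'k \<Rightarrow> 'k \<Rightarrow> ('k \<Rightarrow> complex) \<Rightarrow> complex \<Rightarrow> complex" where
  "gamma_factor \<psi> dx \<pi> l \<xi> \<eta> \<mu> s = Lim (sequentially \<times>\<^sub>F sequentially) (\<lambda>(n, m).
     2 * (LINT x:(frac_ideal (- int n) - frac_ideal (int m))|mult_measure dx.
       bessel \<psi> dx \<pi> l \<xi> \<eta> x * chi_psi \<psi> dx x * \<mu> x * of_real (nabs x) powr (s - 1 / 2)))"

definition zeta_integral ::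
  "('k \<Rightarrow> complex) \<Rightarrow> 'k measure \<Rightarrow> ('k::nonarch_local_field mp \<Rightarrow> 'v \<Rightarrow> 'v) \<Rightarrow>
   complex \<Rightarrow> ('k \<Rightarrow> complex) \<Rightarrow> ('v \<Rightarrow> complex) \<Rightarrow> 'v \<Rightarrow> complex" where
  "zeta_integral \<psi> dx \<pi> s \<mu> l v = 2 * (LINT x:(- {0})|mult_measure dx.
     whittaker_function \<pi> l v (torus x) * chi_psi \<psi> dx x * \<mu> x * of_real (nabs x) powr (s - 1 / 2))"

end

theory Submission
  imports Defs "HOL-Computational_Algebra.Fundamental_Theorem_Algebra"
begin

text \<open>
  For a Whittaker functional \<open>L\<close> at \<open>\<xi>\<close> the function \<open>y \<mapsto> L (\<pi> (x w n(y)) v)\<close> is a step function: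
  supercuspidality kills it for large \<open>y\<close>. Its Fourier transform at \<open>\<zeta>\<close> is a Whittaker functional at \<open>\<zeta>\<close>,
  hence a Bessel value times the chosen one, and Fourier inversion at \<open>y = 0\<close> writes \<open>L (\<pi> (x w) v)\<close>
  as an integral of these over \<open>\<zeta>\<close>. Splitting into square classes \<open>\<zeta> = \<eta> a\<^sup>2\<close> (a two-to-one map with
  Jacobian \<open>\<bar>\<eta>\<bar> \<bar>a\<bar>\<close>) and using \<open>\<chi>\<^sub>\<psi>(x) \<chi>\<^sub>\<psi>(a) = \<chi>\<^sub>\<psi>(x a) (x, a)\<close> to absorb the Hilbert symbols, one finds
  that on the shells \<open>\<bar>x\<bar> = q\<^sup>-\<^sup>j\<close> the zeta integrand of \<open>\<pi>(w) v\<close> is a multiplicative convolution of the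
  gamma integrand with the dual zeta integrand of \<open>v\<close>. A vector whose Whittaker
  functions are supported in a single shell shows that almost all shell integrals of the gamma integrand
  vanish, so summing over the shells is legitimate.

  That the functionals at \<open>\<eta>\<close> form a line is derived from the operators \<open>T \<eta> t\<close> sending \<open>L\<close> to the
  Fourier transform at \<open>\<eta>\<close> of \<open>y \<mapsto> L (\<pi> (t w n(y)) v)\<close>. They commute, because the kernel of
  \<open>T \<eta> a \<circ> T \<eta> (x a)\<close> is symmetric under \<open>x \<mapsto> 1/x\<close>. If a nonzero \<open>T\<close>-stable space of functionals vanishes at \<open>v\<close>,
  then it vanishes on the whole orbit of \<open>v\<close> localised near \<open>\<eta>\<close>, so by irreducibility that localisation is 0 and
  all functionals at \<open>\<eta>\<close> vanish at \<open>v\<close>. Since finitely many values determine a functional, \<open>T \<eta> t\<close> has an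
  eigenvector; applied to its eigenspace the previous remark shows that \<open>T \<eta> t\<close> is a scalar, and applied to a line
  that the line is everything.
\<close>

text \<open>After truncation every integrand is locally constant with compact support, so an
  integral is a finite sum over cosets of \<open>PP n\<close>, and Fubini or a substitution
  rearranges such a sum. The labour lies in finding supports and levels of invariance that are
  uniform in the remaining variables. \<open>bessel\<close> is a definite description and
  \<open>gamma_factor\<close> a limit; neither can be evaluated before the functionals at \<eta> are
  known to form a line and the truncated integrals are known to become stationary. The product rule
  for \<chi> needs the actual values of the Weil constants. They are found as Gauss sums, separated
  by the parity of the valuation and compared with the Hilbert symbol in each case. The composition
  formula for \<open>T\<close> excludes x = 1 and x = -1, because the localised vector itself then
  contributes near z = 0; commutation in these cases comes from the scalar action of t(-1). The
  constant 1/4: the zeta integral on the left contributes 2, the two-to-one map 1/2, and the factors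
  2 inside the gamma factor and the dual zeta integral must be divided out, 2 * 1/2 * 1/4.\<close>

lemma nabs_eq_0_iff [simp]: "nabs (x::'k::nonarch_field) = 0 \<longleftrightarrow> x = 0"
  by (metis diff_zero dist_eq_0_iff dist_nabs)

lemma nabs_0 [simp]: "nabs (0::'k::nonarch_field) = 0" by simp

lemma nabs_nonneg [simp]: "nabs (x::'k::nonarch_field) \<ge> 0"
  using dist_nabs[of x 0] by (metis diff_zero zero_le_dist)

lemma nabs_1 [simp]: "nabs (1::'k::nonarch_field) = 1"
  using nabs_mult[of "1::'k" 1] nabs_eq_0_iff[of "1::'k"] by simp

lemma nabs_minus [simp]: "nabs (- x) = nabs (x::'k::nonarch_field)"
  using dist_nabs[of x 0] dist_nabs[of 0 x] dist_commute[of x 0] by simp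

lemma nabs_diff_commute: "nabs (x - y) = nabs (y - (x::'k::nonarch_field))"
  using nabs_minus[of "x - y"] by simp

lemma nabs_power: "nabs (x ^ n) = nabs (x::'k::nonarch_field) ^ n"
  by (induction n) (auto simp: nabs_mult)

lemma nabs_inverse: "nabs (inverse x) = inverse (nabs (x::'k::nonarch_field))"
proof (cases "x = 0")
  case False
  then have "nabs x * nabs (inverse x) = 1"
    by (metis nabs_mult nabs_1 right_inverse)
  then show ?thesis by (metis inverse_unique)
qed simp

lemma nabs_powi: "nabs (x powi n) = nabs (x::'k::nonarch_field) powi n"
  by (simp add: power_int_def nabs_power nabs_inverse)

lemma nabs_add_le: "nabs x \<le> c \<Longrightarrow> nabs y \<le> c \<Longrightarrow> nabs (x + y) \<le> c" for x y :: "'k::nonarch_field"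
  using nabs_add[of x y] by linarith

lemma nabs_diff_le: "nabs x \<le> c \<Longrightarrow> nabs y \<le> c \<Longrightarrow> nabs (x - y) \<le> c" for x y :: "'k::nonarch_field"
  using nabs_add_le[of x c "- y"] by simp

lemma nabs_add_eq: "nabs y < nabs x \<Longrightarrow> nabs (x + y) = nabs x" for x y :: "'k::nonarch_field"
  using nabs_add[of x y] nabs_add[of "x + y" "- y"] by auto

lemma nabs_of_nat_le: "nabs (of_nat n :: 'k::nonarch_field) \<le> 1"
  by (induction n) (auto intro: nabs_add_le)

section \<open>Residue cardinality, value group and valuation\<close>

abbreviation qcard :: "'k::nonarch_local_field itself \<Rightarrow> real" where
  "qcard t \<equiv> real (residue_card t)"

lemma qcard_gt_1: "qcard TYPE('k::nonarch_local_field) > 1"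
proof -
  obtain p :: 'k where p: "uniformizer p" "nabs p = 1 / qcard TYPE('k)"
    using normalized_uniformizer by blast
  have "p \<noteq> 0" using p by (auto simp: uniformizer_def)
  then have 1: "nabs p > 0" by (metis less_eq_real_def nabs_eq_0_iff nabs_nonneg)
  have "p \<in> (\<lambda>x. p * x) ` ring_of_integers"
    by (rule image_eqI[of _ _ 1]) (auto simp: ring_of_integers_def)
  then have "p \<in> maximal_ideal" using p by (auto simp: uniformizer_def)
  then have "nabs p < 1" by (auto simp: maximal_ideal_def)
  then have "1 / qcard TYPE('k) < 1" "qcard TYPE('k) > 0"
    using p 1 by auto
  then show ?thesis by (simp add: divide_simps split: if_splits)
qed

lemma qcard_pos [simp]: "qcard TYPE('k::nonarch_local_field) > 0" "residue_card TYPE('k) > 0"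
  using qcard_gt_1[where 'k='k] by linarith+

definition unif :: "'k::nonarch_local_field" where
  "unif = (SOME p. uniformizer p \<and> nabs p = 1 / qcard TYPE('k))"

lemma unif: "uniformizer (unif::'k::nonarch_local_field)" "nabs (unif::'k) = inverse (qcard TYPE('k))"
  using someI_ex[OF normalized_uniformizer[where ?'a='k]]
  by (auto simp: unif_def inverse_eq_divide)

lemma unif_nz [simp]: "(unif::'k::nonarch_local_field) \<noteq> 0"
  using unif(1) by (auto simp: uniformizer_def)

lemma nabs_unif_powi: "nabs ((unif::'k::nonarch_local_field) powi n) = qcard TYPE('k) powi (- n)"
  by (simp add: nabs_powi unif power_int_minus power_int_inverse)

text \<open>The gap below 1 in the value group: the maximal ideal is \<open>unif\<close> times the
  integers, so no value lies strictly between 1/q and 1. Integrality of the valuation rests on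
  this.\<close>

lemma nabs_less_1: "nabs (x::'k::nonarch_local_field) < 1 \<Longrightarrow> nabs x \<le> inverse (qcard TYPE('k))"
proof -
  assume "nabs x < 1"
  then have "x \<in> (\<lambda>x. unif * x) ` ring_of_integers"
    using unif(1) by (auto simp: uniformizer_def maximal_ideal_def)
  then obtain y where "x = unif * y" "nabs y \<le> 1" by (auto simp: ring_of_integers_def)
  then show ?thesis by (simp add: nabs_mult unif mult_left_le)
qed

lemma nabs_eq_powi:
  assumes "(x::'k::nonarch_local_field) \<noteq> 0" shows "\<exists>n. nabs x = qcard TYPE('k) powi n"
proof -
  let ?q = "qcard TYPE('k)"
  have q: "?q > 1" by (rule qcard_gt_1)
  have pos: "nabs x > 0" using assms by (metis less_eq_real_def nabs_eq_0_iff nabs_nonneg)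
  define n where "n = \<lfloor>log ?q (nabs x)\<rfloor>"
  have 1: "?q powi n \<le> nabs x"
  proof -
    have "?q powr of_int n \<le> ?q powr (log ?q (nabs x))"
      unfolding n_def using q by (intro powr_mono) auto
    then show ?thesis using q pos by (simp add: powr_real_of_int' powr_log_cancel del: powr_of_int)
  qed
  have 2: "nabs x < ?q powi (n + 1)"
  proof -
    have "?q powr (log ?q (nabs x)) < ?q powr of_int (n+1)"
      unfolding n_def using q by (intro powr_less_mono) linarith+
    then show ?thesis using q pos by (simp add: powr_real_of_int' powr_log_cancel del: powr_of_int of_int_add)
  qed
  \<comment> \<open>This scaling brings the absolute value just below 1; the gap then improves the
    strict bound q^(n+1) to q^n, which meets the lower bound.\<close>
  define y where "y = x * unif powi (n + 1)"
  have "nabs y = nabs x * ?q powi (- (n + 1))" by (simp only: y_def nabs_mult nabs_unif_powi)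
  then have ny: "nabs y = nabs x / ?q powi (n+1)" by (metis divide_inverse power_int_minus)
  then have "nabs y < 1" using 2 q by (simp add: divide_less_eq)
  then have "nabs y \<le> inverse ?q" by (rule nabs_less_1)
  then have "nabs x \<le> ?q powi n" using q ny
    by (simp add: power_int_add field_simps)
  with 1 show ?thesis by (intro exI[of _ n]) auto
qed

lemma q_powi_le_iff: "qcard TYPE('k::nonarch_local_field) powi m \<le> qcard TYPE('k) powi n \<longleftrightarrow> m \<le> n"
  using qcard_gt_1[where 'k='k] by (smt (verit) power_int_strict_increasing power_int_increasing)

lemma q_powi_eq_iff: "qcard TYPE('k::nonarch_local_field) powi m = qcard TYPE('k) powi n \<longleftrightarrow> m = n"
  by (metis q_powi_le_iff order_antisym order_refl)

text \<open>The value at 0 is junk.\<close>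

definition vl :: "'k::nonarch_local_field \<Rightarrow> int" where
  "vl x = (THE n. nabs x = qcard TYPE('k) powi (- n))"

lemma nabs_vl: assumes "(x::'k::nonarch_local_field) \<noteq> 0" shows "nabs x = qcard TYPE('k) powi (- vl x)"
proof -
  obtain n where "nabs x = qcard TYPE('k) powi n" using nabs_eq_powi[OF assms] by blast
  then have "\<exists>!m. nabs x = qcard TYPE('k) powi (-m)"
    by (intro ex1I[of _ "-n"]) (auto simp: q_powi_eq_iff)
  then show ?thesis unfolding vl_def by (rule theI')
qed

lemma vlI: "nabs x = qcard TYPE('k) powi (- n) \<Longrightarrow> vl (x::'k::nonarch_local_field) = n"
  unfolding vl_def by (rule the_equality) (auto simp: q_powi_eq_iff)

lemma vl_mult: "x \<noteq> 0 \<Longrightarrow> y \<noteq> 0 \<Longrightarrow> vl (x * y) = vl x + vl (y::'k::nonarch_local_field)"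
  by (rule vlI) (use qcard_pos[where 'k='k] in \<open>simp add: nabs_mult nabs_vl power_int_add power_int_diff power_int_minus field_simps\<close>)

lemma vl_1 [simp]: "vl (1::'k::nonarch_local_field) = 0" by (rule vlI) simp
lemma vl_minus [simp]: "vl (- x) = vl (x::'k::nonarch_local_field)" by (simp add: vl_def)
lemma vl_diff_commute: "vl (x - y) = vl (y - (x::'k::nonarch_local_field))" by (metis minus_diff_eq vl_minus)
lemma vl_inverse: "x \<noteq> 0 \<Longrightarrow> vl (inverse x) = - vl (x::'k::nonarch_local_field)"
  using vl_mult[of x "inverse x"] by simp
lemma vl_divide: "x \<noteq> 0 \<Longrightarrow> y \<noteq> 0 \<Longrightarrow> vl (x / y) = vl x - vl (y::'k::nonarch_local_field)"
  by (simp add: divide_inverse vl_mult vl_inverse)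
lemma vl_power: "x \<noteq> 0 \<Longrightarrow> vl (x ^ n) = int n * vl (x::'k::nonarch_local_field)"
  by (induction n) (auto simp: vl_mult algebra_simps)
lemma vl_unif_powi [simp]: "vl ((unif::'k::nonarch_local_field) powi n) = n"
  by (rule vlI) (simp only: nabs_unif_powi)
lemma vl_eq_iff: "(x::'k) \<noteq> 0 \<Longrightarrow> y \<noteq> 0 \<Longrightarrow> vl x = vl y \<longleftrightarrow> nabs x = nabs (y::'k::nonarch_local_field)"
  by (simp add: nabs_vl q_powi_eq_iff)

section \<open>Fractional ideals and the topology they define\<close>

abbreviation PP :: "int \<Rightarrow> 'k::nonarch_local_field set" where "PP \<equiv> frac_ideal"

lemma mem_PP: "x \<in> PP n \<longleftrightarrow> x = 0 \<or> n \<le> vl (x::'k::nonarch_local_field)"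
  by (cases "x = 0") (auto simp: frac_ideal_def nabs_vl q_powi_le_iff)

lemma PP_0 [simp]: "0 \<in> PP n" by (simp add: mem_PP)
lemma PP_add: "x \<in> PP n \<Longrightarrow> y \<in> PP n \<Longrightarrow> x + y \<in> PP n" by (auto simp: frac_ideal_def intro: nabs_add_le)
lemma PP_diff: "x \<in> PP n \<Longrightarrow> y \<in> PP n \<Longrightarrow> x - y \<in> PP n" by (auto simp: frac_ideal_def intro: nabs_diff_le)
lemma PP_minus [simp]: "- x \<in> PP n \<longleftrightarrow> x \<in> PP n" by (auto simp: frac_ideal_def)
lemma PP_diff_commute: "x - y \<in> PP n \<longleftrightarrow> y - x \<in> PP n" by (metis PP_minus minus_diff_eq)
lemma PP_monoD: "x \<in> PP n \<Longrightarrow> m \<le> n \<Longrightarrow> x \<in> PP m" by (auto simp: mem_PP)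
lemma PP_mult: "x \<in> PP m \<Longrightarrow> y \<in> PP n \<Longrightarrow> x * y \<in> PP (m + n)"
  by (cases "x = 0"; cases "y = 0") (auto simp: mem_PP vl_mult)
lemma PP_mult_iff: "c \<noteq> 0 \<Longrightarrow> c * x \<in> PP n \<longleftrightarrow> x \<in> PP (n - vl c)"
  by (cases "x = 0") (auto simp: mem_PP vl_mult)
lemma PP_add_iff: "y \<in> PP n \<Longrightarrow> x + y \<in> PP n \<longleftrightarrow> x \<in> PP n"
  by (metis PP_add PP_diff add_diff_cancel_right')
lemma PP_trans: "x - y \<in> PP n \<Longrightarrow> y - z \<in> PP n \<Longrightarrow> x - z \<in> PP n"
  using PP_add[of "x - y" n "y - z"] by simp
lemma PP_vl: "x \<in> PP (vl x)" by (simp add: mem_PP)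
lemma PP_ring: "(PP 0 :: 'k::nonarch_local_field set) = ring_of_integers"
  by (auto simp: frac_ideal_def ring_of_integers_def)
lemma PP_max: "(PP 1 :: 'k::nonarch_local_field set) = maximal_ideal"
proof -
  have "nabs x < 1 \<longleftrightarrow> nabs x \<le> qcard TYPE('k) powi (-1)" for x :: 'k
  proof -
    have "inverse (qcard TYPE('k)) < 1" using qcard_gt_1[where 'k='k] by (simp add: inverse_less_1_iff)
    then show ?thesis using nabs_less_1[of x] by (simp only: power_int_minus power_int_1_right) linarith
  qed
  then show ?thesis by (auto simp: frac_ideal_def maximal_ideal_def)
qed

lemma vl_add_eq:
  assumes "x \<noteq> 0" "h \<in> PP (vl x + 1)" shows "x + h \<noteq> 0" "vl (x + h) = vl (x::'k::nonarch_local_field)"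
proof -
  have "nabs h < nabs x"
  proof (cases "h = 0")
    case False
    then have "nabs h \<le> nabs x" "nabs h \<noteq> nabs x" using assms
      by (auto simp: mem_PP nabs_vl q_powi_le_iff q_powi_eq_iff)
    then show ?thesis by simp
  qed (use assms in \<open>simp add: less_le\<close>)
  from nabs_add_eq[OF this] have "nabs (x + h) = nabs x" .
  then show "x + h \<noteq> 0" using assms(1) by (metis nabs_eq_0_iff)
  then show "vl (x + h) = vl x" using assms(1) \<open>nabs (x + h) = nabs x\<close> by (simp add: vl_eq_iff)
qed

lemma vl_near:
  assumes "x \<noteq> 0" "y - x \<in> PP (vl x + 1)" shows "y \<noteq> 0" "vl y = vl (x::'k::nonarch_local_field)"
  using vl_add_eq[OF assms] by auto

text \<open>Values are powers of q, so the open ball of radius q^(1-n) is the closed ball of radius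
  q^(-n); hence the exponent \<open>1 - n\<close>.\<close>

lemma ball_eq_coset: "ball x (qcard TYPE('k) powi (1 - n)) = {y::'k::nonarch_local_field. y - x \<in> PP n}"
proof -
  have "nabs z < qcard TYPE('k) powi (1 - n) \<longleftrightarrow> z \<in> PP n" for z :: 'k
  proof (cases "z = 0")
    case False
    have "nabs z < qcard TYPE('k) powi (1 - n) \<longleftrightarrow> \<not> (1 - n \<le> - vl z)"
      using nabs_vl[OF False] q_powi_le_iff[where 'k='k, of "1 - n" "- vl z"] by linarith
    then show ?thesis using False by (auto simp: mem_PP)
  next
    case True then show ?thesis by (simp add: zero_less_power_int)
  qed
  then have "y \<in> ball x (qcard TYPE('k) powi (1 - n)) \<longleftrightarrow> y - x \<in> PP n" for y
    using nabs_diff_commute[of x y] by (simp only: mem_ball dist_nabs)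
  then show ?thesis by blast
qed

lemma open_coset: "open {y::'k::nonarch_local_field. y - x \<in> PP n}"
  by (metis ball_eq_coset open_ball)

lemma open_PP: "open (PP n :: 'k::nonarch_local_field set)"
  using open_coset[of 0 n] by simp

lemma open_iff_coset: "open U \<longleftrightarrow> (\<forall>x\<in>U. \<exists>n. \<forall>y::'k::nonarch_local_field. y - x \<in> PP n \<longrightarrow> y \<in> U)"
proof
  assume U: "open U"
  show "\<forall>x\<in>U. \<exists>n. \<forall>y. y - x \<in> PP n \<longrightarrow> y \<in> U"
  proof
    fix x assume "x \<in> U"
    then obtain e where e: "e > 0" "ball x e \<subseteq> U" using U by (meson open_contains_ball)
    obtain m where m: "inverse (qcard TYPE('k)) ^ m < e"
      using real_arch_pow_inv[of e "inverse (qcard TYPE('k))"] e qcard_gt_1[where 'k='k] by (auto simp: inverse_less_1_iff)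
    have "{y. y - x \<in> PP (int m + 1)} \<subseteq> ball x e"
      unfolding ball_eq_coset[symmetric] using m by (intro subset_ball) (auto simp: power_int_minus power_inverse)
    then show "\<exists>n. \<forall>y. y - x \<in> PP n \<longrightarrow> y \<in> U" using e by blast
  qed
next
  assume *: "\<forall>x\<in>U. \<exists>n. \<forall>y. y - x \<in> PP n \<longrightarrow> y \<in> U"
  show "open U"
  proof (rule Topological_Spaces.openI)
    fix x assume "x \<in> U"
    then obtain n where n: "\<forall>y. y - x \<in> PP n \<longrightarrow> y \<in> U" using * by blast
    then show "\<exists>T. open T \<and> x \<in> T \<and> T \<subseteq> U"
      by (intro exI[of _ "{y. y - x \<in> PP n}"]) (auto simp: open_coset)
  qed
qed

lemma compact_PP: "compact (PP n :: 'k::nonarch_local_field set)"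
proof -
  have "PP n = (\<lambda>x. unif powi n * x) ` (PP 0 :: 'k set)"
  proof (intro equalityI subsetI)
    fix x :: 'k assume x: "x \<in> PP n"
    have "x = unif powi n * (unif powi (-n) * x)"
      by (simp add: power_int_minus)
    moreover have "unif powi (-n) * x \<in> PP 0" using x PP_mult_iff[of "unif powi (-n)" x 0] by simp
    ultimately show "x \<in> (\<lambda>x. unif powi n * x) ` PP 0" by blast
  qed (auto simp: PP_mult_iff)
  moreover have "continuous_on (PP 0 :: 'k set) (\<lambda>x. unif powi n * x)"
    unfolding continuous_on_iff
  proof (intro ballI allI impI)
    fix x :: 'k and e :: real assume "e > 0"
    let ?c = "nabs (unif powi n :: 'k)"
    have c: "?c > 0" using nabs_eq_0_iff[of "unif powi n :: 'k"] nabs_nonneg[of "unif powi n :: 'k"] by (simp add: less_le)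
    have "dist (unif powi n * y) (unif powi n * x) = ?c * dist y x" for y :: 'k
      by (simp add: dist_nabs nabs_mult right_diff_distrib[symmetric])
    then show "\<exists>d>0. \<forall>x'\<in>PP 0. dist x' x < d \<longrightarrow> dist (unif powi n * x') (unif powi n * x) < e"
      using c \<open>e > 0\<close> by (intro exI[of _ "e / ?c"]) (auto simp: field_simps)
  qed
  ultimately show ?thesis using compact_ring_of_integers[where ?'a='k] compact_continuous_image by (metis PP_ring)
qed

lemma ex_PP: "\<exists>n. (x::'k::nonarch_local_field) \<in> PP n" by (metis PP_vl)

section \<open>Representatives of cosets\<close>

text \<open>The representatives lie in U, which need not be a union of cosets; this allows sampling
  on a restricted domain such as the source of a change of variables.\<close>

definition reps :: "int \<Rightarrow> 'k::nonarch_local_field set \<Rightarrow> 'k set \<Rightarrow> bool" where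
  "reps n U D \<longleftrightarrow> finite D \<and> D \<subseteq> U \<and> (\<forall>x\<in>U. \<exists>d\<in>D. x - d \<in> PP n) \<and> (\<forall>d\<in>D. \<forall>e\<in>D. d - e \<in> PP n \<longrightarrow> d = e)"

text \<open>The cosets are open and \<open>PP m\<close> is compact, so finitely many of them cover
  it.\<close>

lemma finite_cosets: "finite ((\<lambda>x::'k::nonarch_local_field. {y. y - x \<in> PP n}) ` PP m)"
proof -
  let ?c = "\<lambda>x::'k. {y. y - x \<in> PP n}"
  obtain D where D: "D \<subseteq> PP m" "finite D" "PP m \<subseteq> (\<Union>x\<in>D. ?c x)"
  proof (rule compactE_image[OF compact_PP, of "PP m" ?c m])
    show "PP m \<subseteq> (\<Union>x\<in>PP m. ?c x)" by force
  qed (auto simp: open_coset)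
  have "?c ` PP m \<subseteq> ?c ` D"
  proof
    fix C assume "C \<in> ?c ` PP m"
    then obtain x where x: "x \<in> PP m" "C = ?c x" by blast
    then obtain d where d: "d \<in> D" "x - d \<in> PP n" using D by auto
    have "C = ?c d" unfolding x(2) using d(2) PP_trans PP_diff_commute by blast
    then show "C \<in> ?c ` D" using d by blast
  qed
  then show ?thesis using finite_imageI[OF D(2)] finite_subset by blast
qed

lemma reps_exists: assumes "U \<subseteq> PP m" shows "\<exists>D. reps n (U :: 'k::nonarch_local_field set) D"
proof -
  let ?c = "\<lambda>x::'k. {y. y - x \<in> PP n}"
  define s where "s C = (SOME x. x \<in> C \<and> x \<in> U)" for C
  define D where "D = s ` ?c ` U"
  have fin: "finite D" unfolding D_def
    by (intro finite_imageI finite_subset[OF image_mono[OF assms] finite_cosets])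
  have s: "s (?c x) - x \<in> PP n" "s (?c x) \<in> U" if "x \<in> U" for x
  proof -
    have "s (?c x) \<in> ?c x \<and> s (?c x) \<in> U" unfolding s_def by (rule someI[of _ x]) (use that in simp)
    then show "s (?c x) - x \<in> PP n" "s (?c x) \<in> U" by auto
  qed
  have eq: "?c x = ?c y" if "x - y \<in> PP n" for x y using that PP_trans PP_diff_commute by blast
  have "reps n U D" unfolding reps_def
  proof (intro conjI ballI impI)
    show "D \<subseteq> U" unfolding D_def using s by auto
    fix x assume "x \<in> U"
    then show "\<exists>d\<in>D. x - d \<in> PP n" unfolding D_def using s PP_diff_commute by blast
  next
    fix d e assume "d \<in> D" "e \<in> D" and de: "d - e \<in> PP n"
    then obtain x y where xy: "x \<in> U" "y \<in> U" "d = s (?c x)" "e = s (?c y)" unfolding D_def by blast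
    then have "x - y \<in> PP n" using de s(1)[of x] s(1)[of y] PP_trans PP_diff_commute by metis
    then show "d = e" using eq[of x y] xy by metis
  qed (rule fin)
  then show ?thesis ..
qed

lemma reps_card: assumes "reps n U D" "reps n U E" shows "card D = card E"
proof -
  define f where "f d = (SOME e. e \<in> E \<and> d - e \<in> PP n)" for d
  have f: "f d \<in> E \<and> d - f d \<in> PP n" if "d \<in> D" for d unfolding f_def
    by (rule someI_ex) (use that assms in \<open>auto simp: reps_def\<close>)
  have "bij_betw f D E" unfolding bij_betw_def
  proof
    show "inj_on f D"
    proof
      fix x y assume xy: "x \<in> D" "y \<in> D" "f x = f y"
      then have "x - y \<in> PP n" using f[of x] f[of y] PP_trans PP_diff_commute by metis
      then show "x = y" using xy assms by (auto simp: reps_def)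
    qed
    show "f ` D = E"
    proof
      show "E \<subseteq> f ` D"
      proof
        fix e assume e: "e \<in> E"
        then have "e \<in> U" using assms(2) by (auto simp: reps_def)
        then have "\<exists>d\<in>D. e - d \<in> PP n" using assms(1) unfolding reps_def by blast
        then obtain d where d: "d \<in> D" "e - d \<in> PP n" ..
        then have "e - f d \<in> PP n" using f PP_trans by blast
        then have "e = f d" using e f d assms by (auto simp: reps_def)
        then show "e \<in> f ` D" using d by blast
      qed
    qed (use f in auto)
  qed
  then show ?thesis by (rule bij_betw_same_card)
qed

lemma reps_scale: assumes "reps n U D" "c \<noteq> 0" shows "reps (n + vl c) ((*) c ` U) ((*) c ` D)"
  using assms unfolding reps_def
  by (auto simp: right_diff_distrib[symmetric] PP_mult_iff)

lemma PP_scale: assumes "(c::'k::nonarch_local_field) \<noteq> 0" shows "(*) (c::'k::nonarch_local_field) ` PP n = PP (n + vl c)"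
proof (intro equalityI subsetI)
  fix x :: 'k assume x: "x \<in> PP (n + vl c)"
  have "c * (x / c) \<in> PP (n + vl c)" using x assms by simp
  then have "x / c \<in> PP n" using assms by (subst (asm) PP_mult_iff) auto
  then show "x \<in> (*) c ` PP n" using assms by (intro image_eqI[of _ _ "x / c"]) auto
qed (use assms in \<open>auto simp: PP_mult_iff\<close>)

text \<open>Multiplication by a power of \<open>unif\<close> reduces to n = 0, where the cosets are
  exactly the classes counted by \<open>residue_card\<close>.\<close>

lemma card_reps_Suc: assumes D: "reps (n + 1) (PP n) (D :: 'k::nonarch_local_field set)"
  shows "card D = residue_card TYPE('k)"
proof -
  let ?r = "{(x, y :: 'k). x \<in> ring_of_integers \<and> y \<in> ring_of_integers \<and> x - y \<in> maximal_ideal}"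
  obtain E :: "'k set" where E: "reps 1 (PP 0) E" using reps_exists by blast
  have "reps (1 + n) (PP n) ((*) (unif powi n) ` E)"
    using reps_scale[OF E, of "unif powi n"] PP_scale[of "unif powi n :: 'k" 0] by simp
  then have "card D = card ((*) (unif powi n) ` E)" using reps_card D by (metis add.commute)
  also have "\<dots> = card E" by (rule card_image) (auto intro!: inj_onI)
  also have "bij_betw (\<lambda>d. ?r `` {d}) E (PP 0 // ?r)"
    unfolding bij_betw_def
  proof
    have E': "x \<in> PP 0" if "x \<in> E" for x using E that by (auto simp: reps_def)
    show "inj_on (\<lambda>d. ?r `` {d}) E"
    proof
      fix x y assume xy: "x \<in> E" "y \<in> E" "?r `` {x} = ?r `` {y}"
      then have "y \<in> ?r `` {y}" using E'[of y] by (auto simp: PP_ring PP_max[symmetric])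
      then have "y \<in> ?r `` {x}" using xy by simp
      then have "x - y \<in> PP 1" by (auto simp: PP_max)
      then show "x = y" using E xy by (auto simp: reps_def)
    qed
    show "(\<lambda>d. ?r `` {d}) ` E = PP 0 // ?r"
    proof
      show "(\<lambda>d. ?r `` {d}) ` E \<subseteq> PP 0 // ?r" by (intro image_subsetI quotientI E')
      show "PP 0 // ?r \<subseteq> (\<lambda>d. ?r `` {d}) ` E"
      proof
        fix C assume "C \<in> PP 0 // ?r"
        then obtain x where x: "x \<in> PP 0" "C = ?r `` {x}" by (auto elim: quotientE)
        then obtain d where d: "d \<in> E" "x - d \<in> PP 1" using E by (auto simp: reps_def)
        have "?r `` {x} = ?r `` {d}"
        proof (intro equalityI subsetI)
          fix y assume "y \<in> ?r `` {x}"
          then have "y \<in> PP 0" "x - y \<in> PP 1" by (auto simp: PP_ring PP_max)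
          moreover then have "d - y \<in> PP 1" using d PP_trans PP_diff_commute by blast
          ultimately show "y \<in> ?r `` {d}" using E'[OF d(1)] by (auto simp: PP_ring PP_max)
        next
          fix y assume "y \<in> ?r `` {d}"
          then have "y \<in> PP 0" "d - y \<in> PP 1" by (auto simp: PP_ring PP_max)
          moreover then have "x - y \<in> PP 1" using d PP_trans by blast
          ultimately show "y \<in> ?r `` {x}" using x by (auto simp: PP_ring PP_max)
        qed
        then show "C \<in> (\<lambda>d. ?r `` {d}) ` E" using x d by blast
      qed
    qed
  qed
  then have "card E = card (PP 0 // ?r)" by (rule bij_betw_same_card)
  finally show ?thesis by (simp add: residue_card_def PP_ring)
qed

lemma PP_max_iff: "(x::'k::nonarch_local_field) \<in> PP (max m n) \<longleftrightarrow> x \<in> PP m \<and> x \<in> PP n"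
  by (auto simp: mem_PP)

section \<open>Locally constant functions\<close>

definition loc_const :: "('k::nonarch_local_field \<Rightarrow> 'b) \<Rightarrow> 'k \<Rightarrow> bool" where
  "loc_const f x \<longleftrightarrow> (\<exists>n. \<forall>h\<in>PP n. f (x + h) = f x)"

lemma loc_const_const: "loc_const (\<lambda>_. c) x" by (simp add: loc_const_def)

lemma loc_const_comp2: assumes "loc_const f x" "loc_const g x" shows "loc_const (\<lambda>x. G (f x) (g x)) x"
proof -
  obtain m n where "\<forall>h\<in>PP m. f (x + h) = f x" "\<forall>h\<in>PP n. g (x + h) = g x"
    using assms by (auto simp: loc_const_def)
  then show ?thesis unfolding loc_const_def
    by (intro exI[of _ "max m n"]) (auto simp: PP_max_iff)
qed

text \<open>Compactness turns pointwise levels of invariance into one: finitely many cosets cover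
  the domain, and the largest of their levels works on each of them.\<close>

lemma loc_const_uniform:
  assumes "\<And>x. x \<in> PP m \<Longrightarrow> loc_const f x"
  shows "\<exists>n\<ge>m. \<forall>x\<in>PP m. \<forall>h\<in>PP n. f (x + h) = f x"
proof -
  obtain N where N: "\<And>x h. x \<in> PP m \<Longrightarrow> h \<in> PP (N x) \<Longrightarrow> f (x + h) = f x"
    using assms unfolding loc_const_def by metis
  obtain D where D: "D \<subseteq> PP m" "finite D" "PP m \<subseteq> (\<Union>x\<in>D. {y. y - x \<in> PP (N x)})"
  proof (rule compactE_image[OF compact_PP, of "PP m" "\<lambda>x. {y. y - x \<in> PP (N x)}" m])
    show "PP m \<subseteq> (\<Union>x\<in>PP m. {y. y - x \<in> PP (N x)})" by force
  qed (auto simp: open_coset)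
  \<comment> \<open>Including m ensures that translation by \<open>PP n\<close> cannot leave the
    domain.\<close>
  define n where "n = Max (insert m (N ` D))"
  have n: "m \<le> n" "\<And>d. d \<in> D \<Longrightarrow> N d \<le> n" using D by (auto simp: n_def)
  have "f (x + h) = f x" if "x \<in> PP m" "h \<in> PP n" for x h
  proof -
    have "x \<in> (\<Union>x\<in>D. {y. y - x \<in> PP (N x)})" using D(3) that(1) by (rule subsetD)
    then obtain d where d: "d \<in> D" "x - d \<in> PP (N d)" by auto
    have h: "h \<in> PP (N d)" using that n(2)[OF d(1)] PP_monoD by blast
    have "f (d + (x - d)) = f d" using N D(1) d by blast
    moreover have "f (d + (x - d + h)) = f d" using N D(1) d PP_add[OF d(2) h] by blast
    ultimately show ?thesis by (simp add: algebra_simps)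
  qed
  then show ?thesis using n(1) by blast
qed

lemma loc_const_vl: "x \<noteq> 0 \<Longrightarrow> loc_const vl x"
  unfolding loc_const_def using vl_add_eq(2) by blast

lemma loc_const_nz: "(x::'k::nonarch_local_field) \<noteq> 0 \<Longrightarrow> loc_const (\<lambda>x. x = 0) x"
  unfolding loc_const_def using vl_add_eq(1) by blast

lemma loc_const_mem_PP: "loc_const (\<lambda>x. x - c \<in> PP n) x"
proof -
  have "(x + h - c \<in> PP n) = (x - c \<in> PP n)" if "h \<in> PP n" for h
    using PP_add_iff[OF that, of "x - c"] by (simp add: algebra_simps)
  then show ?thesis unfolding loc_const_def by blast
qed

lemma loc_const_mem_PP0: "loc_const (\<lambda>x. x \<in> PP n) x"
  using loc_const_mem_PP[of 0 n x] by simp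

lemma loc_const_affine: assumes "loc_const f (c * x + d)" shows "loc_const (\<lambda>x. f (c * x + d)) x"
proof (cases "c = 0")
  case False
  obtain n where n: "\<forall>h\<in>PP n. f (c * x + d + h) = f (c * x + d)" using assms by (auto simp: loc_const_def)
  have "f (c * (x + h) + d) = f (c * x + d)" if "h \<in> PP (n - vl c)" for h
  proof -
    have "c * h \<in> PP n" using that False by (simp add: PP_mult_iff)
    then show ?thesis using n[rule_format, of "c * h"] by (simp add: algebra_simps)
  qed
  then show ?thesis unfolding loc_const_def by blast
qed (simp add: loc_const_const)

lemma loc_const_mult: assumes "loc_const f (c * x)" shows "loc_const (\<lambda>x. f (c * x)) x"
  using loc_const_affine[of f c x 0] assms by simp

lemma inverse_near:
  assumes x: "(x::'k::nonarch_local_field) \<noteq> 0" and h: "h \<in> PP n" "h \<in> PP (vl x + 1)"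
  shows "inverse (x + h) - inverse x \<in> PP (n - 2 * vl x)"
proof (cases "h = 0")
  case False
  note y = vl_add_eq[OF x h(2)]
  have "inverse (x + h) - inverse x = - h / ((x + h) * x)" using x y(1) by (simp add: field_simps)
  then show ?thesis using x y h False by (simp add: mem_PP vl_divide vl_mult)
qed simp

lemma loc_const_power2: assumes "loc_const f (x\<^sup>2)" shows "loc_const (\<lambda>x. f (x\<^sup>2)) (x::'k::nonarch_local_field)"
proof -
  obtain n where n: "\<forall>h\<in>PP n. f (x\<^sup>2 + h) = f (x\<^sup>2)" using assms by (auto simp: loc_const_def)
  obtain m where m: "x \<in> PP m" "2 * x \<in> PP m" using ex_PP[of x] ex_PP[of "2 * x"]
    by (metis PP_monoD linorder_le_cases)
  have "f ((x + h)\<^sup>2) = f (x\<^sup>2)" if h: "h \<in> PP (max (n - m) (max n 0))" for h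
  proof -
    have "2 * x * h \<in> PP (m + (n - m))" by (intro PP_mult m) (use h in \<open>auto elim: PP_monoD\<close>)
    moreover have "h * h \<in> PP (n + 0)" by (intro PP_mult) (use h in \<open>auto elim: PP_monoD\<close>)
    ultimately have "2 * x * h + h * h \<in> PP n" by (intro PP_add) auto
    then show ?thesis using n[rule_format, of "2 * x * h + h * h"] by (simp add: power2_eq_square algebra_simps)
  qed
  then show ?thesis unfolding loc_const_def by blast
qed

subsection \<open>Squares near one\<close>

text \<open>The sets {d, f d} partition D into pairs. The intended f is translation by 1 on the
  residue field.\<close>

lemma even_card_involution:
  assumes "finite D" "\<And>d. d \<in> D \<Longrightarrow> f d \<in> D" "\<And>d. d \<in> D \<Longrightarrow> f (f d) = d" "\<And>d. d \<in> D \<Longrightarrow> f d \<noteq> d"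
  shows "even (card D)"
proof -
  let ?C = "(\<lambda>d. {d, f d}) ` D"
  have "2 * card ?C = card (\<Union>?C)"
  proof (rule card_partition)
    show "card c = 2" if "c \<in> ?C" for c using that assms by (auto simp: card_2_iff) (metis)
    show "c1 \<inter> c2 = {}" if "c1 \<in> ?C" "c2 \<in> ?C" "c1 \<noteq> c2" for c1 c2
      using that assms(3) by (auto; metis)
  qed (use assms in auto)
  moreover have "\<Union>?C = D" using assms(2) by auto
  ultimately show ?thesis by (metis dvd_triv_left)
qed

text \<open>If 2 were in the maximal ideal, adding 1 would be a fixed-point-free involution of the
  residue field, and q would be even.\<close>

lemma two_unit:
  assumes "odd (residue_card TYPE('k::nonarch_local_field))"
  shows "(2::'k) \<noteq> 0" "vl (2::'k) = 0"
proof -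
  obtain D :: "'k set" where D: "reps 1 (PP 0) D" using reps_exists by blast
  have one: "(1::'k) \<in> PP 0" by (simp add: mem_PP)
  have "(2::'k) \<notin> PP 1"
  proof
    assume 2: "(2::'k) \<in> PP 1"
    define f where "f d = (SOME e. e \<in> D \<and> d + 1 - e \<in> PP 1)" for d
    have f: "f d \<in> D" "d + 1 - f d \<in> PP 1" if "d \<in> D" for d
    proof -
      have "d + 1 \<in> PP 0" using D that one by (intro PP_add) (auto simp: reps_def)
      then have "\<exists>e. e \<in> D \<and> d + 1 - e \<in> PP 1" using D by (auto simp: reps_def)
      from someI_ex[OF this] show "f d \<in> D" "d + 1 - f d \<in> PP 1" by (auto simp: f_def)
    qed
    have inj: "d = e" if "d \<in> D" "e \<in> D" "d - e \<in> PP 1" for d e using D that by (auto simp: reps_def)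
    have "even (card D)"
    proof (rule even_card_involution)
      show "finite D" using D by (auto simp: reps_def)
      fix d assume d: "d \<in> D"
      show "f d \<in> D" using f d by blast
      show "f (f d) = d"
      proof (rule inj)
        have "2 - (d + 1 - f d) - (f d + 1 - f (f d)) \<in> PP 1"
          by (rule PP_diff[OF PP_diff[OF 2 f(2)[OF d]] f(2)[OF f(1)[OF d]]])
        then show "f (f d) - d \<in> PP 1" by (simp add: algebra_simps)
      qed (use f d in auto)
      show "f d \<noteq> d"
      proof
        assume "f d = d"
        then have "(1::'k) \<in> PP 1" using f(2)[OF d] by simp
        then show False by (simp add: mem_PP)
      qed
    qed
    then show False using card_reps_Suc[of 0 D] D assms by simp
  qed
  then show "(2::'k) \<noteq> 0" by auto
  moreover have "(2::'k) \<in> PP 0" using PP_add[OF one one] by simp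
  ultimately show "vl (2::'k) = 0" using \<open>2 \<notin> PP 1\<close> by (auto simp: mem_PP)
qed

text \<open>Modulo \<open>PP N\<close> an isometry is an injection of a finite set into itself,
  hence onto, so the image is dense; being compact it is closed. This plays the role of Hensel's
  lemma.\<close>

lemma isometry_surj:
  fixes \<phi> :: "'k::nonarch_local_field \<Rightarrow> 'k"
  assumes into: "\<And>x. x \<in> PP m \<Longrightarrow> \<phi> x \<in> PP m"
    and iso: "\<And>x y N. x \<in> PP m \<Longrightarrow> y \<in> PP m \<Longrightarrow> \<phi> x - \<phi> y \<in> PP N \<longleftrightarrow> x - y \<in> PP N"
    and y: "y \<in> PP m"
  shows "\<exists>x\<in>PP m. \<phi> x = y"
proof -
  have approx: "\<exists>x\<in>PP m. \<phi> x - y \<in> PP N" for N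
  proof -
    obtain D :: "'k set" where D: "reps N (PP m) D" using reps_exists by blast
    have DD: "finite D" "D \<subseteq> PP m" using D by (auto simp: reps_def)
    define f where "f d = (SOME e. e \<in> D \<and> \<phi> d - e \<in> PP N)" for d
    have f: "f d \<in> D" "\<phi> d - f d \<in> PP N" if "d \<in> D" for d
    proof -
      have "\<phi> d \<in> PP m" using into DD that by blast
      then have "\<exists>e. e \<in> D \<and> \<phi> d - e \<in> PP N" using D by (auto simp: reps_def)
      from someI_ex[OF this] show "f d \<in> D" "\<phi> d - f d \<in> PP N" by (auto simp: f_def)
    qed
    have "inj_on f D"
    proof
      fix a b assume ab: "a \<in> D" "b \<in> D" "f a = f b"
      then have "\<phi> a - \<phi> b \<in> PP N" using f PP_trans PP_diff_commute by metis
      then have "a - b \<in> PP N" using iso ab DD by blast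
      then show "a = b" using D ab by (auto simp: reps_def)
    qed
    then have "f ` D = D" using DD f by (intro endo_inj_surj) auto
    moreover obtain e where e: "e \<in> D" "y - e \<in> PP N" using D y by (auto simp: reps_def)
    ultimately have "e \<in> f ` D" by simp
    then obtain d where d: "d \<in> D" "f d = e" by blast
    then have "\<phi> d - y \<in> PP N" using f[OF d(1)] e PP_trans PP_diff_commute by metis
    then show ?thesis using d DD by blast
  qed
  have "continuous_on (PP m) \<phi>"
    unfolding continuous_on_open_invariant
  proof (intro allI impI)
    fix B :: "'k set" assume B: "open B"
    have "open (\<phi> -` B \<inter> PP m)" unfolding open_iff_coset
    proof
      fix x assume x: "x \<in> \<phi> -` B \<inter> PP m"
      then obtain n where n: "\<forall>y. y - \<phi> x \<in> PP n \<longrightarrow> y \<in> B" using B by (auto simp: open_iff_coset)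
      show "\<exists>n. \<forall>y. y - x \<in> PP n \<longrightarrow> y \<in> \<phi> -` B \<inter> PP m"
      proof (intro exI allI impI)
        fix z assume z: "z - x \<in> PP (max n m)"
        then have z': "z - x \<in> PP n" "z - x \<in> PP m" by (auto elim: PP_monoD)
        have "z \<in> PP m" using PP_add[OF z'(2), of x] x by simp
        then show "z \<in> \<phi> -` B \<inter> PP m" using n iso[of z x n] x z' by auto
      qed
    qed
    then show "\<exists>A. open A \<and> A \<inter> PP m = \<phi> -` B \<inter> PP m" by blast
  qed
  then have "closed (\<phi> ` PP m)" using compact_PP compact_continuous_image compact_imp_closed by blast
  show ?thesis
  proof (rule ccontr)
    assume "\<not> (\<exists>x\<in>PP m. \<phi> x = y)"
    then have "y \<in> - \<phi> ` PP m" by auto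
    moreover have "open (- \<phi> ` PP m)" using \<open>closed (\<phi> ` PP m)\<close> by auto
    ultimately obtain n where n: "\<forall>z. z - y \<in> PP n \<longrightarrow> z \<in> - \<phi> ` PP m" unfolding open_iff_coset by blast
    then show False using approx[of n] by blast
  qed
qed

text \<open>The difference of squares factors, and \<open>x + y\<close> has the valuation of
  \<open>2 * d\<close> with 2 a unit. Squaring therefore scales all distances near d by one factor,
  which is its Jacobian.\<close>

lemma square_near_iso:
  assumes "odd (residue_card TYPE('k::nonarch_local_field))"
    and d: "(d::'k) \<noteq> 0" and xy: "x - d \<in> PP (vl d + 1)" "y - d \<in> PP (vl d + 1)"
  shows "x\<^sup>2 - y\<^sup>2 \<in> PP (N + vl d) \<longleftrightarrow> x - y \<in> PP N"
proof -
  note two = two_unit[OF assms(1)]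
  have "x + y - 2 * d \<in> PP (vl (2 * d) + 1)" using PP_add[OF xy] two d by (simp add: vl_mult algebra_simps)
  from vl_near[OF _ this] have s: "x + y \<noteq> 0" "vl (x + y) = vl d" using two d by (auto simp: vl_mult)
  have "x\<^sup>2 - y\<^sup>2 = (x + y) * (x - y)" by (simp add: power2_eq_square algebra_simps)
  then show ?thesis using s by (simp add: PP_mult_iff)
qed

text \<open>After a shift by 1, squaring is an isometry of \<open>PP n\<close> into itself, hence
  onto.\<close>

lemma sqrt_near_1:
  assumes odd: "odd (residue_card TYPE('k::nonarch_local_field))" and n: "n \<ge> 1" and y: "y - 1 \<in> PP n"
  shows "\<exists>b. b - 1 \<in> PP n \<and> b\<^sup>2 = (y::'k)"
proof -
  let ?f = "\<lambda>h::'k. (1 + h)\<^sup>2 - 1"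
  have "\<exists>x\<in>PP n. ?f x = y - 1"
  proof (rule isometry_surj[OF _ _ y])
    fix x :: 'k assume x: "x \<in> PP n"
    have "x * x \<in> PP (n + n)" by (intro PP_mult x)
    then have "x * x \<in> PP n" by (rule PP_monoD) (use n in simp)
    then have "x + x + x * x \<in> PP n" using x by (intro PP_add)
    then show "?f x \<in> PP n" by (simp add: power2_eq_square algebra_simps)
  next
    fix x y :: 'k and N assume "x \<in> PP n" "y \<in> PP n"
    then have "x \<in> PP 1" "y \<in> PP 1" using n PP_monoD by blast+
    then show "?f x - ?f y \<in> PP N \<longleftrightarrow> x - y \<in> PP N"
      using square_near_iso[OF odd, of 1 "1 + x" "1 + y" N] by simp
  qed
  then obtain x where "x \<in> PP n" "(1 + x)\<^sup>2 = y" by auto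
  then show ?thesis by (intro exI[of _ "1 + x"]) auto
qed

lemma square_near:
  assumes odd: "odd (residue_card TYPE('k::nonarch_local_field))" and x: "(x::'k) \<noteq> 0" and y: "y - x \<in> PP (vl x + n)" "n \<ge> 1"
  shows "\<exists>b. b - 1 \<in> PP n \<and> y = x * b\<^sup>2"
proof -
  have "x * (y / x - 1) \<in> PP (vl x + n)" using x y(1) by (simp add: right_diff_distrib)
  then have "y / x - 1 \<in> PP n" using x by (subst (asm) PP_mult_iff) auto
  then obtain b where "b - 1 \<in> PP n" "b\<^sup>2 = y / x" using sqrt_near_1[OF odd y(2)] by blast
  then show ?thesis using x by (intro exI[of _ b]) simp
qed

lemma unit_near_1: "b - 1 \<in> PP n \<Longrightarrow> n \<ge> 1 \<Longrightarrow> (b::'k::nonarch_local_field) \<noteq> 0 \<and> vl b = 0"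
  using vl_near[of 1 b] PP_monoD[of "b - 1" n 1] by auto

subsection \<open>Integration of step functions\<close>

text \<open>Supported in \<open>P\<^sup>m\<close> and invariant under \<open>P\<^sup>n\<close>.\<close>

definition step_fun :: "int \<Rightarrow> int \<Rightarrow> ('k::nonarch_local_field \<Rightarrow> complex) \<Rightarrow> bool" where
  "step_fun m n f \<longleftrightarrow> (\<forall>x. x \<notin> PP m \<longrightarrow> f x = 0) \<and> (\<forall>x. \<forall>h\<in>PP n. f (x + h) = f x)"

lemma step_funI: "(\<And>x. x \<notin> PP m \<Longrightarrow> f x = 0) \<Longrightarrow> (\<And>x h. h \<in> PP n \<Longrightarrow> f (x + h) = f x) \<Longrightarrow> step_fun m n f"
  by (auto simp: step_fun_def)

lemma step_fun_mono: "step_fun m n f \<Longrightarrow> m' \<le> m \<Longrightarrow> n \<le> n' \<Longrightarrow> step_fun m' n' f"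
  unfolding step_fun_def using PP_monoD by blast

lemma step_fun_supp: "step_fun m n f \<Longrightarrow> x \<notin> PP m \<Longrightarrow> f x = 0" by (auto simp: step_fun_def)
lemma step_fun_inv: "step_fun m n f \<Longrightarrow> h \<in> PP n \<Longrightarrow> f (x + h) = f x" by (auto simp: step_fun_def)
lemma step_fun_near: "step_fun m n f \<Longrightarrow> x - y \<in> PP n \<Longrightarrow> f x = f y" using step_fun_inv[of m n f "x - y" y] by simp

lemma step_fun_loc_const: "step_fun m n f \<Longrightarrow> loc_const f x" by (auto simp: step_fun_def loc_const_def)

lemma step_fun_ex:
  fixes f :: "'k::nonarch_local_field \<Rightarrow> complex"
  assumes supp: "\<And>x. x \<notin> PP m \<Longrightarrow> f x = 0" and "\<And>x. x \<in> PP m \<Longrightarrow> loc_const f x"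
  shows "\<exists>n\<ge>m. step_fun m n f"
proof -
  obtain n where n: "n \<ge> m" "\<forall>x\<in>PP m. \<forall>h\<in>PP n. f (x + h) = f x"
    using loc_const_uniform[of m f] assms(2) by blast
  have "step_fun m n f"
  proof (rule step_funI)
    fix x h :: 'k assume h: "h \<in> PP n"
    show "f (x + h) = f x"
    proof (cases "x \<in> PP m")
      case False
      then have "x + h \<notin> PP m" using PP_add_iff[OF PP_monoD[OF h n(1)]] by blast
      then show ?thesis using False supp by simp
    qed (use n(2) h in blast)
  qed (rule supp)
  then show ?thesis using n(1) by blast
qed

lemma step_fun_indicator_coset: "(c::'k::nonarch_local_field) \<in> PP m \<Longrightarrow> m \<le> n \<Longrightarrow> step_fun m n (\<lambda>x. if x - c \<in> PP n then f else 0)"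
proof (rule step_funI)
  fix x :: 'k assume "c \<in> PP m" "m \<le> n" "x \<notin> PP m"
  then have "x - c \<notin> PP n" using PP_monoD[of "x - c" n m] PP_add[of "x - c" m c] by auto
  then show "(if x - c \<in> PP n then f else 0) = 0" by simp
next
  fix x h :: 'k assume "h \<in> PP n"
  then have "x + h - c \<in> PP n \<longleftrightarrow> x - c \<in> PP n" using PP_add_iff[of h n "x - c"] by (simp add: algebra_simps)
  then show "(if x + h - c \<in> PP n then f else 0) = (if x - c \<in> PP n then f else 0)" by simp
qed

locale haar_setup =
  fixes dx :: "'k::nonarch_local_field measure"
  assumes haar: "haar_measure dx"
begin

abbreviation I :: "('k \<Rightarrow> complex) \<Rightarrow> complex" where "I f \<equiv> integral\<^sup>L dx f"

definition vol :: "int \<Rightarrow> real" where "vol n = measure dx (PP n)"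

lemma sets_dx: "sets dx = sets borel" and space_dx [simp]: "space dx = UNIV"
  using haar sets_eq_imp_space_eq[of dx borel] by (auto simp: haar_measure_def)

lemma coset_sets [simp, measurable]: "{y. y - x \<in> PP n} \<in> sets dx" "PP n \<in> sets dx"
  by (auto simp: sets_dx open_coset open_PP)

lemma emeasure_coset: "emeasure dx {y. y - x \<in> PP n} = emeasure dx (PP n)"
proof -
  have "{y. y - x \<in> PP n} = (\<lambda>y. x + y) ` PP n"
    by (auto intro!: image_eqI[of _ _ "_ - x"])
  moreover have "(PP n :: 'k set) \<in> sets borel" by (simp add: open_PP)
  ultimately show ?thesis using haar by (simp add: haar_measure_def)
qed

lemma emeasure_PP: "emeasure dx (PP n) = ennreal (vol n)"
  using haar compact_PP[of n, where 'k='k] unfolding vol_def haar_measure_def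
  by (intro emeasure_eq_ennreal_measure) (metis infinity_ennreal_def less_irrefl)

lemma vol_nonneg: "vol n \<ge> 0" by (simp add: vol_def)

lemma measure_coset: "measure dx {y. y - x \<in> PP n} = vol n"
  unfolding measure_def emeasure_coset vol_def ..

lemma indicator_expand:
  fixes f :: "'k \<Rightarrow> complex"
  assumes D: "reps n U D" and supp: "\<And>x. x \<notin> U \<Longrightarrow> f x = 0" and inv: "\<And>x h. h \<in> PP n \<Longrightarrow> f (x + h) = f x"
  shows "f x = (\<Sum>d\<in>D. f d * indicator {y. y - d \<in> PP n} x :: complex)"
proof -
  have near: "f x = f y" if "x - y \<in> PP n" for x y using inv[OF that, of y] by simp
  have fin: "finite D" using D by (auto simp: reps_def)
  show ?thesis
  proof (cases "\<exists>d\<in>D. x - d \<in> PP n")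
    case True
    then obtain d where d: "d \<in> D" "x - d \<in> PP n" by blast
    have "(\<Sum>e\<in>D. f e * indicator {y. y - e \<in> PP n} x) = (\<Sum>e\<in>D. if e = d then f d else 0)"
    proof (rule sum.cong[OF refl])
      fix e assume e: "e \<in> D"
      have "x - e \<in> PP n \<longleftrightarrow> e = d" using D d e PP_trans PP_diff_commute unfolding reps_def by metis
      then show "f e * indicator {y. y - e \<in> PP n} x = (if e = d then f d else 0)" by (auto simp: indicator_def)
    qed
    also have "\<dots> = f d" using fin d by simp
    finally show ?thesis using near[OF d(2)] by simp
  next
    case False
    then have "x \<notin> U" using D by (auto simp: reps_def)
    then show ?thesis using False supp by (auto intro!: sum.neutral[symmetric] simp: indicator_def)
  qed
qed

text \<open>Expands f in indicator functions of cosets; this is what turns the integrals of step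
  functions into finite sums.\<close>

lemma has_integral_reps:
  fixes f :: "'k \<Rightarrow> complex"
  assumes D: "reps n U D" and supp: "\<And>x. x \<notin> U \<Longrightarrow> f x = 0" and inv: "\<And>x h. h \<in> PP n \<Longrightarrow> f (x + h) = f x"
  shows "has_bochner_integral dx f (of_real (vol n) * (\<Sum>d\<in>D. f d))"
proof -
  have "has_bochner_integral dx (\<lambda>x. \<Sum>d\<in>D. f d * indicator {y. y - d \<in> PP n} x) (\<Sum>d\<in>D. f d * of_real (vol n))"
  proof (rule has_bochner_integral_sum)
    fix d
    have "has_bochner_integral dx (indicator {y. y - d \<in> PP n} :: 'k \<Rightarrow> real) (measure dx {y. y - d \<in> PP n})"
      by (rule has_bochner_integral_real_indicator) (auto simp: emeasure_coset emeasure_PP)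
    then have "has_bochner_integral dx (\<lambda>x. complex_of_real (indicator {y. y - d \<in> PP n} x)) (of_real (vol n))"
      unfolding measure_coset by (rule has_bochner_integral_of_real)
    then show "has_bochner_integral dx (\<lambda>x. f d * indicator {y. y - d \<in> PP n} x) (f d * of_real (vol n))"
      using has_bochner_integral_mult_right[of "f d" dx "\<lambda>x. complex_of_real (indicator {y. y - d \<in> PP n} x)"]
      by (simp add: of_real_indicator)
  qed
  moreover have "f = (\<lambda>x. \<Sum>d\<in>D. f d * indicator {y. y - d \<in> PP n} x)"
    by (rule ext, rule indicator_expand[OF D]) (use supp inv in auto)
  ultimately show ?thesis by (simp add: sum_distrib_right[symmetric] mult.commute)
qed

lemma I_reps:
  assumes "step_fun m n f" "reps n U D" "\<And>x. x \<notin> U \<Longrightarrow> f x = 0"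
  shows "I f = of_real (vol n) * (\<Sum>d\<in>D. f d)"
  by (rule has_bochner_integral_integral_eq, rule has_integral_reps[OF assms(2,3)]) (use step_fun_inv[OF assms(1)] in auto)

lemma I_step_fun: "step_fun m n f \<Longrightarrow> reps n (PP m) D \<Longrightarrow> I f = of_real (vol n) * (\<Sum>d\<in>D. f d)"
  by (rule I_reps) (auto simp: step_fun_supp)

lemma integrable_step_fun: assumes "step_fun m n f" shows "integrable dx f"
proof -
  obtain D :: "'k set" where "reps n (PP m) D" using reps_exists by blast
  then show ?thesis using has_integral_reps[of n "PP m" D f] assms
    by (auto simp: step_fun_def has_bochner_integral_iff)
qed

lemma I_indicator_coset: "I (\<lambda>x. if x - c \<in> PP n then 1 else 0) = of_real (vol n)"
proof -
  obtain m where m: "c \<in> PP m" using ex_PP by blast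
  have "c \<in> PP (min m n)" using PP_monoD[OF m] by auto
  then have "step_fun (min m n) n (\<lambda>x. if x - c \<in> PP n then 1 else 0)" by (intro step_fun_indicator_coset) auto
  then have "I (\<lambda>x. if x - c \<in> PP n then 1 else 0) = of_real (vol n) * (\<Sum>d\<in>{c}. if d - c \<in> PP n then 1 else 0)"
    by (rule I_reps[of _ _ _ "{x. x - c \<in> PP n}"]) (auto simp: reps_def)
  then show ?thesis by simp
qed

lemma vol_Suc: "vol n = qcard TYPE('k) * vol (n + 1)"
proof -
  obtain D :: "'k set" where D: "reps (n + 1) (PP n) D" using reps_exists by blast
  have s: "step_fun n n (\<lambda>x. if x - 0 \<in> PP n then 1 else 0 :: complex)" by (intro step_fun_indicator_coset) auto
  have "complex_of_real (vol n) = I (\<lambda>x. if x - 0 \<in> PP n then 1 else 0)" by (simp only: I_indicator_coset)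
  also have "\<dots> = of_real (vol (n+1)) * (\<Sum>d\<in>D. if d - 0 \<in> PP n then 1 else 0)"
    by (rule I_step_fun[OF step_fun_mono[OF s]]) (use D in auto)
  also have "(\<Sum>d\<in>D. if d - 0 \<in> PP n then 1 else 0 :: complex) = (\<Sum>d\<in>D. 1)"
    using D by (intro sum.cong) (auto simp: reps_def)
  finally have "complex_of_real (vol n) = of_real (qcard TYPE('k) * vol (n + 1))" using card_reps_Suc[OF D] by simp
  then show ?thesis by (simp only: of_real_eq_iff)
qed

lemma vol_add: "vol (n + j) = qcard TYPE('k) powi (- j) * vol n"
proof -
  have q0: "qcard TYPE('k) \<noteq> 0" using qcard_pos[where 'k='k] by simp
  have 1: "vol (n + int j) = qcard TYPE('k) powi (- int j) * vol n" for n and j :: nat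
  proof (induction j)
    case (Suc j)
    have "vol (n + int j) = qcard TYPE('k) * vol (n + int j + 1)" by (rule vol_Suc)
    then have "qcard TYPE('k) * vol (n + int (Suc j)) = qcard TYPE('k) powi (- int j) * vol n" using Suc by (simp add: add.commute add.left_commute)
    moreover have "qcard TYPE('k) powi (- int (Suc j)) = qcard TYPE('k) powi (- int j) / qcard TYPE('k)" using q0
      by (simp add: power_int_diff power_int_minus power_int_add field_simps)
    ultimately have "qcard TYPE('k) * vol (n + int (Suc j)) = qcard TYPE('k) * (qcard TYPE('k) powi (- int (Suc j)) * vol n)"
      using q0 by (simp del: of_nat_Suc)
    then show ?case by (simp only: mult_left_cancel[OF q0])
  qed simp
  show ?thesis
  proof (cases "j \<ge> 0")
    case True then show ?thesis using 1[of n "nat j"] by simp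
  next
    case False
    then have "vol n = qcard TYPE('k) powi j * vol (n + j)" using 1[of "n + j" "nat (- j)"] by simp
    then show ?thesis using q0 by (simp add: power_int_minus field_simps)
  qed
qed

text \<open>If one ideal had volume 0 then all would, by \<open>vol_add\<close>, and the field, a
  countable union of them, would be a null set.\<close>

lemma vol_pos: "vol n > 0"
proof (rule ccontr)
  assume "\<not> vol n > 0"
  then have "vol n = 0" using vol_nonneg[of n] by simp
  then have z: "vol m = 0" for m using vol_add[of n "m - n"] by simp
  have "emeasure dx (PP m) = 0" for m using z[of m] emeasure_PP[of m] by simp
  then have "PP m \<in> null_sets dx" for m by (auto simp: null_sets_def)
  then have "(\<Union>i::nat. PP (- int i)) \<in> null_sets dx" by (intro null_sets_UN) auto
  moreover have "(\<Union>i::nat. PP (- int i)) = (UNIV :: 'k set)"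
  proof -
    have "x \<in> PP (- int (nat (- vl x)))" for x :: 'k by (simp add: mem_PP)
    then show ?thesis by blast
  qed
  ultimately have "emeasure dx UNIV = 0" by auto
  then show False using haar by (simp add: haar_measure_def)
qed

lemma vol_nz [simp]: "vol n \<noteq> 0" using vol_pos[of n] by simp

text \<open>A map that scales every distance by q^(-j) carries representatives modulo
  \<open>PP N\<close> to representatives modulo \<open>PP (N + j)\<close>. The two finite sums
  coincide and only the volumes of the cosets differ, so no derivative enters.\<close>

lemma I_change_var:
  assumes f: "step_fun m n f" and g: "step_fun m' n' g"
    and gU: "\<And>x. x \<in> U \<Longrightarrow> g x = f (\<phi> x)" "\<And>x. x \<notin> U \<Longrightarrow> g x = 0"
    and fU: "\<And>z. f z \<noteq> 0 \<Longrightarrow> z \<in> \<phi> ` U"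
    and iso: "\<And>x y N. x \<in> U \<Longrightarrow> y \<in> U \<Longrightarrow> \<phi> x - \<phi> y \<in> PP (N + j) \<longleftrightarrow> x - y \<in> PP N"
  shows "I f = of_real (qcard TYPE('k) powi (- j)) * I g"
proof -
  let ?U = "U \<inter> PP m'"
  \<comment> \<open>Fine enough for g on its own domain and, after the scaling by j, for f.\<close>
  define N where "N = max n' (n - j)"
  obtain D where D: "reps N ?U D" using reps_exists[of ?U m' N] by blast
  have DU: "d \<in> U" if "d \<in> D" for d using D that by (auto simp: reps_def)
  have "inj_on \<phi> D"
  proof
    fix x y assume xy: "x \<in> D" "y \<in> D" "\<phi> x = \<phi> y"
    then have "\<phi> x - \<phi> y \<in> PP (N + j)" by simp
    then have "x - y \<in> PP N" using iso DU xy by blast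
    then show "x = y" using D xy by (auto simp: reps_def)
  qed
  have E: "reps (N + j) (\<phi> ` ?U) (\<phi> ` D)"
    unfolding reps_def
  proof (intro conjI ballI impI)
    fix z assume "z \<in> \<phi> ` ?U"
    then obtain u where u: "u \<in> ?U" "z = \<phi> u" by blast
    have "\<exists>d\<in>D. u - d \<in> PP N" using D u(1) unfolding reps_def by blast
    then obtain d where "d \<in> D" "u - d \<in> PP N" ..
    then show "\<exists>e\<in>\<phi> ` D. z - e \<in> PP (N + j)" using u iso DU by blast
  next
    fix d e assume "d \<in> \<phi> ` D" "e \<in> \<phi> ` D" "d - e \<in> PP (N + j)"
    then obtain x y where xy: "x \<in> D" "y \<in> D" "d = \<phi> x" "e = \<phi> y" "\<phi> x - \<phi> y \<in> PP (N + j)" by blast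
    then have "x - y \<in> PP N" using iso DU by blast
    then show "d = e" using D xy by (auto simp: reps_def)
  qed (use D in \<open>auto simp: reps_def\<close>)
  have "step_fun m (N + j) f" by (rule step_fun_mono[OF f]) (auto simp: N_def)
  then have "I f = of_real (vol (N + j)) * (\<Sum>e\<in>\<phi> ` D. f e)"
  proof (rule I_reps[OF _ E])
    fix z assume z: "z \<notin> \<phi> ` ?U"
    show "f z = 0"
    proof (rule ccontr)
      assume nz: "f z \<noteq> 0"
      then obtain u where u: "u \<in> U" "z = \<phi> u" using fU by blast
      then have "u \<in> PP m'" using nz gU(1)[OF u(1)] step_fun_supp[OF g] by metis
      then show False using u z by blast
    qed
  qed
  also have "(\<Sum>e\<in>\<phi> ` D. f e) = (\<Sum>d\<in>D. g d)"
    using \<open>inj_on \<phi> D\<close> gU(1) DU by (simp add: sum.reindex)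
  also have "of_real (vol (N + j)) = of_real (qcard TYPE('k) powi (- j)) * complex_of_real (vol N)"
    by (simp only: vol_add of_real_mult)
  also have "of_real (qcard TYPE('k) powi (- j)) * complex_of_real (vol N) * (\<Sum>d\<in>D. g d) = of_real (qcard TYPE('k) powi (- j)) * I g"
  proof -
    have "step_fun m' N g" by (rule step_fun_mono[OF g]) (auto simp: N_def)
    then have "I g = of_real (vol N) * (\<Sum>d\<in>D. g d)"
      by (rule I_reps[OF _ D]) (use gU(2) step_fun_supp[OF g] in auto)
    then show ?thesis by simp
  qed
  finally show ?thesis .
qed

lemma step_fun_affine:
  assumes "step_fun m n f" "(c::'k) \<noteq> 0" shows "\<exists>m' n'. step_fun m' n' (\<lambda>x. f (c * x + d))"
proof -
  obtain k where k: "d \<in> PP k" "k \<le> m" using ex_PP[of d] PP_monoD by (metis linorder_le_cases)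
  have "step_fun (k - vl c) (n - vl c) (\<lambda>x. f (c * x + d))"
  proof (rule step_funI)
    fix x :: 'k assume "x \<notin> PP (k - vl c)"
    then have "c * x \<notin> PP k" using assms by (simp add: PP_mult_iff)
    then have "c * x + d \<notin> PP m" using k PP_diff[of "c * x + d" k d] PP_monoD by auto
    then show "f (c * x + d) = 0" using assms step_fun_supp by blast
  next
    fix x h :: 'k assume "h \<in> PP (n - vl c)"
    then have "c * h \<in> PP n" using assms by (simp add: PP_mult_iff)
    then show "f (c * (x + h) + d) = f (c * x + d)" using step_fun_inv[OF assms(1), of "c * h" "c * x + d"] by (simp add: algebra_simps)
  qed
  then show ?thesis by blast
qed

lemma I_affine:
  assumes f: "step_fun m n f" and c: "c \<noteq> 0"
  shows "I (\<lambda>x. f (c * x + d)) = of_real (inverse (nabs c)) * I f"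
proof -
  obtain m' n' where g: "step_fun m' n' (\<lambda>x. f (c * x + d))" using step_fun_affine[OF assms] by blast
  have "I f = of_real (qcard TYPE('k) powi (- vl c)) * I (\<lambda>x. f (c * x + d))"
  proof (rule I_change_var[OF f g, where U = UNIV and \<phi> = "\<lambda>x. c * x + d"])
    fix z show "z \<in> range (\<lambda>x. c * x + d)" using c by (intro image_eqI[of _ _ "(z - d) / c"]) auto
    fix x y N
    have "c * x + d - (c * y + d) = c * (x - y)" by (simp add: algebra_simps)
    then show "c * x + d - (c * y + d) \<in> PP (N + vl c) \<longleftrightarrow> x - y \<in> PP N" using c by (simp add: PP_mult_iff)
  qed auto
  then show ?thesis using c by (simp add: nabs_vl[symmetric])
qed

lemma I_shift: "step_fun m n f \<Longrightarrow> I (\<lambda>x. f (x + d)) = I f"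
  using I_affine[of m n f 1 d] by simp

lemma I_scale: "step_fun m n f \<Longrightarrow> c \<noteq> 0 \<Longrightarrow> I (\<lambda>x. f (c * x)) = of_real (inverse (nabs c)) * I f"
  using I_affine[of m n f c 0] by simp

lemma step_fun_I:
  fixes F :: "'k \<Rightarrow> 'k \<Rightarrow> complex"
  assumes "\<And>y. step_fun m n (\<lambda>x. F x y)" shows "step_fun m n (\<lambda>x. I (F x))"
proof (rule step_funI)
  fix x :: 'k assume "x \<notin> PP m"
  then have "F x = (\<lambda>_. 0)" using step_fun_supp[OF assms] by blast
  then show "I (F x) = 0" by simp
next
  fix x h :: 'k assume "h \<in> PP n"
  then have "F (x + h) = F x" using step_fun_inv[OF assms] by blast
  then show "I (F (x + h)) = I (F x)" by simp
qed

text \<open>Both sides are the same finite double sum. Each use has to supply a support and a level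
  for one variable that hold for all values of the other.\<close>

lemma I_swap:
  assumes 1: "\<And>y. step_fun m n (\<lambda>x. F x y)" and 2: "\<And>x. step_fun m' n' (\<lambda>y. F x y)"
  shows "I (\<lambda>x. I (F x)) = I (\<lambda>y. I (\<lambda>x. F x y))"
proof -
  obtain D :: "'k set" where D: "reps n (PP m) D" using reps_exists by blast
  obtain E :: "'k set" where E: "reps n' (PP m') E" using reps_exists by blast
  have "I (\<lambda>x. I (F x)) = of_real (vol n) * (\<Sum>d\<in>D. of_real (vol n') * (\<Sum>e\<in>E. F d e))"
    using I_step_fun[OF step_fun_I[where F = F, OF 1] D] I_step_fun[OF 2 E] by simp
  also have "\<dots> = of_real (vol n') * (\<Sum>e\<in>E. of_real (vol n) * (\<Sum>d\<in>D. F d e))"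
    by (simp add: sum_distrib_left sum_distrib_right sum.swap[of _ E D] algebra_simps)
  also have "\<dots> = I (\<lambda>y. I (\<lambda>x. F x y))"
    using I_step_fun[OF step_fun_I[where F = "\<lambda>y x. F x y", OF 2] E] I_step_fun[OF 1 D] by simp
  finally show ?thesis .
qed

lemma I_sum: "(\<And>i. i \<in> A \<Longrightarrow> \<exists>m n. step_fun m n (f i)) \<Longrightarrow> I (\<lambda>x. \<Sum>i\<in>A. f i x) = (\<Sum>i\<in>A. I (f i))"
  by (rule Bochner_Integration.integral_sum) (meson integrable_step_fun)

end

section \<open>Shells and square classes\<close>

definition shell :: "int \<Rightarrow> 'k::nonarch_local_field set" where "shell i = {x. x \<noteq> 0 \<and> vl x = i}"

definition sqshell :: "'k::nonarch_local_field \<Rightarrow> int \<Rightarrow> 'k set" where "sqshell \<eta> i = (\<lambda>a. \<eta> * a\<^sup>2) ` shell i"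

lemma shell_PP: "x \<in> shell i \<Longrightarrow> x \<in> PP i" "x \<in> shell i \<Longrightarrow> x \<notin> PP (i + 1)"
  by (auto simp: shell_def mem_PP)

lemma PP_split: "x \<in> PP n \<longleftrightarrow> x \<in> PP (n + 1) \<or> x \<in> shell n"
  by (auto simp: shell_def mem_PP)

lemma shell_near: "x \<in> shell i \<Longrightarrow> h \<in> PP (i + 1) \<Longrightarrow> x + h \<in> shell i"
  using vl_add_eq[of x h] by (auto simp: shell_def)

lemma shell_near_iff: "h \<in> PP (i + 1) \<Longrightarrow> x + h \<in> shell i \<longleftrightarrow> x \<in> shell i"
  using shell_near[of x i h] shell_near[of "x + h" i "- h"] by auto

lemma loc_const_if_near0:
  assumes "\<And>x. x \<noteq> 0 \<Longrightarrow> loc_const f x" "\<And>x. x \<in> PP n \<Longrightarrow> f x = c" shows "loc_const f (x::'k::nonarch_local_field)"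
proof (cases "x = 0")
  case True then show ?thesis unfolding loc_const_def using assms(2)[of 0] assms(2) by (intro exI[of _ n]) auto
qed (use assms in auto)

lemma loc_const_shell:
  assumes "\<And>x. x \<noteq> 0 \<Longrightarrow> loc_const f x"
  shows "loc_const (\<lambda>a. if a \<in> shell i then f a else (0::complex)) (x::'k::nonarch_local_field)"
proof (rule loc_const_if_near0[where n = "i + 1" and c = 0])
  fix x :: 'k assume x: "x \<noteq> 0"
  have "loc_const (\<lambda>a. a \<in> shell i) x" unfolding loc_const_def using shell_near_iff by blast
  then show "loc_const (\<lambda>a. if a \<in> shell i then f a else 0) x" using assms[OF x] by (rule loc_const_comp2[where G = "\<lambda>b y. if b then y else 0"])
qed (use shell_PP in auto)

lemma step_fun_shell:
  assumes "\<And>x. x \<noteq> 0 \<Longrightarrow> loc_const f (x::'k::nonarch_local_field)"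
  shows "\<exists>n\<ge>i. step_fun i n (\<lambda>a. if a \<in> shell i then f a else 0)"
  by (rule step_fun_ex) (use shell_PP loc_const_shell[OF assms] in auto)

definition issq :: "'k::nonarch_local_field \<Rightarrow> bool" where "issq x \<longleftrightarrow> (\<exists>b. b \<noteq> 0 \<and> x = b\<^sup>2)"

lemma issq_nz: "issq x \<Longrightarrow> x \<noteq> 0" by (auto simp: issq_def)
lemma issq_mult: "issq x \<Longrightarrow> issq y \<Longrightarrow> issq (x * y)" unfolding issq_def by (metis mult_eq_0_iff power_mult_distrib)
lemma issq_divide: "issq x \<Longrightarrow> issq y \<Longrightarrow> issq (x / y)" unfolding issq_def by (metis divide_eq_0_iff power_divide)
lemma issq_power2: "b \<noteq> 0 \<Longrightarrow> issq (b\<^sup>2)" by (auto simp: issq_def)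
lemma issq_mult_iff: "issq y \<Longrightarrow> issq (x * y) \<longleftrightarrow> issq x"
  using issq_mult[of x y] issq_divide[of "x * y" y] issq_nz[of y] by auto

lemma sqshell_shell: "\<eta> \<noteq> 0 \<Longrightarrow> sqshell \<eta> i \<subseteq> shell (vl \<eta> + 2 * i)"
  by (auto simp: sqshell_def shell_def vl_mult vl_power)

lemma sqshell_iff: "\<eta> \<noteq> 0 \<Longrightarrow> z \<in> sqshell \<eta> i \<longleftrightarrow> z \<in> shell (vl \<eta> + 2 * i) \<and> issq (z / \<eta>)"
proof
  assume "\<eta> \<noteq> 0" "z \<in> shell (vl \<eta> + 2 * i) \<and> issq (z / \<eta>)"
  then obtain b where "b \<noteq> 0" "z = \<eta> * b\<^sup>2" "vl z = vl \<eta> + 2 * i" by (auto simp: issq_def shell_def field_simps)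
  then show "z \<in> sqshell \<eta> i" using \<open>\<eta> \<noteq> 0\<close> by (auto simp: sqshell_def shell_def vl_mult vl_power)
qed (auto simp: sqshell_def shell_def vl_mult vl_power issq_def)

context haar_setup begin

lemma I_shell_split:
  assumes "\<And>x. loc_const f x"
  shows "I (\<lambda>x. if x \<in> PP n then f x else 0) = I (\<lambda>x. if x \<in> PP (n + 1) then f x else 0) + I (\<lambda>x. if x \<in> shell n then f x else 0)"
proof -
  have "\<exists>n'\<ge>m. step_fun m n' (\<lambda>x. if x \<in> PP m then f x else 0)" for m
  proof (rule step_fun_ex)
    show "loc_const (\<lambda>x. if x \<in> PP m then f x else 0) x" for x
      by (rule loc_const_comp2[where G = "\<lambda>b y. if b then y else 0"]) (use assms loc_const_mem_PP0 in auto)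
  qed auto
  then have 1: "integrable dx (\<lambda>x. if x \<in> PP m then f x else 0)" for m using integrable_step_fun by blast
  obtain n' where "step_fun n n' (\<lambda>x. if x \<in> shell n then f x else 0)" using step_fun_shell[of f n] assms by blast
  note 2 = integrable_step_fun[OF this]
  have "(\<lambda>x. if x \<in> PP n then f x else 0) = (\<lambda>x. (if x \<in> PP (n + 1) then f x else 0) + (if x \<in> shell n then f x else 0))"
    using PP_split[of _ n] shell_PP(2)[of _ n] by (intro ext) auto
  then show ?thesis using Bochner_Integration.integral_add[OF 1[of "n + 1"] 2] by simp
qed

lemma Re_I_nonneg: assumes "step_fun m n f" "\<And>x. Re (f x) \<ge> 0" shows "Re (I f) \<ge> 0"
proof -
  obtain D :: "'k set" where D: "reps n (PP m) D" using reps_exists by blast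
  show ?thesis unfolding I_step_fun[OF assms(1) D] using assms(2) vol_nonneg by (simp add: sum_nonneg)
qed

end

locale odd_haar = haar_setup dx for dx :: "'k::nonarch_local_field measure" +
  assumes odd_q: "odd (residue_card TYPE('k))"
begin

lemma two [simp]: "(2::'k) \<noteq> 0" "vl (2::'k) = 0" "nabs (2::'k) = 1"
  using two_unit[OF odd_q] nabs_vl[of "2::'k"] by auto

lemma near_square:
  assumes "x \<noteq> 0" "h \<in> PP (vl x + 1)" shows "\<exists>b. b - 1 \<in> PP 1 \<and> b \<noteq> 0 \<and> vl b = 0 \<and> x + h = x * (b::'k)\<^sup>2"
  using square_near[OF odd_q assms(1), of "x + h" 1] assms(2) unit_near_1[of _ 1] by auto

lemma loc_const_issq: "\<eta> \<noteq> 0 \<Longrightarrow> z \<noteq> 0 \<Longrightarrow> loc_const (\<lambda>z. issq (z / \<eta>)) (z::'k)"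
  unfolding loc_const_def
proof (intro exI ballI)
  fix h :: 'k assume "\<eta> \<noteq> 0" "z \<noteq> 0" "h \<in> PP (vl z + 1)"
  then obtain b where "b \<noteq> 0" "z + h = z * b\<^sup>2" using near_square by blast
  then have "(z + h) / \<eta> = z / \<eta> * b\<^sup>2" by simp
  then show "issq ((z + h) / \<eta>) = issq (z / \<eta>)" using issq_mult_iff[of "b\<^sup>2" "z / \<eta>"] \<open>b \<noteq> 0\<close> issq_power2 by metis
qed

lemma step_fun_sqshell:
  assumes "\<eta> \<noteq> 0" "\<And>x. x \<noteq> 0 \<Longrightarrow> loc_const f (x::'k)"
  shows "\<exists>n\<ge>vl \<eta> + 2 * i. step_fun (vl \<eta> + 2 * i) n (\<lambda>z. if z \<in> sqshell \<eta> i then f z else 0)"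
proof -
  have "\<exists>n\<ge>vl \<eta> + 2 * i. step_fun (vl \<eta> + 2 * i) n (\<lambda>z. if z \<in> shell (vl \<eta> + 2 * i) then (if issq (z / \<eta>) then f z else 0) else 0)"
  proof (rule step_fun_shell)
    fix x :: 'k assume x: "x \<noteq> 0"
    show "loc_const (\<lambda>z. if issq (z / \<eta>) then f z else 0) x"
      by (rule loc_const_comp2[where G = "\<lambda>b y. if b then y else 0"]) (use x assms loc_const_issq in auto)
  qed
  moreover have "(\<lambda>z. if z \<in> shell (vl \<eta> + 2 * i) then (if issq (z / \<eta>) then f z else 0) else 0) = (\<lambda>z. if z \<in> sqshell \<eta> i then f z else 0)"
    using sqshell_iff[OF assms(1)] by (intro ext) auto
  ultimately show ?thesis by simp
qed

text \<open>On each coset of \<open>PP (i + 1)\<close> in the shell the map a -> \<eta> a^2 scales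
  distances by the constant factor \<bar>\<eta>\<bar> q^(-i), and each value is taken on exactly two
  cosets, those of a and -a. This is the Jacobian of the parametrisation of a square class, with the
  1/2 for its two-to-one nature.\<close>

lemma I_sqshell:
  assumes \<eta>: "\<eta> \<noteq> 0" and f: "\<And>x. x \<noteq> 0 \<Longrightarrow> loc_const f (x::'k)"
  shows "I (\<lambda>z. if z \<in> sqshell \<eta> i then f z else 0) =
    of_real (nabs \<eta> * qcard TYPE('k) powi (- i) / 2) * I (\<lambda>a. if a \<in> shell i then f (\<eta> * a\<^sup>2) else 0)"
proof -
  have "shell i \<subseteq> (PP i :: 'k set)" using shell_PP by blast
  then obtain D :: "'k set" where D: "reps (i + 1) (shell i) D" using reps_exists by blast
  then have fin: "finite D" and Ds: "\<And>d. d \<in> D \<Longrightarrow> d \<noteq> 0 \<and> vl d = i" by (auto simp: reps_def shell_def)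
  define U where "U d = {x. x - d \<in> PP (i + 1)}" for d :: 'k
  define \<phi> where "\<phi> x = \<eta> * x\<^sup>2" for x
  \<comment> \<open>\<open>F d\<close> is f cut off to the image of the coset of d,
    \<open>G d\<close> its pull-back to that coset.\<close>
  define F where "F d z = (if z \<in> \<phi> ` U d then f z else 0)" for d z
  define G where "G d x = (if x \<in> U d then f (\<phi> x) else 0)" for d x
  have U: "x \<noteq> 0 \<and> vl x = i" if "x \<in> U d" "d \<in> D" for x d
    using vl_near[of d x] that Ds[of d] by (auto simp: U_def)
  have \<phi>0: "\<phi> x \<noteq> 0" if "x \<noteq> 0" for x using that \<eta> by (simp add: \<phi>_def)
  have vl\<phi>: "vl (\<phi> x) = vl \<eta> + 2 * i" if "x \<in> U d" "d \<in> D" for x d using U[OF that] \<eta> by (simp add: \<phi>_def vl_mult vl_power)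
  have stpF: "\<exists>n. step_fun (vl \<eta> + 2 * i) n (F d)" if d: "d \<in> D" for d
  proof -
    \<comment> \<open>A small additive perturbation of z is multiplication by a square of an element
      of 1 + P, so stability under such squares gives local constancy of the indicator function of
      the image.\<close>
    have mem1: "z * b\<^sup>2 \<in> \<phi> ` U d" if "z \<in> \<phi> ` U d" "b - 1 \<in> PP 1" for z b
    proof -
      obtain x where x: "x \<in> U d" "z = \<phi> x" using \<open>z \<in> \<phi> ` U d\<close> by blast
      have "x * (b - 1) \<in> PP (i + 1)" using U[OF x(1) d] that(2) by (intro PP_mult) (auto simp: mem_PP)
      then have "x * (b - 1) + (x - d) \<in> PP (i + 1)" using x(1) by (intro PP_add) (auto simp: U_def)
      then have "x * b \<in> U d" by (simp add: U_def algebra_simps)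
      then show ?thesis using x(2) by (auto simp: \<phi>_def power_mult_distrib intro!: image_eqI[of _ _ "x * b"])
    qed
    have mem2: "z * b\<^sup>2 \<in> \<phi> ` U d \<longleftrightarrow> z \<in> \<phi> ` U d" if b: "b - 1 \<in> PP 1" for z b
    proof
      assume *: "z * b\<^sup>2 \<in> \<phi> ` U d"
      have b0: "b \<noteq> 0" "vl b = 0" using unit_near_1[OF b] by auto
      have "inverse b - 1 = - (b - 1) * inverse b" using b0 by (simp add: field_simps)
      then have "inverse b - 1 \<in> PP (1 + 0)" using b b0 by (simp only:, intro PP_mult) (auto simp: mem_PP vl_inverse vl_diff_commute)
      from mem1[OF *, of "inverse b"] this show "z \<in> \<phi> ` U d" using b0 by (simp add: power_inverse field_simps)
    qed (use mem1 b in auto)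
    have "\<exists>n\<ge>vl \<eta> + 2 * i. step_fun (vl \<eta> + 2 * i) n (F d)"
    proof (rule step_fun_ex)
      show "F d x = 0" if "x \<notin> PP (vl \<eta> + 2 * i)" for x using vl\<phi>[of _ d] d that by (auto simp: F_def mem_PP)
      show "loc_const (F d) x" for x unfolding F_def
      proof (rule loc_const_if_near0[where n = "vl \<eta> + 2 * i + 1" and c = 0])
        fix x :: 'k assume x: "x \<noteq> 0"
        have "loc_const (\<lambda>z. z \<in> \<phi> ` U d) x" unfolding loc_const_def
          using near_square[OF x] mem2 by metis
        then show "loc_const (\<lambda>z. if z \<in> \<phi> ` U d then f z else 0) x" using f[OF x] by (rule loc_const_comp2[where G = "\<lambda>b y. if b then y else 0"])
      next
        fix x :: 'k assume x: "x \<in> PP (vl \<eta> + 2 * i + 1)"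
        have "x \<notin> \<phi> ` U d"
        proof
          assume "x \<in> \<phi> ` U d"
          then obtain u where "u \<in> U d" "x = \<phi> u" by blast
          then have "x \<noteq> 0" "vl x = vl \<eta> + 2 * i" using vl\<phi>[of u d] U[of u d] \<phi>0 d by auto
          then show False using x by (simp add: mem_PP)
        qed
        then show "(if x \<in> \<phi> ` U d then f x else 0) = 0" by simp
      qed
    qed
    then show ?thesis by blast
  qed
  have stpG: "\<exists>n. step_fun i n (G d)" if d: "d \<in> D" for d
  proof -
    have "\<exists>n\<ge>i. step_fun i n (G d)"
    proof (rule step_fun_ex)
      show "G d x = 0" if "x \<notin> PP i" for x using U[of x d] d that by (auto simp: G_def mem_PP)
      show "loc_const (G d) x" for x unfolding G_def
      proof (rule loc_const_if_near0[where n = "i + 1" and c = 0])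
        fix x :: 'k assume x: "x \<noteq> 0"
        have 1: "loc_const (\<lambda>z. z \<in> U d) x" unfolding U_def mem_Collect_eq by (rule loc_const_mem_PP)
        have "loc_const (\<lambda>x. f (\<phi> x)) x" unfolding \<phi>_def
          by (rule loc_const_power2[of "\<lambda>y. f (\<eta> * y)"], rule loc_const_mult, rule f) (use x \<eta> in auto)
        with 1 show "loc_const (\<lambda>z. if z \<in> U d then f (\<phi> z) else 0) x" by (rule loc_const_comp2[where G = "\<lambda>b y. if b then y else 0"])
      next
        fix x :: 'k assume x: "x \<in> PP (i + 1)"
        then have "x \<notin> U d" using U[of x d] d by (auto simp: mem_PP)
        then show "(if x \<in> U d then f (\<phi> x) else 0) = 0" by simp
      qed
    qed
    then show ?thesis by blast
  qed
  have main: "I (F d) = of_real (qcard TYPE('k) powi (- (vl \<eta> + i))) * I (G d)" if d: "d \<in> D" for d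
  proof -
    obtain n n' where nn: "step_fun (vl \<eta> + 2 * i) n (F d)" "step_fun i n' (G d)" using stpF[OF d] stpG[OF d] by blast
    show ?thesis
    proof (rule I_change_var[OF nn, where U = "U d" and \<phi> = \<phi>])
      show "G d x = F d (\<phi> x)" if "x \<in> U d" for x using that by (auto simp: G_def F_def)
      show "G d x = 0" if "x \<notin> U d" for x using that by (auto simp: G_def)
      show "z \<in> \<phi> ` U d" if "F d z \<noteq> 0" for z using that by (auto simp: F_def split: if_splits)
      fix x y N assume xy: "x \<in> U d" "y \<in> U d"
      have "\<phi> x - \<phi> y = \<eta> * (x\<^sup>2 - y\<^sup>2)" by (simp add: \<phi>_def algebra_simps)
      then have "\<phi> x - \<phi> y \<in> PP (N + (vl \<eta> + i)) \<longleftrightarrow> x\<^sup>2 - y\<^sup>2 \<in> PP (N + vl d)"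
        using \<eta> Ds[OF d] by (simp add: PP_mult_iff)
      also have "\<dots> \<longleftrightarrow> x - y \<in> PP N"
        using square_near_iso[OF odd_q, of d x y N] Ds[OF d] xy by (auto simp: U_def)
      finally show "\<phi> x - \<phi> y \<in> PP (N + (vl \<eta> + i)) \<longleftrightarrow> x - y \<in> PP N" .
    qed
  qed
  \<comment> \<open>A value in the image is counted twice, once from each root; the roots lie in
    different cosets because 2 is a unit.\<close>
  have sumF: "(\<Sum>d\<in>D. F d z) = 2 * (if z \<in> sqshell \<eta> i then f z else 0)" for z
  proof (cases "z \<in> sqshell \<eta> i")
    case True
    then obtain a where a: "a \<in> shell i" "z = \<phi> a" by (auto simp: sqshell_def \<phi>_def)
    then have a': "- a \<in> shell i" "a \<noteq> 0" "vl a = i" by (auto simp: shell_def)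
    obtain d1 where d1: "d1 \<in> D" "a - d1 \<in> PP (i + 1)" using D a by (auto simp: reps_def)
    obtain d2 where d2: "d2 \<in> D" "- a - d2 \<in> PP (i + 1)" using D a' unfolding reps_def by blast
    have ne: "d1 \<noteq> d2"
    proof
      assume "d1 = d2"
      have "(a - d1) - (- a - d2) \<in> PP (i + 1)" by (rule PP_diff[OF d1(2) d2(2)])
      then have "2 * a \<in> PP (i + 1)" using \<open>d1 = d2\<close> by (simp add: algebra_simps)
      then show False using a' by (simp add: mem_PP vl_mult)
    qed
    have uniq: "d = e" if "d \<in> D" "e \<in> D" "x - d \<in> PP (i + 1)" "x - e \<in> PP (i + 1)" for x d e
    proof -
      have "d - e \<in> PP (i + 1)" using that PP_trans PP_diff_commute by blast
      then show ?thesis using D that by (auto simp: reps_def)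
    qed
    have "F d z = (if d \<in> {d1, d2} then f z else 0)" if d: "d \<in> D" for d
    proof -
      have "z \<in> \<phi> ` U d \<longleftrightarrow> a \<in> U d \<or> - a \<in> U d"
      proof
        assume "z \<in> \<phi> ` U d"
        then obtain x where x: "x \<in> U d" "\<phi> x = \<phi> a" using a by auto
        then have "x\<^sup>2 = a\<^sup>2" using \<eta> by (simp add: \<phi>_def)
        then have "x = a \<or> x = - a" by (simp add: power2_eq_iff)
        then show "a \<in> U d \<or> - a \<in> U d" using x by auto
      next
        assume "a \<in> U d \<or> - a \<in> U d"
        then show "z \<in> \<phi> ` U d" using a by (auto simp: \<phi>_def intro: image_eqI[of _ _ "- a"])
      qed
      also have "\<dots> \<longleftrightarrow> d \<in> {d1, d2}" using uniq[of d d1 a] uniq[of d d2 "- a"] d d1 d2 by (auto simp: U_def)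
      finally show ?thesis by (simp add: F_def)
    qed
    then have "(\<Sum>d\<in>D. F d z) = (\<Sum>d\<in>D. if d \<in> {d1, d2} then f z else 0)" by (intro sum.cong) auto
    also have "\<dots> = (\<Sum>d\<in>{d1, d2}. f z)" using fin d1 d2 by (intro sum.mono_neutral_cong_right) auto
    also have "\<dots> = 2 * f z" using ne by simp
    finally show ?thesis using True by simp
  next
    case False
    have "F d z = 0" if d: "d \<in> D" for d
    proof -
      have "z \<notin> \<phi> ` U d"
      proof
        assume "z \<in> \<phi> ` U d"
        then obtain x where "x \<in> U d" "z = \<phi> x" by blast
        then have "z \<in> sqshell \<eta> i" using U[of x d] d by (auto simp: sqshell_def shell_def \<phi>_def)
        then show False using False by simp
      qed
      then show ?thesis by (simp add: F_def)
    qed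
    then show ?thesis using False by simp
  qed
  have sumG: "(\<Sum>d\<in>D. G d x) = (if x \<in> shell i then f (\<eta> * x\<^sup>2) else 0)" for x
  proof (cases "x \<in> shell i")
    case True
    then obtain d where d: "d \<in> D" "x - d \<in> PP (i + 1)" using D by (auto simp: reps_def)
    have "G e x = (if e = d then f (\<phi> x) else 0)" if e: "e \<in> D" for e
    proof -
      have "x \<in> U e \<longleftrightarrow> e = d"
        using D d e PP_trans[of e x "i + 1" d] PP_diff_commute[of e x] by (auto simp: U_def reps_def)
      then show ?thesis by (simp add: G_def)
    qed
    then have "(\<Sum>e\<in>D. G e x) = (\<Sum>e\<in>D. if e = d then f (\<phi> x) else 0)" by (intro sum.cong) auto
    then show ?thesis using fin d True by (simp add: \<phi>_def)
  next
    case False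
    have "G d x = 0" if d: "d \<in> D" for d using U[of x d] d False by (auto simp: G_def shell_def)
    then show ?thesis using False by simp
  qed
  let ?f = "\<lambda>z. if z \<in> sqshell \<eta> i then f z else 0" and ?g = "\<lambda>a. if a \<in> shell i then f (\<eta> * a\<^sup>2) else 0"
  have "2 * I ?f = I (\<lambda>z. 2 * ?f z)" by simp
  also have "\<dots> = I (\<lambda>z. \<Sum>d\<in>D. F d z)" by (simp only: sumF)
  also have "\<dots> = (\<Sum>d\<in>D. I (F d))" by (rule I_sum) (use stpF in blast)
  also have "\<dots> = of_real (qcard TYPE('k) powi (- (vl \<eta> + i))) * (\<Sum>d\<in>D. I (G d))"
    unfolding sum_distrib_left by (rule sum.cong[OF refl main])
  also have "(\<Sum>d\<in>D. I (G d)) = I (\<lambda>a. \<Sum>d\<in>D. G d a)" by (rule I_sum[symmetric]) (use stpG in blast)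
  also have "\<dots> = I ?g" by (simp only: sumG)
  also have "qcard TYPE('k) powi (- (vl \<eta> + i)) = nabs \<eta> * qcard TYPE('k) powi (- i)"
    using qcard_pos[where 'k='k] by (subst nabs_vl[OF \<eta>], subst power_int_add[symmetric]) auto
  finally show ?thesis by (simp add: field_simps)
qed

text \<open>By \<open>I_sqshell\<close> with f = 1 each square class of units has half the volume of
  the units, so three disjoint classes do not fit.\<close>

lemma unit_squares_index_2:
  assumes u: "vl (u::'k) = 0" "u \<noteq> 0" "\<not> issq u" and w: "vl w = 0" "w \<noteq> 0" "\<not> issq w"
  shows "issq (w / u)"
proof (rule ccontr)
  assume n: "\<not> issq (w / u)"
  let ?s = "\<lambda>\<eta>::'k. (\<lambda>z. if z \<in> sqshell \<eta> 0 then 1 else (0::complex))"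
  let ?V = "\<lambda>z::'k. if z \<in> shell 0 then 1 else (0::complex)"
  have nabs1: "nabs \<eta> = 1" if "\<eta> \<noteq> 0" "vl \<eta> = 0" for \<eta> :: 'k using that nabs_vl[of \<eta>] by simp
  have I: "I (?s \<eta>) = I ?V / 2" if "\<eta> \<noteq> 0" "vl \<eta> = 0" for \<eta>
    using I_sqshell[OF that(1), of "\<lambda>_. 1" 0] nabs1[OF that] by (simp add: loc_const_const)
  have s: "\<exists>n\<ge>0. step_fun 0 n (?s \<eta>)" if "\<eta> \<noteq> 0" "vl \<eta> = 0" for \<eta>
    using step_fun_sqshell[OF that(1), of "\<lambda>_. 1" 0] that by (simp add: loc_const_const)
  obtain n1 n2 n3 where st: "step_fun 0 n1 (?s 1)" "step_fun 0 n2 (?s u)" "step_fun 0 n3 (?s w)"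
    using s[of 1] s[OF u(2,1)] s[OF w(2,1)] by auto
  obtain n0 where st0: "step_fun 0 n0 ?V" using step_fun_shell[of "\<lambda>_. 1" 0] by (auto simp: loc_const_const)
  \<comment> \<open>Nonnegative if the three classes are disjoint, yet its integral is minus half
    the volume of the units.\<close>
  define g where "g z = ?V z - ?s 1 z - ?s u z - ?s w z" for z
  note st' = integrable_step_fun[OF st(1)] integrable_step_fun[OF st(2)] integrable_step_fun[OF st(3)] integrable_step_fun[OF st0]
  have "I g = I ?V - I (?s 1) - I (?s u) - I (?s w)"
    unfolding g_def by (simp add: st' Bochner_Integration.integral_diff Bochner_Integration.integrable_diff)
  then have Ig: "I g = - I ?V / 2" using I[of 1] I[OF u(2,1)] I[OF w(2,1)] by simp
  define N where "N = max (max n0 n1) (max n2 n3)"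
  have gs: "step_fun 0 N g"
    unfolding step_fun_def g_def using st st0 step_fun_mono[of 0 _ _ 0 N] by (auto simp: step_fun_def N_def PP_max_iff)
  have "Re (g z) \<ge> 0" for z
  proof -
    have 1: "\<not> (issq (z / 1) \<and> issq (z / u))" using issq_divide[of "z / 1" "z / u"] issq_nz[of z] u by auto
    have 2: "\<not> (issq (z / 1) \<and> issq (z / w))" using issq_divide[of "z / 1" "z / w"] issq_nz[of z] w by auto
    have 3: "\<not> (issq (z / u) \<and> issq (z / w))" using issq_divide[of "z / u" "z / w"] issq_nz[of "z / u"] n u w by auto
    show ?thesis using 1 2 3 u w by (auto simp: g_def sqshell_iff)
  qed
  from Re_I_nonneg[OF gs this] have le: "Re (I ?V) \<le> 0" using Ig by simp
  have "I (\<lambda>x. if x \<in> PP 0 then 1 else 0) = I (\<lambda>x. if x \<in> PP (0 + 1) then 1 else 0) + I ?V"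
    by (rule I_shell_split) (rule loc_const_const)
  moreover have "I (\<lambda>x. if x \<in> PP n then 1 else 0) = of_real (vol n)" for n using I_indicator_coset[of 0 n] by simp
  ultimately have "I ?V = of_real (vol 0 - vol (0 + 1))" by simp
  moreover have "vol 0 - vol (0+1) > 0" using vol_Suc[of 0] vol_pos[of 1] qcard_gt_1[where 'k='k]
    by (simp add: mult_less_cancel_right2)
  ultimately show False using le by simp
qed

end

section \<open>The additive character and its conductor\<close>

locale local_char = odd_haar dx for dx :: "'k::nonarch_local_field measure" +
  fixes \<psi> :: "'k \<Rightarrow> complex"
  assumes psi_char: "additive_character \<psi>"
    and psi_trivial: "\<forall>x\<in>ring_of_integers. \<psi> x = 1"
    and psi_nontrivial: "\<exists>x\<in>frac_ideal (- 1). \<psi> x \<noteq> 1"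
    and self_dual: "self_dual_haar_measure \<psi> dx"
begin

lemma psi_add: "\<psi> (x + y) = \<psi> x * \<psi> y" and psi_norm [simp]: "norm (\<psi> x) = 1"
  using psi_char by (auto simp: additive_character_def)
lemma psi_nz [simp]: "\<psi> x \<noteq> 0" using psi_norm[of x] by (metis norm_zero zero_neq_one)
lemma psi_1: "x \<in> PP 0 \<Longrightarrow> \<psi> x = 1" using psi_trivial by (simp add: PP_ring)
lemma psi_0 [simp]: "\<psi> 0 = 1" by (simp add: psi_1)
lemma psi_minus_mult [simp]: "\<psi> (- x) * \<psi> x = 1" "\<psi> x * \<psi> (- x) = 1" by (simp_all add: psi_add[symmetric])
lemma psi_minus: "\<psi> (- x) = cnj (\<psi> x)"
  by (metis complex_norm_square mult.commute mult_cancel_left of_real_1 one_power2 psi_minus_mult(2) psi_norm psi_nz)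
lemma psi_near: "x - y \<in> PP 0 \<Longrightarrow> \<psi> x = \<psi> y"
  using psi_add[of "x - y" y] psi_1[of "x - y"] by simp

text \<open>The conductor is exactly the ring of integers: if c is too large, an element y of
  \<open>PP (- 1)\<close> with \<psi>(y) distinct from 1, divided by c, is a witness inside
  \<open>PP n\<close>.\<close>

lemma psi_trivial_iff: "(\<forall>y\<in>PP n. \<psi> (c * y) = 1) \<longleftrightarrow> c \<in> PP (- n)"
proof
  assume c: "c \<in> PP (- n)"
  show "\<forall>y\<in>PP n. \<psi> (c * y) = 1" using PP_mult[OF c, of _ n] psi_1 by auto
next
  assume *: "\<forall>y\<in>PP n. \<psi> (c * y) = 1"
  show "c \<in> PP (- n)"
  proof (rule ccontr)
    assume "c \<notin> PP (- n)"
    then have c: "c \<noteq> 0" "vl c < - n" by (auto simp: mem_PP)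
    obtain y where y: "y \<in> PP (- 1)" "\<psi> y \<noteq> 1" using psi_nontrivial by blast
    have "c * (y / c) \<in> PP (- 1)" using y c by simp
    then have "y / c \<in> PP (- 1 - vl c)" using c by (subst (asm) PP_mult_iff) auto
    then have "y / c \<in> PP n" using c PP_monoD by force
    then show False using * y c by force
  qed
qed

lemma psi_nontrivialE: assumes "c \<notin> PP (- n)" obtains h where "h \<in> PP n" "\<psi> (c * h) \<noteq> 1"
  using psi_trivial_iff[of n c] assms by blast

lemma loc_const_psi: "loc_const \<psi> x" unfolding loc_const_def by (intro exI[of _ 0]) (auto simp: psi_add psi_1)

lemma step_fun_char: "step_fun n (max n (- vl c)) (\<lambda>y. if y \<in> PP n then \<psi> (c * y) else 0)"
proof (rule step_funI)
  fix x h :: 'k assume h: "h \<in> PP (max n (- vl c))"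
  then have h': "h \<in> PP n" "h \<in> PP (- vl c)" by (auto simp: PP_max_iff)
  have "c * h \<in> PP (vl c + - vl c)" by (intro PP_mult h' PP_vl)
  then have "\<psi> (c * (x + h)) = \<psi> (c * x)" by (intro psi_near) (simp add: algebra_simps)
  then show "(if x + h \<in> PP n then \<psi> (c * (x + h)) else 0) = (if x \<in> PP n then \<psi> (c * x) else 0)"
    using PP_add_iff[OF h'(1)] by simp
qed auto

lemma I_char: "I (\<lambda>y. if y \<in> PP n then \<psi> (c * y) else 0) = (if c \<in> PP (- n) then of_real (vol n) else 0)"
proof (cases "c \<in> PP (- n)")
  case True
  then have "(\<lambda>y. if y \<in> PP n then \<psi> (c * y) else 0) = (\<lambda>y. if y - 0 \<in> PP n then 1 else 0)"
    using psi_trivial_iff[of n c] by (intro ext) auto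
  then show ?thesis using True by (simp only: I_indicator_coset if_True)
next
  case False
  then obtain h where h: "h \<in> PP n" "\<psi> (c * h) \<noteq> 1" by (rule psi_nontrivialE)
  let ?f = "\<lambda>y. if y \<in> PP n then \<psi> (c * y) else 0"
  \<comment> \<open>Translation by h multiplies the integral by \<psi>(c h), which differs from 1,
    so the integral vanishes.\<close>
  have "I ?f = I (\<lambda>y. ?f (y + h))" by (rule I_shift[OF step_fun_char, symmetric])
  also have "(\<lambda>y. ?f (y + h)) = (\<lambda>y. \<psi> (c * h) * ?f y)"
    using h PP_add_iff[OF h(1)] by (auto simp: psi_add algebra_simps)
  also have "I \<dots> = \<psi> (c * h) * I ?f" by simp
  finally show ?thesis using h False by simp
qed

section \<open>Fourier transform of step functions\<close>

text \<open>The kernel has no factor 2, unlike \<open>fourier\<close>, so as to agree with the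
  integral that defines the Bessel function.\<close>

definition FT :: "('k \<Rightarrow> complex) \<Rightarrow> 'k \<Rightarrow> complex" where
  "FT f z = I (\<lambda>y. f y * \<psi> (- (z * y)))"

lemma step_fun_FT_integrand: assumes "step_fun m n f" "z \<in> PP k" "m + k \<ge> - j" shows "step_fun m (max (max m n) (max (- k) j)) (\<lambda>y. f y * \<psi> (- (z * y)))"
proof (rule step_funI)
  fix x h :: 'k assume "h \<in> PP (max (max m n) (max (- k) j))"
  then have h: "h \<in> PP n" "h \<in> PP (- k)" by (auto simp: PP_max_iff)
  have "z * h \<in> PP (k + - k)" by (intro PP_mult h assms)
  then have "\<psi> (- (z * (x + h))) = \<psi> (- (z * x))" by (intro psi_near) (simp add: algebra_simps)
  then show "f (x + h) * \<psi> (- (z * (x + h))) = f x * \<psi> (- (z * x))" using step_fun_inv[OF assms(1) h(1)] by simp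
qed (use step_fun_supp[OF assms(1)] in simp)

lemma step_fun_FT_integrand': assumes "step_fun m n f" shows "\<exists>n'. step_fun m n' (\<lambda>y. f y * \<psi> (- (z * y)))"
  using step_fun_FT_integrand[OF assms PP_vl[of z], of "- m - vl z"] by auto

text \<open>Support and level of invariance trade places under the transform, with opposite
  signs.\<close>

lemma step_fun_FT: assumes f: "step_fun m n f" shows "step_fun (- n) (- m) (FT f)"
proof (rule step_funI)
  fix z :: 'k assume "z \<notin> PP (- n)"
  then obtain h where h: "h \<in> PP n" "\<psi> (z * h) \<noteq> 1" by (rule psi_nontrivialE)
  obtain n' where n': "step_fun m n' (\<lambda>y. f y * \<psi> (- (z * y)))" using step_fun_FT_integrand'[OF f] by blast
  have "FT f z = I (\<lambda>y. f (y + h) * \<psi> (- (z * (y + h))))" unfolding FT_def by (rule I_shift[OF n', symmetric])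
  also have "\<dots> = I (\<lambda>y. \<psi> (- (z * h)) * (f y * \<psi> (- (z * y))))"
    using step_fun_inv[OF f h(1)] by (intro arg_cong[where f = I] ext) (simp add: psi_add[symmetric] algebra_simps)
  also have "\<dots> = \<psi> (- (z * h)) * FT f z" by (simp add: FT_def)
  finally show "FT f z = 0" using h by (simp add: psi_minus)
next
  fix z h :: 'k assume h: "h \<in> PP (- m)"
  show "FT f (z + h) = FT f z" unfolding FT_def
  proof (intro arg_cong[where f = I] ext)
    fix y show "f y * \<psi> (- ((z + h) * y)) = f y * \<psi> (- (z * y))"
    proof (cases "y \<in> PP m")
      case True
      have "h * y \<in> PP (- m + m)" by (intro PP_mult h True)
      then have "\<psi> (- ((z + h) * y)) = \<psi> (- (z * y))" by (intro psi_near) (simp add: algebra_simps)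
      then show ?thesis by simp
    qed (use step_fun_supp[OF f] in simp)
  qed
qed

lemma step_fun_schwartz: assumes "step_fun m n (f :: 'k \<Rightarrow> complex)" shows "f \<in> schwartz_bruhat"
proof -
  have "eventually (\<lambda>y. f y = f x) (nhds x)" for x
    unfolding eventually_nhds
    by (intro exI[of _ "{y. y - x \<in> PP n}"]) (use step_fun_near[OF assms] open_coset in auto)
  moreover have "closed (PP m :: 'k set)" using compact_PP compact_imp_closed by blast
  then have "closure {x. f x \<noteq> 0} \<subseteq> PP m" using step_fun_supp[OF assms] by (intro closure_minimal) blast+
  then have "compact (closure {x. f x \<noteq> 0})"
    using compact_PP[of m, where 'k='k] by (metis closed_closure compact_Int_closed inf.absorb_iff2)
  ultimately show ?thesis by (auto simp: schwartz_bruhat_def)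
qed

lemma schwartz_step_fun: assumes "f \<in> schwartz_bruhat" shows "\<exists>m n. step_fun m n (f :: 'k \<Rightarrow> complex)"
proof -
  have l: "loc_const f x" for x
  proof -
    have "eventually (\<lambda>y. f y = f x) (nhds x)" using assms by (auto simp: schwartz_bruhat_def)
    then obtain S where S: "open S" "x \<in> S" "\<And>y. y \<in> S \<Longrightarrow> f y = f x" by (auto simp: eventually_nhds)
    then obtain n where n: "\<forall>y. y - x \<in> PP n \<longrightarrow> y \<in> S" by (auto simp: open_iff_coset)
    have "f (x + h) = f x" if "h \<in> PP n" for h using S(3)[of "x + h"] n that by simp
    then show ?thesis unfolding loc_const_def by blast
  qed
  have "bounded (closure {x. f x \<noteq> 0})" using assms compact_imp_bounded by (auto simp: schwartz_bruhat_def)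
  then obtain e where e: "\<And>x. f x \<noteq> 0 \<Longrightarrow> nabs x \<le> e"
    unfolding bounded_def by (metis (mono_tags, lifting) closure_subset mem_Collect_eq subsetD bounded_any_center[of _ 0]
        \<open>bounded (closure {x. f x \<noteq> 0})\<close> dist_nabs diff_0 nabs_minus)
  obtain k where k: "e < qcard TYPE('k) ^ k" using real_arch_pow qcard_gt_1 by blast
  have "x \<in> PP (- int k)" if "f x \<noteq> 0" for x using e[OF that] k by (simp add: frac_ideal_def)
  then have "\<exists>n\<ge>- int k. step_fun (- int k) n f" by (intro step_fun_ex l) auto
  then show ?thesis by blast
qed

text \<open>Self-duality is assumed for the kernel with the factor 2; since \<bar>2\<bar> = 1, the
  substitution z -> 2z transfers it to \<open>FT\<close>.\<close>

lemma FT_inversion: assumes f: "step_fun m n f" shows "I (\<lambda>z. FT f z * \<psi> (z * y)) = f y"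
proof -
  have 1: "fourier \<psi> dx g z = FT g (2 * z)" for g z
    by (simp add: fourier_def FT_def algebra_simps)
  obtain n' where n': "step_fun (- n) n' (\<lambda>z. FT f z * \<psi> (z * y))"
    using step_fun_FT_integrand'[OF step_fun_FT[OF f], of "- y"] by (auto simp: mult.commute)
  have "fourier \<psi> dx (fourier \<psi> dx f) (- y) = f y"
    using self_dual step_fun_schwartz[OF f] by (auto simp: self_dual_haar_measure_def)
  moreover have "fourier \<psi> dx f = (\<lambda>x. FT f (2 * x))" by (rule ext) (rule 1)
  ultimately have "f y = FT (\<lambda>x. FT f (2 * x)) (2 * (- y))" by (simp only: 1)
  also have "\<dots> = I (\<lambda>x. FT f (2 * x) * \<psi> (2 * x * y))"
    unfolding FT_def[of "\<lambda>x. FT f (2 * x)"] by (simp add: algebra_simps)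
  also have "\<dots> = I (\<lambda>z. FT f z * \<psi> (z * y))" using I_scale[OF n', of 2] by (simp add: algebra_simps)
  finally show ?thesis by simp
qed

subsection \<open>Weil constants\<close>

text \<open>The regularised integral of \<psi>(a y^2) over the whole field: by
  \<open>gauss_eq\<close> any larger domain of integration gives the same value.\<close>

definition gauss :: "'k \<Rightarrow> complex" where
  "gauss a = I (\<lambda>y. if y \<in> PP ((- vl a) div 2) then \<psi> (a * y\<^sup>2) else 0)"

lemma loc_const_psi_square: "loc_const (\<lambda>y. \<psi> (a * y\<^sup>2)) x"
  by (rule loc_const_power2, rule loc_const_mult, rule loc_const_psi)

text \<open>Average over translations y -> y + h. The term a h^2 is integral and drops out, while
  \<psi>(2 a y h) is a nontrivial character of h for every y in the shell.\<close>

lemma shell_gauss_0: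
  assumes a: "a \<noteq> 0" and k: "k < (- vl a) div 2"
  shows "I (\<lambda>y. if y \<in> shell k then \<psi> (a * y\<^sup>2) else 0) = 0"
proof -
  \<comment> \<open>The least r for which a h^2 is integral on \<open>PP r\<close>, that is, half of
    \<open>- vl a\<close> rounded up, whereas the bound on k rounds it down.\<close>
  define r where "r = (1 - vl a) div 2"
  have r: "vl a + 2 * r \<ge> 0" "vl a + k + r < 0" "r > k" using k by (auto simp: r_def)
  let ?f = "\<lambda>y. if y \<in> shell k then \<psi> (a * y\<^sup>2) else 0"
  let ?F = "\<lambda>h y. if h \<in> PP r then ?f y * \<psi> (2 * a * y * h) else 0"
  obtain n where n: "step_fun k n ?f" using step_fun_shell[of "\<lambda>y. \<psi> (a * y\<^sup>2)" k] loc_const_psi_square by blast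
  define n' where "n' = max n (- vl a - r)"
  have F: "?F h y = (if h \<in> PP r then ?f (y + h) else 0)" for h y
  proof (cases "h \<in> PP r")
    case h: True
    then have hk: "h \<in> PP (k + 1)" using r by (auto elim: PP_monoD)
    have "a * (h * h) \<in> PP (vl a + (r + r))" by (intro PP_mult h PP_vl)
    then have "a * (h * h) \<in> PP 0" using r(1) by (auto elim: PP_monoD)
    then have "\<psi> (a * (y + h)\<^sup>2) = \<psi> (a * y\<^sup>2 + 2 * a * y * h)" by (intro psi_near) (simp add: power2_eq_square algebra_simps)
    then show ?thesis using h shell_near_iff[OF hk, of y] by (simp add: psi_add)
  qed simp
  have stp1: "step_fun r (- vl a - k) (\<lambda>h. ?F h y)" for y
  proof (rule step_funI)
    fix x h :: 'k assume h: "h \<in> PP (- vl a - k)"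
    then have hr: "h \<in> PP r" using r by (auto elim: PP_monoD)
    show "?F (x + h) y = ?F x y"
    proof (cases "y \<in> shell k")
      case True
      then have "2 * a * y * h \<in> PP (vl (2 * a * y) + (- vl a - k))" by (intro PP_mult h PP_vl)
      moreover have "vl (2 * a * y) + (- vl a - k) = 0" using True a by (auto simp: shell_def vl_mult)
      ultimately have "\<psi> (2 * a * y * (x + h)) = \<psi> (2 * a * y * x)" by (intro psi_near) (simp add: algebra_simps)
      then show ?thesis using PP_add_iff[OF hr, of x] by simp
    qed simp
  qed auto
  have stp2: "step_fun k n' (\<lambda>y. ?F h y)" for h
  proof (rule step_funI)
    fix x t :: 'k assume "t \<in> PP n'"
    then have t: "t \<in> PP n" "t \<in> PP (- vl a - r)" by (auto simp: n'_def PP_max_iff)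
    show "?F h (x + t) = ?F h x"
    proof (cases "h \<in> PP r")
      case True
      have "(2 * a) * (t * h) \<in> PP (vl (2 * a) + ((- vl a - r) + r))" by (intro PP_mult t True PP_vl)
      moreover have "vl (2 * a) + ((- vl a - r) + r) = 0" using a by (simp add: vl_mult)
      ultimately have "\<psi> (2 * a * (x + t) * h) = \<psi> (2 * a * x * h)" by (intro psi_near) (simp add: algebra_simps)
      then show ?thesis using step_fun_inv[OF n t(1), of x] True by simp
    qed simp
  qed (use step_fun_supp[OF n] in simp)
  have "I (\<lambda>h. I (\<lambda>y. ?F h y)) = I (\<lambda>h. if h - 0 \<in> PP r then I ?f else 0)"
  proof (intro arg_cong[where f = I] ext)
    fix h show "I (\<lambda>y. ?F h y) = (if h - 0 \<in> PP r then I ?f else 0)"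
      unfolding F using I_shift[OF n, of h] by (cases "h \<in> PP r") simp_all
  qed
  also have "\<dots> = I (\<lambda>h. (if h - 0 \<in> PP r then 1 else 0) * I ?f)" by (intro arg_cong[where f = I] ext) simp
  also have "\<dots> = of_real (vol r) * I ?f" by (simp only: integral_mult_left_zero I_indicator_coset)
  finally have 1: "I (\<lambda>h. I (\<lambda>y. ?F h y)) = of_real (vol r) * I ?f" .
  have 2: "I (\<lambda>h. ?F h y) = 0" for y
  proof (cases "y \<in> shell k")
    case True
    have "I (\<lambda>h. ?F h y) = I (\<lambda>h. ?f y * (if h \<in> PP r then \<psi> ((2 * a * y) * h) else 0))"
      by (intro arg_cong[where f = I] ext) simp
    also have "\<dots> = ?f y * I (\<lambda>h. (if h \<in> PP r then \<psi> ((2 * a * y) * h) else 0))" by simp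
    also have "2 * a * y \<notin> PP (- r)" using True a r(2) by (auto simp: mem_PP shell_def vl_mult)
    then have "I (\<lambda>h. (if h \<in> PP r then \<psi> ((2 * a * y) * h) else 0)) = 0" unfolding I_char by simp
    finally show ?thesis by simp
  qed (simp cong: if_cong)
  have "I (\<lambda>h. I (\<lambda>y. ?F h y)) = I (\<lambda>y. I (\<lambda>h. ?F h y))" by (rule I_swap[OF stp1 stp2])
  then show ?thesis using 1 2 by simp
qed

lemma gauss_eq:
  assumes a: "a \<noteq> 0" and n: "n \<le> (- vl a) div 2"
  shows "I (\<lambda>y. if y \<in> PP n then \<psi> (a * y\<^sup>2) else 0) = gauss a"
  using n
proof (induction n rule: int_le_induct)
  case (step i)
  have "I (\<lambda>y. if y \<in> PP (i - 1) then \<psi> (a * y\<^sup>2) else 0) = I (\<lambda>y. if y \<in> PP (i - 1 + 1) then \<psi> (a * y\<^sup>2) else 0)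
     + I (\<lambda>y. if y \<in> shell (i - 1) then \<psi> (a * y\<^sup>2) else 0)"
    by (rule I_shell_split) (rule loc_const_psi_square)
  then show ?case using step shell_gauss_0[OF a, of "i - 1"] by simp
qed (simp add: gauss_def)

lemma step_fun_PP_psi_square: "\<exists>n'\<ge>n. step_fun n n' (\<lambda>y. if y \<in> PP n then \<psi> (a * y\<^sup>2) else 0)"
proof (rule step_fun_ex)
  show "loc_const (\<lambda>y. if y \<in> PP n then \<psi> (a * y\<^sup>2) else 0) x" for x
    by (rule loc_const_comp2[where G = "\<lambda>b y. if b then y else 0"]) (use loc_const_psi_square loc_const_mem_PP0 in auto)
qed auto

text \<open>Interchange the integrals and complete the square, a y^2 - 2 x y = a (y - x/a)^2 -
  x^2/a; the integral over y is then the Gauss integral, independently of x.\<close>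

lemma weil_identity:
  assumes a: "a \<noteq> 0" and f: "step_fun m n f"
  shows "I (\<lambda>y. fourier \<psi> dx f y * \<psi> (a * y\<^sup>2)) = gauss a * I (\<lambda>x. f x * \<psi> (- (inverse a * x\<^sup>2)))"
proof -
  \<comment> \<open>The three bounds say that the Fourier transform vanishes outside
    \<open>PP N\<close>, that x/a lies in \<open>PP N\<close> for x in the support of f, and that
    \<open>gauss_eq\<close> applies.\<close>
  define N where "N = min (min (- n) (m - vl a)) ((- vl a) div 2)"
  have N: "N \<le> - n" "N \<le> m - vl a" "N \<le> (- vl a) div 2" by (auto simp: N_def)
  let ?F = "\<lambda>y x. if y \<in> PP N then f x * (\<psi> (- (2 * y * x)) * \<psi> (a * y\<^sup>2)) else 0"
  have F0: "fourier \<psi> dx f y = 0" if "y \<notin> PP N" for y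
  proof -
    have "y \<notin> PP (- n)" using that N(1) PP_monoD by blast
    then have "2 * y \<notin> PP (- n)" by (simp add: PP_mult_iff)
    then have "FT f (2 * y) = 0" using step_fun_supp[OF step_fun_FT[OF f]] by blast
    then show ?thesis by (simp add: fourier_def FT_def)
  qed
  have 1: "fourier \<psi> dx f y * \<psi> (a * y\<^sup>2) = I (?F y)" for y
  proof (cases "y \<in> PP N")
    case True
    then have "?F y = (\<lambda>x. (f x * \<psi> (- (2 * y * x))) * \<psi> (a * y\<^sup>2))" by auto
    then have "I (?F y) = I (\<lambda>x. (f x * \<psi> (- (2 * y * x))) * \<psi> (a * y\<^sup>2))" by (rule arg_cong)
    then show ?thesis by (simp only: integral_mult_left_zero fourier_def)
  qed (use F0 in simp)
  define L where "L = max (max (- vl a - N) (max (- vl a) 0)) (max (- m) N)"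
  have stp1: "step_fun N L (\<lambda>y. ?F y x)" for x
  proof (rule step_funI)
    fix y t :: 'k assume "t \<in> PP L"
    then have t: "t \<in> PP (- vl a - N)" "t \<in> PP (- vl a)" "t \<in> PP 0" "t \<in> PP (- m)" "t \<in> PP N" by (auto simp: L_def PP_max_iff)
    show "?F (y + t) x = ?F y x"
    proof (cases "y \<in> PP N \<and> x \<in> PP m")
      case True
      have "t * x \<in> PP (- m + m)" by (intro PP_mult t) (use True in auto)
      then have 2: "2 * (t * x) \<in> PP 0" by (simp add: PP_mult_iff)
      have "a * (y * t) \<in> PP (vl a + (N + (- vl a - N)))" by (intro PP_mult t PP_vl) (use True in auto)
      then have 3: "2 * (a * (y * t)) \<in> PP 0" by (simp add: PP_mult_iff)
      have 4: "a * (t * t) \<in> PP (vl a + (- vl a + 0))" by (intro PP_mult t PP_vl)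
      have "\<psi> (- (2 * (y + t) * x)) = \<psi> (- (2 * y * x))" using 2 by (intro psi_near) (simp add: algebra_simps)
      moreover have "\<psi> (a * (y + t)\<^sup>2) = \<psi> (a * y\<^sup>2)"
        using PP_add[OF 3] 4 by (intro psi_near) (simp add: algebra_simps power2_eq_square)
      ultimately show ?thesis using PP_add_iff[OF t(5), of y] by simp
    next
      case False
      then show ?thesis using PP_add_iff[OF t(5), of y] step_fun_supp[OF f, of x] by auto
    qed
  qed auto
  have stp2: "step_fun m (max n (- N)) (\<lambda>x. ?F y x)" for y
  proof (rule step_funI)
    fix x t :: 'k assume "t \<in> PP (max n (- N))"
    then have t: "t \<in> PP n" "t \<in> PP (- N)" by (auto simp: PP_max_iff)
    show "?F y (x + t) = ?F y x"
    proof (cases "y \<in> PP N")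
      case True
      have "y * t \<in> PP (N + - N)" by (intro PP_mult t True)
      then have 2: "2 * (y * t) \<in> PP 0" by (simp add: PP_mult_iff)
      then have "\<psi> (- (2 * y * (x + t))) = \<psi> (- (2 * y * x))" by (intro psi_near) (simp add: algebra_simps)
      then show ?thesis using step_fun_inv[OF f t(1)] by simp
    qed simp
  qed (use step_fun_supp[OF f] in simp)
  have 2: "I (\<lambda>y. ?F y x) = gauss a * (f x * \<psi> (- (inverse a * x\<^sup>2)))" for x
  proof (cases "x \<in> PP m")
    case True
    have "a * (x / a) \<in> PP m" using True a by simp
    then have "x / a \<in> PP (m - vl a)" using a by (subst (asm) PP_mult_iff) auto
    then have xa: "- (x / a) \<in> PP N" using N(2) PP_monoD by fastforce
    let ?g = "\<lambda>y. if y \<in> PP N then \<psi> (a * y\<^sup>2) else 0"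
    obtain n' where n': "step_fun N n' ?g" using step_fun_PP_psi_square by blast
    have "?F y x = (f x * \<psi> (- (inverse a * x\<^sup>2))) * ?g (y + - (x / a))" for y
    proof -
      have "a * (y - x / a)\<^sup>2 - inverse a * x\<^sup>2 = a * y\<^sup>2 - 2 * y * x" using a by (simp add: power2_eq_square field_simps)
      then have "\<psi> (- (2 * y * x)) * \<psi> (a * y\<^sup>2) = \<psi> (- (inverse a * x\<^sup>2)) * \<psi> (a * (y - x / a)\<^sup>2)"
        by (simp add: psi_add[symmetric])
      then show ?thesis using PP_add_iff[OF xa, of y] by simp
    qed
    then have "I (\<lambda>y. ?F y x) = I (\<lambda>y. (f x * \<psi> (- (inverse a * x\<^sup>2))) * ?g (y + - (x / a)))" by simp
    also have "\<dots> = (f x * \<psi> (- (inverse a * x\<^sup>2))) * I (\<lambda>y. ?g (y + - (x / a)))" by (rule integral_mult_right_zero)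
    also have "I (\<lambda>y. ?g (y + - (x / a))) = I ?g" by (rule I_shift[OF n'])
    also have "I ?g = gauss a" by (rule gauss_eq[OF a N(3)])
    finally show ?thesis by simp
  qed (use step_fun_supp[OF f] in \<open>simp cong: if_cong\<close>)
  have "I (\<lambda>y. fourier \<psi> dx f y * \<psi> (a * y\<^sup>2)) = I (\<lambda>y. I (?F y))" by (simp only: 1)
  also have "\<dots> = I (\<lambda>x. I (\<lambda>y. ?F y x))" by (rule I_swap[OF stp1 stp2])
  also have "\<dots> = gauss a * I (\<lambda>x. f x * \<psi> (- (inverse a * x\<^sup>2)))" by (simp only: 2 integral_mult_right_zero)
  finally show ?thesis .
qed

text \<open>\<open>weil_identity\<close> supplies existence, and a single test function the
  uniqueness that the definite description requires.\<close>

lemma weil_constant_eq: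
  assumes a: "a \<noteq> 0"
  shows "weil_constant \<psi> dx a = of_real (nabs a powr (1 / 2)) * gauss a"
proof -
  have pos: "nabs a > 0" using a by (simp add: less_le)
  have pw: "complex_of_real (nabs a powr (- 1 / 2)) * of_real (nabs a powr (1 / 2)) = 1"
    unfolding of_real_mult[symmetric] powr_add[symmetric] using pos a by simp
  let ?J = "\<lambda>\<Phi>. I (\<lambda>x. \<Phi> x * \<psi> (- (inverse a * x\<^sup>2)))"
  show ?thesis unfolding weil_constant_def
  proof (rule the_equality)
    show "\<forall>\<Phi>\<in>schwartz_bruhat. I (\<lambda>x. fourier \<psi> dx \<Phi> x * \<psi> (a * x\<^sup>2)) = of_real (nabs a powr (- 1 / 2)) *
      (of_real (nabs a powr (1 / 2)) * gauss a) * ?J \<Phi>"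
    proof
      fix \<Phi> :: "'k \<Rightarrow> complex" assume "\<Phi> \<in> schwartz_bruhat"
      then obtain m n where "step_fun m n \<Phi>" using schwartz_step_fun by blast
      from weil_identity[OF a this] show "I (\<lambda>x. fourier \<psi> dx \<Phi> x * \<psi> (a * x\<^sup>2)) = of_real (nabs a powr (- 1 / 2)) *
        (of_real (nabs a powr (1 / 2)) * gauss a) * ?J \<Phi>"
        using pw by (simp add: mult.assoc[symmetric])
    qed
  next
    fix c assume c: "\<forall>\<Phi>\<in>schwartz_bruhat. I (\<lambda>x. fourier \<psi> dx \<Phi> x * \<psi> (a * x\<^sup>2)) = of_real (nabs a powr (- 1 / 2)) * c * ?J \<Phi>"
    \<comment> \<open>So small a neighbourhood that \<psi>(-x^2/a) = 1 on it; the test integral is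
      then \<open>vol m\<close>, which is not 0.\<close>
    define m where "m = max (vl a) 0"
    let ?\<Phi> = "\<lambda>x::'k. if x - 0 \<in> PP m then 1 else (0::complex)"
    have s: "step_fun m m ?\<Phi>" by (rule step_fun_indicator_coset) auto
    have "?J ?\<Phi> = I ?\<Phi>"
    proof (intro arg_cong[where f = I] ext)
      fix x
      have "\<psi> (- (inverse a * x\<^sup>2)) = 1" if x: "x \<in> PP m"
      proof -
        have "x \<in> PP (vl a)" "x \<in> PP 0" using x by (auto simp: m_def PP_max_iff)
        then have "inverse a * (x * x) \<in> PP (vl (inverse a) + (vl a + 0))" by (intro PP_mult PP_vl)
        then show ?thesis using a by (intro psi_1) (simp add: vl_inverse power2_eq_square)
      qed
      then show "?\<Phi> x * \<psi> (- (inverse a * x\<^sup>2)) = ?\<Phi> x" by simp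
    qed
    then have J: "?J ?\<Phi> = of_real (vol m)" by (simp only: I_indicator_coset)
    have "gauss a * ?J ?\<Phi> = of_real (nabs a powr (- 1 / 2)) * c * ?J ?\<Phi>"
      by (rule trans[OF weil_identity[OF a s, symmetric] c[rule_format, OF step_fun_schwartz[OF s]]])
    then have "gauss a = of_real (nabs a powr (- 1 / 2)) * c" unfolding J by simp
    then have "of_real (nabs a powr (1 / 2)) * gauss a = (of_real (nabs a powr (- 1 / 2)) * of_real (nabs a powr (1 / 2))) * c"
      by (simp only: mult_ac)
    then show "c = of_real (nabs a powr (1 / 2)) * gauss a" unfolding pw by simp
  qed
qed

end

section \<open>The Hilbert symbol\<close>

lemma hilbert_symbol_commute: "hilbert_symbol a b = hilbert_symbol b (a::'k::nonarch_local_field)"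
proof -
  have "\<exists>x y z. (x, y, z) \<noteq> (0, 0, 0) \<and> z\<^sup>2 = b * x\<^sup>2 + a * y\<^sup>2"
    if "\<exists>x y z. (x, y, z) \<noteq> (0, 0, 0) \<and> z\<^sup>2 = a * x\<^sup>2 + b * y\<^sup>2" for a b :: 'k
  proof -
    from that obtain x y z where "(x, y, z) \<noteq> (0, 0, 0)" "z\<^sup>2 = a * x\<^sup>2 + b * y\<^sup>2" by blast
    then have "(y, x, z) \<noteq> (0, 0, 0) \<and> z\<^sup>2 = b * y\<^sup>2 + a * x\<^sup>2" by auto
    then show ?thesis by blast
  qed
  then have "(\<exists>x y z. (x, y, z) \<noteq> (0, 0, 0) \<and> z\<^sup>2 = b * x\<^sup>2 + a * y\<^sup>2) \<longleftrightarrow>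
    (\<exists>x y z. (x, y, z) \<noteq> (0, 0, 0) \<and> z\<^sup>2 = a * x\<^sup>2 + b * y\<^sup>2)" by blast
  then show ?thesis unfolding hilbert_symbol_def by simp
qed

lemma hilbert_symbol_mult_square:
  assumes "c \<noteq> 0" shows "hilbert_symbol (a * c\<^sup>2) b = hilbert_symbol a (b::'k::nonarch_local_field)"
proof -
  have "\<exists>x y z. (x, y, z) \<noteq> (0, 0, 0) \<and> z\<^sup>2 = (a * c\<^sup>2) * x\<^sup>2 + b * y\<^sup>2"
    if "\<exists>x y z. (x, y, z) \<noteq> (0, 0, 0) \<and> z\<^sup>2 = a * x\<^sup>2 + b * y\<^sup>2" "c \<noteq> 0" for a b c :: 'k
  proof -
    from that(1) obtain x y z where "(x, y, z) \<noteq> (0, 0, 0)" "z\<^sup>2 = a * x\<^sup>2 + b * y\<^sup>2" by blast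
    then have "(x / c, y, z) \<noteq> (0, 0, 0) \<and> z\<^sup>2 = (a * c\<^sup>2) * (x / c)\<^sup>2 + b * y\<^sup>2" using that(2) by (auto simp: power_divide)
    then show ?thesis by blast
  qed
  note * = this
  have e: "a * c\<^sup>2 * (inverse c)\<^sup>2 = a" using assms by (simp add: power_inverse)
  have "(\<exists>x y z. (x, y, z) \<noteq> (0, 0, 0) \<and> z\<^sup>2 = (a * c\<^sup>2) * x\<^sup>2 + b * y\<^sup>2) \<longleftrightarrow>
    (\<exists>x y z. (x, y, z) \<noteq> (0, 0, 0) \<and> z\<^sup>2 = a * x\<^sup>2 + b * y\<^sup>2)" (is "?L \<longleftrightarrow> ?R")
  proof
    assume ?L then show ?R by (rule *[where a = "a * c\<^sup>2" and c = "inverse c", unfolded e]) (use assms in simp)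
  next
    assume ?R then show ?L by (rule *) (rule assms)
  qed
  then show ?thesis unfolding hilbert_symbol_def by simp
qed

lemma hilbert_symbol_mult_square':
  "c \<noteq> 0 \<Longrightarrow> hilbert_symbol b (a * c\<^sup>2) = hilbert_symbol b (a::'k::nonarch_local_field)"
  using hilbert_symbol_mult_square hilbert_symbol_commute by metis

lemma hilbert_symbol_issq: "issq a \<Longrightarrow> hilbert_symbol a b = 1"
proof -
  assume "issq a"
  then obtain c where "c \<noteq> 0" "a = c\<^sup>2" by (auto simp: issq_def)
  then have "(1, 0, c) \<noteq> (0, 0, 0) \<and> c\<^sup>2 = a * 1\<^sup>2 + b * 0\<^sup>2" by auto
  then show ?thesis unfolding hilbert_symbol_def by metis
qed

lemma hilbert_symbol_issq': "issq a \<Longrightarrow> hilbert_symbol b a = 1"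
  using hilbert_symbol_issq hilbert_symbol_commute by metis

lemma hilbert_symbol_values: "hilbert_symbol a b = 1 \<or> hilbert_symbol a b = - 1"
  by (simp add: hilbert_symbol_def)

context local_char begin

lemma issq_near_1: "y - 1 \<in> PP 1 \<Longrightarrow> issq (y :: 'k)"
  using sqrt_near_1[OF odd_q, of 1 y] unit_near_1[of _ 1] unfolding issq_def by (metis dual_order.refl)

text \<open>The form is the norm of the unramified quadratic extension. Only equal valuations of x
  and z could cancel, and then z^2/(u x^2) would be close to 1, hence a square, making u a
  square.\<close>

lemma norm_form_valuation:
  assumes u: "vl (u::'k) = 0" "u \<noteq> 0" "\<not> issq u" and xz: "(x, z) \<noteq> (0, 0)"
  shows "z\<^sup>2 - u * x\<^sup>2 \<noteq> 0 \<and> even (vl (z\<^sup>2 - u * x\<^sup>2))"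
proof (cases "x = 0 \<or> z = 0")
  case True
  then show ?thesis using xz u by (auto simp: vl_mult vl_power)
next
  case False
  then have xz: "x \<noteq> 0" "z \<noteq> 0" by auto
  have nz: "z\<^sup>2 - u * x\<^sup>2 \<noteq> 0"
  proof
    assume "z\<^sup>2 - u * x\<^sup>2 = 0"
    then have "u = (z / x)\<^sup>2" using xz by (simp add: field_simps)
    then show False using u(3) xz unfolding issq_def by (metis divide_eq_0_iff)
  qed
  consider "vl z < vl x" | "vl x < vl z" | "vl x = vl z" by linarith
  then show ?thesis
  proof cases
    case 1
    then have "- (u * x\<^sup>2) \<in> PP (vl (z\<^sup>2) + 1)" using xz u by (simp add: mem_PP vl_mult vl_power)
    from vl_add_eq(2)[OF _ this] show ?thesis using nz xz by (simp add: vl_power)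
  next
    case 2
    then have "z\<^sup>2 \<in> PP (vl (- (u * x\<^sup>2)) + 1)" using xz u by (simp add: mem_PP vl_mult vl_power)
    from vl_add_eq(2)[OF _ this] show ?thesis using nz xz u by (simp add: vl_power vl_mult)
  next
    case 3
    have "vl (z\<^sup>2 - u * x\<^sup>2) = 2 * vl x"
    proof (rule ccontr)
      assume *: "vl (z\<^sup>2 - u * x\<^sup>2) \<noteq> 2 * vl x"
      have "z\<^sup>2 \<in> PP (2 * vl x)" "u * x\<^sup>2 \<in> PP (2 * vl x)" using 3 xz u by (auto simp: mem_PP vl_mult vl_power)
      then have "z\<^sup>2 - u * x\<^sup>2 \<in> PP (2 * vl x)" by (rule PP_diff)
      then have "z\<^sup>2 - u * x\<^sup>2 \<in> PP (2 * vl x + 1)" using * nz by (auto simp: mem_PP)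
      then have "(u * x\<^sup>2) * (z\<^sup>2 / (u * x\<^sup>2) - 1) \<in> PP (2 * vl x + 1)" using xz u by (simp add: right_diff_distrib)
      then have "z\<^sup>2 / (u * x\<^sup>2) - 1 \<in> PP 1" using xz u by (subst (asm) PP_mult_iff) (auto simp: vl_mult vl_power)
      then have 1: "issq (z\<^sup>2 / (u * x\<^sup>2))" by (rule issq_near_1)
      have "issq ((z / x)\<^sup>2 / (z\<^sup>2 / (u * x\<^sup>2)))" by (rule issq_divide[OF issq_power2 1]) (use xz in auto)
      moreover have "(z / x)\<^sup>2 / (z\<^sup>2 / (u * x\<^sup>2)) = u" using xz u by (simp add: field_simps)
      ultimately show False using u by simp
    qed
    then show ?thesis using nz by simp
  qed
qed

lemma hilbert_symbol_unit_odd: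
  assumes u: "vl (u::'k) = 0" "u \<noteq> 0" "\<not> issq u" and b: "b \<noteq> 0" "odd (vl b)"
  shows "hilbert_symbol u b = - 1"
proof -
  have False if "(x, y, z) \<noteq> (0, 0, 0)" and e: "z\<^sup>2 = u * x\<^sup>2 + b * y\<^sup>2" for x y z
  proof -
    have e': "z\<^sup>2 - u * x\<^sup>2 = b * y\<^sup>2" using e by simp
    show False
    proof (cases "(x, z) = (0, 0)")
      case True then show False using that(1) e b by simp
    next
      case False
      from norm_form_valuation[OF u False] have "b * y\<^sup>2 \<noteq> 0" "even (vl (b * y\<^sup>2))" unfolding e' by auto
      then show False using b by (auto simp: vl_mult vl_power)
    qed
  qed
  then show ?thesis unfolding hilbert_symbol_def by auto
qed

text \<open>Take the least positive integer n that is not a square in the field. Then n - 1 is a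
  square s^2, and -n, a quotient of two nonsquare units, is a square t^2.\<close>

lemma nonsquare_sum:
  assumes m: "\<not> issq (- 1 :: 'k)"
  shows "\<exists>s t::'k. s\<^sup>2 + t\<^sup>2 + 1 = 0"
proof -
  obtain D :: "'k set" where D: "reps 1 (PP 0) D" using reps_exists by blast
  have on: "(of_nat n :: 'k) \<in> PP 0" for n using nabs_of_nat_le[of n, where 'k='k] by (simp add: frac_ideal_def)
  define f where "f n = (SOME d. d \<in> D \<and> (of_nat n :: 'k) - d \<in> PP 1)" for n
  have f: "f n \<in> D" "of_nat n - f n \<in> PP 1" for n
  proof -
    have "\<exists>d. d \<in> D \<and> (of_nat n :: 'k) - d \<in> PP 1" using D on[of n] by (auto simp: reps_def)
    from someI_ex[OF this] show "f n \<in> D" "of_nat n - f n \<in> PP 1" by (auto simp: f_def)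
  qed
  have "\<not> inj f" using finite_subset[of "range f" D] f(1) D finite_imageD[of f UNIV] by (auto simp: reps_def)
  then obtain i j where ij: "i < j" "f i = f j" unfolding inj_def by (metis linorder_neqE_nat)
  have "(of_nat j :: 'k) - of_nat i \<in> PP 1" using f(2)[of i] f(2)[of j] ij PP_trans PP_diff_commute by metis
  then have p: "(of_nat (j - i) :: 'k) \<in> PP 1" using ij by (simp add: of_nat_diff)
  \<comment> \<open>Pigeonhole on residues gives an integer congruent to -1, so -k is a square and k
    is not; this shows that some positive integer is a nonsquare.\<close>
  define k where "k = j - i - 1"
  have "(of_nat k :: 'k) - (- 1) \<in> PP 1" using p ij by (simp add: k_def of_nat_diff)
  then have k: "- of_nat k - (1::'k) \<in> PP 1" by (metis PP_minus minus_diff_eq minus_minus minus_diff_commute)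
  then have "issq (- of_nat k :: 'k)" by (rule issq_near_1)
  then have "\<not> issq (of_nat k :: 'k)" using issq_divide[of "of_nat k" "- of_nat k :: 'k"] m issq_nz[of "- of_nat k :: 'k"] by auto
  define n where "n = (LEAST n. n > 0 \<and> \<not> issq (of_nat n :: 'k))"
  have "k > 0" using \<open>issq (- of_nat k :: 'k)\<close> issq_nz[of "- of_nat k :: 'k"] by (cases k) auto
  then have n: "n > 0" "\<not> issq (of_nat n :: 'k)"
    using LeastI[of "\<lambda>n. n > 0 \<and> \<not> issq (of_nat n :: 'k)" k] \<open>\<not> issq (of_nat k :: 'k)\<close> unfolding n_def by auto
  have least: "issq (of_nat i :: 'k)" if "i > 0" "i < n" for i
    using not_less_Least[of i "\<lambda>n. n > 0 \<and> \<not> issq (of_nat n :: 'k)"] that unfolding n_def by auto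
  have "n \<noteq> 1" using n issq_power2[of "1::'k"] by auto
  then have n2: "n \<ge> 2" using n by simp
  then have sq: "issq (of_nat (n - 1) :: 'k)" by (intro least) auto
  then obtain s where s: "s \<noteq> 0" "of_nat (n - 1) = (s::'k)\<^sup>2" by (auto simp: issq_def)
  have e: "of_nat n = of_nat (n - 1) + (1::'k)" using n2 by (metis Suc_1 Suc_le_D diff_Suc_1 of_nat_Suc add.commute)
  have "(of_nat n :: 'k) \<notin> PP 1"
  proof
    assume "(of_nat n :: 'k) \<in> PP 1"
    then have "- (of_nat (n - 1) + 1 :: 'k) \<in> PP 1" unfolding e by (subst PP_minus)
    then have "- of_nat (n - 1) - (1::'k) \<in> PP 1" by simp
    then have *: "issq (- of_nat (n - 1) :: 'k)" by (rule issq_near_1)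
    show False using issq_divide[OF * sq] m issq_nz[OF sq] by simp
  qed
  then have nu: "(of_nat n :: 'k) \<noteq> 0" "vl (of_nat n :: 'k) = 0" using on[of n] by (auto simp: mem_PP)
  have "issq (of_nat n / (- 1 :: 'k))" by (rule unit_squares_index_2) (use m nu n in auto)
  then obtain t where "- of_nat n = (t::'k)\<^sup>2" by (auto simp: issq_def)
  then have "s\<^sup>2 + t\<^sup>2 + 1 = 0" using e s by (simp flip: \<open>- of_nat n = t\<^sup>2\<close>)
  then show ?thesis by blast
qed

text \<open>Two nonsquare units differ by a square, which reduces the claim to (u, u) = 1. A
  solution comes from a root of -1 if there is one, and otherwise from -1 = s^2 + t^2 together with
  a root of -u.\<close>

lemma hilbert_symbol_units:
  assumes u: "vl (u::'k) = 0" "u \<noteq> 0" and w: "vl w = 0" "w \<noteq> 0"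
  shows "hilbert_symbol u w = 1"
proof (cases "issq u \<or> issq w")
  case True then show ?thesis using hilbert_symbol_issq hilbert_symbol_issq' by blast
next
  case False
  then obtain c where c: "c \<noteq> 0" "w / u = c\<^sup>2" using unit_squares_index_2[OF u _ w] by (auto simp: issq_def)
  have "w = u * c\<^sup>2" using c(2) u by (simp add: field_simps)
  then have "hilbert_symbol u w = hilbert_symbol u u" using hilbert_symbol_mult_square'[OF c(1), of u u] by simp
  moreover have "\<exists>x y z. (x, y, z) \<noteq> (0, 0, 0) \<and> z\<^sup>2 = u * x\<^sup>2 + u * y\<^sup>2"
  proof (cases "issq (- 1 :: 'k)")
    case True
    then obtain i :: 'k where "- 1 = i\<^sup>2" by (auto simp: issq_def)
    then have "(1::'k, i, 0::'k) \<noteq> (0, 0, 0) \<and> 0\<^sup>2 = u * 1\<^sup>2 + u * i\<^sup>2" by (simp flip: \<open>- 1 = i\<^sup>2\<close>)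
    then show ?thesis by blast
  next
    case m: False
    have "issq (u / (- 1))" by (rule unit_squares_index_2) (use m u False in auto)
    then obtain d where d: "- u = d\<^sup>2" "d \<noteq> 0" by (auto simp: issq_def)
    obtain s t :: 'k where "s\<^sup>2 + t\<^sup>2 + 1 = 0" using nonsquare_sum[OF m] by blast
    then have "s\<^sup>2 + t\<^sup>2 = - 1" by (simp only: eq_neg_iff_add_eq_0)
    then have "d\<^sup>2 = u * (s\<^sup>2 + t\<^sup>2)" using d by simp
    then have "(s, t, d) \<noteq> (0, 0, 0) \<and> d\<^sup>2 = u * s\<^sup>2 + u * t\<^sup>2" using d by (simp add: ring_distribs)
    then show ?thesis by blast
  qed
  then have "hilbert_symbol u u = 1" unfolding hilbert_symbol_def by simp
  ultimately show ?thesis by simp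
qed

subsection \<open>Gauss sums\<close>

text \<open>The Weil constant in the form computed by \<open>weil_constant_eq\<close>.\<close>

definition beta :: "'k \<Rightarrow> complex" where "beta a = of_real (nabs a powr (1 / 2)) * gauss a"

lemma q_powr_powi: "x \<noteq> 0 \<Longrightarrow> nabs (x::'k) powr (1 / 2) = qcard TYPE('k) powr (- real_of_int (vl x) / 2)"
proof -
  assume x: "x \<noteq> 0"
  have "nabs x = qcard TYPE('k) powr (- real_of_int (vl x))"
    using nabs_vl[OF x] powr_real_of_int'[of "qcard TYPE('k)" "- vl x"] qcard_pos(1)[where 'k='k] by simp
  then show ?thesis by (simp add: powr_powr)
qed

lemma vol_eq: "vol n = qcard TYPE('k) powi (- n) * vol 0"
  using vol_add[of 0 n] by simp

lemma beta_even: assumes a: "a \<noteq> 0" "even (vl a)" shows "beta a = of_real (vol 0)"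
proof -
  define m where "m = (- vl a) div 2"
  have m: "vl a = - 2 * m" using a by (auto simp: m_def)
  have "gauss a = I (\<lambda>y. if y - 0 \<in> PP m then 1 else 0)"
    unfolding gauss_def m_def[symmetric]
  proof (intro arg_cong[where f = I] ext)
    fix y
    have "\<psi> (a * y\<^sup>2) = 1" if "y \<in> PP m"
    proof -
      have "a * (y * y) \<in> PP (vl a + (m + m))" by (intro PP_mult that PP_vl)
      then show ?thesis by (intro psi_1) (simp add: m power2_eq_square)
    qed
    then show "(if y \<in> PP m then \<psi> (a * y\<^sup>2) else 0) = (if y - 0 \<in> PP m then 1 else 0)" by simp
  qed
  then have "gauss a = of_real (vol m)" by (simp only: I_indicator_coset)
  moreover have "nabs a powr (1 / 2) = qcard TYPE('k) powi m"
    using q_powr_powi[OF a(1)] m by (simp add: powr_real_of_int')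
  ultimately show ?thesis using vol_eq[of m] qcard_pos[where 'k='k] by (simp add: beta_def power_int_minus)
qed

lemma beta_mult_square: assumes a: "a \<noteq> 0" and c: "c \<noteq> 0" shows "beta (a * c\<^sup>2) = beta a"
proof -
  define m where "m = (- vl a) div 2"
  have m: "(- vl (a * c\<^sup>2)) div 2 = m - vl c" using a c by (simp add: vl_mult vl_power m_def)
  let ?f = "\<lambda>y. if y \<in> PP m then \<psi> (a * y\<^sup>2) else 0"
  obtain n' where n': "step_fun m n' ?f" using step_fun_PP_psi_square by blast
  have "gauss (a * c\<^sup>2) = I (\<lambda>y. ?f (c * y))" unfolding gauss_def m
    using c by (intro arg_cong[where f = I] ext) (auto simp: PP_mult_iff mult.assoc power_mult_distrib)
  also have "\<dots> = of_real (inverse (nabs c)) * I ?f" by (rule I_scale[OF n' c])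
  also have "I ?f = gauss a" by (simp add: gauss_def m_def)
  finally have g: "gauss (a * c\<^sup>2) = of_real (inverse (nabs c)) * gauss a" .
  have pos: "nabs a > 0" "nabs c > 0" using a c by (simp_all add: less_le)
  have "nabs (a * c\<^sup>2) powr (1 / 2) = nabs a powr (1/2) * nabs c"
    using pos by (simp add: nabs_mult nabs_power powr_mult powr_half_sqrt)
  then show ?thesis using g c by (simp add: beta_def)
qed

lemma gauss_minus: "gauss (- a) = cnj (gauss a)"
  unfolding gauss_def vl_minus Bochner_Integration.integral_cnj[symmetric]
  by (intro arg_cong[where f = I] ext) (simp add: psi_minus)

lemma beta_minus: "beta (- a) = cnj (beta a)"
  by (simp add: beta_def gauss_minus)

text \<open>Only the outermost shell of the domain has a nontrivial phase. Under z = a y^2 and z = u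
  a y^2 it covers the two halves of the shell of valuation -1, on which \<psi> integrates to
  \<open>- vol 0\<close>; this cancels the contributions of the inner ideal.\<close>

lemma gauss_nonsquare:
  assumes u: "vl (u::'k) = 0" "u \<noteq> 0" "\<not> issq u" and a: "a \<noteq> 0" "odd (vl a)"
  shows "gauss (u * a) = - gauss a"
proof -
  define m where "m = (- vl a) div 2"
  have m: "vl a = - (2 * m + 1)" using a(2) unfolding m_def by presburger
  let ?shell_int = "\<lambda>b. I (\<lambda>y. if y \<in> shell m then \<psi> (b * y\<^sup>2) else 0)"
  let ?sq = "\<lambda>b. I (\<lambda>z. if z \<in> sqshell b m then \<psi> z else 0)"
  have g: "gauss b = of_real (vol (m + 1)) + ?shell_int b" if b: "b \<noteq> 0" "vl b = vl a" for b
  proof -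
    have "gauss b = I (\<lambda>y. if y \<in> PP m then \<psi> (b * y\<^sup>2) else 0)" by (simp add: gauss_def m_def b)
    also have "\<dots> = I (\<lambda>y. if y \<in> PP (m + 1) then \<psi> (b * y\<^sup>2) else 0) + ?shell_int b"
      by (rule I_shell_split) (rule loc_const_psi_square)
    also have "I (\<lambda>y. if y \<in> PP (m + 1) then \<psi> (b * y\<^sup>2) else 0) = I (\<lambda>y. if y - 0 \<in> PP (m + 1) then 1 else 0)"
    proof (intro arg_cong[where f = I] ext)
      fix y
      have "\<psi> (b * y\<^sup>2) = 1" if "y \<in> PP (m + 1)"
      proof -
        have "b * (y * y) \<in> PP (vl b + ((m + 1) + (m + 1)))" by (intro PP_mult that PP_vl)
        then have "b * (y * y) \<in> PP 0" by (rule PP_monoD) (simp add: m b)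
        then show ?thesis by (intro psi_1) (simp add: power2_eq_square)
      qed
      then show "(if y \<in> PP (m + 1) then \<psi> (b * y\<^sup>2) else 0) = (if y - 0 \<in> PP (m + 1) then 1 else 0)" by simp
    qed
    also have "\<dots> = of_real (vol (m + 1))" by (rule I_indicator_coset)
    finally show ?thesis .
  qed
  have ua: "u * a \<noteq> 0" "vl (u * a) = vl a" using u a by (auto simp: vl_mult)
  have sq: "?sq b = of_real (nabs a * qcard TYPE('k) powi (- m) / 2) * ?shell_int b" if b: "b \<noteq> 0" "vl b = vl a" for b
    using I_sqshell[OF b(1), of \<psi> m] loc_const_psi vl_eq_iff[OF b(1) a(1)] b by simp
  have "?sq a + ?sq (u * a) = I (\<lambda>z. if z \<in> shell (- 1) then \<psi> z else 0)"
  proof -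
    obtain n1 n2 where "step_fun (vl a + 2 * m) n1 (\<lambda>z. if z \<in> sqshell a m then \<psi> z else 0)"
       "step_fun (vl (u * a) + 2 * m) n2 (\<lambda>z. if z \<in> sqshell (u * a) m then \<psi> z else 0)"
      using step_fun_sqshell[OF a(1), of \<psi> m] step_fun_sqshell[OF ua(1), of \<psi> m] loc_const_psi by blast
    then have "?sq a + ?sq (u * a) = I (\<lambda>z. (if z \<in> sqshell a m then \<psi> z else 0) + (if z \<in> sqshell (u * a) m then \<psi> z else 0))"
      by (subst Bochner_Integration.integral_add) (auto intro: integrable_step_fun)
    also have "\<dots> = I (\<lambda>z. if z \<in> shell (- 1) then \<psi> z else 0)"
    proof (intro arg_cong[where f = I] ext)
      fix z
      have 1: "z \<in> sqshell a m \<longleftrightarrow> z \<in> shell (- 1) \<and> issq (z / a)" "z \<in> sqshell (u * a) m \<longleftrightarrow> z \<in> shell (- 1) \<and> issq (z / (u * a))"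
        using sqshell_iff[OF a(1), of z m] sqshell_iff[OF ua(1), of z m] ua m by auto
      have 2: "issq (z / (u * a)) \<longleftrightarrow> \<not> issq (z / a)" if z: "z \<in> shell (- 1)"
      proof
        assume *: "issq (z / (u * a))"
        show "\<not> issq (z / a)"
        proof
          assume "issq (z / a)"
          from issq_divide[OF this *] show False using u a issq_nz[OF *] by simp
        qed
      next
        assume *: "\<not> issq (z / a)"
        have z': "z \<noteq> 0" "vl z = - 1" using z by (auto simp: shell_def)
        have even: "vl (z / a) = 2 * m" using z' a m by (simp add: vl_divide)
        \<comment> \<open>Dividing by an even power of \<open>unif\<close> gives a unit, to which
          the index 2 statement applies.\<close>
        define y where "y = z / a / (unif powi m)\<^sup>2"
        have "vl y = vl (z / a) - vl ((unif powi m :: 'k)\<^sup>2)" unfolding y_def by (rule vl_divide) (use z' a in auto)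
        then have y: "y \<noteq> 0" "vl y = 0" using z' a even by (auto simp: y_def vl_power)
        have ny: "\<not> issq y" using * issq_mult[of y "(unif powi m)\<^sup>2"] issq_power2[of "unif powi m :: 'k"] by (auto simp: y_def)
        have "issq (y / u)" by (rule unit_squares_index_2[OF u y(2,1) ny])
        from issq_mult[OF this issq_power2[of "unif powi m :: 'k"]] show "issq (z / (u * a))"
          by (simp add: y_def mult.commute)
      qed
      show "(if z \<in> sqshell a m then \<psi> z else 0) + (if z \<in> sqshell (u * a) m then \<psi> z else 0) = (if z \<in> shell (- 1) then \<psi> z else 0)"
        using 1 2 by auto
    qed
    finally show ?thesis .
  qed
  also have "\<dots> = - of_real (vol 0)"
  proof -
    have "I (\<lambda>z. if z \<in> PP (- 1) then \<psi> z else 0) = I (\<lambda>z. if z \<in> PP (- 1 + 1) then \<psi> z else 0) + I (\<lambda>z. if z \<in> shell (- 1) then \<psi> z else 0)"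
      by (rule I_shell_split) (rule loc_const_psi)
    moreover have "(1::'k) \<notin> PP 1" "(1::'k) \<in> PP 0" by (auto simp: mem_PP)
    ultimately show ?thesis using I_char[of "- 1" 1] I_char[of 0 1] by (simp cong: if_cong add: eq_neg_iff_add_eq_0 add.commute)
  qed
  finally have "of_real (nabs a * qcard TYPE('k) powi (- m) / 2) * (?shell_int a + ?shell_int (u * a)) = - complex_of_real (vol 0)"
    unfolding sq[OF a(1) refl] sq[OF ua] by (simp add: ring_distribs)
  moreover have "nabs a * qcard TYPE('k) powi (- m) = qcard TYPE('k) powi (m + 1)"
    using nabs_vl[OF a(1)] m by (simp add: power_int_add[symmetric] qcard_pos(1)[THEN less_imp_neq, THEN not_sym])
  moreover have "vol 0 = qcard TYPE('k) powi (m + 1) * vol (m + 1)"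
    using vol_add[of "m + 1" "- (m + 1)"] by (simp add: add.commute)
  ultimately have "complex_of_real (qcard TYPE('k) powi (m + 1)) * (?shell_int a + ?shell_int (u * a)) = of_real (qcard TYPE('k) powi (m + 1)) * (- 2 * of_real (vol (m + 1)))"
    by (simp add: field_simps)
  then have "?shell_int a + ?shell_int (u * a) = - 2 * of_real (vol (m + 1))"
    using qcard_pos(1)[where 'k='k] by (subst (asm) mult_left_cancel) auto
  then show ?thesis using g[OF a(1) refl] g[OF ua] by (simp add: eq_neg_iff_add_eq_0 algebra_simps)
qed

lemma beta_nonsquare:
  assumes u: "vl (u::'k) = 0" "u \<noteq> 0" "\<not> issq u" and a: "a \<noteq> 0" "odd (vl a)"
  shows "beta (u * a) = - beta a"
  using gauss_nonsquare[OF assms] nabs_vl[OF u(2)] u by (simp add: beta_def nabs_mult)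

text \<open>Expand the product as a double integral and shift one variable by the other: the phase
  becomes a h^2 + 2 a h z. Integration over z leaves only h in \<open>PP (m + 1)\<close>, where
  \<psi>(a h^2) = 1.\<close>

lemma beta_cnj_odd:
  assumes a: "a \<noteq> 0" "odd (vl a)" shows "beta a * cnj (beta a) = (of_real (vol 0))\<^sup>2"
proof -
  define m where "m = (- vl a) div 2"
  have m: "vl a = - (2 * m + 1)" using a(2) unfolding m_def by presburger
  let ?f = "\<lambda>b y. if y \<in> PP m then \<psi> (b * y\<^sup>2) else 0"
  obtain n1 where n1: "step_fun m n1 (?f a)" using step_fun_PP_psi_square by blast
  obtain n2 where n2: "step_fun m n2 (?f (- a))" using step_fun_PP_psi_square by blast
  let ?g = "\<lambda>h z. if h \<in> PP m \<and> z \<in> PP m then \<psi> (a * h\<^sup>2) * \<psi> (2 * a * h * z) else 0"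
  have "gauss a * cnj (gauss a) = I (?f a) * I (?f (- a))"
    unfolding gauss_minus[symmetric] by (simp add: gauss_def m_def)
  also have "\<dots> = I (\<lambda>z. ?f (- a) z * I (?f a))" by (simp only: integral_mult_left_zero mult.commute)
  also have "\<dots> = I (\<lambda>z. I (\<lambda>h. ?g h z))"
  proof (intro arg_cong[where f = I] ext)
    fix z
    have "?f (- a) z * I (?f a) = ?f (- a) z * I (\<lambda>h. ?f a (h + z))" using I_shift[OF n1, of z] by simp
    also have "\<dots> = I (\<lambda>h. ?f (- a) z * ?f a (h + z))" by (rule integral_mult_right_zero[symmetric])
    also have "\<dots> = I (\<lambda>h. ?g h z)"
    proof (intro arg_cong[where f = I] ext)
      fix h
      have "\<psi> (- a * z\<^sup>2) * \<psi> (a * (h + z)\<^sup>2) = \<psi> (a * h\<^sup>2) * \<psi> (2 * a * h * z)"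
        unfolding psi_add[symmetric] by (simp add: power2_eq_square algebra_simps)
      then show "?f (- a) z * ?f a (h + z) = ?g h z" using PP_add_iff[of z m h] by auto
    qed
    finally show "?f (- a) z * I (?f a) = I (\<lambda>h. ?g h z)" .
  qed
  also have "\<dots> = I (\<lambda>h. I (\<lambda>z. ?g h z))"
  proof (rule I_swap)
    define L where "L = max m (m + 1)"
    fix h
    show "step_fun m (m + 1) (\<lambda>z. ?g h z)"
    proof (rule step_funI)
      fix z t :: 'k assume t: "t \<in> PP (m + 1)"
      then have tm: "t \<in> PP m" by (auto elim: PP_monoD)
      show "?g h (z + t) = ?g h z"
      proof (cases "h \<in> PP m")
        case True
        have "a * (h * t) \<in> PP (vl a + (m + (m + 1)))" by (intro PP_mult PP_vl True t)
        then have "2 * (a * (h * t)) \<in> PP 0" using m by (simp add: PP_mult_iff)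
        then have "\<psi> (2 * a * h * (z + t)) = \<psi> (2 * a * h * z)" by (intro psi_near) (simp add: algebra_simps)
        then show ?thesis using PP_add_iff[OF tm, of z] by simp
      qed simp
    qed auto
  next
    fix z
    show "step_fun m (m + 1) (\<lambda>h. ?g h z)"
    proof (rule step_funI)
      fix h t :: 'k assume t: "t \<in> PP (m + 1)"
      then have tm: "t \<in> PP m" by (auto elim: PP_monoD)
      show "?g (h + t) z = ?g h z"
      proof (cases "h \<in> PP m \<and> z \<in> PP m")
        case True
        have "a * (z * t) \<in> PP (vl a + (m + (m + 1)))" by (intro PP_mult PP_vl t) (use True in auto)
        then have 1: "2 * (a * (z * t)) \<in> PP 0" using m by (simp add: PP_mult_iff)
        have "a * (h * t) \<in> PP (vl a + (m + (m + 1)))" by (intro PP_mult PP_vl t) (use True in auto)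
        then have 2: "2 * (a * (h * t)) \<in> PP 0" using m by (simp add: PP_mult_iff)
        have "a * (t * t) \<in> PP (vl a + (m + (m + 1)))" by (intro PP_mult PP_vl t tm)
        then have 3: "a * (t * t) \<in> PP 0" using m by simp
        have "\<psi> (2 * a * (h + t) * z) = \<psi> (2 * a * h * z)" using 1 by (intro psi_near) (simp add: algebra_simps)
        moreover have "\<psi> (a * (h + t)\<^sup>2) = \<psi> (a * h\<^sup>2)" using PP_add[OF 2 3] by (intro psi_near) (simp add: power2_eq_square algebra_simps)
        ultimately show ?thesis using PP_add_iff[OF tm, of h] by simp
      qed (use PP_add_iff[OF tm, of h] in auto)
    qed auto
  qed
  also have "\<dots> = I (\<lambda>h. of_real (vol m) * (if h - 0 \<in> PP (m + 1) then 1 else 0))"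
  proof (intro arg_cong[where f = I] ext)
    fix h
    show "I (\<lambda>z. ?g h z) = of_real (vol m) * (if h - 0 \<in> PP (m + 1) then 1 else 0)"
    proof (cases "h \<in> PP m")
      case True
      have "I (\<lambda>z. ?g h z) = I (\<lambda>z. \<psi> (a * h\<^sup>2) * (if z \<in> PP m then \<psi> ((2 * a * h) * z) else 0))"
        using True by (intro arg_cong[where f = I] ext) auto
      also have "\<dots> = \<psi> (a * h\<^sup>2) * (if 2 * a * h \<in> PP (- m) then of_real (vol m) else 0)"
        by (simp only: integral_mult_right_zero I_char)
      also have "2 * a * h \<in> PP (- m) \<longleftrightarrow> h \<in> PP (m + 1)" using a m by (simp add: PP_mult_iff vl_mult)
      also have "\<psi> (a * h\<^sup>2) * (if h \<in> PP (m + 1) then of_real (vol m) else 0) = (if h \<in> PP (m + 1) then of_real (vol m) else 0)"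
      proof (cases "h \<in> PP (m + 1)")
        case True
        have "a * (h * h) \<in> PP (vl a + ((m + 1) + (m + 1)))" by (intro PP_mult PP_vl True)
        then have "a * (h * h) \<in> PP 0" by (rule PP_monoD) (simp add: m)
        then show ?thesis by (simp add: psi_1 power2_eq_square)
      qed simp
      finally show ?thesis by simp
    next
      case False
      then have "h \<notin> PP (m + 1)" using PP_monoD[of h "m + 1" m] by auto
      then show ?thesis using False by (simp cong: if_cong)
    qed
  qed
  also have "\<dots> = of_real (vol m) * of_real (vol (m + 1))" by (simp only: integral_mult_right_zero I_indicator_coset)
  finally have g: "gauss a * cnj (gauss a) = of_real (vol m * vol (m + 1))" by simp
  have pos: "nabs a > 0" using a by (simp add: less_le)
  have "beta a * cnj (beta a) = of_real (nabs a powr (1/2) * nabs a powr (1/2)) * (gauss a * cnj (gauss a))"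
    by (simp add: beta_def)
  also have "nabs a powr (1/2) * nabs a powr (1/2) = nabs a" using pos by (simp add: powr_add[symmetric])
  also have "of_real (nabs a) * (gauss a * cnj (gauss a)) = of_real (nabs a * (vol m * vol (m + 1)))" by (simp add: g)
  also have "vol m * vol (m + 1) = inverse (nabs a) * (vol 0)\<^sup>2"
  proof -
    have "qcard TYPE('k) powi (- m) * qcard TYPE('k) powi (- (m + 1)) = qcard TYPE('k) powi (vl a)"
      using qcard_pos(1)[where 'k='k] by (subst power_int_add[symmetric]) (auto simp: m)
    also have "\<dots> = inverse (nabs a)" by (simp only: nabs_vl[OF a(1)] power_int_minus inverse_inverse_eq)
    finally show ?thesis unfolding vol_eq[of m] vol_eq[of "m + 1"] by (simp add: power2_eq_square mult_ac)
  qed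
  also have "nabs a * (inverse (nabs a) * (vol 0)\<^sup>2) = (vol 0)\<^sup>2" using a by simp
  finally show ?thesis by simp
qed

subsection \<open>The Weil character and the Hilbert symbol\<close>

abbreviation chi :: "'k \<Rightarrow> complex" where "chi \<equiv> chi_psi \<psi> dx"

lemma chi_eq: "a \<noteq> 0 \<Longrightarrow> chi a = of_real (vol 0) / beta a"
  using beta_even[of 1] weil_constant_eq[of 1] weil_constant_eq[of a] by (simp add: chi_psi_def beta_def)

lemma beta_nz: "a \<noteq> 0 \<Longrightarrow> beta a \<noteq> 0"
  using beta_even[of a] beta_cnj_odd[of a] by (cases "even (vl a)") auto

lemma chi_nz: "a \<noteq> 0 \<Longrightarrow> chi a \<noteq> 0"
  by (simp add: chi_eq beta_nz)

lemma chi_mult_square: "a \<noteq> 0 \<Longrightarrow> c \<noteq> 0 \<Longrightarrow> chi (a * c\<^sup>2) = chi a"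
  by (simp add: chi_eq beta_mult_square)

lemma even_vl_decomp: assumes "(a::'k) \<noteq> 0" "even (vl a)" shows "\<exists>u c. u \<noteq> 0 \<and> vl u = 0 \<and> c \<noteq> 0 \<and> a = u * c\<^sup>2"
proof -
  obtain j where j: "vl a = 2 * j" using assms by auto
  let ?c = "unif powi j :: 'k"
  have "vl (a / ?c\<^sup>2) = vl a - vl (?c\<^sup>2)" by (rule vl_divide) (use assms in auto)
  then have "vl (a / ?c\<^sup>2) = 0" using j by (simp add: vl_power)
  then show ?thesis using assms by (intro exI[of _ "a / ?c\<^sup>2"] exI[of _ ?c]) simp
qed

lemma chi_mult_even_odd:
  assumes a: "a \<noteq> 0" "even (vl a)" and b: "b \<noteq> 0" "odd (vl b)"
  shows "chi a * chi b = chi (a * b) * of_int (hilbert_symbol a b)"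
proof -
  obtain u c where u: "u \<noteq> 0" "vl u = 0" and c: "c \<noteq> 0" and auc: "a = u * c\<^sup>2" using even_vl_decomp[OF a] by blast
  have 1: "hilbert_symbol a b = hilbert_symbol u b" unfolding auc by (rule hilbert_symbol_mult_square[OF c])
  have 2: "chi (a * b) = chi (u * b)" using chi_mult_square[of "u * b" c] u b c by (simp add: auc mult_ac)
  have 3: "chi a = 1" using a vol_pos[of 0] by (simp add: chi_eq beta_even)
  show ?thesis
  proof (cases "issq u")
    case True
    then obtain d where "d \<noteq> 0" "u = d\<^sup>2" by (auto simp: issq_def)
    then have "chi (u * b) = chi b" using chi_mult_square[OF b(1), of d] by (simp add: mult.commute)
    then show ?thesis using 1 2 3 hilbert_symbol_issq[OF True] by simp
  next
    case False
    have "chi (u * b) = - chi b" using beta_nonsquare[OF u(2,1) False b] u b by (simp add: chi_eq)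
    then show ?thesis using 1 2 3 hilbert_symbol_unit_odd[OF u(2,1) False b] by simp
  qed
qed

lemma hilbert_symbol_minus_self:
  assumes "issq (- u)" shows "hilbert_symbol a (a * u) = (1 :: int)"
proof -
  obtain c where "c \<noteq> 0" "- u = c\<^sup>2" using assms by (auto simp: issq_def)
  then have "(c, 1, 0) \<noteq> (0, 0, 0) \<and> 0\<^sup>2 = a * c\<^sup>2 + (a * u) * 1\<^sup>2" by (simp flip: \<open>- u = c\<^sup>2\<close>)
  then show ?thesis unfolding hilbert_symbol_def by metis
qed

text \<open>The right side is a times a norm form of even valuation, so its valuation is odd while
  that of z^2 is even.\<close>

lemma hilbert_symbol_odd_odd:
  assumes u: "vl (u::'k) = 0" "u \<noteq> 0" "\<not> issq (- u)" and a: "a \<noteq> 0" "odd (vl a)"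
  shows "hilbert_symbol a (a * u) = - 1"
proof -
  have False if nz: "(x, y, z) \<noteq> (0, 0, 0)" and e: "z\<^sup>2 = a * x\<^sup>2 + (a * u) * y\<^sup>2" for x y z
  proof -
    have e': "z\<^sup>2 = a * (x\<^sup>2 - (- u) * y\<^sup>2)" using e by (simp add: algebra_simps)
    show False
    proof (cases "(y, x) = (0, 0)")
      case True then show False using nz e by simp
    next
      case False
      from norm_form_valuation[OF _ _ u(3) False] u have n: "x\<^sup>2 - (- u) * y\<^sup>2 \<noteq> 0" "even (vl (x\<^sup>2 - (- u) * y\<^sup>2))" by auto
      then have "z \<noteq> 0" using e' a by auto
      then have "vl (z\<^sup>2) = 2 * vl z" by (simp add: vl_power)
      moreover have "vl (z\<^sup>2) = vl a + vl (x\<^sup>2 - (- u) * y\<^sup>2)" unfolding e' by (rule vl_mult[OF a(1) n(1)])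
      ultimately show False using n(2) a(2) by presburger
    qed
  qed
  then show ?thesis unfolding hilbert_symbol_def by auto
qed

text \<open>By parity of the valuations: \<chi> is 1 on even ones; a nonsquare unit changes its sign
  on odd ones; and for two odd ones \<open>beta b\<close> is plus or minus the conjugate of
  \<open>beta a\<close>, so that the product follows from the modulus.\<close>

theorem chi_mult:
  assumes a: "a \<noteq> 0" and b: "b \<noteq> 0"
  shows "chi a * chi b = chi (a * b) * of_int (hilbert_symbol a b)"
proof -
  consider "even (vl a)" "even (vl b)" | "even (vl a)" "odd (vl b)" | "odd (vl a)" "even (vl b)" | "odd (vl a)" "odd (vl b)" by blast
  then show ?thesis
  proof cases
    case 1
    obtain u c where u: "u \<noteq> 0" "vl u = 0" and c: "c \<noteq> 0" and auc: "a = u * c\<^sup>2" using even_vl_decomp[OF a 1(1)] by blast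
    obtain w d where w: "w \<noteq> 0" "vl w = 0" and d: "d \<noteq> 0" and bwd: "b = w * d\<^sup>2" using even_vl_decomp[OF b 1(2)] by blast
    have "hilbert_symbol a b = hilbert_symbol u w" unfolding auc bwd
      by (simp only: hilbert_symbol_mult_square[OF c] hilbert_symbol_mult_square'[OF d])
    also have "\<dots> = 1" by (rule hilbert_symbol_units[OF u(2,1) w(2,1)])
    finally show ?thesis using 1 a b vol_pos[of 0] by (simp add: chi_eq beta_even vl_mult)
  next
    case 2 then show ?thesis using chi_mult_even_odd a b by blast
  next
    case 3
    then show ?thesis using chi_mult_even_odd[OF b 3(2) a 3(1)] by (simp add: mult.commute hilbert_symbol_commute)
  next
    case 4
    have "vl (b / a) = vl b - vl a" by (rule vl_divide[OF b a])
    then obtain u c where u: "u \<noteq> 0" "vl u = 0" and c: "c \<noteq> 0" and buc: "b / a = u * c\<^sup>2"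
      using even_vl_decomp[of "b / a"] 4 a b by auto
    have b': "b = (a * u) * c\<^sup>2" using buc a by (simp add: field_simps)
    have 1: "hilbert_symbol a b = hilbert_symbol a (a * u)" unfolding b' by (rule hilbert_symbol_mult_square'[OF c])
    have 2: "beta b = beta (a * u)" unfolding b' using a u c by (simp add: beta_mult_square)
    have 3: "chi (a * b) = 1" using a b 4 vol_pos[of 0] by (simp add: chi_eq beta_even vl_mult)
    have nn: "beta a * cnj (beta a) = (of_real (vol 0))\<^sup>2" by (rule beta_cnj_odd[OF a 4(1)])
    have bz: "beta a \<noteq> 0" by (rule beta_nz[OF a])
    have v: "complex_of_real (vol 0) \<noteq> 0" by simp
    show ?thesis
    proof (cases "issq (- u)")
      case True
      then obtain d where d: "d \<noteq> 0" "- u = d\<^sup>2" by (auto simp: issq_def)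
      have "a * u = (- a) * d\<^sup>2" by (simp flip: d(2))
      then have "beta b = cnj (beta a)" using 2 beta_mult_square[of "- a" d] a d beta_minus by simp
      then have "chi a * chi b = 1" using nn bz v a b by (simp add: chi_eq power2_eq_square)
      then show ?thesis using 3 1 hilbert_symbol_minus_self[OF True] by simp
    next
      case False
      have "beta ((- u) * (- a)) = - beta (- a)" by (rule beta_nonsquare) (use u False a 4 in auto)
      then have "beta b = - cnj (beta a)" using 2 beta_minus by (simp add: mult.commute)
      then have "chi a * chi b = - 1" using nn bz v a b by (simp add: chi_eq power2_eq_square)
      then show ?thesis using 3 1 hilbert_symbol_odd_odd[OF u(2,1) False a 4(1)] by simp
    qed
  qed
qed

end

section \<open>Relations in the metaplectic cover and representations\<close>

lemma mat2_nth [simp]: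
  "mat2 a b c d $ 1 $ 1 = a" "mat2 a b c d $ 1 $ 2 = b" "mat2 a b c d $ 2 $ 1 = c" "mat2 a b c d $ 2 $ 2 = d"
  by (simp_all add: mat2_def)

lemma mat2_eq_iff: "mat2 a b c d = M \<longleftrightarrow> a = M $ 1 $ 1 \<and> b = M $ 1 $ 2 \<and> c = M $ 2 $ 1 \<and> d = M $ 2 $ 2"
  by (auto simp: vec_eq_iff forall_2)

lemma mat2_mult: "mat2 a b c d ** mat2 a' b' c' d' = mat2 (a * a' + b * c') (a * b' + b * d') (c * a' + d * c') (c * b' + d * d')"
  by (rule sym) (simp add: mat2_eq_iff matrix_matrix_mult_def sum_2)

lemma mat2_one: "mat 1 = mat2 1 0 0 1" by (rule sym) (simp add: mat2_eq_iff mat_def)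

lemma det_mat2 [simp]: "det (mat2 a b c d) = a * d - b * c" by (simp add: det_2)

lemma mat2_expand: "g = mat2 (g $ 1 $ 1) (g $ 1 $ 2) (g $ 2 $ 1) (g $ 2 $ 2)"
  by (rule sym) (simp add: mat2_eq_iff)

lemma kubota_chi_mat2: "kubota_chi (mat2 a b c d) = (if c \<noteq> 0 then c else d)"
  by (simp add: kubota_chi_def)

lemma kubota_chi_nz: "det g = 1 \<Longrightarrow> kubota_chi g \<noteq> 0"
  using mat2_expand[of g] by (auto simp: kubota_chi_def det_2)

lemma hilbert_symbol_1 [simp]: "hilbert_symbol 1 b = 1" "hilbert_symbol b 1 = 1"
  using hilbert_symbol_issq[of 1 b] hilbert_symbol_issq'[of 1 b] issq_power2[of 1] by auto

lemma hilbert_symbol_inverse: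
  assumes "(a::'k::nonarch_local_field) \<noteq> 0"
  shows "hilbert_symbol (inverse a) b = hilbert_symbol a b" "hilbert_symbol b (inverse a) = hilbert_symbol b a"
proof -
  have "inverse a = a * (inverse a)\<^sup>2" using assms by (simp add: power2_eq_square)
  then show "hilbert_symbol (inverse a) b = hilbert_symbol a b" "hilbert_symbol b (inverse a) = hilbert_symbol b a"
    using hilbert_symbol_mult_square[of "inverse a" a b] hilbert_symbol_mult_square'[of "inverse a" b a] assms by auto
qed

lemma Mp_mult: "(g, a) \<otimes>\<^bsub>Mp\<^esub> (h, b) = (g ** h, kubota_cocycle g h * a * b)" by (simp add: Mp_def)
lemma Mp_one: "\<one>\<^bsub>Mp\<^esub> = (mat 1, 1)" by (simp add: Mp_def)
lemma Mp_carrier: "(g, a) \<in> carrier Mp \<longleftrightarrow> det g = 1 \<and> (a = 1 \<or> a = - 1)" by (auto simp: Mp_def)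

lemma carrier_gens: "unip y \<in> carrier Mp" "weyl \<in> carrier Mp" "x \<noteq> 0 \<Longrightarrow> torus x \<in> carrier Mp"
  by (auto simp: unip_def weyl_def torus_def Mp_carrier)

locale mp_rep = local_char dx \<psi> for dx :: "'k::nonarch_local_field measure" and \<psi> +
  fixes smul :: "complex \<Rightarrow> 'v::ab_group_add \<Rightarrow> 'v" and \<pi> :: "'k mp \<Rightarrow> 'v \<Rightarrow> 'v"
  assumes rep: "representation_Mp smul \<pi>"
    and irreducible: "irreducible_Mp smul \<pi>"
    and admissible: "admissible_Mp smul \<pi>"
    and genuine: "genuine_Mp \<pi>"
    and supercuspidal: "supercuspidal_Mp dx smul \<pi>"
begin

sublocale V: vector_space smul using rep by (simp add: representation_Mp_def)

abbreviation "pn y \<equiv> \<pi> (unip y)"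
abbreviation "pt x \<equiv> \<pi> (torus x)"
abbreviation "pw \<equiv> \<pi> weyl"
abbreviation "hs a b \<equiv> complex_of_int (hilbert_symbol a b)"

lemma pi_linear: "g \<in> carrier Mp \<Longrightarrow> Vector_Spaces.linear smul smul (\<pi> g)"
  using rep by (auto simp: representation_Mp_def)

lemma pi_hom: "g \<in> carrier Mp \<Longrightarrow> module_hom smul smul (\<pi> g)"
  using pi_linear unfolding Vector_Spaces.linear_def by blast

lemmas pi_add = module_hom.add[OF pi_hom] and pi_scale = module_hom.scale[OF pi_hom]
  and pi_sum = module_hom.sum[OF pi_hom] and pi_0 = module_hom.zero[OF pi_hom] and pi_minus = module_hom.neg[OF pi_hom]

lemma pi_mult: "g \<in> carrier Mp \<Longrightarrow> h \<in> carrier Mp \<Longrightarrow> \<pi> g (\<pi> h v) = \<pi> (g \<otimes>\<^bsub>Mp\<^esub> h) v"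
  using rep by (auto simp: representation_Mp_def)

lemma pi_neg: assumes "det g = 1" shows "\<pi> (g, - 1) v = - \<pi> (g, 1) v"
proof -
  have c: "(g, 1) \<in> carrier Mp" "(mat 1, - 1) \<in> carrier (Mp :: 'k mp monoid)" using assms by (auto simp: Mp_carrier det_I)
  have "kubota_cocycle g (mat 1) = 1" using kubota_chi_nz[OF assms]
    by (simp add: kubota_cocycle_def)
  then have "(g, 1) \<otimes>\<^bsub>Mp\<^esub> (mat 1, - 1) = (g, - 1)" by (simp add: Mp_mult)
  then have "\<pi> (g, - 1) v = \<pi> (g, 1) (\<pi> (mat 1, - 1) v)" using pi_mult[OF c, of v] by simp
  also have "\<dots> = \<pi> (g, 1) (- v)" using genuine by (simp add: genuine_Mp_def)
  also have "\<dots> = - \<pi> (g, 1) v" by (rule pi_minus[OF c(1)])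
  finally show ?thesis .
qed

text \<open>Genuineness turns the cocycle into a scalar sign. Relations between group elements then
  become matrix identities plus one Hilbert symbol.\<close>

lemma pi_mult_cocycle:
  assumes "det g = 1" "det h = 1"
  shows "\<pi> (g, 1) (\<pi> (h, 1) v) = smul (of_int (kubota_cocycle g h)) (\<pi> (g ** h, 1) v)"
proof -
  have "\<pi> (g, 1) (\<pi> (h, 1) v) = \<pi> (g ** h, kubota_cocycle g h) v"
    using pi_mult[of "(g, 1)" "(h, 1)" v] assms by (simp add: Mp_carrier Mp_mult)
  moreover have "det (g ** h) = 1" using assms by (simp add: det_mul)
  moreover have "kubota_cocycle g h = 1 \<or> kubota_cocycle g h = - 1"
    unfolding kubota_cocycle_def by (rule hilbert_symbol_values)
  ultimately show ?thesis using pi_neg[of "g ** h" v] by auto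
qed

lemmas cocycle_simps = unip_def torus_def weyl_def pi_mult_cocycle mat2_mult kubota_cocycle_def kubota_chi_mat2

lemma pn_0 [simp]: "pn 0 v = v"
  using rep by (simp add: representation_Mp_def Mp_one mat2_one unip_def)

lemma pt_1 [simp]: "pt 1 v = v"
  using rep by (simp add: representation_Mp_def Mp_one mat2_one torus_def)

lemma pn_pn: "pn x (pn y v) = pn (x + y) v"
  by (simp add: cocycle_simps add.commute)

lemma pt_pn: "x \<noteq> 0 \<Longrightarrow> pt x (pn y v) = pn (x\<^sup>2 * y) (pt x v)"
proof -
  assume "x \<noteq> 0"
  then have e: "x * x * y * inverse x = x * y" by simp
  show ?thesis using \<open>x \<noteq> 0\<close> by (simp add: cocycle_simps power2_eq_square e)
qed

lemma pt_pt: assumes "x \<noteq> 0" "y \<noteq> 0" shows "pt x (pt y v) = smul (hs x y) (pt (x * y) v)"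
proof -
  have "inverse x * inverse y / inverse x = inverse y" "inverse x * inverse y / inverse y = inverse x"
    using assms by (auto simp: field_simps)
  then show ?thesis using assms hilbert_symbol_commute[of x y]
    by (simp add: cocycle_simps hilbert_symbol_inverse)
qed

lemma pw_pt: "a \<noteq> 0 \<Longrightarrow> pw (pt (inverse a) v) = pt a (pw v)"
proof -
  assume a: "a \<noteq> 0"
  have "inverse a / a = (inverse a)\<^sup>2" by (simp add: power2_eq_square divide_inverse)
  then have "hilbert_symbol (inverse a) (inverse a / a) = 1" using hilbert_symbol_issq'[OF issq_power2[of "inverse a"]] a by simp
  then show ?thesis using a by (simp add: cocycle_simps)
qed

lemma pw_pn: "pw (pn z v) = \<pi> (mat2 0 (- 1) 1 z, 1) v"
  by (simp add: cocycle_simps)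

lemma pt_pw_pn: "t \<noteq> 0 \<Longrightarrow> pt t (pw (pn y v)) = \<pi> (mat2 0 (- t) (inverse t) (inverse t * y), 1) v"
  unfolding pw_pn by (simp add: cocycle_simps)

lemma pn_pt_pw_pn:
  "t \<noteq> 0 \<Longrightarrow> pn s (pt t (pw (pn y v))) = \<pi> (mat2 (s * inverse t) (- t + s * inverse t * y) (inverse t) (inverse t * y), 1) v"
  by (subst pt_pw_pn) (simp_all add: cocycle_simps mult.assoc)

text \<open>The rank one relation w n(z) w = n(-1/z) t(1/z) w n(-1/z), with its sign in the cover.
  It controls large unipotent arguments and the composition of transforms.\<close>

lemma pw_pn_pw:
  assumes z: "z \<noteq> 0"
  shows "pw (pn z (pw v)) = smul (hs z z) (pn (- inverse z) (pt (inverse z) (pw (pn (- inverse z) v))))"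
proof -
  have "pw (pn z (pw v)) = smul (hs z z) (\<pi> (mat2 (- 1) 0 z (- 1), 1) v)"
    using z unfolding pw_pn by (simp add: cocycle_simps)
  moreover have "pn (- inverse z) (pt (inverse z) (pw (pn (- inverse z) v))) = \<pi> (mat2 (- 1) 0 z (- 1), 1) v"
    using z by (subst pn_pt_pw_pn) (auto simp: field_simps)
  ultimately show ?thesis by simp
qed

lemma bessel_argument:
  assumes "x \<noteq> 0" shows "\<pi> (torus x \<otimes>\<^bsub>Mp\<^esub> weyl \<otimes>\<^bsub>Mp\<^esub> unip y) v = pt x (pw (pn y v))"
proof -
  have t: "torus x \<otimes>\<^bsub>Mp\<^esub> weyl = (mat2 0 (- x) (inverse x) 0, 1)"
    using assms by (simp add: torus_def weyl_def Mp_mult mat2_mult kubota_cocycle_def kubota_chi_mat2)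
  then have c: "torus x \<otimes>\<^bsub>Mp\<^esub> weyl \<in> carrier Mp" using assms by (simp add: Mp_carrier)
  have "pt x (pw (pn y v)) = \<pi> (torus x \<otimes>\<^bsub>Mp\<^esub> weyl) (pn y v)" using assms by (intro pi_mult carrier_gens)
  also have "\<dots> = \<pi> (torus x \<otimes>\<^bsub>Mp\<^esub> weyl \<otimes>\<^bsub>Mp\<^esub> unip y) v" using c by (simp add: pi_mult carrier_gens)
  finally show ?thesis by simp
qed

text \<open>Bruhat decomposition lifted to the cover; e records the sheet.\<close>

lemma bruhat:
  assumes "g \<in> carrier Mp"
  shows "\<exists>e. (e = 1 \<or> e = - 1) \<and> ((\<exists>s a. a \<noteq> 0 \<and> (\<forall>v. \<pi> g v = smul e (pn s (pt a v)))) \<or>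
    (\<exists>s t y. t \<noteq> 0 \<and> (\<forall>v. \<pi> g v = smul e (pn s (pt t (pw (pn y v)))))))"
proof -
  obtain A e0 where g: "g = (A, e0)" by (cases g)
  obtain a b c d where A: "A = mat2 a b c d" using mat2_expand by blast
  have det: "a * d - b * c = 1" and e0: "e0 = 1 \<or> e0 = - 1" using assms by (auto simp: g A Mp_carrier)
  define e :: complex where "e = of_int e0"
  have e: "e = 1 \<or> e = - 1" using e0 by (auto simp: e_def)
  have pe: "\<pi> g v = smul e (\<pi> (A, 1) v)" for v
    using e0 pi_neg[of A v] det by (auto simp: g e_def A)
  show ?thesis
  proof (cases "c = 0")
    case True
    then have ad: "a \<noteq> 0" "d = inverse a" using det by (auto simp: inverse_unique)
    have "pn (a * b) (pt a v) = \<pi> (A, 1) v" for v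
    proof -
      have e: "a * b * inverse a = b" using ad by simp
      show ?thesis using ad True by (simp add: cocycle_simps A e)
    qed
    then show ?thesis using e pe ad(1) by metis
  next
    case False
    have "pn (a / c) (pt (inverse c) (pw (pn (d / c) v))) = \<pi> (A, 1) v" for v
    proof -
      have "- inverse c + a / c * c * (d / c) = (a * d - 1) / c" using False by (simp add: field_simps)
      also have "\<dots> = b" using det False by (simp add: field_simps)
      finally show ?thesis using False by (subst pn_pt_pw_pn) (auto simp: A)
    qed
    then show ?thesis using e pe False by (metis nonzero_imp_inverse_nonzero)
  qed
qed

lemma invariant_subspace:
  assumes sub: "V.subspace W" and n: "\<And>y v. v \<in> W \<Longrightarrow> pn y v \<in> W" and t: "\<And>a v. a \<noteq> 0 \<Longrightarrow> v \<in> W \<Longrightarrow> pt a v \<in> W"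
    and w: "\<And>v. v \<in> W \<Longrightarrow> pw v \<in> W"
  shows "W = {0} \<or> W = UNIV"
proof -
  have "\<pi> g v \<in> W" if g: "g \<in> carrier Mp" and v: "v \<in> W" for g v
  proof -
    have sc: "smul e u \<in> W" if "u \<in> W" for e u using sub that V.subspace_scale by blast
    from bruhat[OF g] show ?thesis using sc n t w v by metis
  qed
  then have "\<forall>g\<in>carrier Mp. \<pi> g ` W \<subseteq> W" by blast
  then show ?thesis using irreducible sub unfolding irreducible_Mp_def by blast
qed

lemma smooth: "\<exists>N\<ge>1. (\<forall>h\<in>PP N. pn h v = v) \<and> (\<forall>b. b - 1 \<in> PP N \<longrightarrow> pt b v = v)"
proof -
  obtain H n where H: "v \<in> fixed_vectors \<pi> H" "\<forall>g\<in>congruence_subgroup n. (g, 1) \<in> H"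
  proof -
    obtain H where "open_subgroup_Mp H" "v \<in> fixed_vectors \<pi> H" using admissible unfolding admissible_Mp_def by blast
    then show ?thesis using that unfolding open_subgroup_Mp_def by blast
  qed
  have fx: "\<pi> (g, 1) v = v" if "g \<in> congruence_subgroup n" for g
    using H that by (auto simp: fixed_vectors_def)
  \<comment> \<open>Level at least 1 makes every such b a unit.\<close>
  define N where "N = max (int n) 1"
  have "pn h v = v" if "h \<in> PP N" for h
    unfolding unip_def using that
    by (intro fx) (auto simp: congruence_subgroup_def forall_2 mat2_one N_def PP_max_iff)
  moreover have "pt b v = v" if b: "b - 1 \<in> PP N" for b
  proof -
    have b1: "b - 1 \<in> PP 1" "b - 1 \<in> PP (int n)" using b by (auto simp: N_def PP_max_iff)
    have b0: "b \<noteq> 0" "vl b = 0" using unit_near_1[OF b1(1)] by auto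
    have "inverse b - 1 = inverse b * - (b - 1)" using b0 by (simp add: field_simps)
    moreover have "inverse b * - (b - 1) \<in> PP (0 + int n)" using b0 b1 by (intro PP_mult) (auto simp: mem_PP vl_inverse vl_diff_commute)
    ultimately have "inverse b - 1 \<in> PP (int n)" by simp
    then show ?thesis unfolding torus_def using b0 b1
      by (intro fx) (auto simp: congruence_subgroup_def forall_2 mat2_one)
  qed
  ultimately show ?thesis by (intro exI[of _ N]) (auto simp: N_def)
qed

lemma fixed_unip: "\<exists>N\<ge>1. \<forall>h\<in>PP N. pn h v = v" using smooth by blast

lemma step_fun_like_pn: assumes "\<forall>h\<in>PP N. pn h v = v" "y - z \<in> PP N" shows "pn y v = pn z v"
  using pn_pn[of z "y - z" v] assms by simp

subsection \<open>Central character\<close>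

text \<open>A Schur argument without an existence theorem for eigenvalues. The operator commutes
  with the generators and its square is a sign, with root \<open>l\<close>. Either its
  \<open>l\<close>-eigenspace is everything, or it is 0; in the latter case adding \<open>l\<close>
  times v to the image of v lands in it, and the operator is \<open>- l\<close>.\<close>

lemma pt_minus_1_scalar: "\<exists>\<omega>. \<omega> \<noteq> 0 \<and> (\<forall>v. pt (- 1) v = smul \<omega> v)"
proof -
  let ?Z = "pt (- 1)"
  have m1: "(- 1 :: 'k) \<noteq> 0" by simp
  have Zc: "torus (- 1 :: 'k) \<in> carrier Mp" by (rule carrier_gens) simp
  define e where "e = hs (- 1 :: 'k) (- 1)"
  define l where "l = csqrt e"
  have l: "l * l = e" "l \<noteq> 0" using hilbert_symbol_values[of "- 1 :: 'k" "- 1"] power2_csqrt[of e] by (auto simp: l_def e_def power2_eq_square)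
  have ZZ: "?Z (?Z v) = smul e v" for v using pt_pt[OF m1 m1, of v] by (simp add: e_def)
  define W where "W c = {v. ?Z v = smul c v}" for c
  have W: "W c = {0} \<or> W c = UNIV" for c
  proof (rule invariant_subspace)
    show "V.subspace (W c)"
      unfolding W_def by (rule V.subspaceI) (auto simp: pi_add[OF Zc] pi_scale[OF Zc] V.scale_right_distrib V.scale_left_commute pi_0[OF Zc])
  next
    fix y v assume "v \<in> W c"
    then show "pn y v \<in> W c" using pt_pn[OF m1, of y v] by (simp add: W_def pi_scale[OF carrier_gens(1)])
  next
    fix a :: 'k and v assume a: "a \<noteq> 0" and v: "v \<in> W c"
    have "?Z (pt a v) = pt a (?Z v)" using pt_pt[OF m1 a, of v] pt_pt[OF a m1, of v] hilbert_symbol_commute[of a "- 1"] by simp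
    then show "pt a v \<in> W c" using v a by (simp add: W_def pi_scale[OF carrier_gens(3)])
  next
    fix v assume v: "v \<in> W c"
    have "?Z (pw v) = pw (?Z v)" using pw_pt[OF m1, of v] by simp
    then show "pw v \<in> W c" using v by (simp add: W_def pi_scale[OF carrier_gens(2)])
  qed
  show ?thesis
  proof (cases "W l = UNIV")
    case True
    then have "\<forall>v. ?Z v = smul l v" unfolding W_def by blast
    then show ?thesis using l(2) by blast
  next
    case False
    then have W0: "W l = {0}" using W by blast
    have "?Z v = smul (- l) v" for v
    proof -
      let ?u = "?Z v + smul l v"
      have "?Z ?u = smul e v + smul l (?Z v)" by (simp add: pi_add[OF Zc] pi_scale[OF Zc] ZZ)
      also have "\<dots> = smul l ?u" using l(1) by (simp add: V.scale_right_distrib add.commute)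
      finally have "?u \<in> W l" by (simp add: W_def)
      then have "?u = 0" using W0 by simp
      then show ?thesis by (simp add: add_eq_0_iff2)
    qed
    then show ?thesis using l(2) by (intro exI[of _ "- l"]) simp
  qed
qed

end

section \<open>Whittaker functionals and the range of their characters\<close>

context mp_rep begin

definition Wh :: "'k \<Rightarrow> ('v \<Rightarrow> complex) set" where
  "Wh z = {L. whittaker_functional \<psi> smul \<pi> z L}"

lemma Wh_hom: "L \<in> Wh z \<Longrightarrow> module_hom smul (*) L"
  by (auto simp: Wh_def whittaker_functional_def Vector_Spaces.linear_def)

lemmas Wh_add = module_hom.add[OF Wh_hom] and Wh_scale = module_hom.scale[OF Wh_hom]
  and Wh_sum = module_hom.sum[OF Wh_hom] and Wh_zero = module_hom.zero[OF Wh_hom]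
  and Wh_diff = module_hom.diff[OF Wh_hom] and Wh_minus = module_hom.neg[OF Wh_hom]

lemma Wh_pn: "L \<in> Wh z \<Longrightarrow> L (pn a v) = \<psi> (z * a) * L v"
  by (auto simp: Wh_def whittaker_functional_def)

lemma WhI:
  assumes "\<And>u v. L (u + v) = L u + L v" "\<And>c v. L (smul c v) = c * L v" "\<And>a v. L (pn a v) = \<psi> (z * a) * L v"
  shows "L \<in> Wh z"
proof -
  have "vector_space ((*) :: complex \<Rightarrow> complex \<Rightarrow> complex)" by unfold_locales (auto simp: algebra_simps)
  then have "Vector_Spaces.linear smul (*) L"
    using assms(1,2) V.vector_space_axioms unfolding Vector_Spaces.linear_def module_hom_def module_hom_axioms_def
    by (auto simp: vector_space_def module_def)
  then show ?thesis using assms(3) by (simp add: Wh_def whittaker_functional_def)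
qed

lemma Wh_conductor:
  assumes "L \<in> Wh z" "\<forall>h\<in>PP N. pn h v = v" "L v \<noteq> 0" shows "z \<in> PP (- N)"
proof -
  have "\<psi> (z * h) = 1" if "h \<in> PP N" for h using Wh_pn[OF assms(1), of h v] assms(2,3) that by simp
  then show ?thesis using psi_trivial_iff by blast
qed

text \<open>For z in \<open>PP (- n)\<close> the functional is invariant under translation by
  \<open>PP n\<close>, so applied to the vanishing average of v it gives \<open>vol n\<close> times
  its value at v.\<close>

lemma Wh_cuspidal: "\<exists>n. \<forall>z\<in>PP (- n). \<forall>L\<in>Wh z. L v = 0"
proof -
  obtain n where n: "simple_integral smul dx (PP n) (\<lambda>x. pn x v) = 0"
    using supercuspidal by (auto simp: supercuspidal_Mp_def)
  obtain N where N: "\<forall>h\<in>PP N. pn h v = v" using fixed_unip by blast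
  let ?f = "\<lambda>x. pn x v"
  let ?A = "\<lambda>u. {x \<in> PP n. ?f x = u}"
  have near: "?f x = ?f y" if "x - y \<in> PP N" for x y using step_fun_like_pn[OF N that] .
  have fin: "finite (?f ` PP n)"
  proof -
    obtain D :: "'k set" where D: "reps N (PP n) D" using reps_exists by blast
    have "?f ` PP n \<subseteq> ?f ` D"
    proof
      fix u assume "u \<in> ?f ` PP n"
      then obtain x where x: "x \<in> PP n" "u = ?f x" by blast
      then have "\<exists>d\<in>D. x - d \<in> PP N" using D unfolding reps_def by blast
      then obtain d where "d \<in> D" "x - d \<in> PP N" ..
      then show "u \<in> ?f ` D" using x near by blast
    qed
    then show ?thesis by (rule finite_subset) (use D in \<open>simp add: reps_def\<close>)
  qed
  have op: "open (?A u)" for u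
    unfolding open_iff_coset
  proof
    fix x assume x: "x \<in> ?A u"
    show "\<exists>k. \<forall>y. y - x \<in> PP k \<longrightarrow> y \<in> ?A u"
    proof (intro exI allI impI)
      fix y assume "y - x \<in> PP (max n N)"
      then have y: "y - x \<in> PP n" "y - x \<in> PP N" by (auto simp: PP_max_iff)
      have "y \<in> PP n" using PP_add[OF y(1), of x] x by simp
      then show "y \<in> ?A u" using near[OF y(2)] x by simp
    qed
  qed
  \<comment> \<open>The level sets of the orbit map partition \<open>PP n\<close>, so the weights of
    the finite average add up to \<open>vol n\<close>.\<close>
  have "(\<Sum>u\<in>?f ` PP n. measure dx (?A u)) = measure dx (\<Union>u\<in>?f ` PP n. ?A u)"
  proof (rule measure_finite_Union[symmetric])
    show "emeasure dx (?A u) \<noteq> \<infinity>" for u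
    proof -
      have "emeasure dx (?A u) \<le> emeasure dx (PP n)" by (rule emeasure_mono) auto
      then show ?thesis by (auto simp: emeasure_PP top_unique)
    qed
  qed (use fin op in \<open>auto simp: sets_dx disjoint_family_on_def\<close>)
  also have "(\<Union>u\<in>?f ` PP n. ?A u) = PP n" by auto
  finally have tot: "(\<Sum>u\<in>?f ` PP n. measure dx (?A u)) = vol n" by (simp add: vol_def)
  have "L v = 0" if z: "z \<in> PP (- n)" and L: "L \<in> Wh z" for z L
  proof -
    have Lu: "L u = L v" if u: "u \<in> ?f ` PP n" for u
    proof -
      obtain x where x: "x \<in> PP n" "u = pn x v" using u by blast
      then show ?thesis using Wh_pn[OF L, of x v] psi_trivial_iff[of n z] z by simp
    qed
    have "0 = L (simple_integral smul dx (PP n) ?f)" using n Wh_zero[OF L] by simp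
    also have "\<dots> = (\<Sum>u\<in>?f ` PP n. of_real (measure dx (?A u)) * L u)"
      unfolding simple_integral_def by (simp add: Wh_sum[OF L] Wh_scale[OF L])
    also have "\<dots> = (\<Sum>u\<in>?f ` PP n. of_real (measure dx (?A u)) * L v)"
      by (intro sum.cong refl) (simp add: Lu)
    also have "\<dots> = of_real (vol n) * L v" unfolding sum_distrib_right[symmetric] of_real_sum[symmetric] tot ..
    finally show ?thesis by simp
  qed
  then show ?thesis by blast
qed

text \<open>Smoothness bounds the conductor from one side and supercuspidality from the other; the
  latter also excludes z = 0. The bounds depend on v only, not on L.\<close>

lemma Wh_bounds: "\<exists>m k. \<forall>z. \<forall>L\<in>Wh z. L v \<noteq> 0 \<longrightarrow> z \<noteq> 0 \<and> m \<le> vl z \<and> vl z < k"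
proof -
  obtain n where n: "\<forall>z\<in>PP (- n). \<forall>L\<in>Wh z. L v = 0" using Wh_cuspidal by blast
  obtain N where N: "\<forall>h\<in>PP N. pn h v = v" using fixed_unip by blast
  show ?thesis
  proof (intro exI allI ballI impI)
    fix z L assume L: "L \<in> Wh z" "L v \<noteq> 0"
    have "z \<notin> PP (- n)" using n L by blast
    moreover have "z \<in> PP (- N)" by (rule Wh_conductor[OF L(1) N L(2)])
    ultimately show "z \<noteq> 0 \<and> - N \<le> vl z \<and> vl z < - n" by (auto simp: mem_PP)
  qed
qed

lemma Wh_pt: assumes L: "L \<in> Wh z" and t: "t \<noteq> 0" shows "(\<lambda>v. L (pt t v)) \<in> Wh (z * t\<^sup>2)"
proof (rule WhI)
  fix a v show "L (pt t (pn a v)) = \<psi> (z * t\<^sup>2 * a) * L (pt t v)"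
    using pt_pn[OF t] Wh_pn[OF L] by (simp add: mult.assoc)
qed (use t in \<open>simp_all add: pi_add[OF carrier_gens(3)] pi_scale[OF carrier_gens(3)] Wh_add[OF L] Wh_scale[OF L]\<close>)

lemma Wh_pt_near: assumes "\<forall>b. b - 1 \<in> PP N \<longrightarrow> pt b v = v" "N \<ge> 1" "b - 1 \<in> PP N" "x \<noteq> 0"
  shows "pt (x * b) v = pt x v"
proof -
  have b: "b \<noteq> 0" using unit_near_1[OF assms(3,2)] by simp
  have "issq b" using issq_near_1 assms(2,3) PP_monoD by blast
  then have "pt x (pt b v) = pt (x * b) v" using pt_pt[OF assms(4) b, of v] hilbert_symbol_issq'[OF \<open>issq b\<close>, of x] by simp
  then show ?thesis using assms by simp
qed

section \<open>Functions on the big cell and their transforms\<close>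

definition bigcell :: "('v \<Rightarrow> complex) \<Rightarrow> 'k \<Rightarrow> 'v \<Rightarrow> 'k \<Rightarrow> complex" where
  "bigcell L x v y = L (pt x (pw (pn y v)))"

lemma hs_square: "hs a b * hs a b = 1"
  using hilbert_symbol_values[of a b] by auto

text \<open>When y is large, n(-1/y) fixes w v, and the relation for w n(-1/y) w expresses w n(y) v
  through w w v, which leaves the big cell.\<close>

lemma pt_pw_pn_large:
  assumes x: "x \<noteq> 0" and y: "y \<noteq> 0" and fixed: "pn (- inverse y) (pw v) = pw v"
  shows "\<exists>e. pt x (pw (pn y v)) = smul e (pn (- ((x / y)\<^sup>2 * y)) (pt (- (x / y)) (pw (pw v))))"
proof -
  let ?t = "- (x / y)"
  have iy: "- inverse y \<noteq> 0" "inverse (- inverse y) = - y" using y by auto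
  define e where "e = hs (- inverse y) (- inverse y)"
  have e: "e * e = 1" unfolding e_def by (rule hs_square)
  have "pw (pw v) = smul e (pn y (pt (- y) (pw (pn y v))))"
    using pw_pn_pw[OF iy(1), of v] unfolding fixed iy(2) e_def by simp
  then have "pn (- y) (pw (pw v)) = smul e (pt (- y) (pw (pn y v)))"
    by (simp add: pi_scale[OF carrier_gens(1)] pn_pn)
  then have 1: "pt (- y) (pw (pn y v)) = smul e (pn (- y) (pw (pw v)))" using e by simp
  define e' where "e' = hs ?t (- y)"
  have e': "e' * e' = 1" unfolding e'_def by (rule hs_square)
  have t: "?t \<noteq> 0" "?t * (- y) = x" using x y by auto
  have "smul e' (pt x (pw (pn y v))) = pt ?t (pt (- y) (pw (pn y v)))"
    using pt_pt[OF t(1), of "- y"] y t(2) by (simp add: e'_def)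
  also have "\<dots> = smul e (pn (?t\<^sup>2 * (- y)) (pt ?t (pw (pw v))))"
    unfolding 1 by (simp only: pi_scale[OF carrier_gens(3)[OF t(1)]] pt_pn[OF t(1)])
  finally have "smul e' (smul e' (pt x (pw (pn y v)))) = smul (e' * e) (pn (?t\<^sup>2 * (- y)) (pt ?t (pw (pw v))))" by simp
  then have "pt x (pw (pn y v)) = smul (e' * e) (pn (?t\<^sup>2 * (- y)) (pt ?t (pw (pw v))))" using e' by simp
  then show ?thesis by auto
qed

text \<open>For large y the value is, up to a scalar, that of a functional twisted by x/y at w w v,
  and \<open>Wh_bounds\<close> makes it vanish. Support and level hold for all L and all x of
  valuation at least k.\<close>

lemma bigcell_step_fun:
  assumes z: "z \<noteq> 0"
  shows "\<exists>m n. \<forall>x. x \<noteq> 0 \<and> k \<le> vl x \<longrightarrow> (\<forall>L\<in>Wh z. step_fun m n (bigcell L x v))"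
proof -
  obtain N where N: "\<forall>h\<in>PP N. pn h v = v" using fixed_unip by blast
  obtain N' where N': "\<forall>h\<in>PP N'. pn h (pw v) = pw v" using fixed_unip by blast
  obtain m0 k0 where mk: "\<And>z L. L \<in> Wh z \<Longrightarrow> L (pw (pw v)) \<noteq> 0 \<Longrightarrow> z \<noteq> 0 \<and> m0 \<le> vl z \<and> vl z < k0" using Wh_bounds by metis
  \<comment> \<open>The first bound puts -1/y into \<open>PP N'\<close>; the second pushes the
    character z (x/y)^2 beyond the range allowed for w w v.\<close>
  define m where "m = min (- N') ((vl z + 2 * k - k0) div 2)"
  show ?thesis
  proof (intro exI allI impI ballI step_funI; (elim conjE)?)
    fix x y :: 'k and L assume x: "x \<noteq> 0" "k \<le> vl x" and L: "L \<in> Wh z" and y: "y \<notin> PP m"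
    have y0: "y \<noteq> 0" "vl y < m" using y by (auto simp: mem_PP)
    have "- inverse y \<in> PP N'" using y0 by (simp add: mem_PP vl_inverse m_def)
    then obtain e where e: "pt x (pw (pn y v)) = smul e (pn (- ((x / y)\<^sup>2 * y)) (pt (- (x / y)) (pw (pw v))))"
      using pt_pw_pn_large[OF x(1) y0(1)] N' by blast
    have t: "- (x / y) \<noteq> 0" using x y0 by simp
    have "L (pt (- (x / y)) (pw (pw v))) = 0"
    proof (rule ccontr)
      assume "\<not> ?thesis"
      from mk[OF Wh_pt[OF L t] this] have "vl (z * (- (x / y))\<^sup>2) < k0" by simp
      then have "vl z + 2 * (vl x - vl y) < k0" using z x y0 by (simp add: vl_mult vl_power vl_divide)
      moreover have "vl y < (vl z + 2 * k - k0) div 2" using y0 by (simp add: m_def)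
      ultimately show False using x(2) by presburger
    qed
    then show "bigcell L x v y = 0" unfolding bigcell_def e by (simp add: Wh_scale[OF L] Wh_pn[OF L])
  next
    fix x y h :: 'k and L assume "h \<in> PP N"
    then show "bigcell L x v (y + h) = bigcell L x v y" unfolding bigcell_def using step_fun_like_pn[OF N, of "y + h" y] by simp
  qed
qed

lemma bigcell_step_fun1: assumes "z \<noteq> 0" "x \<noteq> 0" shows "\<exists>m n. \<forall>L\<in>Wh z. step_fun m n (bigcell L x v)"
  using bigcell_step_fun[OF assms(1), of "vl x" v] assms(2) by blast

definition T :: "'k \<Rightarrow> 'k \<Rightarrow> ('v \<Rightarrow> complex) \<Rightarrow> 'v \<Rightarrow> complex" where
  "T z x L v = FT (bigcell L x v) z"

lemma T_Wh: assumes z: "z \<noteq> 0" and x: "x \<noteq> 0" and L: "L \<in> Wh z" shows "T \<zeta> x L \<in> Wh \<zeta>"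
proof (rule WhI)
  note gens = pi_add[OF carrier_gens(1)] pi_add[OF carrier_gens(2)] pi_add[OF carrier_gens(3)[OF x]]
    pi_scale[OF carrier_gens(1)] pi_scale[OF carrier_gens(2)] pi_scale[OF carrier_gens(3)[OF x]]
  have int: "integrable dx (\<lambda>y. bigcell L x v y * \<psi> (- (\<zeta> * y)))" for v
  proof -
    obtain m n where "step_fun m n (bigcell L x v)" using bigcell_step_fun1[OF z x] L by blast
    then show ?thesis using step_fun_FT_integrand' integrable_step_fun by blast
  qed
  fix u v c a
  have "bigcell L x (u + v) = (\<lambda>y. bigcell L x u y + bigcell L x v y)" by (rule ext) (simp add: bigcell_def gens Wh_add[OF L])
  then show "T \<zeta> x L (u + v) = T \<zeta> x L u + T \<zeta> x L v" using int by (simp add: T_def FT_def ring_distribs)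
  have "bigcell L x (smul c v) = (\<lambda>y. c * bigcell L x v y)" by (rule ext) (simp add: bigcell_def gens Wh_scale[OF L])
  then show "T \<zeta> x L (smul c v) = c * T \<zeta> x L v" by (simp add: T_def FT_def mult.assoc)
  obtain m n where "step_fun m n (bigcell L x v)" using bigcell_step_fun1[OF z x] L by blast
  then obtain n' where n': "step_fun m n' (\<lambda>y. bigcell L x v y * \<psi> (- (\<zeta> * y)))" using step_fun_FT_integrand' by blast
  have "bigcell L x (pn a v) y * \<psi> (- (\<zeta> * y)) = \<psi> (\<zeta> * a) * (bigcell L x v (y + a) * \<psi> (- (\<zeta> * (y + a))))" for y
  proof -
    have "\<psi> (- (\<zeta> * y)) = \<psi> (\<zeta> * a) * \<psi> (- (\<zeta> * (y + a)))" by (simp add: psi_add[symmetric] algebra_simps)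
    then show ?thesis by (simp add: bigcell_def pn_pn)
  qed
  then have "T \<zeta> x L (pn a v) = \<psi> (\<zeta> * a) * I (\<lambda>y. bigcell L x v (y + a) * \<psi> (- (\<zeta> * (y + a))))" by (simp add: T_def FT_def)
  also have "I (\<lambda>y. bigcell L x v (y + a) * \<psi> (- (\<zeta> * (y + a)))) = T \<zeta> x L v" unfolding T_def FT_def by (rule I_shift[OF n'])
  finally show "T \<zeta> x L (pn a v) = \<psi> (\<zeta> * a) * T \<zeta> x L v" .
qed

lemma T_inversion: assumes "z \<noteq> 0" "x \<noteq> 0" "L \<in> Wh z"
  shows "L (pt x (pw (pn y v))) = I (\<lambda>\<zeta>. T \<zeta> x L v * \<psi> (\<zeta> * y))"
proof -
  obtain m n where "step_fun m n (bigcell L x v)" using bigcell_step_fun1[OF assms(1,2)] assms(3) by blast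
  from FT_inversion[OF this, of y] show ?thesis by (simp add: T_def bigcell_def)
qed

lemma pt_pw_pn_pt:
  assumes b: "b \<noteq> 0" and x: "x \<noteq> 0"
  shows "pt (x * b) (pw (pn y (pt b v))) = smul (hs (x * b) b) (pt x (pw (pn (inverse (b\<^sup>2) * y) v)))"
proof -
  have "b\<^sup>2 * (inverse (b\<^sup>2) * y) = y" using b by simp
  then have "pn y (pt b v) = pt b (pn (inverse (b\<^sup>2) * y) v)" by (simp only: pt_pn[OF b])
  moreover have "pw (pt b u) = pt (inverse b) (pw u)" for u using pw_pt[of "inverse b" u] b by simp
  moreover have "pt (x * b) (pt (inverse b) u) = smul (hs (x * b) b) (pt x u)" for u
  proof -
    have e: "x * b * inverse b = x" using b by simp
    show ?thesis using pt_pt[of "x * b" "inverse b" u] x b by (simp add: hilbert_symbol_inverse(2)[OF b] e)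
  qed
  ultimately show ?thesis by simp
qed

text \<open>Conjugation by t(b) replaces y by b^2 y. Transforms along a whole square class are
  thereby expressed by one representative; the factor \<bar>b\<bar>^(-2) is the modulus of that
  substitution.\<close>

lemma T_scale:
  assumes z: "z \<noteq> 0" and x: "x \<noteq> 0" and b: "b \<noteq> 0" and L: "L \<in> Wh z"
  shows "T (\<zeta> * b\<^sup>2) x L v = of_real (inverse ((nabs b)\<^sup>2)) * hs (x * b) b * T \<zeta> (x * b) L (pt b v)"
proof -
  have "x * b \<noteq> 0" using x b by simp
  then obtain m n where "step_fun m n (bigcell L (x * b) (pt b v))" using bigcell_step_fun1[OF z] L by blast
  then obtain n' where n': "step_fun m n' (\<lambda>y. bigcell L (x * b) (pt b v) y * \<psi> (- (\<zeta> * y)))" using step_fun_FT_integrand' by blast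
  let ?g = "\<lambda>y. bigcell L (x * b) (pt b v) y * \<psi> (- (\<zeta> * y))"
  have "bigcell L x v y * \<psi> (- (\<zeta> * b\<^sup>2 * y)) = hs (x * b) b * ?g (b\<^sup>2 * y)" for y
    unfolding bigcell_def pt_pw_pn_pt[OF b x] using b hs_square[of "x * b" b]
    by (simp add: Wh_scale[OF L] mult.assoc[symmetric])
  then have "T (\<zeta> * b\<^sup>2) x L v = hs (x * b) b * I (\<lambda>y. ?g (b\<^sup>2 * y))" by (simp add: T_def FT_def)
  also have "I (\<lambda>y. ?g (b\<^sup>2 * y)) = of_real (inverse (nabs (b\<^sup>2))) * I ?g" by (rule I_scale[OF n']) (use b in simp)
  finally show ?thesis by (simp add: T_def FT_def nabs_power mult_ac)
qed

subsection \<open>Localised vectors\<close>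

text \<open>The vector \<open>u\<close> has the Whittaker functions of \<open>v\<close> cut off to the set \<open>U\<close> of characters; it is obtained by averaging \<open>\<pi>(n(y)) v\<close> against a Fourier transform.\<close>

definition localised :: "'k set \<Rightarrow> 'v \<Rightarrow> 'v \<Rightarrow> bool" where
  "localised U v u \<longleftrightarrow> (\<forall>z. \<forall>L\<in>Wh z. L u = (if z \<in> U then L v else 0))"

text \<open>Average the translates of v by \<open>PP (- M)\<close> modulo \<open>PP n\<close>
  against the conjugate of \<psi>(c y). The prefactor is the reciprocal of the number of cosets, and
  orthogonality selects the characters near c.\<close>

lemma localised_coset: "\<exists>u. localised {z. z - c \<in> PP M} v u"
proof -
  obtain N where N: "\<forall>h\<in>PP N. pn h v = v" using fixed_unip by blast
  \<comment> \<open>\<open>PP n\<close> must fix v, lie in the kernel of \<psi>(c y), and be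
    contained in \<open>PP (- M)\<close>.\<close>
  define n where "n = max (max N (- vl c)) (- M)"
  have n: "\<forall>h\<in>PP n. pn h v = v" "c \<in> PP (- n)" "- M \<le> n"
    using N by (auto simp: n_def PP_max_iff mem_PP[of c])
  obtain D :: "'k set" where D: "reps n (PP (- M)) D" using reps_exists by blast
  have step_fun: "step_fun (- M) n (\<lambda>y. if y \<in> PP (- M) then \<psi> (d * y) else 0)" if "d \<in> PP (- n)" for d
  proof (rule step_funI)
    fix x h :: 'k assume h: "h \<in> PP n"
    then have hM: "h \<in> PP (- M)" using n(3) PP_monoD by blast
    have "d * h \<in> PP (- n + n)" by (rule PP_mult[OF that h])
    then have "\<psi> (d * (x + h)) = \<psi> (d * x)" by (intro psi_near) (simp add: algebra_simps)
    then show "(if x + h \<in> PP (- M) then \<psi> (d * (x + h)) else 0) = (if x \<in> PP (- M) then \<psi> (d * x) else 0)"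
      using PP_add_iff[OF hM] by simp
  qed auto
  have S: "of_real (vol n) * (\<Sum>y\<in>D. \<psi> (d * y)) = (if d \<in> PP M then of_real (vol (- M)) else 0)" if d: "d \<in> PP (- n)" for d
  proof -
    have "(\<Sum>y\<in>D. \<psi> (d * y)) = (\<Sum>y\<in>D. if y \<in> PP (- M) then \<psi> (d * y) else 0)"
      using D by (intro sum.cong) (auto simp: reps_def)
    then show ?thesis using I_step_fun[OF step_fun[OF d] D] I_char[of "- M" d] by simp
  qed
  from S[of 0] have card: "of_real (vol n) * of_nat (card D) = complex_of_real (vol (- M))" by simp
  have vn: "complex_of_real (vol n) \<noteq> 0" "complex_of_real (vol (- M)) \<noteq> 0" by simp_all
  define u where "u = smul (of_real (vol n) / of_real (vol (- M))) (\<Sum>d\<in>D. smul (\<psi> (- (c * d))) (pn d v))"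
  have "L u = (if z \<in> {z. z - c \<in> PP M} then L v else 0)" if L: "L \<in> Wh z" for z L
  proof -
    have "L u = of_real (vol n) / of_real (vol (- M)) * (\<Sum>d\<in>D. \<psi> (- (c * d)) * (\<psi> (z * d) * L v))"
      unfolding u_def by (simp add: Wh_scale[OF L] Wh_sum[OF L] Wh_pn[OF L])
    also have "(\<Sum>d\<in>D. \<psi> (- (c * d)) * (\<psi> (z * d) * L v)) = (\<Sum>d\<in>D. \<psi> ((z - c) * d)) * L v"
    proof -
    have *: "\<psi> (- (c * d)) * \<psi> (z * d) = \<psi> ((z - c) * d)" for d
      unfolding psi_add[symmetric] by (simp add: algebra_simps)
    show ?thesis by (simp only: sum_distrib_right mult.assoc[symmetric] *)
    qed
    finally have Lu: "L u = of_real (vol n) * (\<Sum>d\<in>D. \<psi> ((z - c) * d)) / of_real (vol (- M)) * L v" by simp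
    show ?thesis
    proof (cases "L v = 0")
      case False
      have "z \<in> PP (- n)" by (rule Wh_conductor[OF L n(1) False])
      then have "z - c \<in> PP (- n)" using n(2) by (rule PP_diff)
      from S[OF this] show ?thesis unfolding Lu using vn(2) by simp
    qed (simp add: Lu)
  qed
  then show ?thesis unfolding localised_def by blast
qed

lemma localised_exists:
  assumes U: "U \<subseteq> PP m" "\<And>x h. x \<in> U \<Longrightarrow> h \<in> PP M \<Longrightarrow> x + h \<in> U"
  shows "\<exists>u. localised U v u"
proof -
  obtain E where E: "reps M U E" using reps_exists[OF U(1)] by blast
  then have fin: "finite E" by (simp add: reps_def)
  have "\<forall>e. \<exists>u. localised {z. z - e \<in> PP M} v u" using localised_coset by blast
  from choice[OF this] obtain w where w: "\<And>e. localised {z. z - e \<in> PP M} v (w e)" by blast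
  have "L (\<Sum>e\<in>E. w e) = (if z \<in> U then L v else 0)" if L: "L \<in> Wh z" for z L
  proof -
    have "L (\<Sum>e\<in>E. w e) = (\<Sum>e\<in>E. if z - e \<in> PP M then L v else 0)"
      using w L by (simp add: Wh_sum[OF L] localised_def)
    also have "\<dots> = (if z \<in> U then L v else 0)"
    proof (cases "z \<in> U")
      case True
      then obtain d where d: "d \<in> E" "z - d \<in> PP M" using E by (auto simp: reps_def)
      have "z - e \<in> PP M \<longleftrightarrow> e = d" if "e \<in> E" for e
        using E d that PP_trans[of e z M d] PP_diff_commute[of e z] by (auto simp: reps_def)
      then have "(\<Sum>e\<in>E. if z - e \<in> PP M then L v else 0) = (\<Sum>e\<in>E. if e = d then L v else 0)" by (intro sum.cong) auto
      then show ?thesis using fin d True by simp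
    next
      case False
      have "z - e \<notin> PP M" if "e \<in> E" for e using U(2)[of e "z - e"] E that False by (auto simp: reps_def)
      then show ?thesis using False by simp
    qed
    finally show ?thesis .
  qed
  then show ?thesis unfolding localised_def by blast
qed

lemma T_localised:
  assumes "localised U v u" "z \<noteq> 0" "x \<noteq> 0" "L \<in> Wh z"
  shows "T \<zeta> x L u = (if \<zeta> \<in> U then T \<zeta> x L v else 0)"
  using assms T_Wh unfolding localised_def by blast

text \<open>The transform is constant near \<eta>, because the function transformed has bounded
  support, so Fourier inversion for a vector localised there returns that constant times the
  volume.\<close>

lemma T_dual:
  assumes \<eta>: "\<eta> \<noteq> 0" and a: "a \<noteq> 0"
  shows "\<exists>M0. \<forall>M\<ge>M0. \<forall>u. localised {z. z - \<eta> \<in> PP M} v u \<longrightarrow> (\<forall>L\<in>Wh \<eta>. L (pt a (pw u)) = of_real (vol M) * T \<eta> a L v)"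
proof -
  obtain m n where mn: "\<forall>L\<in>Wh \<eta>. step_fun m n (bigcell L a v)" using bigcell_step_fun1[OF \<eta> a] by blast
  show ?thesis
  proof (intro exI allI impI ballI)
    fix M u L assume M: "- m \<le> M" and u: "localised {z. z - \<eta> \<in> PP M} v u" and L: "L \<in> Wh \<eta>"
    have "T \<zeta> a L u = T \<eta> a L v * (if \<zeta> - \<eta> \<in> PP M then 1 else 0)" for \<zeta>
    proof -
      have "T \<zeta> a L v = T \<eta> a L v" if "\<zeta> - \<eta> \<in> PP M"
      proof -
        have "\<zeta> - \<eta> \<in> PP (- m)" using that M PP_monoD by blast
        then show ?thesis using step_fun_near[OF step_fun_FT, of m n "bigcell L a v" \<zeta> \<eta>] mn L by (simp add: T_def)
      qed
      then show ?thesis using T_localised[OF u \<eta> a L, of \<zeta>] by simp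
    qed
    then have "I (\<lambda>\<zeta>. T \<zeta> a L u) = T \<eta> a L v * of_real (vol M)" by (simp only: integral_mult_right_zero I_indicator_coset)
    then show "L (pt a (pw u)) = of_real (vol M) * T \<eta> a L v" using T_inversion[OF \<eta> a L, of 0 u] by simp
  qed
qed

text \<open>The vector does not depend on L: on values at v the operator T is evaluation at another
  vector, hence linear in L.\<close>

lemma T_dual_vector:
  assumes "\<eta> \<noteq> 0" "a \<noteq> 0" shows "\<exists>v'. \<forall>L\<in>Wh \<eta>. T \<eta> a L v = L v'"
proof -
  obtain M where M: "\<And>u L. localised {z. z - \<eta> \<in> PP M} v u \<Longrightarrow> L \<in> Wh \<eta> \<Longrightarrow> L (pt a (pw u)) = of_real (vol M) * T \<eta> a L v"
    using T_dual[OF assms, of v] by blast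
  obtain u where u: "localised {z. z - \<eta> \<in> PP M} v u" using localised_coset by blast
  have "T \<eta> a L v = L (smul (1 / of_real (vol M)) (pt a (pw u)))" if "L \<in> Wh \<eta>" for L
    using M[OF u that] by (simp add: Wh_scale[OF that])
  then show ?thesis by blast
qed

end

section \<open>Uniformity of the transforms and localised vectors on the big cell\<close>

lemma PP_divide: "(c::'k::nonarch_local_field) \<noteq> 0 \<Longrightarrow> h \<in> PP n \<Longrightarrow> h / c \<in> PP (n - vl c)"
  by (cases "h = 0") (auto simp: mem_PP vl_divide)

context mp_rep begin

lemma localisedD: "localised U v u \<Longrightarrow> L \<in> Wh z \<Longrightarrow> L u = (if z \<in> U then L v else 0)"
  by (simp add: localised_def)

definition Zs :: "int \<Rightarrow> int \<Rightarrow> 'k set" where "Zs C e = {z. z \<noteq> 0 \<and> C \<le> vl z \<and> vl z < e}"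

lemma Zs_mult_unit: "vl b = 0 \<Longrightarrow> b \<noteq> 0 \<Longrightarrow> z * b \<in> Zs C e \<longleftrightarrow> z \<in> Zs C e"
  by (cases "z = 0") (auto simp: Zs_def vl_mult)

lemma step_fun_Zs:
  assumes f: "\<And>z c. z \<in> Zs C e \<Longrightarrow> c - 1 \<in> PP N \<Longrightarrow> f (z * c) = f z" and N: "N \<ge> 1"
  shows "step_fun C (e + N) (\<lambda>z. if z \<in> Zs C e then f z else 0)"
proof (rule step_funI)
  fix z :: 'k assume "z \<notin> PP C" then show "(if z \<in> Zs C e then f z else 0) = 0" by (auto simp: Zs_def mem_PP)
next
  have 1: "z + h \<in> Zs C e \<and> f (z + h) = f z" if z: "z \<in> Zs C e" and h: "h \<in> PP (e + N)" for z h
  proof -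
    have z0: "z \<noteq> 0" "vl z < e" using z by (auto simp: Zs_def)
    define c where "c = 1 + h / z"
    have "h / z \<in> PP (e + N - vl z)" using z0 h by (intro PP_divide)
    then have c: "c - 1 \<in> PP N" using z0 PP_monoD by (fastforce simp: c_def)
    have zc: "z + h = z * c" using z0 by (simp add: c_def field_simps)
    have "c \<noteq> 0 \<and> vl c = 0" by (rule unit_near_1[OF c N])
    then show ?thesis unfolding zc using f[OF z c] z Zs_mult_unit by blast
  qed
  fix z h :: 'k assume h: "h \<in> PP (e + N)"
  show "(if z + h \<in> Zs C e then f (z + h) else 0) = (if z \<in> Zs C e then f z else 0)"
  proof (cases "z \<in> Zs C e")
    case True then show ?thesis using 1[OF True h] by simp
  next
    case False
    have "z + h \<notin> Zs C e"
    proof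
      assume "z + h \<in> Zs C e"
      from 1[OF this, of "- h"] h False show False by simp
    qed
    then show ?thesis using False by simp
  qed
qed

lemma step_fun_near_1:
  fixes f :: "'k \<Rightarrow> complex"
  assumes f: "\<And>b c. b - 1 \<in> PP N \<Longrightarrow> c - 1 \<in> PP n \<Longrightarrow> f (b * c) = f b" and N: "1 \<le> N" "N \<le> n"
  shows "step_fun 0 n (\<lambda>b. if b - 1 \<in> PP N then f b else (0::complex))"
proof (rule step_funI)
  fix b :: 'k assume "b \<notin> PP 0"
  then have "b - 1 \<notin> PP N" using unit_near_1[of b N] N by (auto simp: mem_PP)
  then show "(if b - 1 \<in> PP N then f b else 0) = 0" by simp
next
  fix b h :: 'k assume h: "h \<in> PP n"
  then have hN: "h \<in> PP N" using N PP_monoD by blast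
  have *: "b + h - 1 \<in> PP N \<longleftrightarrow> b - 1 \<in> PP N" using PP_add_iff[OF hN, of "b - 1"] by (simp add: algebra_simps)
  have "f (b + h) = f b" if b: "b - 1 \<in> PP N"
  proof -
    have b0: "b \<noteq> 0" "vl b = 0" using unit_near_1[OF b N(1)] by auto
    have "h / b \<in> PP n" using PP_divide[OF b0(1) h] b0(2) by simp
    then have "f (b * (1 + h / b)) = f b" by (intro f[OF b]) simp
    then show ?thesis using b0 by (simp add: ring_distribs)
  qed
  then show "(if b + h - 1 \<in> PP N then f (b + h) else 0) = (if b - 1 \<in> PP N then f b else 0)" using * by simp
qed

text \<open>For t of nonnegative valuation the functions on the big cell share support and level, so
  finitely many sample points determine them; at each of these the value vanishes for small t by
  \<open>Wh_bounds\<close>.\<close>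

lemma T_vanish:
  assumes \<eta>: "\<eta> \<noteq> 0" shows "\<exists>K. \<forall>t. t \<noteq> 0 \<and> K \<le> vl t \<longrightarrow> (\<forall>\<zeta>. \<forall>L\<in>Wh \<eta>. T \<zeta> t L v = 0)"
proof -
  obtain m n where mn: "\<And>x L. x \<noteq> 0 \<Longrightarrow> 0 \<le> vl x \<Longrightarrow> L \<in> Wh \<eta> \<Longrightarrow> step_fun m n (bigcell L x v)" using bigcell_step_fun[OF \<eta>, of 0 v] by metis
  obtain D :: "'k set" where D: "reps n (PP m) D" using reps_exists by blast
  have "\<forall>d. \<exists>k. \<forall>z. \<forall>L\<in>Wh z. L (pw (pn d v)) \<noteq> 0 \<longrightarrow> vl z < k" using Wh_bounds by blast
  from choice[OF this] obtain k where k: "\<And>d z L. L \<in> Wh z \<Longrightarrow> L (pw (pn d v)) \<noteq> 0 \<Longrightarrow> vl z < k d" by blast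
  define K where "K = Max (insert 0 ((\<lambda>d. k d - vl \<eta>) ` D))"
  have fin: "finite D" using D by (simp add: reps_def)
  have K: "0 \<le> K" "\<And>d. d \<in> D \<Longrightarrow> k d - vl \<eta> \<le> K" using fin by (auto simp: K_def)
  have "T \<zeta> t L v = 0" if t: "t \<noteq> 0" "K \<le> vl t" and L: "L \<in> Wh \<eta>" for t L \<zeta>
  proof -
    have step_fun: "step_fun m n (bigcell L t v)" using mn[OF t(1) _ L] t K by simp
    have z: "bigcell L t v d = 0" if d: "d \<in> D" for d
    proof (rule ccontr)
      assume "\<not> ?thesis"
      then have "L (pt t (pw (pn d v))) \<noteq> 0" by (simp add: bigcell_def)
      from k[OF Wh_pt[OF L t(1)] this] have "vl \<eta> + 2 * vl t < k d" using \<eta> t by (simp add: vl_mult vl_power)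
      then show False using K(1) K(2)[OF d] t(2) by linarith
    qed
    have "bigcell L t v y = 0" for y
    proof (cases "y \<in> PP m")
      case True
      then have "\<exists>d\<in>D. y - d \<in> PP n" using D unfolding reps_def by blast
      then obtain d where "d \<in> D" "y - d \<in> PP n" ..
      then show ?thesis using z step_fun_near[OF step_fun] by metis
    qed (rule step_fun_supp[OF step_fun])
    then show ?thesis by (simp add: T_def FT_def)
  qed
  then show ?thesis by blast
qed

text \<open>By \<open>T_scale\<close> a factor b near 1 in t amounts to a factor b^2 in \<zeta>, and
  the transform is locally constant in \<zeta> at a level uniform in t.\<close>

lemma T_inv:
  assumes \<eta>: "\<eta> \<noteq> 0"
  shows "\<exists>N\<ge>1. \<forall>t b. t \<noteq> 0 \<and> k \<le> vl t \<and> b - 1 \<in> PP N \<longrightarrow> (\<forall>L\<in>Wh \<eta>. T \<zeta> (t * b) L v = T \<zeta> t L v)"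
proof -
  obtain Nv where Nv: "Nv \<ge> 1" "\<forall>b. b - 1 \<in> PP Nv \<longrightarrow> pt b v = v" using smooth by blast
  obtain m n where mn: "\<And>x L. x \<noteq> 0 \<Longrightarrow> k \<le> vl x \<Longrightarrow> L \<in> Wh \<eta> \<Longrightarrow> step_fun m n (bigcell L x v)" using bigcell_step_fun[OF \<eta>, of k v] by metis
  define N where "N = max Nv (- m - vl \<zeta>)"
  have "T \<zeta> (t * b) L v = T \<zeta> t L v" if t: "t \<noteq> 0" "k \<le> vl t" and b: "b - 1 \<in> PP N" and L: "L \<in> Wh \<eta>" for t b L
  proof -
    have b': "b - 1 \<in> PP Nv" "b - 1 \<in> PP (- m - vl \<zeta>)" using b by (auto simp: N_def PP_max_iff)
    have b0: "b \<noteq> 0" "vl b = 0" using unit_near_1[OF b'(1) Nv(1)] by auto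
    have sq: "issq b" using issq_near_1 PP_monoD[OF b'(1) Nv(1)] by blast
    have "T (\<zeta> * b\<^sup>2) t L v = T \<zeta> (t * b) L v"
      using T_scale[OF \<eta> t(1) b0(1) L, of \<zeta> v] Nv b' nabs_vl[OF b0(1)] b0(2) hilbert_symbol_issq'[OF sq, of "t * b"] by simp
    moreover have "T (\<zeta> * b\<^sup>2) t L v = T \<zeta> t L v"
    proof -
      have "b + 1 \<in> PP 0" using b0 by (intro PP_add) (auto simp: mem_PP)
      then have "\<zeta> * ((b - 1) * (b + 1)) \<in> PP (vl \<zeta> + (- m - vl \<zeta> + 0))" by (intro PP_mult b' PP_vl)
      then have "\<zeta> * b\<^sup>2 - \<zeta> \<in> PP (- m)" by (simp add: power2_eq_square algebra_simps)
      then show ?thesis unfolding T_def by (rule step_fun_near[OF step_fun_FT[OF mn[OF t L]]])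
    qed
    ultimately show ?thesis by simp
  qed
  then show ?thesis using Nv(1) by (intro exI[of _ N]) (auto simp: N_def)
qed

text \<open>Comes from \<open>chi_mult\<close> at x z and z, since x z^2 has the same \<chi> as x.
  Trading symbols for values of \<chi> makes later sign checks cancellations.\<close>

lemma hs_chi: "x \<noteq> 0 \<Longrightarrow> z \<noteq> 0 \<Longrightarrow> hs (x * z) z = chi (x * z) * chi z / chi x"
  using chi_mult[of "x * z" z] chi_mult_square[of x z] chi_nz[of x] by (simp add: power2_eq_square mult.assoc)

lemma hs_self_mult: "(x::'k) \<noteq> 0 \<Longrightarrow> z \<noteq> 0 \<Longrightarrow> hs z z * hs x z = hs (x * z) z"
proof -
  assume x: "x \<noteq> 0" and z: "z \<noteq> 0"
  have 1: "chi z * chi z = hs z z" using chi_mult[OF z z] chi_mult_square[of 1 z] z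
    by (simp add: power2_eq_square chi_eq beta_even vol_pos[THEN less_imp_neq, THEN not_sym])
  have 2: "chi x * chi z = chi (x * z) * hs x z" by (rule chi_mult[OF x z])
  have "chi (x * z) = chi x * chi z * hs x z" using 2 hs_square[of x z] by (simp add: mult.assoc)
  then have "hs (x * z) z = chi x * chi z * hs x z * chi z / chi x" using hs_chi[OF x z] by simp
  also have "\<dots> = (chi z * chi z) * hs x z" using chi_nz[OF x] by simp
  finally show ?thesis using 1 by simp
qed

lemma hs_mult_square: "(b::'k) \<noteq> 0 \<Longrightarrow> issq b \<Longrightarrow> hilbert_symbol (x * (z * b)) (z * b) = hilbert_symbol (x * z) z"
proof -
  assume b: "b \<noteq> 0" "issq b"
  then obtain c where c: "c \<noteq> 0" "b = c\<^sup>2" by (auto simp: issq_def)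
  show ?thesis using hilbert_symbol_mult_square[OF c(1), of "x * z"] hilbert_symbol_mult_square'[OF c(1), of _ z] c(2)
    by (simp add: mult.assoc)
qed

lemma pt_pw_pn_pw:
  assumes x: "x \<noteq> 0" and z: "z \<noteq> 0" and L: "L \<in> Wh \<eta>"
  shows "L (pt x (pw (pn z (pw u)))) = hs (x * z) z * \<psi> (- (\<eta> * x\<^sup>2 / z)) * L (pt (x / z) (pw (pn (- inverse z) u)))"
proof -
  note c = carrier_gens(3)[OF x]
  have "pt x (pw (pn z (pw u))) = smul (hs z z * hs x z) (pn (- (x\<^sup>2 / z)) (pt (x / z) (pw (pn (- inverse z) u))))"
    unfolding pw_pn_pw[OF z] pi_scale[OF c] pt_pn[OF x] using pt_pt[OF x, of "inverse z"] z x
    by (simp add: pi_scale[OF carrier_gens(1)] hilbert_symbol_inverse divide_inverse)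
  moreover have "hs x z * hs z z = hs (x * z) z" using hs_self_mult[OF x z] by (simp add: mult.commute)
  ultimately show ?thesis using L by (simp add: hs_self_mult[OF x z] Wh_scale Wh_pn)
qed

lemma weyl_squared: "\<exists>\<omega>. \<forall>v. pw (pw v) = smul \<omega> v"
proof -
  obtain \<omega> where \<omega>: "\<And>v. pt (- 1) v = smul \<omega> v" using pt_minus_1_scalar by blast
  have "pw (pw v) = smul (hs (- 1 :: 'k) (- 1)) (pt (- 1) v)" for v by (simp add: cocycle_simps)
  then show ?thesis unfolding \<omega> by auto
qed

text \<open>The substitution \<zeta> = \<eta> b^2 maps 1 + P^N onto the neighbourhood of \<eta> with
  Jacobian \<bar>\<eta>\<bar>, and \<open>T_scale\<close> moves b from the character into the torus
  argument, since t(b) fixes v.\<close>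

lemma localised_integral:
  assumes \<eta>: "\<eta> \<noteq> 0" and L: "L \<in> Wh \<eta>" and u: "localised {z. z - \<eta> \<in> PP (N + vl \<eta>)} v u"
    and Nv: "\<forall>b. b - 1 \<in> PP N \<longrightarrow> pt b v = v" and N: "N \<ge> 1" and t: "t \<noteq> 0"
  shows "L (pt t (pw (pn y u))) = of_real (nabs \<eta>) * I (\<lambda>b. if b - 1 \<in> PP N then \<psi> (\<eta> * b\<^sup>2 * y) * T \<eta> (t * b) L v else 0)"
proof -
  define f where "f \<zeta> = (if \<zeta> - \<eta> \<in> PP (N + vl \<eta>) then T \<zeta> t L v * \<psi> (\<zeta> * y) else 0)" for \<zeta>
  define g where "g b = (if b - 1 \<in> PP N then \<psi> (\<eta> * b\<^sup>2 * y) * T \<eta> (t * b) L v else 0)" for b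
  obtain m n where mn: "step_fun m n (bigcell L t v)" using bigcell_step_fun1[OF \<eta> t] L by blast
  have gf: "g b = (if b - 1 \<in> PP N then f (\<eta> * b\<^sup>2) else 0)" for b
  proof (cases "b - 1 \<in> PP N")
    case b: True
    have b0: "b \<noteq> 0" "vl b = 0" using unit_near_1[OF b N] by auto
    have sq: "issq b" using issq_near_1 PP_monoD[OF b N] by blast
    have "T (\<eta> * b\<^sup>2) t L v = T \<eta> (t * b) L v"
      using T_scale[OF \<eta> t(1) b0(1) L, of \<eta> v] Nv b nabs_vl[OF b0(1)] b0(2) hilbert_symbol_issq'[OF sq, of "t * b"] by simp
    moreover have "\<eta> * b\<^sup>2 - \<eta> \<in> PP (N + vl \<eta>)"
    proof -
      have "b + 1 \<in> PP 0" using b0 by (intro PP_add) (auto simp: mem_PP)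
      then have "\<eta> * ((b - 1) * (b + 1)) \<in> PP (vl \<eta> + (N + 0))" by (intro PP_mult b PP_vl)
      then show ?thesis by (simp add: power2_eq_square algebra_simps)
    qed
    ultimately show ?thesis using b by (simp add: f_def g_def)
  qed (simp add: g_def)
  have lf: "loc_const f \<zeta>" for \<zeta> unfolding f_def
  proof (rule loc_const_comp2[where G = "\<lambda>b y. if b then y else 0"])
    show "loc_const (\<lambda>\<zeta>. \<zeta> - \<eta> \<in> PP (N + vl \<eta>)) \<zeta>" by (rule loc_const_mem_PP)
    show "loc_const (\<lambda>\<zeta>. T \<zeta> t L v * \<psi> (\<zeta> * y)) \<zeta>"
    proof (rule loc_const_comp2[where G = "\<lambda>a b. a * b"])
      show "loc_const (\<lambda>\<zeta>. T \<zeta> t L v) \<zeta>" unfolding T_def by (rule step_fun_loc_const[OF step_fun_FT[OF mn]])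
      show "loc_const (\<lambda>\<zeta>. \<psi> (\<zeta> * y)) \<zeta>" using loc_const_mult[of \<psi> y \<zeta>] loc_const_psi by (simp add: mult.commute)
    qed
  qed
  have "\<exists>n\<ge>min (vl \<eta>) (N + vl \<eta>). step_fun (min (vl \<eta>) (N + vl \<eta>)) n f"
  proof (rule step_fun_ex[OF _ lf])
    fix \<zeta> :: 'k assume *: "\<zeta> \<notin> PP (min (vl \<eta>) (N + vl \<eta>))"
    show "f \<zeta> = 0"
    proof (rule ccontr)
      assume "f \<zeta> \<noteq> 0"
      then have "\<zeta> - \<eta> \<in> PP (N + vl \<eta>)" by (auto simp: f_def split: if_splits)
      then have "\<zeta> - \<eta> \<in> PP (min (vl \<eta>) (N + vl \<eta>))" by (rule PP_monoD) simp
      from PP_add[OF this, of \<eta>] have "\<zeta> \<in> PP (min (vl \<eta>) (N + vl \<eta>))" by (simp add: mem_PP[of \<eta>])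
      then show False using * by blast
    qed
  qed
  then obtain m1 n1 where s1: "step_fun m1 n1 f" by blast
  have "\<exists>n\<ge>0. step_fun 0 n g"
  proof (rule step_fun_ex)
    fix b :: 'k assume "b \<notin> PP 0"
    then have "b - 1 \<notin> PP N" using unit_near_1[of b N] N by (auto simp: mem_PP)
    then show "g b = 0" by (simp add: g_def)
  next
    fix b :: 'k
    have "loc_const (\<lambda>b. if b - 1 \<in> PP N then f (\<eta> * b\<^sup>2) else 0) b"
    proof (rule loc_const_comp2[where G = "\<lambda>b y. if b then y else 0"])
      show "loc_const (\<lambda>b. b - 1 \<in> PP N) b" by (rule loc_const_mem_PP)
      show "loc_const (\<lambda>b. f (\<eta> * b\<^sup>2)) b" by (rule loc_const_power2[of "\<lambda>y. f (\<eta> * y)"], rule loc_const_mult, rule lf)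
    qed
    then show "loc_const g b" using gf by presburger
  qed
  then obtain n2 where s2: "step_fun 0 n2 g" by blast
  have "L (pt t (pw (pn y u))) = I (\<lambda>\<zeta>. T \<zeta> t L u * \<psi> (\<zeta> * y))" by (rule T_inversion[OF \<eta> t L])
  also have "\<dots> = I f" using T_localised[OF u \<eta> t L] by (intro arg_cong[where f = I] ext) (simp add: f_def)
  also have "I f = of_real (qcard TYPE('k) powi (- vl \<eta>)) * I g"
  proof (rule I_change_var[OF s1 s2, where U = "{b. b - 1 \<in> PP N}" and \<phi> = "\<lambda>b. \<eta> * b\<^sup>2"])
    show "g b = f (\<eta> * b\<^sup>2)" if "b \<in> {b. b - 1 \<in> PP N}" for b using that gf by simp
    show "g b = 0" if "b \<notin> {b. b - 1 \<in> PP N}" for b using that gf by simp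
    show "\<zeta> \<in> (\<lambda>b. \<eta> * b\<^sup>2) ` {b. b - 1 \<in> PP N}" if "f \<zeta> \<noteq> 0" for \<zeta>
    proof -
      have "\<zeta> - \<eta> \<in> PP (vl \<eta> + N)" using that by (auto simp: f_def add.commute split: if_splits)
      from square_near[OF odd_q \<eta> this N] show ?thesis by auto
    qed
    fix b c :: 'k and M assume "b \<in> {b. b - 1 \<in> PP N}" "c \<in> {b. b - 1 \<in> PP N}"
    then have bc: "b - 1 \<in> PP 1" "c - 1 \<in> PP 1" using PP_monoD[OF _ N] by auto
    have "\<eta> * b\<^sup>2 - \<eta> * c\<^sup>2 = \<eta> * (b\<^sup>2 - c\<^sup>2)" by (simp add: algebra_simps)
    then show "\<eta> * b\<^sup>2 - \<eta> * c\<^sup>2 \<in> PP (M + vl \<eta>) \<longleftrightarrow> b - c \<in> PP M"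
      using square_near_iso[OF odd_q, of 1 b c M] bc \<eta> by (simp add: PP_mult_iff)
  qed
  finally have 1: "L (pt t (pw (pn y u))) = of_real (nabs \<eta>) * I g" unfolding nabs_vl[OF \<eta>] .
  have "g = (\<lambda>b. if b - 1 \<in> PP N then \<psi> (\<eta> * b\<^sup>2 * y) * T \<eta> (t * b) L v else 0)" by (rule ext) (rule g_def)
  then show ?thesis using 1 by simp
qed

end

section \<open>Composition and commutation of the transforms\<close>

context mp_rep begin

lemma psi_mult_near: "\<kappa> \<in> PP k \<Longrightarrow> c - 1 \<in> PP N \<Longrightarrow> k + N \<ge> 0 \<Longrightarrow> \<psi> (\<kappa> * c) = \<psi> \<kappa>"
proof -
  assume "\<kappa> \<in> PP k" "c - 1 \<in> PP N" "k + N \<ge> 0"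
  then have "\<kappa> * (c - 1) \<in> PP 0" using PP_mult PP_monoD by blast
  then show ?thesis by (intro psi_near) (simp add: algebra_simps)
qed

lemma inverse_near_1: "c - 1 \<in> PP N \<Longrightarrow> N \<ge> 1 \<Longrightarrow> inverse c - 1 \<in> PP N"
  using inverse_near[of 1 "c - 1" N] PP_monoD[of "c - 1" N 1] by simp

lemma mult_near_1: "b - 1 \<in> PP N \<Longrightarrow> c - 1 \<in> PP N \<Longrightarrow> N \<ge> 1 \<Longrightarrow> b * c - 1 \<in> PP N"
proof -
  assume b: "b - 1 \<in> PP N" and c: "c - 1 \<in> PP N" and N: "N \<ge> 1"
  have "b \<in> PP 0" using unit_near_1[OF b N] by (simp add: mem_PP)
  then have "b * (c - 1) + (b - 1) \<in> PP N" using PP_mult[OF _ c, of b 0] b by (intro PP_add) auto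
  then show ?thesis by (simp add: algebra_simps)
qed

text \<open>Substituting \<open>b \<mapsto> 1/b\<close> shows that the kernel at \<open>(1/x, z/x\<^sup>2)\<close> equals the kernel at \<open>(x, z)\<close>; this symmetry makes the operators \<open>T\<close> commute.\<close>

definition kern :: "'k \<Rightarrow> 'k \<Rightarrow> int \<Rightarrow> 'k \<Rightarrow> complex" where
  "kern \<eta> x N z = I (\<lambda>b. if b - 1 \<in> PP N then \<psi> (- (\<eta> * (x\<^sup>2 * inverse b + b) / z)) else 0)"

lemma kern_phase_near:
  assumes z: "z \<noteq> 0" and b: "b - 1 \<in> PP 1" and c: "c - 1 \<in> PP n" "n \<ge> 1"
    and n: "vl (\<eta> * x\<^sup>2 / z) + n \<ge> 0" "vl (\<eta> / z) + n \<ge> 0"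
  shows "\<psi> (- (\<eta> * (x\<^sup>2 * inverse (b * c) + b * c) / z)) = \<psi> (- (\<eta> * (x\<^sup>2 * inverse b + b) / z))"
proof -
  have b0: "b \<noteq> 0" "vl b = 0" using unit_near_1[OF b] by auto
  have c0: "c \<noteq> 0" "vl c = 0" using unit_near_1[OF c] by auto
  have split: "\<psi> (- (\<eta> * (x\<^sup>2 * inverse d + d) / z)) = \<psi> ((- (\<eta> * x\<^sup>2 / z)) * inverse d) * \<psi> ((- (\<eta> / z)) * d)" for d
    unfolding psi_add[symmetric] by (intro arg_cong[where f = \<psi>]) (simp add: divide_inverse algebra_simps)
  have ib: "inverse b \<in> PP 0" "b \<in> PP 0" using b0 by (auto simp: mem_PP vl_inverse)
  have 1: "- (\<eta> * x\<^sup>2 / z) * inverse b \<in> PP (vl (- (\<eta> * x\<^sup>2 / z)) + 0)" by (intro PP_mult PP_vl ib)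
  have 2: "- (\<eta> / z) * b \<in> PP (vl (- (\<eta> / z)) + 0)" by (intro PP_mult PP_vl ib)
  have "\<psi> ((- (\<eta> * x\<^sup>2 / z)) * inverse (b * c)) = \<psi> ((- (\<eta> * x\<^sup>2 / z) * inverse b) * inverse c)" using b0 c0 by (simp add: mult_ac)
  also have "\<dots> = \<psi> ((- (\<eta> * x\<^sup>2 / z)) * inverse b)" by (rule psi_mult_near[OF 1 inverse_near_1[OF c]]) (use n in simp)
  finally have 3: "\<psi> ((- (\<eta> * x\<^sup>2 / z)) * inverse (b * c)) = \<psi> ((- (\<eta> * x\<^sup>2 / z)) * inverse b)" .
  have "\<psi> ((- (\<eta> / z) * b) * c) = \<psi> ((- (\<eta> / z)) * b)" by (rule psi_mult_near[OF 2 c(1)]) (use n in simp)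
  then have 4: "\<psi> ((- (\<eta> / z)) * (b * c)) = \<psi> ((- (\<eta> / z)) * b)" by (simp only: mult.assoc)
  show ?thesis unfolding split 3 4 ..
qed

lemma kern_step_fun:
  assumes "z \<noteq> 0" "N \<ge> 1" "\<eta> \<noteq> 0"
  shows "\<exists>n. step_fun 0 n (\<lambda>b. if b - 1 \<in> PP N then \<psi> (- (\<eta> * (x\<^sup>2 * inverse b + b) / z)) else 0)"
proof -
  define n where "n = max N (max (- vl (\<eta> * x\<^sup>2 / z)) (- vl (\<eta> / z)))"
  have "step_fun 0 n (\<lambda>b. if b - 1 \<in> PP N then \<psi> (- (\<eta> * (x\<^sup>2 * inverse b + b) / z)) else 0)"
  proof (rule step_fun_near_1)
    fix b c :: 'k assume b: "b - 1 \<in> PP N" and c: "c - 1 \<in> PP n"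
    show "\<psi> (- (\<eta> * (x\<^sup>2 * inverse (b * c) + b * c) / z)) = \<psi> (- (\<eta> * (x\<^sup>2 * inverse b + b) / z))"
      by (rule kern_phase_near[OF assms(1) PP_monoD[OF b assms(2)] c]) (use assms(2) in \<open>auto simp: n_def\<close>)
  qed (use assms in \<open>auto simp: n_def\<close>)
  then show ?thesis by blast
qed

lemma kern_inverse:
  assumes z: "z \<noteq> 0" and N: "N \<ge> 1" and \<eta>: "\<eta> \<noteq> 0" and x: "x \<noteq> 0"
  shows "kern \<eta> (inverse x) N (z / x\<^sup>2) = kern \<eta> x N z"
proof -
  let ?f = "\<lambda>b. if b - 1 \<in> PP N then \<psi> (- (\<eta> * (x\<^sup>2 * inverse b + b) / z)) else 0"
  let ?g = "\<lambda>b. if b - 1 \<in> PP N then \<psi> (- (\<eta> * ((inverse x)\<^sup>2 * inverse b + b) / (z / x\<^sup>2))) else 0"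
  obtain n n' where n: "step_fun 0 n ?f" "step_fun 0 n' ?g" using kern_step_fun[OF z N \<eta>, of x] kern_step_fun[of "z / x\<^sup>2" N \<eta> "inverse x"] z x N \<eta> by auto
  have "I ?f = of_real (qcard TYPE('k) powi (- 0)) * I ?g"
  proof (rule I_change_var[OF n, where U = "{b. b - 1 \<in> PP N}" and \<phi> = inverse])
    show "?g b = ?f (inverse b)" if b: "b \<in> {b. b - 1 \<in> PP N}" for b
    proof -
      have b': "b - 1 \<in> PP N" using b by simp
      have b0: "b \<noteq> 0" using unit_near_1[OF b' N] by simp
      have *: "\<eta> * ((inverse x)\<^sup>2 * inverse b + b) / (z / x\<^sup>2) = \<eta> * (x\<^sup>2 * inverse (inverse b) + inverse b) / z"
      proof -
        have "((inverse x)\<^sup>2 * inverse b + b) * x\<^sup>2 = x\<^sup>2 * inverse (inverse b) + inverse b"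
          using x by (simp add: ring_distribs power_inverse mult_ac)
        then show ?thesis using x z by (simp add: divide_simps mult.assoc)
      qed
      show ?thesis unfolding * using inverse_near_1[OF b' N] b' by simp
    qed
    show "?g b = 0" if "b \<notin> {b. b - 1 \<in> PP N}" for b using that by simp
    show "b \<in> inverse ` {b. b - 1 \<in> PP N}" if "?f b \<noteq> 0" for b
    proof -
      have "b - 1 \<in> PP N" using that by (auto split: if_splits)
      from inverse_near_1[OF this N] show ?thesis by (intro image_eqI[of _ _ "inverse b"]) auto
    qed
    fix b c :: 'k and M assume "b \<in> {b. b - 1 \<in> PP N}" "c \<in> {b. b - 1 \<in> PP N}"
    then have b: "b \<noteq> 0" "vl b = 0" and c: "c \<noteq> 0" "vl c = 0" using unit_near_1[of b N] unit_near_1[of c N] N by auto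
    have "inverse b - inverse c = (inverse b * inverse c) * (c - b)" using b c by (simp add: field_simps)
    moreover have "inverse b * inverse c \<noteq> 0" "vl (inverse b * inverse c) = 0" using b c by (auto simp: vl_mult vl_inverse)
    ultimately have "inverse b - inverse c \<in> PP (M + 0) \<longleftrightarrow> c - b \<in> PP M"
      using PP_mult_iff[of "inverse b * inverse c" "c - b" M] by simp
    then show "inverse b - inverse c \<in> PP (M + 0) \<longleftrightarrow> b - c \<in> PP M" using PP_diff_commute[of b c M] by blast
  qed
  then show ?thesis by (simp add: kern_def)
qed

text \<open>Here z is the argument of the unipotent element between the two Weyl elements; C and e
  truncate its valuation.\<close>

definition comp_integrand :: "'k \<Rightarrow> 'k \<Rightarrow> 'k \<Rightarrow> ('v \<Rightarrow> complex) \<Rightarrow> 'v \<Rightarrow> int \<Rightarrow> int \<Rightarrow> int \<Rightarrow> 'k \<Rightarrow> complex" where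
  "comp_integrand \<eta> x a L v N C e z =
     (if z \<in> Zs C e then hs (x * z) z * T \<eta> (x / z) L v * \<psi> (- (\<eta> * a\<^sup>2 * z)) * kern \<eta> x N z else 0)"

text \<open>The step function clause is carried along because the comparison of two such formulas
  rescales z.\<close>

definition composition_formula :: "'k \<Rightarrow> 'k \<Rightarrow> 'k \<Rightarrow> ('v \<Rightarrow> complex) \<Rightarrow> 'v \<Rightarrow> int \<Rightarrow> int \<Rightarrow> int \<Rightarrow> bool" where
  "composition_formula \<eta> x a L v N C e \<longleftrightarrow> (\<exists>m n. step_fun m n (comp_integrand \<eta> x a L v N C e)) \<and>
    of_real (vol (N + vl \<eta>)) * T \<eta> a (T \<eta> (x * a) L) v =
    of_real ((nabs a)\<^sup>2 * nabs \<eta>) * hs (x * a) a * I (comp_integrand \<eta> x a L v N C e)"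

text \<open>\<open>T_dual\<close> turns the outer transform into evaluation at t(a) w u, and
  \<open>T_scale\<close> moves t(a) into the character. What remains is the integral over z of the
  values at t(x) w n(z) w u, where the rank one relation and \<open>localised_integral\<close>
  apply.\<close>

lemma T_composition:
  assumes \<eta>: "\<eta> \<noteq> 0" and x: "x \<noteq> 0" and a: "a \<noteq> 0" and x1: "x\<^sup>2 \<noteq> 1" and L: "L \<in> Wh \<eta>"
  shows "\<exists>C0. \<forall>C\<le>C0. \<exists>N0\<ge>1. \<forall>N\<ge>N0. \<forall>u. localised {z. z - \<eta> \<in> PP (N + vl \<eta>)} v u \<longrightarrow> (\<exists>e0. \<forall>e\<ge>e0.
    composition_formula \<eta> x a L v N C e)"
proof -
  obtain K where K: "\<And>t. t \<noteq> 0 \<Longrightarrow> K \<le> vl t \<Longrightarrow> T \<eta> t L v = 0" using T_vanish[OF \<eta>, of v] L by blast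
  obtain Nv where Nv: "Nv \<ge> 1" "\<forall>b. b - 1 \<in> PP Nv \<longrightarrow> pt b v = v" using smooth by blast
  obtain Md where Md: "\<And>M u L. M \<ge> Md \<Longrightarrow> localised {z. z - \<eta> \<in> PP M} v u \<Longrightarrow> L \<in> Wh \<eta> \<Longrightarrow> L (pt a (pw u)) = of_real (vol M) * T \<eta> a L v"
    using T_dual[OF \<eta> a, of v] by blast
  show ?thesis
  \<comment> \<open>For \<open>vl z < C\<close> this bound gives \<open>vl (x / z) \<ge> K\<close>,
    where the transform vanishes.\<close>
  proof (rule exI[of _ "vl x - K + 1"], intro allI impI)
    fix C assume C: "C \<le> vl x - K + 1"
    \<comment> \<open>In order: 1 + P^N fixes v, \<open>T_dual\<close> applies, \<psi>(\<eta> a^2 z)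
      ignores factors in 1 + P^N when \<open>vl z \<ge> C\<close>, and \<eta> x^2 stays outside the
      neighbourhood of \<eta>.\<close>
    define N0 where "N0 = max (max Nv (Md - vl \<eta>)) (max (- (vl \<eta> + 2 * vl a + C)) (vl (x\<^sup>2 - 1) + 1))"
    show "\<exists>N0\<ge>1. \<forall>N\<ge>N0. \<forall>u. localised {z. z - \<eta> \<in> PP (N + vl \<eta>)} v u \<longrightarrow> (\<exists>e0. \<forall>e\<ge>e0.
      composition_formula \<eta> x a L v N C e)"
    proof (rule exI[of _ N0], intro conjI allI impI)
      show "1 \<le> N0" using Nv by (auto simp: N0_def)
      fix N u assume "N0 \<le> N" and u: "localised {z. z - \<eta> \<in> PP (N + vl \<eta>)} v u"
      then have N: "Nv \<le> N" "1 \<le> N" "Md \<le> N + vl \<eta>" "vl \<eta> + 2 * vl a + C + N \<ge> 0" "vl (x\<^sup>2 - 1) < N"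
        using Nv(1) by (auto simp: N0_def)
      obtain e1 where e1: "\<forall>h\<in>PP e1. pn h (pw u) = pw u" using fixed_unip by blast
      obtain \<omega> where \<omega>: "\<And>v. pw (pw v) = smul \<omega> v" using weyl_squared by blast
      show "\<exists>e0. \<forall>e\<ge>e0. composition_formula \<eta> x a L v N C e"
      proof (rule exI[of _ e1], intro allI impI)
        fix e assume e: "e1 \<le> e"
        obtain NT where NT: "NT \<ge> 1" "\<And>t b. t \<noteq> 0 \<Longrightarrow> vl x - e \<le> vl t \<Longrightarrow> b - 1 \<in> PP NT \<Longrightarrow> T \<eta> (t * b) L v = T \<eta> t L v"
          using T_inv[OF \<eta>, of "vl x - e" \<eta> v] L by blast
        \<comment> \<open>A common level for the transform and for all phases, given C \<le>
          \<open>vl z\<close> < e.\<close>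
        define n where "n = max (max NT N) (max (max (e - vl \<eta> - 2 * vl x) (e - vl \<eta>)) (- (vl \<eta> + 2 * vl a + C)))"
        have n: "NT \<le> n" "N \<le> n" "1 \<le> n" "e - vl \<eta> - 2 * vl x \<le> n" "e - vl \<eta> \<le> n" "vl \<eta> + 2 * vl a + C + n \<ge> 0"
          using NT(1) by (auto simp: n_def)
        define A where "A t = T \<eta> t L v" for t
        define \<kappa> where "\<kappa> z = hs (x * z) z * \<psi> (- (\<eta> * x\<^sup>2 / z)) * \<psi> (- (\<eta> * a\<^sup>2 * z))" for z
        define G where "G z b = \<kappa> z * (\<psi> (\<eta> * b\<^sup>2 * (- inverse z)) * A (x / z * b))" for z b
        define H where "H z b = hs (x * z) z * A (x / z) * \<psi> (- (\<eta> * a\<^sup>2 * z)) * \<psi> (- (\<eta> * (x\<^sup>2 * inverse b + b) / z))" for z b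
        define GG where "GG z b = (if z \<in> Zs C e then if b - 1 \<in> PP N then G z b else 0 else 0)" for z b
        define HH where "HH z b = (if z \<in> Zs C e then if b - 1 \<in> PP N then H z b else 0 else 0)" for z b
        have Zs: "z \<noteq> 0" "C \<le> vl z" "vl z < e" if "z \<in> Zs C e" for z using that by (auto simp: Zs_def)
        have sqn: "issq c" "c \<noteq> 0" "vl c = 0" if "c - 1 \<in> PP n" for c :: 'k
          using issq_near_1[OF PP_monoD[OF that n(3)]] unit_near_1[OF that n(3)] by auto
        have sqN: "issq c" "c \<noteq> 0" "vl c = 0" if "c - 1 \<in> PP N" for c :: 'k
          using issq_near_1[OF PP_monoD[OF that N(2)]] unit_near_1[OF that N(2)] by auto
        have A_near: "A (t * c) = A t" if "t \<noteq> 0" "vl x - e \<le> vl t" "c - 1 \<in> PP n" for t c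
          using NT(2)[OF that(1,2) PP_monoD[OF that(3) n(1)]] by (simp add: A_def)
        have vlxz: "x / z \<noteq> 0" "vl x - e \<le> vl (x / z)" if "z \<in> Zs C e" for z
          using Zs[OF that] x by (auto simp: vl_divide)
        have hsn: "hs (x * (z * c)) (z * c) = hs (x * z) z" if "issq c" "c \<noteq> 0" for z c :: 'k
          using hs_mult_square[OF that(2,1)] by simp
        have psia: "\<psi> (- (\<eta> * a\<^sup>2 * (z * c))) = \<psi> (- (\<eta> * a\<^sup>2 * z))" if z: "z \<in> Zs C e" and c: "c - 1 \<in> PP k" and k: "vl \<eta> + 2 * vl a + C + k \<ge> 0" for z c k
        proof -
          have "\<psi> ((- (\<eta> * a\<^sup>2 * z)) * c) = \<psi> (- (\<eta> * a\<^sup>2 * z))"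
          proof (rule psi_mult_near[OF PP_vl c])
            have "vl (- (\<eta> * a\<^sup>2 * z)) = vl \<eta> + 2 * vl a + vl z" using \<eta> a Zs[OF z] by (simp add: vl_mult vl_power)
            then show "vl (- (\<eta> * a\<^sup>2 * z)) + k \<ge> 0" using Zs(2)[OF z] k by simp
          qed
          then show ?thesis by (simp add: mult.assoc)
        qed
        have ex2: "vl (\<eta> * x\<^sup>2 / z) + n \<ge> 0" "vl (\<eta> / z) + n \<ge> 0" if "z \<in> Zs C e" for z
          using Zs[OF that] n x \<eta> by (auto simp: vl_mult vl_power vl_divide)
        have Gz: "G (z * c) b = G z b" if z: "z \<in> Zs C e" and b: "b - 1 \<in> PP N" and c: "c - 1 \<in> PP n" for z b c
        proof -
          note zz = Zs[OF z] note cc = sqn[OF c] note bb = sqN[OF b]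
          have ic: "inverse c - 1 \<in> PP n" by (rule inverse_near_1[OF c n(3)])
          have 1: "\<psi> (- (\<eta> * x\<^sup>2 / (z * c))) = \<psi> (- (\<eta> * x\<^sup>2 / z))"
          proof -
            have "\<psi> ((- (\<eta> * x\<^sup>2 / z)) * inverse c) = \<psi> (- (\<eta> * x\<^sup>2 / z))"
              by (rule psi_mult_near[OF PP_vl ic]) (use ex2[OF z] in simp)
            then show ?thesis by (simp add: divide_inverse mult_ac)
          qed
          have 2: "\<psi> (\<eta> * b\<^sup>2 * (- inverse (z * c))) = \<psi> (\<eta> * b\<^sup>2 * (- inverse z))"
          proof -
            have "\<psi> ((\<eta> * b\<^sup>2 * (- inverse z)) * inverse c) = \<psi> (\<eta> * b\<^sup>2 * (- inverse z))"
            proof (rule psi_mult_near[OF PP_vl ic])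
              have "vl (\<eta> * b\<^sup>2 * (- inverse z)) = vl (\<eta> / z)" using \<eta> bb zz by (simp add: vl_mult vl_power vl_divide vl_inverse)
              then show "vl (\<eta> * b\<^sup>2 * (- inverse z)) + n \<ge> 0" using ex2[OF z] by simp
            qed
            then show ?thesis by (simp add: mult_ac)
          qed
          have 3: "A (x / (z * c) * b) = A (x / z * b)"
          proof -
            have "A ((x / z * b) * inverse c) = A (x / z * b)"
              by (rule A_near[OF _ _ ic]) (use vlxz[OF z] bb x zz in \<open>auto simp: vl_mult vl_divide\<close>)
            then show ?thesis by (simp add: divide_inverse mult_ac)
          qed
          show ?thesis unfolding G_def \<kappa>_def 1 2 3 hsn[OF cc(1,2)] psia[OF z c n(6)] ..
        qed
        have Gb: "G z (b * c) = G z b" if z: "z \<in> Zs C e" and b: "b - 1 \<in> PP N" and c: "c - 1 \<in> PP n" for z b c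
        proof -
          note zz = Zs[OF z] note cc = sqn[OF c] note bb = sqN[OF b]
          have c2: "c * c - 1 \<in> PP n" by (rule mult_near_1[OF c c n(3)])
          have 2: "\<psi> (\<eta> * (b * c)\<^sup>2 * (- inverse z)) = \<psi> (\<eta> * b\<^sup>2 * (- inverse z))"
          proof -
            have "\<psi> ((\<eta> * b\<^sup>2 * (- inverse z)) * (c * c)) = \<psi> (\<eta> * b\<^sup>2 * (- inverse z))"
            proof (rule psi_mult_near[OF PP_vl c2])
              have "vl (\<eta> * b\<^sup>2 * (- inverse z)) = vl (\<eta> / z)" using \<eta> bb zz by (simp add: vl_mult vl_power vl_divide vl_inverse)
              then show "vl (\<eta> * b\<^sup>2 * (- inverse z)) + n \<ge> 0" using ex2[OF z] by simp
            qed
            then show ?thesis by (simp add: power2_eq_square mult_ac)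
          qed
          have 3: "A (x / z * (b * c)) = A (x / z * b)"
            unfolding mult.assoc[symmetric]
            by (rule A_near[OF _ _ c]) (use vlxz[OF z] bb x zz in \<open>auto simp: vl_mult vl_divide\<close>)
          show ?thesis unfolding G_def 2 3 ..
        qed
        have Hz: "H (z * c) b = H z b" if z: "z \<in> Zs C e" and b: "b - 1 \<in> PP N" and c: "c - 1 \<in> PP n" for z b c
        proof -
          note zz = Zs[OF z] note cc = sqn[OF c] note bb = sqN[OF b]
          have ic: "inverse c - 1 \<in> PP n" by (rule inverse_near_1[OF c n(3)])
          have 1: "\<psi> (- (\<eta> * (x\<^sup>2 * inverse b + b) / (z * c))) = \<psi> (- (\<eta> * (x\<^sup>2 * inverse b + b) / z))"
          proof -
            have "\<psi> (- (\<eta> * x\<^sup>2 / z) * inverse b + - (\<eta> / z) * b) = \<psi> ((- (\<eta> * x\<^sup>2 / z) * inverse b + - (\<eta> / z) * b) * inverse c)"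
            proof (rule psi_mult_near[OF _ ic, symmetric])
              have b0: "inverse b \<in> PP 0" "b \<in> PP 0" using bb by (auto simp: mem_PP vl_inverse)
              have "- (\<eta> * x\<^sup>2 / z) \<in> PP (- n)" "- (\<eta> / z) \<in> PP (- n)" using ex2[OF z] by (auto intro!: PP_monoD[OF PP_vl])
              from PP_mult[OF this(1) b0(1)] PP_mult[OF this(2) b0(2)]
              show "- (\<eta> * x\<^sup>2 / z) * inverse b + - (\<eta> / z) * b \<in> PP (- n)" by (intro PP_add) auto
            qed simp
            moreover have "- (\<eta> * x\<^sup>2 / z) * inverse b + - (\<eta> / z) * b = - (\<eta> * (x\<^sup>2 * inverse b + b) / z)"
              by (simp add: divide_inverse algebra_simps)
            moreover have "- (\<eta> * (x\<^sup>2 * inverse b + b) / z) * inverse c = - (\<eta> * (x\<^sup>2 * inverse b + b) / (z * c))"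
              by (simp add: divide_inverse mult_ac)
            ultimately show ?thesis by simp
          qed
          have 3: "A (x / (z * c)) = A (x / z)"
          proof -
            have "A ((x / z) * inverse c) = A (x / z)" by (rule A_near[OF _ _ ic]) (use vlxz[OF z] in auto)
            then show ?thesis by (simp add: divide_inverse mult_ac)
          qed
          show ?thesis unfolding H_def 1 3 hsn[OF cc(1,2)] psia[OF z c n(6)] ..
        qed
        have Hb: "H z (b * c) = H z b" if z: "z \<in> Zs C e" and b: "b - 1 \<in> PP N" and c: "c - 1 \<in> PP n" for z b c
          unfolding H_def kern_phase_near[OF Zs(1)[OF z] PP_monoD[OF b N(2)] c n(3) ex2[OF z]] ..
        have GGz: "step_fun C (e + n) (\<lambda>z. GG z b)" for b unfolding GG_def
          by (rule step_fun_Zs[OF _ n(3)]) (use Gz in auto)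
        have HHz: "step_fun C (e + n) (\<lambda>z. HH z b)" for b unfolding HH_def
          by (rule step_fun_Zs[OF _ n(3)]) (use Hz in auto)
        have GGb: "step_fun 0 n (\<lambda>b. GG z b)" for z
        proof (cases "z \<in> Zs C e")
          case True
          have "step_fun 0 n (\<lambda>b. if b - 1 \<in> PP N then G z b else 0)"
            by (rule step_fun_near_1[OF _ N(2) n(2)]) (use Gb True in auto)
          then show ?thesis using True by (simp add: GG_def)
        qed (simp add: GG_def step_fun_def)
        have HHb: "step_fun 0 n (\<lambda>b. HH z b)" for z
        proof (cases "z \<in> Zs C e")
          case True
          have "step_fun 0 n (\<lambda>b. if b - 1 \<in> PP N then H z b else 0)"
            by (rule step_fun_near_1[OF _ N(2) n(2)]) (use Hb True in auto)
          then show ?thesis using True by (simp add: HH_def)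
        qed (simp add: HH_def step_fun_def)
        have Nb: "\<forall>b. b - 1 \<in> PP N \<longrightarrow> pt b v = v" using Nv N PP_monoD by blast
        \<comment> \<open>Near z = 0, n(z) fixes w u and the value is a multiple of that at t(x) u,
          which is 0 because \<eta> x^2 differs from \<eta>; this is where x^2 must not be 1. Below
          C the transform vanishes.\<close>
        have S0: "bigcell L x (pw u) z * \<psi> (- (\<eta> * a\<^sup>2 * z)) = of_real (nabs \<eta>) * I (GG z)" for z
        proof (cases "z = 0 \<or> e \<le> vl z")
          case True
          then have "z \<in> PP e" by (auto simp: mem_PP)
          then have "z \<in> PP e1" using e PP_monoD by blast
          then have "bigcell L x (pw u) z = \<omega> * L (pt x u)" using e1 \<omega> L
            by (simp add: bigcell_def Wh_scale pi_scale[OF carrier_gens(3)[OF x]])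
          moreover have "\<eta> * x\<^sup>2 - \<eta> \<notin> PP (N + vl \<eta>)"
          proof
            assume "\<eta> * x\<^sup>2 - \<eta> \<in> PP (N + vl \<eta>)"
            then have "\<eta> * (x\<^sup>2 - 1) \<in> PP (N + vl \<eta>)" by (simp add: algebra_simps)
            then have "x\<^sup>2 - 1 \<in> PP N" using \<eta> by (simp add: PP_mult_iff)
            then show False using N(5) x1 by (simp add: mem_PP)
          qed
          then have "L (pt x u) = 0" using localisedD[OF u Wh_pt[OF L x]] by simp
          moreover have "z \<notin> Zs C e" using True by (auto simp: Zs_def)
          then have "GG z = (\<lambda>_. 0)" by (auto simp: GG_def)
          ultimately show ?thesis by simp
        next
          case False
          then have z: "z \<noteq> 0" "vl z < e" by auto
          have xz: "x / z \<noteq> 0" using x z by simp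
          let ?J = "I (\<lambda>b. if b - 1 \<in> PP N then \<psi> (\<eta> * b\<^sup>2 * (- inverse z)) * A (x / z * b) else 0)"
          have F: "bigcell L x (pw u) z = hs (x * z) z * \<psi> (- (\<eta> * x\<^sup>2 / z)) * (of_real (nabs \<eta>) * ?J)"
            unfolding bigcell_def pt_pw_pn_pw[OF x z(1) L] localised_integral[OF \<eta> L u Nb N(2) xz] A_def ..
          show ?thesis
          proof (cases "C \<le> vl z")
            case True
            then have zZ: "z \<in> Zs C e" using z by (simp add: Zs_def)
            have "I (GG z) = I (\<lambda>b. \<kappa> z * (if b - 1 \<in> PP N then \<psi> (\<eta> * b\<^sup>2 * (- inverse z)) * A (x / z * b) else 0))"
              using zZ by (intro arg_cong[where f = I] ext) (simp add: GG_def G_def)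
            also have "\<dots> = \<kappa> z * ?J" by (rule integral_mult_right_zero)
            finally show ?thesis unfolding F \<kappa>_def by (simp only: mult_ac)
          next
            case False
            have "A (x / z * b) = 0" if b: "b - 1 \<in> PP N" for b
              unfolding A_def
            proof (rule K)
              show "x / z * b \<noteq> 0" using xz sqN[OF b] by simp
              have "vl (x / z * b) = vl x - vl z" using x z sqN[OF b] by (simp add: vl_mult vl_divide)
              then show "K \<le> vl (x / z * b)" using False C by simp
            qed
            then have "?J = I (\<lambda>_. 0)" by (intro arg_cong[where f = I] ext) simp
            then have "?J = 0" by simp
            moreover have "GG z = (\<lambda>_. 0)" using False by (auto simp: GG_def Zs_def)
            ultimately show ?thesis unfolding F by simp
          qed
        qed
        \<comment> \<open>Replacing z by b z turns x/z * b into x/z, so b survives only in the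
          phase, which is that of \<open>kern\<close>.\<close>
        have S3: "I (\<lambda>z. GG z b) = I (\<lambda>z. HH z b)" for b
        proof (cases "b - 1 \<in> PP N")
          case b: True
          note bb = sqN[OF b]
          have "HH z b = GG (b * z) b" for z
          proof (cases "z \<in> Zs C e")
            case z: True
            note zz = Zs[OF z]
            have "G (z * b) b = H z b"
            proof -
              have 1: "\<psi> (- (\<eta> * x\<^sup>2 / (z * b))) * \<psi> (\<eta> * b\<^sup>2 * (- inverse (z * b))) = \<psi> (- (\<eta> * (x\<^sup>2 * inverse b + b) / z))"
                unfolding psi_add[symmetric] using zz bb by (intro arg_cong[where f = \<psi>]) (simp add: field_simps power2_eq_square)
              have 2: "x / (z * b) * b = x / z" using bb by simp
              show ?thesis unfolding G_def \<kappa>_def H_def 2 hsn[OF bb(1,2)] psia[OF z b N(4)] 1[symmetric] by (simp only: mult_ac)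
            qed
            then show ?thesis using z b Zs_mult_unit[OF bb(3,2), of z] by (simp add: HH_def GG_def mult.commute)
          next
            case False
            then show ?thesis using Zs_mult_unit[OF bb(3,2), of z] by (simp add: HH_def GG_def mult.commute)
          qed
          then have "I (\<lambda>z. HH z b) = I (\<lambda>z. GG (b * z) b)" by simp
          also have "\<dots> = of_real (inverse (nabs b)) * I (\<lambda>z. GG z b)" by (rule I_scale[OF GGz bb(2)])
          also have "nabs b = 1" using nabs_vl[OF bb(2)] bb(3) by simp
          finally show ?thesis by simp
        qed (simp add: HH_def GG_def cong: if_cong)
        have S5: "I (HH z) = comp_integrand \<eta> x a L v N C e z" for z
        proof (cases "z \<in> Zs C e")
          case True
          let ?c = "hs (x * z) z * A (x / z) * \<psi> (- (\<eta> * a\<^sup>2 * z))"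
          have "I (HH z) = I (\<lambda>b. ?c * (if b - 1 \<in> PP N then \<psi> (- (\<eta> * (x\<^sup>2 * inverse b + b) / z)) else 0))"
            using True by (intro arg_cong[where f = I] ext) (simp add: HH_def H_def)
          also have "\<dots> = ?c * kern \<eta> x N z" unfolding kern_def by (rule integral_mult_right_zero)
          finally show ?thesis using True by (simp add: comp_integrand_def A_def)
        next
          case False
          then have "HH z = (\<lambda>_. 0)" by (auto simp: HH_def)
          then show ?thesis using False by (simp add: comp_integrand_def)
        qed
        have "step_fun C (e + n) (\<lambda>z. I (HH z))" by (rule step_fun_I) (rule HHz)
        then have step_fun: "step_fun C (e + n) (comp_integrand \<eta> x a L v N C e)" unfolding S5 .
        have xa: "x * a \<noteq> 0" using x a by simp
        have "of_real (vol (N + vl \<eta>)) * T \<eta> a (T \<eta> (x * a) L) v = T \<eta> (x * a) L (pt a (pw u))"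
          by (rule Md[OF N(3) u T_Wh[OF \<eta> xa L], symmetric])
        also have "\<dots> = of_real ((nabs a)\<^sup>2) * hs (x * a) a * T (\<eta> * a\<^sup>2) x L (pw u)"
          unfolding T_scale[OF \<eta> x a L, of \<eta> "pw u"] using hs_square[of "x * a" a] a by (simp add: field_simps)
        also have "T (\<eta> * a\<^sup>2) x L (pw u) = I (\<lambda>z. of_real (nabs \<eta>) * I (GG z))" unfolding T_def FT_def S0 ..
        also have "\<dots> = of_real (nabs \<eta>) * I (\<lambda>z. I (GG z))" by (rule integral_mult_right_zero)
        also have "I (\<lambda>z. I (GG z)) = I (\<lambda>b. I (\<lambda>z. GG z b))" by (rule I_swap[OF GGz GGb])
        also have "\<dots> = I (\<lambda>b. I (\<lambda>z. HH z b))" unfolding S3 ..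
        also have "\<dots> = I (\<lambda>z. I (HH z))" by (rule I_swap[OF HHz HHb, symmetric])
        also have "\<dots> = I (comp_integrand \<eta> x a L v N C e)" unfolding S5 ..
        finally have "of_real (vol (N + vl \<eta>)) * T \<eta> a (T \<eta> (x * a) L) v =
          of_real ((nabs a)\<^sup>2 * nabs \<eta>) * hs (x * a) a * I (comp_integrand \<eta> x a L v N C e)" by (simp add: mult_ac)
        then show "composition_formula \<eta> x a L v N C e" using step_fun unfolding composition_formula_def by blast
      qed
    qed
  qed
qed

end

text \<open>Gaussian elimination: each equation is solved for one unknown with nonzero
  coefficient.\<close>

lemma homogeneous_system:
  fixes g :: "'i \<Rightarrow> 'b \<Rightarrow> complex"
  assumes "finite B" "finite A" "card B < card A"
  shows "\<exists>c. (\<exists>i\<in>A. c i \<noteq> 0) \<and> (\<forall>b\<in>B. (\<Sum>i\<in>A. c i * g i b) = 0)"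
  using assms
proof (induction B arbitrary: A g rule: finite_induct)
  case empty
  then show ?case by (intro exI[of _ "\<lambda>_. 1"]) (auto simp: card_gt_0_iff)
next
  case (insert b B)
  show ?case
  proof (cases "\<forall>i\<in>A. g i b = 0")
    case True
    then show ?thesis using insert.IH[of A g] insert.prems insert.hyps by (auto simp: True)
  next
    case False
    then obtain i0 where i0: "i0 \<in> A" "g i0 b \<noteq> 0" by blast
    let ?A = "A - {i0}" and ?g = "\<lambda>i x. g i x - g i b / g i0 b * g i0 x"
    have "card B < card ?A" using insert.prems insert.hyps i0 by simp
    then obtain c where c: "\<exists>i\<in>?A. c i \<noteq> 0" "\<forall>x\<in>B. (\<Sum>i\<in>?A. c i * ?g i x) = 0"
      using insert.IH[of ?A ?g] insert.prems by auto
    define c' where "c' = c(i0 := - (\<Sum>i\<in>?A. c i * g i b) / g i0 b)"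
    have "(\<Sum>i\<in>A. c' i * g i x) = (\<Sum>i\<in>?A. c i * ?g i x)" for x
    proof -
      have "(\<Sum>i\<in>A. c' i * g i x) = c' i0 * g i0 x + (\<Sum>i\<in>?A. c' i * g i x)"
        using i0 insert.prems by (simp add: sum.remove)
      also have "(\<Sum>i\<in>?A. c' i * g i x) = (\<Sum>i\<in>?A. c i * g i x)" by (intro sum.cong) (auto simp: c'_def)
      also have "c' i0 * g i0 x = - (\<Sum>i\<in>?A. c i * (g i b / g i0 b * g i0 x))"
        by (simp add: c'_def sum_distrib_right sum_divide_distrib sum_negf[symmetric] mult.assoc)
      finally show ?thesis by (simp add: sum_subtractf right_diff_distrib)
    qed
    moreover have "(\<Sum>i\<in>?A. c i * ?g i b) = 0" using i0 by simp
    moreover have "\<exists>i\<in>A. c' i \<noteq> 0" using c(1) by (auto simp: c'_def)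
    ultimately show ?thesis using c(2) by (intro exI[of _ c']) auto
  qed
qed

lemma Mp_closed: "g \<in> carrier Mp \<Longrightarrow> h \<in> carrier Mp \<Longrightarrow> g \<otimes>\<^bsub>Mp\<^esub> h \<in> carrier Mp"
  by (cases g; cases h) (use hilbert_symbol_values in \<open>fastforce simp: Mp_mult Mp_carrier det_mul kubota_cocycle_def\<close>)

context mp_rep begin

lemma T_comp_scalar: "T \<zeta> t (\<lambda>v. c * L v) v = c * T \<zeta> t L v"
proof -
  have "bigcell (\<lambda>v. c * L v) t v = (\<lambda>y. c * bigcell L t v y)" by (rule ext) (simp add: bigcell_def)
  then show ?thesis by (simp add: T_def FT_def mult.assoc)
qed

text \<open>Since t(-1) acts by a scalar, t and -t give proportional transforms; the factor is the
  same for all functionals and vectors.\<close>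

lemma T_minus:
  assumes t: "t \<noteq> 0" shows "\<exists>c. \<forall>z. \<forall>L\<in>Wh z. \<forall>\<zeta> v. T \<zeta> (- t) L v = c * T \<zeta> t L v"
proof -
  obtain \<omega> where \<omega>: "\<And>v. pt (- 1) v = smul \<omega> v" using pt_minus_1_scalar by blast
  have m1: "(- 1 :: 'k) \<noteq> 0" by simp
  have "T \<zeta> (- t) L v = hs t (- 1) * \<omega> * T \<zeta> t L v" if L: "L \<in> Wh z" for z L \<zeta> v
  proof -
    have "smul \<omega> (pt t u) = smul (hs t (- 1)) (pt (- t) u)" for u
      using pt_pt[OF t m1, of u] by (simp add: \<omega> pi_scale[OF carrier_gens(3)[OF t]])
    then have "smul (hs t (- 1)) (smul \<omega> (pt t u)) = pt (- t) u" for u using hs_square[of t "- 1"] by simp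
    then have "pt (- t) u = smul (hs t (- 1) * \<omega>) (pt t u)" for u by simp
    then have "bigcell L (- t) v = (\<lambda>y. hs t (- 1) * \<omega> * bigcell L t v y)" by (intro ext) (simp add: bigcell_def Wh_scale[OF L])
    then show ?thesis by (simp add: T_def FT_def mult.assoc)
  qed
  then show ?thesis by blast
qed

text \<open>Write both orders by the composition formula, the second with 1/x and x a, and
  substitute z -> z/x^2. The kernels agree by \<open>kern_inverse\<close>, the signs by
  \<open>hs_chi\<close>, and the modulus \<bar>x\<bar>^2 turns \<bar>a\<bar>^2 into \<bar>x
  a\<bar>^2.\<close>

lemma T_commute_generic:
  assumes \<eta>: "\<eta> \<noteq> 0" and x: "x \<noteq> 0" and a: "a \<noteq> 0" and x1: "x\<^sup>2 \<noteq> 1" and L: "L \<in> Wh \<eta>"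
  shows "T \<eta> a (T \<eta> (x * a) L) v = T \<eta> (x * a) (T \<eta> a L) v"
proof -
  have ix: "inverse x \<noteq> 0" "(inverse x)\<^sup>2 \<noteq> 1" and xa: "x * a \<noteq> 0" and ixa: "inverse x * (x * a) = a"
    using x a x1 by (auto simp: power_inverse)
  from T_composition[OF \<eta> x a x1 L, of v] obtain C0 where C0:
    "\<And>C. C \<le> C0 \<Longrightarrow> \<exists>N0\<ge>1. \<forall>N\<ge>N0. \<forall>u. localised {z. z - \<eta> \<in> PP (N + vl \<eta>)} v u \<longrightarrow> (\<exists>e0. \<forall>e\<ge>e0.
    composition_formula \<eta> x a L v N C e)" by blast
  from T_composition[OF \<eta> ix(1) xa ix(2) L, of v] obtain C1 where C1:
    "\<And>C. C \<le> C1 \<Longrightarrow> \<exists>N0\<ge>1. \<forall>N\<ge>N0. \<forall>u. localised {z. z - \<eta> \<in> PP (N + vl \<eta>)} v u \<longrightarrow> (\<exists>e0. \<forall>e\<ge>e0.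
    composition_formula \<eta> (inverse x) (x * a) L v N C e)" by blast
  \<comment> \<open>The substitution lowers valuations of z by \<open>2 * vl x\<close>, so the
    second formula is truncated at \<open>C - 2 * vl x\<close>.\<close>
  define C where "C = min C0 (C1 + 2 * vl x)"
  from C0[of C] obtain N0 where N0: "N0 \<ge> 1" "\<And>N u. N \<ge> N0 \<Longrightarrow> localised {z. z - \<eta> \<in> PP (N + vl \<eta>)} v u \<Longrightarrow> \<exists>e0. \<forall>e\<ge>e0.
    composition_formula \<eta> x a L v N C e" unfolding C_def by (metis min.cobounded1)
  have "C - 2 * vl x \<le> C1" by (simp add: C_def)
  from C1[OF this] obtain N1 where N1: "N1 \<ge> 1" "\<And>N u. N \<ge> N1 \<Longrightarrow> localised {z. z - \<eta> \<in> PP (N + vl \<eta>)} v u \<Longrightarrow> \<exists>e0. \<forall>e\<ge>e0.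
    composition_formula \<eta> (inverse x) (x * a) L v N (C - 2 * vl x) e" by blast
  define N where "N = max N0 N1"
  have N: "N \<ge> N0" "N \<ge> N1" "N \<ge> 1" using N0(1) by (auto simp: N_def)
  obtain u where u: "localised {z. z - \<eta> \<in> PP (N + vl \<eta>)} v u" using localised_coset by blast
  from N0(2)[OF N(1) u] obtain e0 where e0: "\<And>e. e \<ge> e0 \<Longrightarrow> of_real (vol (N + vl \<eta>)) * T \<eta> a (T \<eta> (x * a) L) v =
    of_real ((nabs a)\<^sup>2 * nabs \<eta>) * hs (x * a) a * I (comp_integrand \<eta> x a L v N C e)"
    unfolding composition_formula_def by blast
  from N1(2)[OF N(2) u] obtain e1 where e1: "\<And>e. e \<ge> e1 \<Longrightarrow>
    (\<exists>m n. step_fun m n (comp_integrand \<eta> (inverse x) (x * a) L v N (C - 2 * vl x) e)) \<and> of_real (vol (N + vl \<eta>)) * T \<eta> (x * a) (T \<eta> a L) v =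
    of_real ((nabs (x * a))\<^sup>2 * nabs \<eta>) * hs a (x * a) * I (comp_integrand \<eta> (inverse x) (x * a) L v N (C - 2 * vl x) e)" unfolding composition_formula_def ixa by blast
  define e where "e = max e0 (e1 + 2 * vl x)"
  have e: "e \<ge> e0" "e - 2 * vl x \<ge> e1" by (auto simp: e_def)
  let ?g1 = "comp_integrand \<eta> x a L v N C e"
  let ?g2 = "comp_integrand \<eta> (inverse x) (x * a) L v N (C - 2 * vl x) (e - 2 * vl x)"
  obtain m n where g2: "step_fun m n ?g2" using e1[OF e(2)] by blast
  have pt: "hs a (x * a) * ?g2 (inverse (x\<^sup>2) * z) = hs (x * a) a * ?g1 z" for z
  proof (cases "z \<in> Zs C e")
    case True
    then have z: "z \<noteq> 0" by (simp add: Zs_def)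
    have vz: "vl (inverse (x\<^sup>2) * z) = vl z - 2 * vl x" using x z by (simp add: vl_mult vl_inverse vl_power)
    have mem: "inverse (x\<^sup>2) * z \<in> Zs (C - 2 * vl x) (e - 2 * vl x)" using True x by (simp add: Zs_def vz)
    have 1: "inverse x / (inverse (x\<^sup>2) * z) = x / z" using x z by (simp add: field_simps power2_eq_square)
    have 2: "\<eta> * (x * a)\<^sup>2 * (inverse (x\<^sup>2) * z) = \<eta> * a\<^sup>2 * z" using x by (simp add: field_simps)
    have 3: "kern \<eta> (inverse x) N (inverse (x\<^sup>2) * z) = kern \<eta> x N z"
      using kern_inverse[OF z N(3) \<eta> x] by (simp add: divide_inverse mult.commute)
    have s: "hs a (x * a) * hs (inverse x * (inverse (x\<^sup>2) * z)) (inverse (x\<^sup>2) * z) = hs (x * a) a * hs (x * z) z"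
    proof -
      have "x * (inverse x)\<^sup>2 = inverse x" using x by (simp add: power2_eq_square)
      then have c1: "chi (inverse x) = chi x" using chi_mult_square[of x "inverse x"] x by simp
      have c2: "chi (inverse (x\<^sup>2) * z) = chi z" using chi_mult_square[of z "inverse x"] x z by (simp add: power_inverse mult.commute)
      have e3: "inverse x * (inverse (x\<^sup>2) * z) = (x * z) * (inverse (x\<^sup>2))\<^sup>2" using x by (simp add: field_simps power2_eq_square)
      have c3: "chi (inverse x * (inverse (x\<^sup>2) * z)) = chi (x * z)" unfolding e3 by (rule chi_mult_square) (use x z in auto)
      have "hs a (x * a) = hs (inverse x * (x * a)) (x * a)" by (simp only: ixa)
      also have "\<dots> = chi a * chi (x * a) / chi x" using hs_chi[OF ix(1) xa] unfolding ixa c1 .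
      finally have h1: "hs a (x * a) = hs (x * a) a" using hs_chi[OF x a] by (simp add: mult.commute)
      have "inverse (x\<^sup>2) * z \<noteq> 0" using x z by simp
      from hs_chi[OF ix(1) this] have "hs (inverse x * (inverse (x\<^sup>2) * z)) (inverse (x\<^sup>2) * z) = chi (x * z) * chi z / chi x"
        unfolding c1 c2 c3 .
      then show ?thesis using h1 hs_chi[OF x z] by simp
    qed
    have "hs a (x * a) * ?g2 (inverse (x\<^sup>2) * z) = (hs a (x * a) * hs (inverse x * (inverse (x\<^sup>2) * z)) (inverse (x\<^sup>2) * z)) *
       (T \<eta> (x / z) L v * \<psi> (- (\<eta> * a\<^sup>2 * z)) * kern \<eta> x N z)"
      using mem unfolding comp_integrand_def 1 2 3 by simp
    also have "\<dots> = hs (x * a) a * ?g1 z" unfolding s using True by (simp add: comp_integrand_def)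
    finally show ?thesis .
  next
    case False
    have "inverse (x\<^sup>2) * z \<notin> Zs (C - 2 * vl x) (e - 2 * vl x)"
    proof
      assume *: "inverse (x\<^sup>2) * z \<in> Zs (C - 2 * vl x) (e - 2 * vl x)"
      then have z: "z \<noteq> 0" by (auto simp: Zs_def)
      then have "vl (inverse (x\<^sup>2) * z) = vl z - 2 * vl x" using x by (simp add: vl_mult vl_inverse vl_power)
      then show False using * False z by (simp add: Zs_def)
    qed
    then show ?thesis using False by (simp add: comp_integrand_def)
  qed
  have "hs (x * a) a * I ?g1 = I (\<lambda>z. hs (x * a) a * ?g1 z)" by (rule integral_mult_right_zero[symmetric])
  also have "\<dots> = I (\<lambda>z. hs a (x * a) * ?g2 (inverse (x\<^sup>2) * z))" unfolding pt ..
  also have "\<dots> = hs a (x * a) * I (\<lambda>z. ?g2 (inverse (x\<^sup>2) * z))" by (rule integral_mult_right_zero)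
  also have "I (\<lambda>z. ?g2 (inverse (x\<^sup>2) * z)) = of_real (inverse (nabs (inverse (x\<^sup>2)))) * I ?g2"
    by (rule I_scale[OF g2]) (use x in simp)
  also have "inverse (nabs (inverse (x\<^sup>2))) = (nabs x)\<^sup>2" by (simp add: nabs_inverse nabs_power)
  finally have key: "hs (x * a) a * I ?g1 = hs a (x * a) * (of_real ((nabs x)\<^sup>2) * I ?g2)" .
  have "of_real (vol (N + vl \<eta>)) * T \<eta> a (T \<eta> (x * a) L) v = of_real ((nabs a)\<^sup>2 * nabs \<eta>) * (hs (x * a) a * I ?g1)"
    using e0[OF e(1)] by (simp add: mult.assoc)
  also have "\<dots> = of_real ((nabs (x * a))\<^sup>2 * nabs \<eta>) * hs a (x * a) * I ?g2"
    unfolding key by (simp add: nabs_mult power_mult_distrib mult_ac)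
  also have "\<dots> = of_real (vol (N + vl \<eta>)) * T \<eta> (x * a) (T \<eta> a L) v" using e1[OF e(2)] by simp
  finally show ?thesis by simp
qed

lemma T_commute:
  assumes \<eta>: "\<eta> \<noteq> 0" and s: "s \<noteq> 0" and t: "t \<noteq> 0" and L: "L \<in> Wh \<eta>"
  shows "T \<eta> t (T \<eta> s L) v = T \<eta> s (T \<eta> t L) v"
proof -
  consider "s = t" | "s = - t" | "(s / t)\<^sup>2 \<noteq> 1" using t by (auto simp: power2_eq_1_iff divide_eq_eq)
  then show ?thesis
  proof cases
    case 2
    obtain c where c: "\<And>z L \<zeta> v. L \<in> Wh z \<Longrightarrow> T \<zeta> (- t) L v = c * T \<zeta> t L v" using T_minus[OF t] by blast
    have "T \<eta> s L = (\<lambda>v. c * T \<eta> t L v)" using c[OF L] 2 by auto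
    then have "T \<eta> t (T \<eta> s L) v = c * T \<eta> t (T \<eta> t L) v" by (simp add: T_comp_scalar)
    also have "\<dots> = T \<eta> s (T \<eta> t L) v" using c[OF T_Wh[OF \<eta> t L]] 2 by simp
    finally show ?thesis .
  next
    case 3
    have "s / t * t = s" using t by simp
    then show ?thesis using T_commute_generic[OF \<eta> _ t 3 L, of v] s t by simp
  qed simp
qed

subsection \<open>Uniqueness of Whittaker functionals\<close>

text \<open>The vectors whose whole orbit is killed by U form an invariant subspace, proper because
  of \<open>u0\<close>.\<close>

lemma vanishing_subspace:
  assumes U: "\<And>L. L \<in> U \<Longrightarrow> module_hom smul (*) L" and L0: "L0 \<in> U" "L0 u0 \<noteq> 0"
    and w: "\<And>g L. g \<in> carrier Mp \<Longrightarrow> L \<in> U \<Longrightarrow> L (\<pi> g w) = 0"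
  shows "w = 0"
proof -
  define W where "W = {w. \<forall>g\<in>carrier Mp. \<forall>L\<in>U. L (\<pi> g w) = 0}"
  have "V.subspace W"
  proof (rule V.subspaceI)
    show "0 \<in> W" unfolding W_def using pi_0 module_hom.zero[OF U] by simp
    show "x + y \<in> W" if "x \<in> W" "y \<in> W" for x y
      unfolding W_def
    proof (intro CollectI ballI)
      fix g :: "'k mp" and L assume g: "g \<in> carrier Mp" and L: "L \<in> U"
      have "L (\<pi> g x) = 0" "L (\<pi> g y) = 0" using that g L unfolding W_def by blast+
      then show "L (\<pi> g (x + y)) = 0" using pi_add[OF g] module_hom.add[OF U[OF L]] by simp
    qed
    show "smul c x \<in> W" if "x \<in> W" for c x
      unfolding W_def
    proof (intro CollectI ballI)
      fix g :: "'k mp" and L assume g: "g \<in> carrier Mp" and L: "L \<in> U"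
      have "L (\<pi> g x) = 0" using that g L unfolding W_def by blast
      then show "L (\<pi> g (smul c x)) = 0" using pi_scale[OF g] module_hom.scale[OF U[OF L]] by simp
    qed
  qed
  moreover have "\<pi> h v \<in> W" if "h \<in> carrier Mp" "v \<in> W" for h v
    unfolding W_def
  proof (intro CollectI ballI)
    fix g :: "'k mp" and L assume g: "g \<in> carrier Mp" and L: "L \<in> U"
    have "L (\<pi> (g \<otimes>\<^bsub>Mp\<^esub> h) v) = 0" using Mp_closed[OF g that(1)] that(2) L unfolding W_def by blast
    then show "L (\<pi> g (\<pi> h v)) = 0" by (simp only: pi_mult[OF g that(1)])
  qed
  ultimately have "W = {0} \<or> W = UNIV" using irreducible unfolding irreducible_Mp_def by blast
  moreover have "u0 \<notin> W"
  proof
    assume "u0 \<in> W"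
    then have "L0 (\<pi> (unip 0) u0) = 0" using L0(1) carrier_gens(1) unfolding W_def by blast
    then show False using L0 by simp
  qed
  moreover have "w \<in> W" unfolding W_def using w by blast
  ultimately show "w = 0" by blast
qed

lemma stable_separates:
  assumes \<eta>: "\<eta> \<noteq> 0" and U: "U \<subseteq> Wh \<eta>" and stable: "\<And>t L. t \<noteq> 0 \<Longrightarrow> L \<in> U \<Longrightarrow> T \<eta> t L \<in> U"
    and L0: "L0 \<in> U" "L0 u0 \<noteq> 0" and v: "\<And>L. L \<in> U \<Longrightarrow> L v = 0" and L': "L' \<in> Wh \<eta>"
  shows "L' v = 0"
proof -
  obtain N where N: "N \<ge> 1" "\<forall>b. b - 1 \<in> PP N \<longrightarrow> pt b v = v" using smooth by blast
  obtain u where u: "localised {z. z - \<eta> \<in> PP (N + vl \<eta>)} v u" using localised_coset by blast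
  obtain \<omega> where \<omega>: "\<And>v. pt (- 1) v = smul \<omega> v" using pt_minus_1_scalar by blast
  have "u = 0"
  proof (rule vanishing_subspace[of U L0 u0 u])
    show "module_hom smul (*) L" if "L \<in> U" for L using Wh_hom U that by blast
    fix g :: "'k mp" and L assume g: "g \<in> carrier Mp" and LU: "L \<in> U"
    then have L: "L \<in> Wh \<eta>" using U by blast
    \<comment> \<open>On the torus the localisation sees only a = b and a = -b with b in 1 + P^N,
      and for these t(a) acts on v by a scalar.\<close>
    have 1: "L (pt a u) = 0" if a: "a \<noteq> 0" for a
    proof (cases "\<eta> * a\<^sup>2 - \<eta> \<in> PP (N + vl \<eta>)")
      case True
      then obtain b where b: "b - 1 \<in> PP N" "\<eta> * a\<^sup>2 = \<eta> * b\<^sup>2"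
        using square_near[OF odd_q \<eta>, of "\<eta> * a\<^sup>2" N] N(1) by (auto simp: add.commute)
      then have "a = b \<or> a = - b" using \<eta> by (simp add: power2_eq_iff)
      moreover have pb: "pt b v = v" using b N by blast
      have "L (pt (- b) v) = 0"
      proof -
        have "b \<noteq> 0" using unit_near_1[OF b(1) N(1)] by simp
        then have "smul (hs (- 1) b) (pt (- b) v) = smul \<omega> v" using pt_pt[of "- 1" b v] pb by (simp add: \<omega>)
        then have "hs (- 1) b * L (pt (- b) v) = \<omega> * L v" using Wh_scale[OF L] by metis
        then show ?thesis using v[OF LU] hilbert_symbol_values[of "- 1" b] by auto
      qed
      ultimately have "L (pt a v) = 0" using v[OF LU] pb by auto
      then show ?thesis using localisedD[OF u Wh_pt[OF L a]] by simp
    next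
      case False
      then show ?thesis using localisedD[OF u Wh_pt[OF L a]] by simp
    qed
    \<comment> \<open>On the big cell the value is an integral of
      \<open>T \<eta> (t * b) L v\<close>, and these functionals stay in U.\<close>
    have 2: "L (pt t (pw (pn y u))) = 0" if t: "t \<noteq> 0" for t y
    proof -
      have "(\<lambda>b. if b - 1 \<in> PP N then \<psi> (\<eta> * b\<^sup>2 * y) * T \<eta> (t * b) L v else 0) = (\<lambda>_. 0)"
      proof
        fix b
        have "T \<eta> (t * b) L v = 0" if "b - 1 \<in> PP N" using unit_near_1[OF that N(1)] t stable LU v by simp
        then show "(if b - 1 \<in> PP N then \<psi> (\<eta> * b\<^sup>2 * y) * T \<eta> (t * b) L v else 0) = 0" by simp
      qed
      then show ?thesis using localised_integral[OF \<eta> L u N(2,1) t, of y] by simp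
    qed
    from bruhat[OF g] show "L (\<pi> g u) = 0" using 1 2 by (auto simp: Wh_scale[OF L] Wh_pn[OF L] Wh_minus[OF L])
  qed (use L0 in auto)
  then have "L' u = 0" using Wh_zero[OF L'] by simp
  moreover have "L' u = L' v" using localisedD[OF u L'] by simp
  ultimately show ?thesis by simp
qed

text \<open>Bounds on the valuation of a and invariance under a congruence subgroup leave finitely
  many translates to test, whatever L is.\<close>

lemma torus_determined:
  assumes \<eta>: "\<eta> \<noteq> 0"
  shows "\<exists>B. finite B \<and> (\<forall>L\<in>Wh \<eta>. (\<forall>u\<in>B. L u = 0) \<longrightarrow> (\<forall>a. a \<noteq> 0 \<longrightarrow> L (pt a w) = 0))"
proof -
  obtain m k where mk: "\<And>z L. L \<in> Wh z \<Longrightarrow> L w \<noteq> 0 \<Longrightarrow> m \<le> vl z \<and> vl z < k" using Wh_bounds by metis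
  obtain N where N: "N \<ge> 1" "\<forall>b. b - 1 \<in> PP N \<longrightarrow> pt b w = w" using smooth by blast
  \<comment> \<open>Crude bounds for \<open>vl a\<close> from those on
    \<open>vl \<eta> + 2 * vl a\<close>; the absolute values absorb the division by 2.\<close>
  define C e where "C = - \<bar>m - vl \<eta>\<bar>" and "e = \<bar>k - vl \<eta>\<bar>"
  have "Zs C e \<subseteq> PP C" by (auto simp: Zs_def mem_PP)
  then obtain D where D: "reps (e + N) (Zs C e) D" using reps_exists by blast
  define B where "B = (\<lambda>d. pt d w) ` D"
  have "L (pt a w) = 0" if L: "L \<in> Wh \<eta>" and B: "\<forall>u\<in>B. L u = 0" and a: "a \<noteq> 0" for L a
  proof (rule ccontr)
    assume nz: "L (pt a w) \<noteq> 0"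
    have "m \<le> vl \<eta> + 2 * vl a \<and> vl \<eta> + 2 * vl a < k" using mk[OF Wh_pt[OF L a] nz] \<eta> a by (simp add: vl_mult vl_power)
    then have "a \<in> Zs C e" using a by (auto simp: Zs_def C_def e_def)
    then have "\<exists>d\<in>D. a - d \<in> PP (e + N)" using D unfolding reps_def by blast
    then obtain d where d: "d \<in> D" "a - d \<in> PP (e + N)" ..
    then have dZ: "d \<noteq> 0" "vl d < e" using D by (auto simp: reps_def Zs_def)
    have "(a - d) / d \<in> PP (e + N - vl d)" by (rule PP_divide[OF dZ(1) d(2)])
    then have "a / d - 1 \<in> PP N" using dZ PP_monoD by (fastforce simp: diff_divide_distrib)
    then have "pt (d * (a / d)) w = pt d w" by (rule Wh_pt_near[OF N(2,1) _ dZ(1)])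
    then have "pt a w = pt d w" using dZ by simp
    then show False using nz B d by (auto simp: B_def)
  qed
  moreover have "finite B" using D by (simp add: B_def reps_def)
  ultimately show ?thesis by blast
qed

text \<open>Test the torus orbits of one nonzero vector, of its image under w w, and of finitely
  many w n(d) images. By Bruhat these cover its orbit, the remaining large unipotent arguments being
  reduced to w w; irreducibility then kills L.\<close>

lemma finitely_determined:
  assumes \<eta>: "\<eta> \<noteq> 0"
  shows "\<exists>B. finite B \<and> (\<forall>L\<in>Wh \<eta>. (\<forall>u\<in>B. L u = 0) \<longrightarrow> (\<forall>v. L v = 0))"
proof -
  obtain v0 :: 'v where v0: "v0 \<noteq> 0" using irreducible by (auto simp: irreducible_Mp_def)
  have "\<forall>w. \<exists>B. finite B \<and> (\<forall>L\<in>Wh \<eta>. (\<forall>u\<in>B. L u = 0) \<longrightarrow> (\<forall>a. a \<noteq> 0 \<longrightarrow> L (pt a w) = 0))"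
    using torus_determined[OF \<eta>] by blast
  from choice[OF this] obtain B where B: "\<And>w. finite (B w)"
    "\<And>w L a. L \<in> Wh \<eta> \<Longrightarrow> \<forall>u\<in>B w. L u = 0 \<Longrightarrow> a \<noteq> 0 \<Longrightarrow> L (pt a w) = 0" by metis
  obtain N where N: "\<forall>h\<in>PP N. pn h v0 = v0" using fixed_unip by blast
  obtain N' where N': "\<forall>h\<in>PP N'. pn h (pw v0) = pw v0" using fixed_unip by blast
  \<comment> \<open>An argument y outside \<open>PP (1 - N')\<close> has
    \<open>vl y \<le> - N'\<close>, so -1/y lies in \<open>PP N'\<close>.\<close>
  obtain D :: "'k set" where D: "reps N (PP (1 - N')) D" using reps_exists by blast
  define BB where "BB = B v0 \<union> B (pw (pw v0)) \<union> (\<Union>d\<in>D. B (pw (pn d v0)))"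
  have "L v = 0" if L: "L \<in> Wh \<eta>" and z: "\<forall>u\<in>BB. L u = 0" for L v
  proof (rule ccontr)
    assume nz: "L v \<noteq> 0"
    have 1: "L (pt a v0) = 0" if "a \<noteq> 0" for a using B(2)[OF L _ that, of v0] z by (auto simp: BB_def)
    have 2: "L (pt a (pw (pw v0))) = 0" if "a \<noteq> 0" for a using B(2)[OF L _ that, of "pw (pw v0)"] z by (auto simp: BB_def)
    have 3: "L (pt a (pw (pn d v0))) = 0" if "a \<noteq> 0" "d \<in> D" for a d using B(2)[OF L _ that(1), of "pw (pn d v0)"] z that(2) by (auto simp: BB_def)
    have 4: "L (pt a (pw (pn y v0))) = 0" if a: "a \<noteq> 0" for a y
    proof (cases "y \<in> PP (1 - N')")
      case True
      then have "\<exists>d\<in>D. y - d \<in> PP N" using D unfolding reps_def by blast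
      then obtain d where d: "d \<in> D" "y - d \<in> PP N" ..
      then show ?thesis using 3[OF a d(1)] step_fun_like_pn[OF N d(2)] by simp
    next
      case False
      then have y: "y \<noteq> 0" "vl y \<le> - N'" by (auto simp: mem_PP)
      then have "- inverse y \<in> PP N'" by (simp add: mem_PP vl_inverse)
      then obtain e where e: "pt a (pw (pn y v0)) = smul e (pn (- ((a / y)\<^sup>2 * y)) (pt (- (a / y)) (pw (pw v0))))"
        using pt_pw_pn_large[OF a y(1)] N' by blast
      have "- (a / y) \<noteq> 0" using a y by simp
      then show ?thesis unfolding e by (simp add: Wh_scale[OF L] Wh_pn[OF L] 2 del: neg_equal_0_iff_equal)
    qed
    have "v0 = 0"
    proof (rule vanishing_subspace[of "{L}" L v v0])
      fix g :: "'k mp" and L' assume "g \<in> carrier Mp" "L' \<in> {L}"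
      then show "L' (\<pi> g v0) = 0" using bruhat[of g] 1 4 by (auto simp: Wh_scale[OF L] Wh_pn[OF L] Wh_minus[OF L])
    qed (use Wh_hom[OF L] nz in auto)
    then show False using v0 by simp
  qed
  moreover have "finite BB" using B(1) D by (auto simp: BB_def reps_def)
  ultimately show ?thesis by blast
qed

lemma Wh_lincomb: "(\<And>i. i \<in> A \<Longrightarrow> f i \<in> Wh z) \<Longrightarrow> (\<lambda>v. \<Sum>i\<in>A. c i * f i v) \<in> Wh z"
  by (rule WhI) (auto simp: Wh_add[where z = z] Wh_scale[where z = z] Wh_pn[where z = z] sum_distrib_left sum.distrib[symmetric] algebra_simps intro!: sum.cong)

text \<open>Functionals are determined by finitely many values, so sufficiently many iterates of
  \<open>L0\<close> are dependent and some nonzero polynomial in T kills \<open>L0\<close>. The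
  fundamental theorem of algebra splits it into linear factors.\<close>

lemma T_eigenvector:
  assumes \<eta>: "\<eta> \<noteq> 0" and t: "t \<noteq> 0" and L0: "L0 \<in> Wh \<eta>" "L0 u0 \<noteq> 0"
  shows "\<exists>c L u. L \<in> Wh \<eta> \<and> L u \<noteq> 0 \<and> (\<forall>v. T \<eta> t L v = c * L v)"
proof -
  let ?A = "T \<eta> t"
  define Li where "Li i = (?A ^^ i) L0" for i
  have Li: "Li i \<in> Wh \<eta>" for i unfolding Li_def by (induction i) (auto simp: L0 T_Wh[OF \<eta> t])
  obtain B where B: "finite B" "\<And>L. L \<in> Wh \<eta> \<Longrightarrow> \<forall>u\<in>B. L u = 0 \<Longrightarrow> \<forall>v. L v = 0" using finitely_determined[OF \<eta>] by blast
  define ev where "ev n p v = (\<Sum>i\<le>n. coeff p i * Li i v)" for n and p :: "complex poly" and v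
  have ev_Wh: "ev n p \<in> Wh \<eta>" for n p unfolding ev_def by (rule Wh_lincomb) (rule Li)
  have A_lin: "?A (ev n p) v = (\<Sum>i\<le>n. coeff p i * Li (Suc i) v)" for n p v
  proof -
    obtain v' where v': "\<And>L. L \<in> Wh \<eta> \<Longrightarrow> ?A L v = L v'" using T_dual_vector[OF \<eta> t, of v] by blast
    have "?A (ev n p) v = ev n p v'" by (rule v'[OF ev_Wh])
    also have "\<dots> = (\<Sum>i\<le>n. coeff p i * Li (Suc i) v)" unfolding ev_def using v'[OF Li] by (simp add: Li_def)
    finally show ?thesis .
  qed
  \<comment> \<open>Multiplying the polynomial by X - c means applying T - c; the degree bound keeps
    the truncated sum complete.\<close>
  have factor: "ev (Suc n) ([:- c, 1:] * p) v = ?A (ev n p) v - c * ev n p v" if "degree p \<le> n" for n c p v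
  proof -
    have top: "coeff p (Suc n) = 0" using that by (intro coeff_eq_0) simp
    have "ev (Suc n) ([:- c, 1:] * p) v = (\<Sum>i\<le>Suc n. coeff (pCons 0 p) i * Li i v) - c * (\<Sum>i\<le>Suc n. coeff p i * Li i v)"
      unfolding ev_def sum_distrib_left sum_subtractf[symmetric] by (intro sum.cong) (auto simp: algebra_simps)
    also have "(\<Sum>i\<le>Suc n. coeff (pCons 0 p) i * Li i v) = (\<Sum>i\<le>n. coeff p i * Li (Suc i) v)"
      unfolding sum.atMost_Suc_shift by simp
    also have "(\<Sum>i\<le>Suc n. coeff p i * Li i v) = ev n p v" by (simp add: ev_def top)
    finally show ?thesis unfolding A_lin .
  qed
  \<comment> \<open>Split off a root c: either the cofactor already kills \<open>L0\<close>, or what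
    it produces is an eigenvector for c.\<close>
  have step: "\<exists>c L u. L \<in> Wh \<eta> \<and> L u \<noteq> 0 \<and> (\<forall>v. ?A L v = c * L v)"
    if "degree p = n" "p \<noteq> 0" "\<forall>v. ev n p v = 0" for n p
    using that
  proof (induction n arbitrary: p)
    case 0
    then have "coeff p 0 \<noteq> 0" by (metis leading_coeff_0_iff)
    then show ?case using 0(3) L0(2) by (auto simp: ev_def Li_def)
  next
    case (Suc n)
    then have "\<not> constant (poly p)" by (simp add: constant_degree)
    then obtain c where "poly p c = 0" using fundamental_theorem_of_algebra by blast
    then obtain r where r: "p = [:- c, 1:] * r" by (auto simp: poly_eq_0_iff_dvd)
    have r0: "r \<noteq> 0" using r Suc.prems by auto
    have "degree ([:- c, 1:] * r) = 1 + degree r" using r0 by (subst degree_mult_eq) auto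
    then have dr: "degree r = n" using r Suc.prems by simp
    show ?case
    proof (cases "\<forall>v. ev n r v = 0")
      case True then show ?thesis using Suc.IH[OF dr r0] by blast
    next
      case False
      have "?A (ev n r) v = c * ev n r v" for v using factor[of r n c v] dr Suc.prems(3) r by simp
      then show ?thesis using False ev_Wh by blast
    qed
  qed
  obtain c where c: "\<exists>i\<in>{..card B}. c i \<noteq> 0" "\<forall>b\<in>B. (\<Sum>i\<in>{..card B}. c i * Li i b) = 0"
    using homogeneous_system[OF B(1), of "{..card B}" Li] by auto
  define p where "p = Abs_poly (\<lambda>i. if i \<le> card B then c i else 0)"
  have cp: "coeff p i = (if i \<le> card B then c i else 0)" for i
    unfolding p_def by (subst coeff_Abs_poly[of "card B"]) auto
  have p0: "p \<noteq> 0" using c(1) cp by (metis atMost_iff coeff_0)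
  have dp: "degree p \<le> card B" by (rule degree_le) (simp add: cp)
  have z: "ev (card B) p v = 0" for v
  proof -
    have "\<forall>u\<in>B. ev (card B) p u = 0" using c(2) by (simp add: ev_def cp)
    then show ?thesis using B(2)[OF ev_Wh] by blast
  qed
  have "ev (degree p) p v = ev (card B) p v" for v
    unfolding ev_def using dp by (intro sum.mono_neutral_left) (auto simp: coeff_eq_0)
  then show ?thesis using step[OF refl p0] z by simp
qed

text \<open>Commutation makes the eigenspace stable. By \<open>T_dual_vector\<close> the deviation
  from the scalar c is evaluation at one vector \<open>v' - smul c v\<close>, which the eigenspace
  kills, and then so does every functional.\<close>

lemma T_scalar:
  assumes \<eta>: "\<eta> \<noteq> 0" and t: "t \<noteq> 0" and L0: "L0 \<in> Wh \<eta>" "L0 u0 \<noteq> 0"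
  shows "\<exists>c. \<forall>L\<in>Wh \<eta>. \<forall>v. T \<eta> t L v = c * L v"
proof -
  obtain c L1 u1 where L1: "L1 \<in> Wh \<eta>" "L1 u1 \<noteq> 0" "\<And>v. T \<eta> t L1 v = c * L1 v" using T_eigenvector[OF assms] by blast
  define U where "U = {L \<in> Wh \<eta>. \<forall>v. T \<eta> t L v = c * L v}"
  have "T \<eta> t L v = c * L v" if L: "L \<in> Wh \<eta>" for L v
  proof -
    obtain v' where v': "\<And>L. L \<in> Wh \<eta> \<Longrightarrow> T \<eta> t L v = L v'" using T_dual_vector[OF \<eta> t, of v] by blast
    have "L (v' - smul c v) = 0"
    proof (rule stable_separates[where \<eta> = \<eta> and U = U and ?L0.0 = L1 and ?u0.0 = u1])
      show "\<eta> \<noteq> 0" "L1 u1 \<noteq> 0" "L \<in> Wh \<eta>" by fact+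
      show "U \<subseteq> Wh \<eta>" "L1 \<in> U" using L1 by (auto simp: U_def)
      show "T \<eta> s L \<in> U" if "s \<noteq> 0" "L \<in> U" for s L
      proof -
        have L: "L \<in> Wh \<eta>" and e: "T \<eta> t L = (\<lambda>v. c * L v)" using that by (auto simp: U_def)
        have "T \<eta> t (T \<eta> s L) v = c * T \<eta> s L v" for v
          unfolding T_commute[OF \<eta> that(1) t L] e by (rule T_comp_scalar)
        then show ?thesis using T_Wh[OF \<eta> that(1) L] by (simp add: U_def)
      qed
      show "L (v' - smul c v) = 0" if "L \<in> U" for L
      proof -
        have L: "L \<in> Wh \<eta>" using that by (simp add: U_def)
        show ?thesis using that v'[OF L] by (simp add: U_def Wh_diff[OF L] Wh_scale[OF L])
      qed
    qed
    then show ?thesis using v'[OF L] by (simp add: Wh_diff[OF L] Wh_scale[OF L])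
  qed
  then show ?thesis by blast
qed

theorem Wh_unique:
  assumes \<eta>: "\<eta> \<noteq> 0" and L1: "L1 \<in> Wh \<eta>" "L1 u1 \<noteq> 0" and L: "L \<in> Wh \<eta>"
  shows "\<exists>c. \<forall>v. L v = c * L1 v"
proof -
  define U where "U = {\<lambda>v. c * L1 v | c. True}"
  have zero: "L v = 0" if "L1 v = 0" for v
  proof (rule stable_separates[where \<eta> = \<eta> and U = U and ?L0.0 = L1 and ?u0.0 = u1])
    show "\<eta> \<noteq> 0" "L1 u1 \<noteq> 0" "L \<in> Wh \<eta>" by fact+
    show "U \<subseteq> Wh \<eta>" unfolding U_def by (auto intro!: WhI simp: Wh_add[OF L1(1)] Wh_scale[OF L1(1)] Wh_pn[OF L1(1)] algebra_simps)
    show "L1 \<in> U" unfolding U_def by (auto intro: exI[of _ 1])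
    show "L v = 0" if "L \<in> U" for L using that \<open>L1 v = 0\<close> by (auto simp: U_def)
    show "T \<eta> t L \<in> U" if t: "t \<noteq> 0" and "L \<in> U" for t L
    proof -
      obtain c where c: "L = (\<lambda>v. c * L1 v)" using \<open>L \<in> U\<close> by (auto simp: U_def)
      obtain d where "\<And>v. T \<eta> t L1 v = d * L1 v" using T_scalar[OF \<eta> t L1] L1(1) by blast
      then have "T \<eta> t L = (\<lambda>v. (c * d) * L1 v)" unfolding c by (intro ext) (simp add: T_comp_scalar)
      then show ?thesis by (auto simp: U_def)
    qed
  qed
  have "L v = (L u1 / L1 u1) * L1 v" for v
  proof -
    have "L1 (v - smul (L1 v / L1 u1) u1) = 0" using L1 by (simp add: Wh_diff[OF L1(1)] Wh_scale[OF L1(1)])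
    from zero[OF this] show ?thesis by (simp add: Wh_diff[OF L] Wh_scale[OF L])
  qed
  then show ?thesis by blast
qed

end

section \<open>Multiplicative local constancy and shell integrals\<close>

text \<open>There are no small subgroups: on 1 + P^N the values stay within 1/2 of 1, but if one
  differed from 1, repeated squaring would enlarge the distance by a factor of at least 3/2 each
  time.\<close>

lemma mult_character_near_1:
  assumes "mult_character (\<mu> :: 'k::nonarch_local_field \<Rightarrow> complex)"
  shows "\<exists>N\<ge>1. \<forall>b. b - 1 \<in> PP N \<longrightarrow> \<mu> b = 1"
proof -
  have cont: "continuous_on (- {0}) \<mu>" and nz: "\<And>x. x \<noteq> 0 \<Longrightarrow> \<mu> x \<noteq> 0" and mult: "\<And>x y. x \<noteq> 0 \<Longrightarrow> y \<noteq> 0 \<Longrightarrow> \<mu> (x * y) = \<mu> x * \<mu> y"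
    using assms by (auto simp: mult_character_def)
  have mu1: "\<mu> 1 = 1" using mult[of 1 1] nz[of 1] by simp
  obtain d where d: "d > 0" "\<And>x. x \<noteq> 0 \<Longrightarrow> dist x 1 < d \<Longrightarrow> dist (\<mu> x) 1 < 1 / 2"
    using cont[unfolded continuous_on_iff, rule_format, of 1 "1/2"] mu1 by auto
  have "open (ball (1::'k) d)" "1 \<in> ball (1::'k) d" using d by auto
  then obtain n where n: "\<forall>y. y - 1 \<in> PP n \<longrightarrow> y \<in> ball (1::'k) d" unfolding open_iff_coset by blast
  define N where "N = max n 1"
  have small: "norm (\<mu> b - 1) < 1 / 2" if "b - 1 \<in> PP N" for b
  proof -
    have b: "b - 1 \<in> PP n" "b \<noteq> 0" using that unit_near_1[of b 1] by (auto simp: N_def PP_max_iff)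
    then have "dist b 1 < d" using n by (auto simp: dist_commute)
    then show ?thesis using d(2) b by (simp add: dist_norm)
  qed
  have "\<mu> b = 1" if b: "b - 1 \<in> PP N" for b
  proof (rule ccontr)
    assume ne: "\<mu> b \<noteq> 1"
    have sq: "c\<^sup>2 - 1 \<in> PP N" if c: "c - 1 \<in> PP N" for c :: 'k
    proof -
      have "c \<in> PP 0" using unit_near_1[of c N] c by (auto simp: N_def mem_PP)
      then have "c * (c - 1) + (c - 1) \<in> PP N" using PP_mult[OF _ c, of c 0] c by (intro PP_add) auto
      then show ?thesis by (simp add: power2_eq_square algebra_simps)
    qed
    have grow: "b ^ (2 ^ k) - 1 \<in> PP N \<and> norm (\<mu> (b ^ (2 ^ k)) - 1) \<ge> (3 / 2) ^ k * norm (\<mu> b - 1)" for k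
    proof (induction k)
      case (Suc k)
      let ?c = "b ^ (2 ^ k)"
      have c: "?c - 1 \<in> PP N" using Suc by simp
      have c0: "?c \<noteq> 0" using unit_near_1[OF c] by (simp add: N_def)
      have e: "b ^ (2 ^ Suc k) = ?c\<^sup>2" by (simp add: power_mult[symmetric] mult.commute)
      have "\<mu> (?c\<^sup>2) - 1 = (\<mu> ?c - 1) * (\<mu> ?c + 1)" using mult[OF c0 c0] by (simp add: power2_eq_square algebra_simps)
      then have "norm (\<mu> (?c\<^sup>2) - 1) = norm (\<mu> ?c - 1) * norm (\<mu> ?c + 1)" by (simp add: norm_mult)
      moreover have h: "3 / 2 \<le> norm (\<mu> ?c + 1)"
        using norm_triangle_ineq4[of "\<mu> ?c + 1" "\<mu> ?c - 1"] small[OF c] by simp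
      ultimately have "norm (\<mu> (?c\<^sup>2) - 1) \<ge> norm (\<mu> ?c - 1) * (3 / 2)"
        using mult_left_mono[OF h norm_ge_zero[of "\<mu> ?c - 1"]] by simp
      moreover have "(3 / 2) ^ Suc k * norm (\<mu> b - 1) = 3 / 2 * ((3 / 2) ^ k * norm (\<mu> b - 1))" by simp
      ultimately have "(3 / 2) ^ Suc k * norm (\<mu> b - 1) \<le> norm (\<mu> (?c\<^sup>2) - 1)" using Suc by linarith
      then show ?case unfolding e using sq[OF c] by blast
    qed (use b in simp)
    obtain k where k: "1 / norm (\<mu> b - 1) < (3 / 2) ^ k" using real_arch_pow[of "3/2"] by auto
    have pos: "norm (\<mu> b - 1) > 0" using ne by simp
    then have "1 < (3 / 2) ^ k * norm (\<mu> b - 1)" using k by (simp add: divide_less_eq)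
    moreover have "norm (\<mu> (b ^ (2 ^ k)) - 1) < 1 / 2" using grow[of k] small by blast
    ultimately show False using grow[of k] by linarith
  qed
  then show ?thesis by (intro exI[of _ N]) (auto simp: N_def)
qed

text \<open>On each shell the function is invariant under one congruence subgroup of units.\<close>

definition locmult :: "('k::nonarch_local_field \<Rightarrow> 'b) \<Rightarrow> bool" where
  "locmult f \<longleftrightarrow> (\<forall>i. \<exists>N\<ge>1. \<forall>z\<in>shell i. \<forall>c. c - 1 \<in> PP N \<longrightarrow> f (z * c) = f z)"

lemma locmult_comp2: assumes "locmult f" "locmult g" shows "locmult (\<lambda>x. G (f x) (g x))"
  unfolding locmult_def
proof
  fix i
  obtain N where "N \<ge> 1" "\<forall>z\<in>shell i. \<forall>c. c - 1 \<in> PP N \<longrightarrow> f (z * c) = f z"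
    using assms(1) unfolding locmult_def by blast
  moreover obtain M where "\<forall>z\<in>shell i. \<forall>c. c - 1 \<in> PP M \<longrightarrow> g (z * c) = g z"
    using assms(2) unfolding locmult_def by blast
  ultimately show "\<exists>N\<ge>1. \<forall>z\<in>shell i. \<forall>c. c - 1 \<in> PP N \<longrightarrow> G (f (z * c)) (g (z * c)) = G (f z) (g z)"
    by (intro exI[of _ "max N M"]) (auto simp: PP_max_iff)
qed

lemmas locmult_mult = locmult_comp2[where G = "\<lambda>a b. a * b"]

lemma locmult_comp: "locmult f \<Longrightarrow> locmult (\<lambda>x. G (f x))" using locmult_comp2[of f f "\<lambda>a b. G a"] by simp

lemma locmult_loc_const: assumes "locmult f" "x \<noteq> 0" shows "loc_const f (x::'k::nonarch_local_field)"
proof -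
  obtain N where N: "N \<ge> 1" "\<And>z c. z \<in> shell (vl x) \<Longrightarrow> c - 1 \<in> PP N \<Longrightarrow> f (z * c) = f z" using assms unfolding locmult_def by meson
  have "f (x + h) = f x" if h: "h \<in> PP (vl x + N)" for h
  proof -
    have "h / x \<in> PP N" using PP_divide[OF assms(2) h] by simp
    then have "f (x * (1 + h / x)) = f x" using assms(2) by (intro N) (auto simp: shell_def)
    then show ?thesis using assms(2) by (simp add: ring_distribs)
  qed
  then show ?thesis unfolding loc_const_def by blast
qed

lemma locmult_nabs: "locmult (nabs :: 'k::nonarch_local_field \<Rightarrow> real)"
  unfolding locmult_def
proof
  fix i
  have "nabs (z * c) = nabs z" if "c - 1 \<in> PP 1" for z c :: 'k
    using unit_near_1[OF that] nabs_vl[of c] by (simp add: nabs_mult)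
  then show "\<exists>N\<ge>1. \<forall>z\<in>shell i. \<forall>c. c - 1 \<in> PP N \<longrightarrow> nabs (z * c) = nabs (z :: 'k)" by (intro exI[of _ 1]) auto
qed

context haar_setup begin

definition shell_int :: "int \<Rightarrow> ('k \<Rightarrow> complex) \<Rightarrow> complex" where "shell_int i f = I (\<lambda>x. if x \<in> shell i then f x else 0)"

lemma shell_int_cong: "(\<And>x. x \<in> shell i \<Longrightarrow> f x = g x) \<Longrightarrow> shell_int i f = shell_int i g"
  unfolding shell_int_def by (intro arg_cong[where f = I] ext) simp

lemma shell_int_cmult: "shell_int i (\<lambda>x. c * f x) = c * shell_int i f"
proof -
  have "(\<lambda>x. if x \<in> shell i then c * f x else 0) = (\<lambda>x. c * (if x \<in> shell i then f x else 0))" by auto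
  then show ?thesis unfolding shell_int_def by (simp only: integral_mult_right_zero)
qed

lemma shell_int_0: "(\<And>x. x \<in> shell i \<Longrightarrow> f x = 0) \<Longrightarrow> shell_int i f = 0"
  using shell_int_cong[of i f "\<lambda>_. 0"] by (simp add: shell_int_def)

lemma step_fun_shell_int: "locmult f \<Longrightarrow> \<exists>n. step_fun i n (\<lambda>x. if x \<in> shell i then f x else 0)"
  using step_fun_shell[of f i] locmult_loc_const by blast

lemma sum_shells: "(\<Sum>j\<in>{C..<e}. if x \<in> shell j then f x else (0::complex)) = (if x \<noteq> 0 \<and> C \<le> vl x \<and> vl x < e then f x else 0)"
proof -
  have "(\<Sum>j\<in>{C..<e}. if x \<in> shell j then f x else 0) = (\<Sum>j\<in>{C..<e}. if j = vl x then (if x \<noteq> 0 then f x else 0) else 0)"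
    by (intro sum.cong) (auto simp: shell_def)
  then show ?thesis by simp
qed

lemma step_fun_annulus:
  assumes f: "locmult (f :: 'k \<Rightarrow> complex)"
  shows "\<exists>m n. step_fun m n (\<lambda>x. if x \<noteq> 0 \<and> C \<le> vl x \<and> vl x < e then f x else 0)"
proof -
  have "\<exists>n\<ge>C. step_fun C n (\<lambda>x. if x \<noteq> 0 \<and> C \<le> vl x \<and> vl x < e then f x else 0)"
  proof (rule step_fun_ex)
    show "(if x \<noteq> 0 \<and> C \<le> vl x \<and> vl x < e then f x else 0) = 0" if "x \<notin> PP C" for x using that by (auto simp: mem_PP)
    show "loc_const (\<lambda>x. if x \<noteq> 0 \<and> C \<le> vl x \<and> vl x < e then f x else 0) x" for x
    proof (rule loc_const_if_near0[where n = e and c = 0])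
      fix x :: 'k assume x: "x \<noteq> 0"
      have "loc_const (\<lambda>x. x \<noteq> 0 \<and> C \<le> vl x \<and> vl x < e) x"
        by (rule loc_const_comp2[where G = "\<lambda>a b. \<not> a \<and> C \<le> b \<and> b < e", OF loc_const_nz[OF x] loc_const_vl[OF x]])
      then show "loc_const (\<lambda>x. if x \<noteq> 0 \<and> C \<le> vl x \<and> vl x < e then f x else 0) x" using locmult_loc_const[OF f x]
        by (rule loc_const_comp2[where G = "\<lambda>b y. if b then y else 0"])
    qed (auto simp: mem_PP)
  qed
  then show ?thesis by blast
qed

lemma I_annulus:
  assumes f: "locmult f"
  shows "I (\<lambda>x. if x \<noteq> 0 \<and> C \<le> vl x \<and> vl x < e then f x else 0) = (\<Sum>j\<in>{C..<e}. shell_int j f)"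
proof -
  have "I (\<lambda>x. if x \<noteq> 0 \<and> C \<le> vl x \<and> vl x < e then f x else 0) = I (\<lambda>x. \<Sum>j\<in>{C..<e}. if x \<in> shell j then f x else 0)"
    unfolding sum_shells ..
  also have "\<dots> = (\<Sum>j\<in>{C..<e}. shell_int j f)" unfolding shell_int_def by (rule I_sum) (use step_fun_shell_int[OF f] in blast)
  finally show ?thesis .
qed

lemma integral_mult_measure:
  assumes f: "step_fun m n f"
  shows "integral\<^sup>L (mult_measure dx) f = I (\<lambda>x. of_real (1 / nabs x) * f x)"
proof -
  have "(\<lambda>x::'k. dist x 0) \<in> borel_measurable borel" by (intro borel_measurable_continuous_onI continuous_intros)
  then have "(nabs :: 'k \<Rightarrow> real) \<in> borel_measurable borel" by (simp add: dist_nabs)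
  then have "(\<lambda>x::'k. 1 / nabs x) \<in> borel_measurable borel" by (intro borel_measurable_divide) auto
  then have "(\<lambda>x. 1 / nabs x) \<in> borel_measurable dx"
    by (simp only: measurable_cong_sets[OF sets_dx refl])
  moreover have "f \<in> borel_measurable dx" using integrable_step_fun[OF f] by (rule borel_measurable_integrable)
  ultimately have "integral\<^sup>L (density dx (\<lambda>x. ennreal (1 / nabs x))) f = I (\<lambda>x. (1 / nabs x) *\<^sub>R f x)"
    by (intro integral_density) auto
  then show ?thesis by (simp add: mult_measure_def scaleR_conv_of_real)
qed

text \<open>The set A has to agree with the annulus only where f is nonzero. This covers both the
  truncations in the gamma factor and the complement of 0 in the zeta integrals.\<close>

lemma I_mult_annulus:
  assumes f: "locmult f" and A: "\<And>x. x \<in> A \<and> f x \<noteq> 0 \<longleftrightarrow> x \<noteq> 0 \<and> C \<le> vl x \<and> vl x < e \<and> f x \<noteq> 0"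
  shows "(LINT x:A|mult_measure dx. f x) = (\<Sum>j\<in>{C..<e}. shell_int j (\<lambda>x. of_real (1 / nabs x) * f x))"
proof -
  let ?f = "\<lambda>x. if x \<noteq> 0 \<and> C \<le> vl x \<and> vl x < e then f x else 0"
  have "indicator A x *\<^sub>R f x = ?f x" for x using A[of x] by (auto simp: indicator_def)
  then have "(LINT x:A|mult_measure dx. f x) = integral\<^sup>L (mult_measure dx) ?f" by (simp add: set_lebesgue_integral_def)
  also have "\<dots> = I (\<lambda>x. of_real (1 / nabs x) * ?f x)"
  proof -
    obtain m n where "step_fun m n ?f" using step_fun_annulus[OF f] by blast
    then show ?thesis by (rule integral_mult_measure)
  qed
  also have "\<dots> = I (\<lambda>x. if x \<noteq> 0 \<and> C \<le> vl x \<and> vl x < e then of_real (1 / nabs x) * f x else 0)"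
    by (intro arg_cong[where f = I] ext) simp
  also have "\<dots> = (\<Sum>j\<in>{C..<e}. shell_int j (\<lambda>x. of_real (1 / nabs x) * f x))"
    by (rule I_annulus) (rule locmult_comp2[OF locmult_nabs f, where G = "\<lambda>a b. of_real (1 / a) * b"])
  finally show ?thesis .
qed

end

text \<open>The parity of the valuation and the leading residue determine the square class, since
  units congruent modulo the maximal ideal differ by a square.\<close>

lemma (in odd_haar) finite_square_class_representatives:
  assumes R: "square_class_representatives R X" and X: "0 \<notin> X"
  shows "finite (R :: 'k set)"
proof -
  obtain D :: "'k set" where D: "reps 1 (PP 0) D" using reps_exists by blast
  define u where "u \<eta> = \<eta> / unif powi (vl \<eta>)" for \<eta> :: 'k
  define f where "f \<eta> = (even (vl \<eta>), SOME d. d \<in> D \<and> u \<eta> - d \<in> PP 1)" for \<eta> :: 'k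
  have nz: "\<eta> \<noteq> 0" if "\<eta> \<in> R" for \<eta> using that R X by (auto simp: square_class_representatives_def)
  have u: "u \<eta> \<noteq> 0" "vl (u \<eta>) = 0" if "\<eta> \<noteq> 0" for \<eta> using that by (auto simp: u_def vl_divide)
  have fd: "snd (f \<eta>) \<in> D \<and> u \<eta> - snd (f \<eta>) \<in> PP 1" if "\<eta> \<noteq> 0" for \<eta>
  proof -
    have "u \<eta> \<in> PP 0" using u[OF that] by (simp add: mem_PP)
    then have "\<exists>d. d \<in> D \<and> u \<eta> - d \<in> PP 1" using D unfolding reps_def by blast
    then show ?thesis unfolding f_def snd_conv by (rule someI_ex)
  qed
  have "inj_on f R"
  proof
    fix \<eta> \<eta>' assume \<eta>: "\<eta> \<in> R" "\<eta>' \<in> R" and f: "f \<eta> = f \<eta>'"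
    note n = nz[OF \<eta>(1)] nz[OF \<eta>(2)]
    have "u \<eta> - u \<eta>' \<in> PP 1" using fd[OF n(1)] fd[OF n(2)] f PP_trans PP_diff_commute by metis
    then obtain b where b: "b - 1 \<in> PP 1" "u \<eta> = u \<eta>' * b\<^sup>2"
      using square_near[OF odd_q u(1)[OF n(2)], of "u \<eta>" 1] u(2)[OF n(2)] by auto
    have b0: "b \<noteq> 0" using unit_near_1[OF b(1)] by simp
    have "even (vl \<eta> - vl \<eta>')" using f by (auto simp: f_def)
    then obtain j where j: "vl \<eta> = vl \<eta>' + (j + j)" by (metis add.commute diff_add_cancel evenE mult_2)
    have "\<eta> = u \<eta> * unif powi (vl \<eta>)" by (simp add: u_def)
    also have "unif powi (vl \<eta>) = unif powi (vl \<eta>') * (unif powi j * unif powi j :: 'k)"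
      unfolding j by (subst power_int_add, simp)+ (rule refl)
    also have "u \<eta> * (unif powi (vl \<eta>') * (unif powi j * unif powi j)) = (u \<eta>' * unif powi (vl \<eta>')) * (b * unif powi j)\<^sup>2"
      unfolding b(2) by (simp only: power2_eq_square mult_ac)
    also have "u \<eta>' * unif powi (vl \<eta>') = \<eta>'" by (simp add: u_def)
    finally have e: "\<eta> = \<eta>' * (b * unif powi j)\<^sup>2" .
    have "\<exists>!\<zeta>. \<zeta> \<in> R \<and> (\<exists>a. a \<noteq> 0 \<and> \<eta> = \<zeta> * a\<^sup>2)" using R \<eta>(1) unfolding square_class_representatives_def by blast
    moreover have "\<eta> \<in> R \<and> (\<exists>a. a \<noteq> 0 \<and> \<eta> = \<eta> * a\<^sup>2)" using \<eta> by (intro conjI exI[of _ 1]) auto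
    moreover have "\<eta>' \<in> R \<and> (\<exists>a. a \<noteq> 0 \<and> \<eta> = \<eta>' * a\<^sup>2)" using \<eta> e b0 by (intro conjI exI[of _ "b * unif powi j"]) auto
    ultimately show "\<eta> = \<eta>'" by blast
  qed
  moreover have "f ` R \<subseteq> UNIV \<times> D" using fd nz by (auto simp: f_def)
  then have "finite (f ` R)" by (rule finite_subset) (use D in \<open>simp add: reps_def\<close>)
  ultimately show ?thesis using finite_imageD by blast
qed

subsection \<open>The functional equation\<close>

locale mp_functional_equation = mp_rep dx \<psi> smul \<pi>
  for dx :: "'k::nonarch_local_field measure" and \<psi> and smul :: "complex \<Rightarrow> 'v::ab_group_add \<Rightarrow> 'v" and \<pi> :: "'k mp \<Rightarrow> 'v \<Rightarrow> 'v" +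
  fixes l :: "'k \<Rightarrow> 'v \<Rightarrow> complex" and R :: "'k set" and \<mu> :: "'k \<Rightarrow> complex" and \<xi> :: 'k and s :: complex
  assumes functionals: "\<forall>\<eta>\<in>whittaker_support \<psi> smul \<pi>. whittaker_functional \<psi> smul \<pi> \<eta> (l \<eta>) \<and> (\<exists>u. l \<eta> u \<noteq> 0)"
    and representatives: "square_class_representatives R (whittaker_support \<psi> smul \<pi>)"
    and mu_char: "mult_character \<mu>"
    and xi: "\<xi> \<in> whittaker_support \<psi> smul \<pi>"
begin

abbreviation "KS \<equiv> whittaker_support \<psi> smul \<pi>"

lemma KS_iff: "\<eta> \<in> KS \<longleftrightarrow> \<eta> \<noteq> 0 \<and> (\<exists>L\<in>Wh \<eta>. \<exists>v. L v \<noteq> 0)"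
  by (auto simp: whittaker_support_def Wh_def)

lemma l_Wh: "\<eta> \<in> KS \<Longrightarrow> l \<eta> \<in> Wh \<eta>" and l_nz: "\<eta> \<in> KS \<Longrightarrow> \<exists>u. l \<eta> u \<noteq> 0" and KS_nz: "\<eta> \<in> KS \<Longrightarrow> \<eta> \<noteq> 0"
  using functionals by (auto simp: Wh_def KS_iff)

lemma R_KS: "\<eta> \<in> R \<Longrightarrow> \<eta> \<in> KS"
  using representatives by (auto simp: square_class_representatives_def)

lemma R_unique: "\<eta> \<in> R \<Longrightarrow> \<eta>' \<in> R \<Longrightarrow> \<eta> * a\<^sup>2 = \<eta>' * b\<^sup>2 \<Longrightarrow> a \<noteq> 0 \<Longrightarrow> b \<noteq> 0 \<Longrightarrow> \<eta> = \<eta>'"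
proof -
  assume \<eta>: "\<eta> \<in> R" "\<eta>' \<in> R" and e: "\<eta> * a\<^sup>2 = \<eta>' * b\<^sup>2" "a \<noteq> 0" "b \<noteq> 0"
  then have e': "\<eta> = \<eta>' * (b / a)\<^sup>2" by (simp add: field_simps)
  have "\<exists>!\<zeta>. \<zeta> \<in> R \<and> (\<exists>a. a \<noteq> 0 \<and> \<eta> = \<zeta> * a\<^sup>2)" using representatives R_KS[OF \<eta>(1)] unfolding square_class_representatives_def by blast
  moreover have "\<eta> \<in> R \<and> (\<exists>a. a \<noteq> 0 \<and> \<eta> = \<eta> * a\<^sup>2)" using \<eta> by (intro conjI exI[of _ 1]) auto
  moreover have "\<eta>' \<in> R \<and> (\<exists>a. a \<noteq> 0 \<and> \<eta> = \<eta>' * a\<^sup>2)" using \<eta> e' e by (intro conjI exI[of _ "b / a"]) auto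
  ultimately show "\<eta> = \<eta>'" by blast
qed

lemma R_finite: "finite R"
  by (rule finite_square_class_representatives[OF representatives]) (auto simp: KS_iff)

definition J :: "'k \<Rightarrow> 'k \<Rightarrow> complex" where "J \<eta> x = bessel \<psi> dx \<pi> l \<xi> \<eta> x"

text \<open>The transform is a functional at \<eta>, hence a multiple of \<open>l \<eta>\<close>.
  The truncated integrals become constant once they contain the support, so the limit exists, and a
  vector with \<open>l \<eta> u \<noteq> 0\<close> pins the constant down.\<close>

lemma T_bessel:
  assumes \<eta>: "\<eta> \<in> KS" and x: "x \<noteq> 0" shows "T \<eta> x (l \<xi>) v = J \<eta> x * l \<eta> v"
proof -
  obtain u where u: "l \<eta> u \<noteq> 0" using l_nz[OF \<eta>] by blast
  note xi_nz = KS_nz[OF xi]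
  obtain c where c: "\<And>v. T \<eta> x (l \<xi>) v = c * l \<eta> v"
    using Wh_unique[OF KS_nz[OF \<eta>] l_Wh[OF \<eta>] u T_Wh[OF xi_nz x l_Wh[OF xi], of \<eta>]] by blast
  let ?S = "\<lambda>v n. LINT y:frac_ideal (- int n)|dx. whittaker_function \<pi> (l \<xi>) v (torus x \<otimes>\<^bsub>Mp\<^esub> weyl \<otimes>\<^bsub>Mp\<^esub> unip y) * \<psi> (- (\<eta> * y))"
  have one: "whittaker_function \<pi> (l \<eta>) v \<one>\<^bsub>Mp\<^esub> = l \<eta> v" for v
    using rep by (simp add: whittaker_function_def representation_Mp_def)
  have lim: "?S v \<longlonglongrightarrow> c * l \<eta> v" for v
  proof -
    obtain m n where mn: "step_fun m n (bigcell (l \<xi>) x v)" using bigcell_step_fun1[OF xi_nz x] l_Wh[OF xi] by blast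
    have "?S v k = c * l \<eta> v" if k: "k \<ge> nat (- m)" for k
    proof -
      have "indicator (PP (- int k)) y *\<^sub>R (whittaker_function \<pi> (l \<xi>) v (torus x \<otimes>\<^bsub>Mp\<^esub> weyl \<otimes>\<^bsub>Mp\<^esub> unip y) * \<psi> (- (\<eta> * y)))
        = bigcell (l \<xi>) x v y * \<psi> (- (\<eta> * y))" for y
      proof (cases "y \<in> PP m")
        case True
        then have "y \<in> PP (- int k)" by (rule PP_monoD) (use k in linarith)
        then show ?thesis using bessel_argument[OF x] by (simp add: whittaker_function_def bigcell_def)
      next
        case False
        then show ?thesis using bessel_argument[OF x] step_fun_supp[OF mn False] by (simp add: whittaker_function_def bigcell_def)
      qed
      then have "?S v k = T \<eta> x (l \<xi>) v" by (simp add: set_lebesgue_integral_def T_def FT_def)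
      then show ?thesis using c by simp
    qed
    then have "eventually (\<lambda>k. ?S v k = c * l \<eta> v) sequentially" unfolding eventually_sequentially by blast
    then show ?thesis by (rule tendsto_eventually)
  qed
  have "J \<eta> x = c" unfolding J_def bessel_def one
  proof (rule the_equality)
    show "\<forall>v. ?S v \<longlonglongrightarrow> c * l \<eta> v" using lim by blast
    fix c' assume "\<forall>v. ?S v \<longlonglongrightarrow> c' * l \<eta> v"
    then have "?S u \<longlonglongrightarrow> c' * l \<eta> u" by blast
    from LIMSEQ_unique[OF this lim] show "c' = c" using u by simp
  qed
  then show ?thesis using c by simp
qed

definition \<Omega> :: "'k \<Rightarrow> complex" where "\<Omega> x = \<mu> x * of_real (nabs x) powr (s - 1 / 2)"

lemma Omega_mult: "x \<noteq> 0 \<Longrightarrow> y \<noteq> 0 \<Longrightarrow> \<Omega> (x * y) = \<Omega> x * \<Omega> y"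
  using mu_char by (simp add: \<Omega>_def mult_character_def nabs_mult powr_times_real)

lemma Omega_nz: "x \<noteq> 0 \<Longrightarrow> \<Omega> x \<noteq> 0"
  using mu_char by (simp add: \<Omega>_def mult_character_def)

text \<open>Because (1 - s) - 1/2 = -(s - 1/2), passing to 1 - s and the inverse character is
  inversion of \<Omega>.\<close>

lemma Omega_inverse: "x \<noteq> 0 \<Longrightarrow> inverse (\<mu> x) * of_real (nabs x) powr (1 - s - 1 / 2) = inverse (\<Omega> x)"
proof -
  assume "x \<noteq> 0"
  have "1 - s - 1 / 2 = - (s - 1 / 2)" by (simp add: field_simps)
  then have "of_real (nabs x) powr (1 - s - 1 / 2) = inverse (complex_of_real (nabs x) powr (s - 1 / 2))"
    by (simp only: powr_minus)
  then show ?thesis by (simp only: \<Omega>_def inverse_mult_distrib)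
qed

lemma locmult_chi: "locmult chi"
  unfolding locmult_def
proof
  fix i
  have "chi (z * c) = chi z" if "z \<in> shell i" "c - 1 \<in> PP 1" for z c
  proof -
    have "issq c" by (rule issq_near_1[OF that(2)])
    then obtain d where "d \<noteq> 0" "c = d\<^sup>2" by (auto simp: issq_def)
    then show ?thesis using chi_mult_square[of z d] that by (simp add: shell_def)
  qed
  then show "\<exists>N\<ge>1. \<forall>z\<in>shell i. \<forall>c. c - 1 \<in> PP N \<longrightarrow> chi (z * c) = chi z" by blast
qed

lemma locmult_Omega: "locmult \<Omega>"
  unfolding locmult_def
proof
  fix i
  obtain N where N: "N \<ge> 1" "\<forall>b. b - 1 \<in> PP N \<longrightarrow> \<mu> b = 1" using mult_character_near_1[OF mu_char] by blast
  have "\<Omega> (z * c) = \<Omega> z" if "z \<in> shell i" "c - 1 \<in> PP N" for z c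
  proof -
    have c: "c \<noteq> 0" "nabs c = 1" using unit_near_1[OF that(2) N(1)] nabs_vl[of c] by auto
    then have "\<Omega> c = 1" using N(2) that(2) by (simp add: \<Omega>_def)
    then show ?thesis using Omega_mult[of z c] that c by (simp add: shell_def)
  qed
  then show "\<exists>N\<ge>1. \<forall>z\<in>shell i. \<forall>c. c - 1 \<in> PP N \<longrightarrow> \<Omega> (z * c) = \<Omega> z" using N(1) by blast
qed

lemma locmult_J: assumes \<eta>: "\<eta> \<in> KS" shows "locmult (J \<eta>)"
  unfolding locmult_def
proof
  fix i
  obtain u where u: "l \<eta> u \<noteq> 0" using l_nz[OF \<eta>] by blast
  obtain N where N: "N \<ge> 1" "\<And>t b. t \<noteq> 0 \<Longrightarrow> i \<le> vl t \<Longrightarrow> b - 1 \<in> PP N \<Longrightarrow> T \<eta> (t * b) (l \<xi>) u = T \<eta> t (l \<xi>) u"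
    using T_inv[OF KS_nz[OF xi], of i \<eta> u] l_Wh[OF xi] by blast
  have "J \<eta> (z * c) = J \<eta> z" if z: "z \<in> shell i" and c: "c - 1 \<in> PP N" for z c
  proof -
    have z0: "z \<noteq> 0" "vl z = i" using z by (auto simp: shell_def)
    have "c \<noteq> 0" using unit_near_1[OF c N(1)] by simp
    then have "J \<eta> (z * c) * l \<eta> u = J \<eta> z * l \<eta> u"
      using N(2)[OF z0(1) _ c] z0 T_bessel[OF \<eta>, of z u] T_bessel[OF \<eta>, of "z * c" u] by simp
    then show ?thesis using u by simp
  qed
  then show "\<exists>N\<ge>1. \<forall>z\<in>shell i. \<forall>c. c - 1 \<in> PP N \<longrightarrow> J \<eta> (z * c) = J \<eta> z" using N(1) by blast
qed

lemma locmult_pt: "locmult (\<lambda>a. L (pt a v))"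
  unfolding locmult_def
proof
  fix i
  obtain N where N: "N \<ge> 1" "\<forall>b. b - 1 \<in> PP N \<longrightarrow> pt b v = v" using smooth by blast
  have "pt (z * c) v = pt z v" if "z \<in> shell i" "c - 1 \<in> PP N" for z c
    by (rule Wh_pt_near[OF N(2,1)]) (use that in \<open>auto simp: shell_def\<close>)
  then show "\<exists>N\<ge>1. \<forall>z\<in>shell i. \<forall>c. c - 1 \<in> PP N \<longrightarrow> L (pt (z * c) v) = L (pt z v)" using N(1) by auto
qed

text \<open>The integrands of the gamma factor and of the two zeta integrals, as densities with respect to \<open>dx\<close>.\<close>

definition gamma_dens :: "'k \<Rightarrow> 'k \<Rightarrow> complex" where "gamma_dens \<eta> x = of_real (1 / nabs x) * (J \<eta> x * chi x * \<Omega> x)"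
definition zeta_dens :: "('v \<Rightarrow> complex) \<Rightarrow> 'v \<Rightarrow> 'k \<Rightarrow> complex" where "zeta_dens L v a = of_real (1 / nabs a) * (L (pt a v) * chi a * inverse (\<Omega> a))"
definition xi_dens :: "'v \<Rightarrow> 'k \<Rightarrow> complex" where "xi_dens v x = of_real (1 / nabs x) * (l \<xi> (pt x v) * chi x * \<Omega> x)"

lemmas locmult_inv_nabs = locmult_comp[OF locmult_nabs, where G = "\<lambda>a. complex_of_real (1 / a)"]

lemma locmult_gamma_dens: "\<eta> \<in> KS \<Longrightarrow> locmult (gamma_dens \<eta>)"
  unfolding gamma_dens_def[abs_def] by (intro locmult_mult locmult_inv_nabs locmult_J locmult_chi locmult_Omega)

lemma locmult_zeta_dens: "locmult (zeta_dens L v)"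
  unfolding zeta_dens_def[abs_def] by (intro locmult_mult locmult_inv_nabs locmult_pt locmult_chi locmult_comp[OF locmult_Omega])

section \<open>Decomposition over square classes and convolution on shells\<close>

lemma torus_range: "\<exists>M::int. M \<ge> 0 \<and> (\<forall>\<eta>\<in>insert \<xi> R. \<forall>a. \<forall>L\<in>Wh (\<eta> * a\<^sup>2). a \<noteq> 0 \<longrightarrow> L v \<noteq> 0 \<longrightarrow> \<bar>vl a\<bar> \<le> M)"
proof -
  obtain m k where mk: "\<And>z L. L \<in> Wh z \<Longrightarrow> L v \<noteq> 0 \<Longrightarrow> m \<le> vl z \<and> vl z < k" using Wh_bounds by metis
  define M0 where "M0 = Max ((\<lambda>\<eta>. \<bar>vl \<eta>\<bar>) ` insert \<xi> R)"
  have M0: "\<bar>vl \<eta>\<bar> \<le> M0" if "\<eta> \<in> insert \<xi> R" for \<eta> unfolding M0_def using that R_finite by (intro Max_ge) auto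
  define M where "M = \<bar>m\<bar> + \<bar>k\<bar> + M0"
  have "\<bar>vl a\<bar> \<le> M" if \<eta>: "\<eta> \<in> insert \<xi> R" and a: "a \<noteq> 0" and L: "L \<in> Wh (\<eta> * a\<^sup>2)" "L v \<noteq> 0" for \<eta> a L
  proof -
    have "\<eta> \<noteq> 0" using \<eta> KS_nz R_KS xi by auto
    then have "m \<le> vl \<eta> + 2 * vl a \<and> vl \<eta> + 2 * vl a < k" using mk[OF L] a by (simp add: vl_mult vl_power)
    then show ?thesis using M0[OF \<eta>] unfolding M_def by linarith
  qed
  moreover have "M \<ge> 0" using M0[of \<xi>] unfolding M_def by simp
  ultimately show ?thesis by blast
qed

text \<open>Fourier inversion at 0, cut along the sets \<open>sqshell \<eta> i\<close>. The factor
  \<bar>a\<bar>^(-2) of \<open>T_scale\<close> and the Jacobian \<bar>a\<bar> of the squaring map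
  combine to 1/\<bar>a\<bar>.\<close>

lemma shell_formula:
  assumes x: "x \<noteq> 0"
    and M: "\<And>\<eta> a L. \<eta> \<in> R \<Longrightarrow> a \<noteq> 0 \<Longrightarrow> L \<in> Wh (\<eta> * a\<^sup>2) \<Longrightarrow> L v \<noteq> 0 \<Longrightarrow> \<bar>vl a\<bar> \<le> M"
  shows "l \<xi> (pt x (pw v)) = (\<Sum>\<eta>\<in>R. \<Sum>i\<in>{-M..M}. of_real (nabs \<eta> / 2) *
    shell_int i (\<lambda>a. of_real (1 / nabs a) * (hs (x * a) a * J \<eta> (x * a) * l \<eta> (pt a v))))"
proof -
  note x0 = KS_nz[OF xi] and lx = l_Wh[OF xi]
  define f where "f \<zeta> = T \<zeta> x (l \<xi>) v" for \<zeta>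
  obtain m n where mn: "step_fun m n (bigcell (l \<xi>) x v)" using bigcell_step_fun1[OF x0 x] lx by blast
  have fW: "T \<zeta> x (l \<xi>) \<in> Wh \<zeta>" for \<zeta> by (rule T_Wh[OF x0 x lx])
  have lf: "loc_const f \<zeta>" for \<zeta> unfolding f_def T_def by (rule step_fun_loc_const[OF step_fun_FT[OF mn]])
  \<comment> \<open>A nonzero value makes \<zeta> a character of a nonzero functional, so it belongs
    to exactly one class \<eta> and one shell, and v limits that shell to [-M, M].\<close>
  have pw: "f \<zeta> = (\<Sum>\<eta>\<in>R. \<Sum>i\<in>{-M..M}. if \<zeta> \<in> sqshell \<eta> i then f \<zeta> else 0)" for \<zeta>
  proof (cases "f \<zeta> = 0")
    case False
    have "\<zeta> \<noteq> 0" using Wh_bounds[of v] fW[of \<zeta>] False unfolding f_def by blast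
    then have "\<zeta> \<in> KS" using fW[of \<zeta>] False by (auto simp: KS_iff f_def)
    then have "\<exists>!\<eta>. \<eta> \<in> R \<and> (\<exists>a. a \<noteq> 0 \<and> \<zeta> = \<eta> * a\<^sup>2)" using representatives unfolding square_class_representatives_def by blast
    then obtain \<eta> a where \<eta>: "\<eta> \<in> R" "a \<noteq> 0" "\<zeta> = \<eta> * a\<^sup>2" by blast
    have va: "\<bar>vl a\<bar> \<le> M" by (rule M[OF \<eta>(1,2)]) (use fW[of \<zeta>] \<eta> False in \<open>auto simp: f_def\<close>)
    have eq: "\<zeta> \<in> sqshell \<eta>' i \<longleftrightarrow> \<eta>' = \<eta> \<and> i = vl a" if \<eta>': "\<eta>' \<in> R" for \<eta>' i
    proof
      assume "\<zeta> \<in> sqshell \<eta>' i"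
      then obtain b where b: "b \<noteq> 0" "vl b = i" "\<zeta> = \<eta>' * b\<^sup>2" by (auto simp: sqshell_def shell_def)
      have "\<eta>' = \<eta>" by (rule R_unique[OF \<eta>' \<eta>(1) _ b(1) \<eta>(2)]) (use b \<eta> in simp)
      moreover have "vl (\<eta>' * b\<^sup>2) = vl (\<eta> * a\<^sup>2)" using b \<eta> by simp
      then have "vl b = vl a" using \<open>\<eta>' = \<eta>\<close> b \<eta> KS_nz[OF R_KS[OF \<eta>(1)]] by (simp add: vl_mult vl_power)
      ultimately show "\<eta>' = \<eta> \<and> i = vl a" using b by simp
    qed (use \<eta> in \<open>auto simp: sqshell_def shell_def\<close>)
    have "(\<Sum>\<eta>'\<in>R. \<Sum>i\<in>{-M..M}. if \<zeta> \<in> sqshell \<eta>' i then f \<zeta> else 0) = (\<Sum>\<eta>'\<in>R. if \<eta>' = \<eta> then (\<Sum>i\<in>{-M..M}. if i = vl a then f \<zeta> else 0) else 0)"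
      using eq by (intro sum.cong) auto
    also have "\<dots> = f \<zeta>" using R_finite \<eta>(1) va by (simp add: abs_le_iff)
    finally show ?thesis by simp
  qed (simp cong: if_cong)
  have summand: "I (\<lambda>\<zeta>. if \<zeta> \<in> sqshell \<eta> i then f \<zeta> else 0) = of_real (nabs \<eta> / 2) *
    shell_int i (\<lambda>a. of_real (1 / nabs a) * (hs (x * a) a * J \<eta> (x * a) * l \<eta> (pt a v)))" if \<eta>: "\<eta> \<in> R" for \<eta> i
  proof -
    note \<eta>0 = KS_nz[OF R_KS[OF \<eta>]]
    have "I (\<lambda>\<zeta>. if \<zeta> \<in> sqshell \<eta> i then f \<zeta> else 0) = of_real (nabs \<eta> * qcard TYPE('k) powi (- i) / 2) * shell_int i (\<lambda>a. f (\<eta> * a\<^sup>2))"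
      unfolding shell_int_def by (rule I_sqshell[OF \<eta>0 lf])
    also have "shell_int i (\<lambda>a. f (\<eta> * a\<^sup>2)) = shell_int i (\<lambda>a. of_real (inverse (qcard TYPE('k) powi (- i))) * (of_real (1 / nabs a) * (hs (x * a) a * J \<eta> (x * a) * l \<eta> (pt a v))))"
    proof (rule shell_int_cong)
      fix a :: 'k assume "a \<in> shell i"
      then have a: "a \<noteq> 0" "vl a = i" by (auto simp: shell_def)
      have "f (\<eta> * a\<^sup>2) = of_real (inverse ((nabs a)\<^sup>2)) * hs (x * a) a * (J \<eta> (x * a) * l \<eta> (pt a v))"
        unfolding f_def T_scale[OF x0 x a(1) lx] using T_bessel[OF R_KS[OF \<eta>], of "x * a" "pt a v"] x a by simp
      moreover have "qcard TYPE('k) powi (- i) = nabs a" using nabs_vl[OF a(1)] a(2) by simp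
      ultimately show "f (\<eta> * a\<^sup>2) = of_real (inverse (qcard TYPE('k) powi (- i))) * (of_real (1 / nabs a) * (hs (x * a) a * J \<eta> (x * a) * l \<eta> (pt a v)))"
        by (simp add: power2_eq_square divide_inverse mult_ac)
    qed
    also have "\<dots> = of_real (inverse (qcard TYPE('k) powi (- i))) * shell_int i (\<lambda>a. of_real (1 / nabs a) * (hs (x * a) a * J \<eta> (x * a) * l \<eta> (pt a v)))"
      by (rule shell_int_cmult)
    finally show ?thesis using qcard_pos[where 'k='k] by (simp add: field_simps)
  qed
  have "l \<xi> (pt x (pw v)) = I f" using T_inversion[OF x0 x lx, of 0 v] by (simp add: f_def[abs_def])
  also have "\<dots> = I (\<lambda>\<zeta>. \<Sum>\<eta>\<in>R. \<Sum>i\<in>{-M..M}. if \<zeta> \<in> sqshell \<eta> i then f \<zeta> else 0)" using pw by (intro arg_cong[where f = I] ext) blast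
  also have "\<dots> = (\<Sum>\<eta>\<in>R. \<Sum>i\<in>{-M..M}. I (\<lambda>\<zeta>. if \<zeta> \<in> sqshell \<eta> i then f \<zeta> else 0))"
  proof -
    have st: "\<exists>m n. step_fun m n (\<lambda>\<zeta>. if \<zeta> \<in> sqshell \<eta> i then f \<zeta> else 0)" if "\<eta> \<in> R" for \<eta> i
      using step_fun_sqshell[OF KS_nz[OF R_KS[OF that]], of f i] lf by blast
    have int: "integrable dx (\<lambda>\<zeta>. if \<zeta> \<in> sqshell \<eta> i then f \<zeta> else 0)" if "\<eta> \<in> R" for \<eta> i using st[OF that] integrable_step_fun by blast
    show ?thesis using int
      by (subst Bochner_Integration.integral_sum, intro Bochner_Integration.integrable_sum, blast)
        (intro sum.cong refl Bochner_Integration.integral_sum, blast)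
  qed
  also have "\<dots> = (\<Sum>\<eta>\<in>R. \<Sum>i\<in>{-M..M}. of_real (nabs \<eta> / 2) *
    shell_int i (\<lambda>a. of_real (1 / nabs a) * (hs (x * a) a * J \<eta> (x * a) * l \<eta> (pt a v))))"
    by (intro sum.cong refl summand)
  finally show ?thesis .
qed

lemma shell_Zs: "shell i = Zs i (i + 1)" by (auto simp: shell_def Zs_def)

text \<open>Rewrite every factor in x as one in x a divided by one in a, the Hilbert symbol by
  \<open>hs_chi\<close>. Substituting x a for x contributes 1/\<bar>a\<bar>, which cancels the
  \<bar>a\<bar> from 1/\<bar>x\<bar> = \<bar>a\<bar>/\<bar>x a\<bar>, and the double integral
  factors.\<close>

lemma shell_convolution:
  assumes \<eta>: "\<eta> \<in> KS"
  shows "shell_int j (\<lambda>x. of_real (1 / nabs x) * chi x * \<Omega> x * shell_int i (\<lambda>a. of_real (1 / nabs a) * (hs (x * a) a * J \<eta> (x * a) * l \<eta> (pt a v))))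
    = shell_int (i + j) (gamma_dens \<eta>) * shell_int i (zeta_dens (l \<eta>) v)"
proof -
  let ?g = "gamma_dens \<eta>" and ?h = "zeta_dens (l \<eta>) v"
  define F where "F x a = (if x \<in> shell j then if a \<in> shell i then ?g (a * x) * (of_real (nabs a) * ?h a) else 0 else 0)" for x a
  have pt: "of_real (1 / nabs x) * chi x * \<Omega> x * (of_real (1 / nabs a) * (hs (x * a) a * J \<eta> (x * a) * l \<eta> (pt a v)))
    = ?g (a * x) * (of_real (nabs a) * ?h a)" if "x \<noteq> 0" "a \<noteq> 0" for x a
  proof -
    have 1: "hs (x * a) a * chi x = chi (x * a) * chi a" using hs_chi[OF that] chi_nz[OF that(1)] by simp
    have 2: "\<Omega> x = \<Omega> (x * a) * inverse (\<Omega> a)" using Omega_mult[OF that] Omega_nz[OF that(2)] by simp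
    have 3: "1 / nabs x = nabs a * (1 / nabs (x * a))" using that by (simp add: nabs_mult)
    have "of_real (1 / nabs x) * chi x * \<Omega> x * (of_real (1 / nabs a) * (hs (x * a) a * J \<eta> (x * a) * l \<eta> (pt a v)))
      = of_real (1 / nabs x) * \<Omega> x * (hs (x * a) a * chi x) * (of_real (1 / nabs a) * (J \<eta> (x * a) * l \<eta> (pt a v)))" by (simp only: mult_ac)
    also have "\<dots> = ?g (a * x) * (of_real (nabs a) * ?h a)"
      unfolding 1 2 3 gamma_dens_def zeta_dens_def of_real_mult by (simp only: mult_ac)
    finally show ?thesis .
  qed
  have gl: "locmult ?g" by (rule locmult_gamma_dens[OF \<eta>])
  have hl: "locmult (\<lambda>a. of_real (nabs a) * ?h a)"
    by (rule locmult_mult[OF locmult_comp[OF locmult_nabs, where G = of_real] locmult_zeta_dens])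
  obtain N1 where N1: "N1 \<ge> 1" "\<And>z c. z \<in> shell (i + j) \<Longrightarrow> c - 1 \<in> PP N1 \<Longrightarrow> ?g (z * c) = ?g z" using gl unfolding locmult_def by blast
  obtain N2 where N2: "N2 \<ge> 1" "\<And>z c. z \<in> shell i \<Longrightarrow> c - 1 \<in> PP N2 \<Longrightarrow> of_real (nabs (z * c)) * ?h (z * c) = of_real (nabs z) * ?h z" using hl unfolding locmult_def by blast
  define N where "N = max N1 N2"
  have N: "N \<ge> 1" "N1 \<le> N" "N2 \<le> N" using N1 by (auto simp: N_def)
  have ax: "a * x \<in> shell (i + j)" if "a \<in> shell i" "x \<in> shell j" for a x using that by (auto simp: shell_def vl_mult)
  have s1: "step_fun j (j + 1 + N) (\<lambda>x. F x a)" for a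
  proof (cases "a \<in> shell i")
    case True
    have "step_fun j (j + 1 + N) (\<lambda>x. if x \<in> Zs j (j + 1) then ?g (a * x) * (of_real (nabs a) * ?h a) else 0)"
    proof (rule step_fun_Zs[OF _ N(1)])
      fix z c :: 'k assume z: "z \<in> Zs j (j + 1)" and c: "c - 1 \<in> PP N"
      have "?g ((a * z) * c) = ?g (a * z)" using N1(2)[OF ax[OF True] PP_monoD[OF c N(2)]] z by (simp add: shell_Zs)
      then show "?g (a * (z * c)) * (of_real (nabs a) * ?h a) = ?g (a * z) * (of_real (nabs a) * ?h a)" by (simp only: mult.assoc)
    qed
    then show ?thesis using True by (simp add: F_def shell_Zs[symmetric] cong: if_cong)
  qed (simp add: F_def step_fun_def)
  have s2: "step_fun i (i + 1 + N) (\<lambda>a. F x a)" for x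
  proof (cases "x \<in> shell j")
    case True
    have "step_fun i (i + 1 + N) (\<lambda>a. if a \<in> Zs i (i + 1) then ?g (a * x) * (of_real (nabs a) * ?h a) else 0)"
    proof (rule step_fun_Zs[OF _ N(1)])
      fix z c :: 'k assume z: "z \<in> Zs i (i + 1)" and c: "c - 1 \<in> PP N"
      have "?g ((z * x) * c) = ?g (z * x)" using N1(2)[OF ax[OF _ True] PP_monoD[OF c N(2)]] z by (simp add: shell_Zs)
      then have "?g (z * c * x) = ?g (z * x)" by (simp only: mult_ac)
      moreover have "of_real (nabs (z * c)) * ?h (z * c) = of_real (nabs z) * ?h z" using N2(2)[OF _ PP_monoD[OF c N(3)]] z by (simp add: shell_Zs)
      ultimately show "?g (z * c * x) * (of_real (nabs (z * c)) * ?h (z * c)) = ?g (z * x) * (of_real (nabs z) * ?h z)" by simp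
    qed
    then show ?thesis using True by (simp add: F_def shell_Zs[symmetric] cong: if_cong)
  qed (simp add: F_def step_fun_def)
  have "shell_int j (\<lambda>x. of_real (1 / nabs x) * chi x * \<Omega> x * shell_int i (\<lambda>a. of_real (1 / nabs a) * (hs (x * a) a * J \<eta> (x * a) * l \<eta> (pt a v))))
    = I (\<lambda>x. I (F x))"
    unfolding shell_int_def[of j]
  proof (intro arg_cong[where f = I] ext)
    fix x
    show "(if x \<in> shell j then of_real (1 / nabs x) * chi x * \<Omega> x * shell_int i (\<lambda>a. of_real (1 / nabs a) * (hs (x * a) a * J \<eta> (x * a) * l \<eta> (pt a v))) else 0) = I (F x)"
    proof (cases "x \<in> shell j")
      case True
      have "of_real (1 / nabs x) * chi x * \<Omega> x * shell_int i (\<lambda>a. of_real (1 / nabs a) * (hs (x * a) a * J \<eta> (x * a) * l \<eta> (pt a v)))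
        = shell_int i (\<lambda>a. of_real (1 / nabs x) * chi x * \<Omega> x * (of_real (1 / nabs a) * (hs (x * a) a * J \<eta> (x * a) * l \<eta> (pt a v))))"
        by (rule shell_int_cmult[symmetric])
      also have "\<dots> = shell_int i (\<lambda>a. ?g (a * x) * (of_real (nabs a) * ?h a))"
        by (rule shell_int_cong, rule pt) (use True in \<open>auto simp: shell_def\<close>)
      also have "\<dots> = I (F x)" unfolding shell_int_def using True by (intro arg_cong[where f = I] ext) (simp add: F_def)
      finally show ?thesis using True by simp
    next
      case False
      then have "F x = (\<lambda>_. 0)" by (auto simp: F_def)
      then show ?thesis using False by simp
    qed
  qed
  also have "\<dots> = I (\<lambda>a. I (\<lambda>x. F x a))" by (rule I_swap[OF s1 s2])
  also have "\<dots> = shell_int i (\<lambda>a. shell_int (i + j) ?g * ?h a)"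
    unfolding shell_int_def[of i]
  proof (intro arg_cong[where f = I] ext)
    fix a
    show "I (\<lambda>x. F x a) = (if a \<in> shell i then shell_int (i + j) ?g * ?h a else 0)"
    proof (cases "a \<in> shell i")
      case True
      then have a: "a \<noteq> 0" "vl a = i" by (auto simp: shell_def)
      let ?G = "\<lambda>y. if y \<in> shell (i + j) then ?g y else 0"
      obtain n where n: "step_fun (i + j) n ?G" using step_fun_shell_int[OF gl] by blast
      have "I (\<lambda>x. F x a) = I (\<lambda>x. (of_real (nabs a) * ?h a) * ?G (a * x))"
      proof (intro arg_cong[where f = I] ext)
        fix x
        have "a * x \<in> shell (i + j) \<longleftrightarrow> x \<in> shell j" using a by (cases "x = 0") (auto simp: shell_def vl_mult)
        then show "F x a = (of_real (nabs a) * ?h a) * ?G (a * x)" using True by (simp add: F_def)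
      qed
      also have "\<dots> = (of_real (nabs a) * ?h a) * I (\<lambda>x. ?G (a * x))" by (rule integral_mult_right_zero)
      also have "I (\<lambda>x. ?G (a * x)) = of_real (inverse (nabs a)) * I ?G" by (rule I_scale[OF n a(1)])
      finally show ?thesis using True a by (simp add: shell_int_def)
    next
      case False
      then have "(\<lambda>x. F x a) = (\<lambda>_. 0)" by (auto simp: F_def)
      then show ?thesis using False by simp
    qed
  qed
  also have "\<dots> = shell_int (i + j) ?g * shell_int i ?h" by (rule shell_int_cmult)
  finally show ?thesis .
qed

lemma xi_dens_formula:
  assumes M: "\<And>\<eta> a L. \<eta> \<in> R \<Longrightarrow> a \<noteq> 0 \<Longrightarrow> L \<in> Wh (\<eta> * a\<^sup>2) \<Longrightarrow> L v \<noteq> 0 \<Longrightarrow> \<bar>vl a\<bar> \<le> M"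
  shows "shell_int j (xi_dens (pw v)) = (\<Sum>\<eta>\<in>R. \<Sum>i\<in>{-M..M}. of_real (nabs \<eta> / 2) * (shell_int (i + j) (gamma_dens \<eta>) * shell_int i (zeta_dens (l \<eta>) v)))"
proof -
  let ?c = "\<lambda>x. of_real (1 / nabs x) * chi x * \<Omega> x"
  let ?s = "\<lambda>\<eta> i x. shell_int i (\<lambda>a. of_real (1 / nabs a) * (hs (x * a) a * J \<eta> (x * a) * l \<eta> (pt a v)))"
  have lm: "locmult (\<lambda>x. ?c x * ?s \<eta> i x)" if \<eta>: "\<eta> \<in> R" for \<eta> i
  proof (intro locmult_mult locmult_inv_nabs locmult_chi locmult_Omega)
    show "locmult (?s \<eta> i)"
      unfolding locmult_def
    proof
      fix k
      obtain N where N: "N \<ge> 1" "\<And>z c. z \<in> shell (k + i) \<Longrightarrow> c - 1 \<in> PP N \<Longrightarrow> J \<eta> (z * c) = J \<eta> z"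
        using locmult_J[OF R_KS[OF \<eta>]] unfolding locmult_def by blast
      have "?s \<eta> i (z * c) = ?s \<eta> i z" if z: "z \<in> shell k" and c: "c - 1 \<in> PP N" for z c :: 'k
      proof (rule shell_int_cong)
        fix a :: 'k assume a: "a \<in> shell i"
        have c': "c \<noteq> 0" "vl c = 0" using unit_near_1[OF c N(1)] by auto
        obtain d where d: "d \<noteq> 0" "c = d\<^sup>2" using issq_near_1[OF PP_monoD[OF c N(1)]] by (auto simp: issq_def)
        have za: "z * a \<in> shell (k + i)" using z a by (auto simp: shell_def vl_mult)
        have e: "z * c * a = z * a * c" by (simp only: mult_ac)
        have "J \<eta> (z * c * a) = J \<eta> (z * a)" unfolding e by (rule N(2)[OF za c])
        moreover have "hs (z * c * a) a = hs (z * a) a"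
          using hilbert_symbol_mult_square[OF d(1), of "z * a" a] unfolding e d(2)[symmetric] by simp
        ultimately show "of_real (1 / nabs a) * (hs (z * c * a) a * J \<eta> (z * c * a) * l \<eta> (pt a v)) = of_real (1 / nabs a) * (hs (z * a) a * J \<eta> (z * a) * l \<eta> (pt a v))" by simp
      qed
      then show "\<exists>N\<ge>1. \<forall>z\<in>shell k. \<forall>c. c - 1 \<in> PP N \<longrightarrow> ?s \<eta> i (z * c) = ?s \<eta> i z" using N(1) by blast
    qed
  qed
  have int: "integrable dx (\<lambda>x. if x \<in> shell j then ?c x * ?s \<eta> i x else 0)" if "\<eta> \<in> R" for \<eta> i
    using step_fun_shell_int[OF lm[OF that]] integrable_step_fun by blast
  have "shell_int j (xi_dens (pw v)) = I (\<lambda>x. \<Sum>\<eta>\<in>R. \<Sum>i\<in>{-M..M}. of_real (nabs \<eta> / 2) * (if x \<in> shell j then ?c x * ?s \<eta> i x else 0))"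
    unfolding shell_int_def[of j]
  proof (intro arg_cong[where f = I] ext)
    fix x
    show "(if x \<in> shell j then xi_dens (pw v) x else 0) = (\<Sum>\<eta>\<in>R. \<Sum>i\<in>{-M..M}. of_real (nabs \<eta> / 2) * (if x \<in> shell j then ?c x * ?s \<eta> i x else 0))"
    proof (cases "x \<in> shell j")
      case True
      then have x: "x \<noteq> 0" by (simp add: shell_def)
      have "xi_dens (pw v) x = ?c x * l \<xi> (pt x (pw v))" by (simp add: xi_dens_def mult_ac)
      also have "\<dots> = (\<Sum>\<eta>\<in>R. \<Sum>i\<in>{-M..M}. of_real (nabs \<eta> / 2) * (?c x * ?s \<eta> i x))"
      proof -
        have sf: "l \<xi> (pt x (pw v)) = (\<Sum>\<eta>\<in>R. \<Sum>i\<in>{-M..M}. of_real (nabs \<eta> / 2) * ?s \<eta> i x)"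
          by (rule shell_formula[OF x]) (rule M)
        show ?thesis unfolding sf sum_distrib_left by (intro sum.cong refl) (simp only: mult_ac)
      qed
      finally show ?thesis using True by simp
    qed simp
  qed
  also have "\<dots> = (\<Sum>\<eta>\<in>R. \<Sum>i\<in>{-M..M}. of_real (nabs \<eta> / 2) * shell_int j (\<lambda>x. ?c x * ?s \<eta> i x))"
  proof -
    have int': "integrable dx (\<lambda>x. of_real (nabs \<eta> / 2) * (if x \<in> shell j then ?c x * ?s \<eta> i x else 0))" if "\<eta> \<in> R" for \<eta> i
      using int[OF that] by (intro integrable_mult_right)
    have "I (\<lambda>x. \<Sum>\<eta>\<in>R. \<Sum>i\<in>{-M..M}. of_real (nabs \<eta> / 2) * (if x \<in> shell j then ?c x * ?s \<eta> i x else 0))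
      = (\<Sum>\<eta>\<in>R. \<Sum>i\<in>{-M..M}. I (\<lambda>x. of_real (nabs \<eta> / 2) * (if x \<in> shell j then ?c x * ?s \<eta> i x else 0)))"
      using int'
      by (subst Bochner_Integration.integral_sum, intro Bochner_Integration.integrable_sum, blast)
        (intro sum.cong refl Bochner_Integration.integral_sum, blast)
    then show ?thesis by (simp only: integral_mult_right_zero shell_int_def[of j])
  qed
  also have "\<dots> = (\<Sum>\<eta>\<in>R. \<Sum>i\<in>{-M..M}. of_real (nabs \<eta> / 2) * (shell_int (i + j) (gamma_dens \<eta>) * shell_int i (zeta_dens (l \<eta>) v)))"
    by (intro sum.cong refl) (simp only: shell_convolution[OF R_KS])
  finally show ?thesis .
qed


section \<open>Gamma factor and zeta integrals as finite sums\<close>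

lemma gamma_factor_eq:
  assumes \<eta>: "\<eta> \<in> KS" and G: "G \<ge> 0" "\<And>j. \<bar>j\<bar> > G \<Longrightarrow> shell_int j (gamma_dens \<eta>) = 0"
  shows "gamma_factor \<psi> dx \<pi> l \<xi> \<eta> \<mu> s = 2 * (\<Sum>j\<in>{-G..G}. shell_int j (gamma_dens \<eta>))"
proof -
  have lm: "locmult (\<lambda>x. J \<eta> x * chi x * \<Omega> x)" by (intro locmult_mult locmult_J \<eta> locmult_chi locmult_Omega)
  \<comment> \<open>The domain carries the valuations from -n to m - 1, which is why m must reach G
    + 1 while n need only reach G.\<close>
  have eq: "(LINT x:(frac_ideal (- int n) - frac_ideal (int m))|mult_measure dx.
       bessel \<psi> dx \<pi> l \<xi> \<eta> x * chi_psi \<psi> dx x * \<mu> x * of_real (nabs x) powr (s - 1 / 2)) = (\<Sum>j\<in>{-G..G}. shell_int j (gamma_dens \<eta>))"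
    if nm: "n \<ge> nat G" "m \<ge> nat (G + 1)" for n m
  proof -
    have "(LINT x:(PP (- int n) - PP (int m))|mult_measure dx. J \<eta> x * chi x * \<Omega> x) = (\<Sum>j\<in>{- int n..<int m}. shell_int j (gamma_dens \<eta>))"
      unfolding gamma_dens_def[abs_def] by (rule I_mult_annulus[OF lm]) (auto simp: mem_PP)
    also have "\<dots> = (\<Sum>j\<in>{-G..G}. shell_int j (gamma_dens \<eta>))"
      using nm G by (intro sum.mono_neutral_right) auto
    finally show ?thesis by (simp only: J_def \<Omega>_def mult.assoc)
  qed
  have "eventually (\<lambda>x. fst x \<ge> nat G \<and> snd x \<ge> nat (G + 1)) (sequentially \<times>\<^sub>F sequentially)"
    by (intro eventually_prodI eventually_ge_at_top)
  then have "eventually (\<lambda>x. (\<lambda>(n, m). 2 * (LINT x:(frac_ideal (- int n) - frac_ideal (int m))|mult_measure dx.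
       bessel \<psi> dx \<pi> l \<xi> \<eta> x * chi_psi \<psi> dx x * \<mu> x * of_real (nabs x) powr (s - 1 / 2))) x = 2 * (\<Sum>j\<in>{-G..G}. shell_int j (gamma_dens \<eta>)))
     (sequentially \<times>\<^sub>F sequentially)"
  proof eventually_elim
    case (elim x)
    then show ?case using eq[of "fst x" "snd x"] by (cases x) (simp only: fst_conv snd_conv prod.case)
  qed
  from tendsto_eventually[OF this] show ?thesis
    unfolding gamma_factor_def by (intro tendsto_Lim) (auto simp: prod_filter_eq_bot)
qed

lemma zeta_integral_xi_dens:
  assumes "\<And>x. x \<noteq> 0 \<Longrightarrow> l \<xi> (pt x v) \<noteq> 0 \<Longrightarrow> \<bar>vl x\<bar> \<le> M"
  shows "zeta_integral \<psi> dx \<pi> s \<mu> (l \<xi>) v = 2 * (\<Sum>j\<in>{-M..M}. shell_int j (xi_dens v))"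
proof -
  have lm: "locmult (\<lambda>x. l \<xi> (pt x v) * chi x * \<Omega> x)" by (intro locmult_mult locmult_pt locmult_chi locmult_Omega)
  have "(LINT x:(- {0})|mult_measure dx. l \<xi> (pt x v) * chi x * \<Omega> x) = (\<Sum>j\<in>{-M..<M + 1}. shell_int j (xi_dens v))"
    unfolding xi_dens_def[abs_def] by (rule I_mult_annulus[OF lm]) (use assms in \<open>force simp: abs_le_iff\<close>)
  moreover have "{-M..<M + 1} = {-M..M}" by auto
  ultimately show ?thesis by (simp add: zeta_integral_def whittaker_function_def \<Omega>_def mult.assoc)
qed

lemma zeta_integral_zeta_dens:
  assumes "\<And>x. x \<noteq> 0 \<Longrightarrow> L (pt x v) \<noteq> 0 \<Longrightarrow> \<bar>vl x\<bar> \<le> M"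
  shows "zeta_integral \<psi> dx \<pi> (1 - s) (\<lambda>x. inverse (\<mu> x)) L v = 2 * (\<Sum>j\<in>{-M..M}. shell_int j (zeta_dens L v))"
proof -
  have lm: "locmult (\<lambda>x. L (pt x v) * chi x * inverse (\<Omega> x))" by (intro locmult_mult locmult_pt locmult_chi locmult_comp[OF locmult_Omega])
  have "(LINT x:(- {0})|mult_measure dx. L (pt x v) * chi x * inverse (\<Omega> x)) = (\<Sum>j\<in>{-M..<M + 1}. shell_int j (zeta_dens L v))"
    unfolding zeta_dens_def[abs_def] by (rule I_mult_annulus[OF lm]) (use assms in \<open>force simp: abs_le_iff\<close>)
  moreover have "{-M..<M + 1} = {-M..M}" by auto
  moreover have "(LINT x:(- {0})|mult_measure dx. L (pt x v) * chi x * inverse (\<mu> x) * of_real (nabs x) powr (1 - s - 1 / 2))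
    = (LINT x:(- {0})|mult_measure dx. L (pt x v) * chi x * inverse (\<Omega> x))"
    unfolding set_lebesgue_integral_def
  proof (intro arg_cong[where f = "integral\<^sup>L (mult_measure dx)"] ext)
    fix x
    show "indicator (- {0}) x *\<^sub>R (L (pt x v) * chi x * inverse (\<mu> x) * of_real (nabs x) powr (1 - s - 1 / 2)) =
      indicator (- {0}) x *\<^sub>R (L (pt x v) * chi x * inverse (\<Omega> x))"
      using Omega_inverse[of x] by (cases "x = 0") (simp_all add: mult.assoc)
  qed
  ultimately show ?thesis by (simp add: zeta_integral_def whittaker_function_def)
qed

text \<open>Cut \<open>v0\<close> down to \<open>sqshell \<eta> i0\<close>. In the convolution
  formula a single term survives, a nonzero constant times the gamma shell integral at i0 + j, while
  the left side vanishes for large \<bar>j\<bar> because w u has bounded torus range.\<close>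

lemma gamma_dens_finite_support:
  assumes \<eta>: "\<eta> \<in> R" and nz: "shell_int i0 (zeta_dens (l \<eta>) v0) \<noteq> 0"
  shows "\<exists>G. \<forall>j. \<bar>j\<bar> > G \<longrightarrow> shell_int j (gamma_dens \<eta>) = 0"
proof -
  note \<eta>0 = KS_nz[OF R_KS[OF \<eta>]]
  have "sqshell \<eta> i0 \<subseteq> PP (vl \<eta> + 2 * i0)" using sqshell_shell[OF \<eta>0, of i0] shell_PP(1) by blast
  moreover have "x + h \<in> sqshell \<eta> i0" if x: "x \<in> sqshell \<eta> i0" and h: "h \<in> PP (vl \<eta> + 2 * i0 + 1)" for x h
  proof -
    have x0: "x \<noteq> 0" "vl x = vl \<eta> + 2 * i0" using x sqshell_shell[OF \<eta>0, of i0] by (auto simp: shell_def)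
    then obtain b where b: "b \<noteq> 0" "vl b = 0" "x + h = x * b\<^sup>2" using near_square[of x h] h by auto
    obtain a where a: "a \<in> shell i0" "x = \<eta> * a\<^sup>2" using x by (auto simp: sqshell_def)
    have "a * b \<in> shell i0" "x + h = \<eta> * (a * b)\<^sup>2" using a b by (auto simp: shell_def vl_mult power_mult_distrib)
    then show ?thesis by (auto simp: sqshell_def)
  qed
  ultimately obtain u where u: "localised (sqshell \<eta> i0) v0 u" using localised_exists by blast
  have lu: "l \<eta>' (pt a u) = (if \<eta>' * a\<^sup>2 \<in> sqshell \<eta> i0 then l \<eta>' (pt a v0) else 0)" if "\<eta>' \<in> R" "a \<noteq> 0" for \<eta>' a
    using localisedD[OF u Wh_pt[OF l_Wh[OF R_KS[OF that(1)]] that(2)]] .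
  have z1: "shell_int i0 (zeta_dens (l \<eta>) u) = shell_int i0 (zeta_dens (l \<eta>) v0)"
  proof (rule shell_int_cong)
    fix a :: 'k assume a: "a \<in> shell i0"
    then have "\<eta> * a\<^sup>2 \<in> sqshell \<eta> i0" "a \<noteq> 0" by (auto simp: sqshell_def shell_def)
    then show "zeta_dens (l \<eta>) u a = zeta_dens (l \<eta>) v0 a" using lu[OF \<eta>, of a] by (simp add: zeta_dens_def)
  qed
  have z2: "shell_int i (zeta_dens (l \<eta>') u) = 0" if \<eta>': "\<eta>' \<in> R" and ne: "\<not> (\<eta>' = \<eta> \<and> i = i0)" for \<eta>' i
  proof (rule shell_int_0)
    fix a :: 'k assume "a \<in> shell i"
    then have a: "a \<noteq> 0" "vl a = i" by (auto simp: shell_def)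
    have "\<eta>' * a\<^sup>2 \<notin> sqshell \<eta> i0"
    proof
      assume "\<eta>' * a\<^sup>2 \<in> sqshell \<eta> i0"
      then obtain b where b: "b \<noteq> 0" "vl b = i0" "\<eta>' * a\<^sup>2 = \<eta> * b\<^sup>2" by (auto simp: sqshell_def shell_def)
      have e: "\<eta>' = \<eta>" by (rule R_unique[OF \<eta>' \<eta> b(3) a(1) b(1)])
      have "\<eta> * a\<^sup>2 = \<eta> * b\<^sup>2" using b(3) unfolding e .
      then have "vl (\<eta> * a\<^sup>2) = vl (\<eta> * b\<^sup>2)" by (rule arg_cong)
      then have "vl a = vl b" using a b \<eta>0 by (simp add: vl_mult vl_power)
      then show False using ne e a b by simp
    qed
    then show "zeta_dens (l \<eta>') u a = 0" using lu[OF \<eta>' a(1)] by (simp add: zeta_dens_def)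
  qed
  obtain M where M: "M \<ge> 0" "\<And>\<eta> a L. \<eta> \<in> R \<Longrightarrow> a \<noteq> 0 \<Longrightarrow> L \<in> Wh (\<eta> * a\<^sup>2) \<Longrightarrow> L u \<noteq> 0 \<Longrightarrow> \<bar>vl a\<bar> \<le> M"
    using torus_range[of u] by (metis insertI2)
  obtain M' where M': "M' \<ge> 0" "\<And>a L. a \<noteq> 0 \<Longrightarrow> L \<in> Wh (\<xi> * a\<^sup>2) \<Longrightarrow> L (pw u) \<noteq> 0 \<Longrightarrow> \<bar>vl a\<bar> \<le> M'"
    using torus_range[of "pw u"] by (metis insertI1)
  have i0: "i0 \<in> {-M..M}"
  proof (rule ccontr)
    assume n: "i0 \<notin> {-M..M}"
    have "shell_int i0 (zeta_dens (l \<eta>) u) = 0"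
    proof (rule shell_int_0)
      fix a :: 'k assume "a \<in> shell i0"
      then have a: "a \<noteq> 0" "vl a = i0" by (auto simp: shell_def)
      then have "l \<eta> (pt a u) = 0" using M(2)[OF \<eta> a(1) Wh_pt[OF l_Wh[OF R_KS[OF \<eta>]] a(1)]] n by force
      then show "zeta_dens (l \<eta>) u a = 0" by (simp add: zeta_dens_def)
    qed
    then show False using nz z1 by simp
  qed
  have "shell_int (i0 + j) (gamma_dens \<eta>) = 0" if j: "\<bar>j\<bar> > M'" for j
  proof -
    have "shell_int j (xi_dens (pw u)) = 0"
    proof (rule shell_int_0)
      fix x :: 'k assume "x \<in> shell j"
      then have x: "x \<noteq> 0" "vl x = j" by (auto simp: shell_def)
      then have "l \<xi> (pt x (pw u)) = 0" using M'(2)[OF x(1) Wh_pt[OF l_Wh[OF xi] x(1)]] j by force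
      then show "xi_dens (pw u) x = 0" by (simp add: xi_dens_def)
    qed
    moreover have "shell_int j (xi_dens (pw u)) = (\<Sum>\<eta>'\<in>R. \<Sum>i\<in>{-M..M}. of_real (nabs \<eta>' / 2) * (shell_int (i + j) (gamma_dens \<eta>') * shell_int i (zeta_dens (l \<eta>') u)))"
      by (rule xi_dens_formula) (rule M(2))
    also have "\<dots> = (\<Sum>\<eta>'\<in>R. if \<eta>' = \<eta> then (\<Sum>i\<in>{-M..M}. if i = i0 then of_real (nabs \<eta> / 2) * (shell_int (i0 + j) (gamma_dens \<eta>) * shell_int i0 (zeta_dens (l \<eta>) u)) else 0) else 0)"
    proof (rule sum.cong[OF refl])
      fix \<eta>' assume \<eta>': "\<eta>' \<in> R"
      have 1: "of_real (nabs \<eta>' / 2) * (shell_int (i + j) (gamma_dens \<eta>') * shell_int i (zeta_dens (l \<eta>') u)) = (if \<eta>' = \<eta> then if i = i0 then of_real (nabs \<eta> / 2) * (shell_int (i0 + j) (gamma_dens \<eta>) * shell_int i0 (zeta_dens (l \<eta>) u)) else 0 else 0)" for i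
        using z2[OF \<eta>', of i] by auto
      show "(\<Sum>i\<in>{-M..M}. of_real (nabs \<eta>' / 2) * (shell_int (i + j) (gamma_dens \<eta>') * shell_int i (zeta_dens (l \<eta>') u))) =
        (if \<eta>' = \<eta> then (\<Sum>i\<in>{-M..M}. if i = i0 then of_real (nabs \<eta> / 2) * (shell_int (i0 + j) (gamma_dens \<eta>) * shell_int i0 (zeta_dens (l \<eta>) u)) else 0) else 0)"
        unfolding 1 by simp
    qed
    also have "\<dots> = of_real (nabs \<eta> / 2) * (shell_int (i0 + j) (gamma_dens \<eta>) * shell_int i0 (zeta_dens (l \<eta>) u))"
      using R_finite \<eta> i0 by simp
    finally show ?thesis using \<eta>0 nz z1 by simp
  qed
  then have "shell_int j (gamma_dens \<eta>) = 0" if "\<bar>j\<bar> > M' + \<bar>i0\<bar>" for j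
    using that \<open>\<And>j. \<bar>j\<bar> > M' \<Longrightarrow> shell_int (i0 + j) (gamma_dens \<eta>) = 0\<close>[of "j - i0"] by simp
  then show ?thesis by blast
qed

theorem functional_equation:
  "zeta_integral \<psi> dx \<pi> s \<mu> (l \<xi>) (\<pi> weyl v) =
    1 / 4 * (\<Sum>\<eta>\<in>R. of_real (nabs \<eta>) * gamma_factor \<psi> dx \<pi> l \<xi> \<eta> \<mu> s *
               zeta_integral \<psi> dx \<pi> (1 - s) (\<lambda>x. inverse (\<mu> x)) (l \<eta>) v)"
proof -
  \<comment> \<open>If all zeta shell integrals at \<eta> vanish, the single-shell argument says
    nothing about the gamma integrand, but that term is multiplied by 0 on both sides.\<close>
  define nonnull where "nonnull \<eta> \<longleftrightarrow> (\<exists>v i. shell_int i (zeta_dens (l \<eta>) v) \<noteq> 0)" for \<eta>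
  have "\<forall>\<eta>. \<exists>G. \<eta> \<in> R \<longrightarrow> nonnull \<eta> \<longrightarrow> (\<forall>j. \<bar>j\<bar> > G \<longrightarrow> shell_int j (gamma_dens \<eta>) = 0)"
    using gamma_dens_finite_support unfolding nonnull_def by blast
  from choice[OF this] obtain g where g: "\<And>\<eta> j. \<eta> \<in> R \<Longrightarrow> nonnull \<eta> \<Longrightarrow> \<bar>j\<bar> > g \<eta> \<Longrightarrow> shell_int j (gamma_dens \<eta>) = 0" by blast
  define G where "G = Max (insert 0 (g ` R))"
  have G0: "G \<ge> 0" and "\<And>\<eta>. \<eta> \<in> R \<Longrightarrow> g \<eta> \<le> G" using R_finite by (auto simp: G_def)
  then have G: "shell_int j (gamma_dens \<eta>) = 0" if "\<eta> \<in> R" "nonnull \<eta>" "\<bar>j\<bar> > G" for \<eta> j using g[OF that(1,2)] that by force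
  obtain M where M: "M \<ge> 0" "\<And>\<eta> a L. \<eta> \<in> R \<Longrightarrow> a \<noteq> 0 \<Longrightarrow> L \<in> Wh (\<eta> * a\<^sup>2) \<Longrightarrow> L v \<noteq> 0 \<Longrightarrow> \<bar>vl a\<bar> \<le> M"
    using torus_range[of v] by (metis insertI2)
  obtain M' where M': "M' \<ge> 0" "\<And>a L. a \<noteq> 0 \<Longrightarrow> L \<in> Wh (\<xi> * a\<^sup>2) \<Longrightarrow> L (pw v) \<noteq> 0 \<Longrightarrow> \<bar>vl a\<bar> \<le> M'"
    using torus_range[of "pw v"] by (metis insertI1)
  \<comment> \<open>Large enough for the left side, and for a window shifted by any i in [-M, M]
    still to contain [-G, G].\<close>
  define N where "N = max M' (G + M)"
  let ?Z = "\<lambda>\<eta>. zeta_integral \<psi> dx \<pi> (1 - s) (\<lambda>x. inverse (\<mu> x)) (l \<eta>) v"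
  have Z: "?Z \<eta> = 2 * (\<Sum>i\<in>{-M..M}. shell_int i (zeta_dens (l \<eta>) v))" if "\<eta> \<in> R" for \<eta>
    by (rule zeta_integral_zeta_dens) (use M(2)[OF that _ Wh_pt[OF l_Wh[OF R_KS[OF that]]]] in blast)
  have part: "(\<Sum>j\<in>{-N..N}. \<Sum>i\<in>{-M..M}. shell_int (i + j) (gamma_dens \<eta>) * shell_int i (zeta_dens (l \<eta>) v)) = gamma_factor \<psi> dx \<pi> l \<xi> \<eta> \<mu> s * ?Z \<eta> / 4"
    if \<eta>: "\<eta> \<in> R" for \<eta>
  proof (cases "nonnull \<eta>")
    case True
    have \<Gamma>: "gamma_factor \<psi> dx \<pi> l \<xi> \<eta> \<mu> s = 2 * (\<Sum>j\<in>{-G..G}. shell_int j (gamma_dens \<eta>))"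
      by (rule gamma_factor_eq[OF R_KS[OF \<eta>] G0 G[OF \<eta> True]])
    have sum: "(\<Sum>j\<in>{-N..N}. shell_int (i + j) (gamma_dens \<eta>)) = (\<Sum>j\<in>{-G..G}. shell_int j (gamma_dens \<eta>))" if i: "i \<in> {-M..M}" for i
    proof -
      have "(\<Sum>j\<in>{-N..N}. shell_int (i + j) (gamma_dens \<eta>)) = (\<Sum>k\<in>(+) i ` {-N..N}. shell_int k (gamma_dens \<eta>))"
        by (subst sum.reindex) auto
      also have "(+) i ` {-N..N} = {i - N..i + N}" by simp
      also have "(\<Sum>k\<in>{i - N..i + N}. shell_int k (gamma_dens \<eta>)) = (\<Sum>j\<in>{-G..G}. shell_int j (gamma_dens \<eta>))"
      proof (rule sum.mono_neutral_right)
        show "{-G..G} \<subseteq> {i - N..i + N}" using i by (auto simp: N_def)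
        show "\<forall>k\<in>{i - N..i + N} - {-G..G}. shell_int k (gamma_dens \<eta>) = 0" using G[OF \<eta> True] by auto
      qed simp
      finally show ?thesis .
    qed
    have "(\<Sum>j\<in>{-N..N}. \<Sum>i\<in>{-M..M}. shell_int (i + j) (gamma_dens \<eta>) * shell_int i (zeta_dens (l \<eta>) v))
      = (\<Sum>i\<in>{-M..M}. (\<Sum>j\<in>{-N..N}. shell_int (i + j) (gamma_dens \<eta>)) * shell_int i (zeta_dens (l \<eta>) v))"
      by (subst sum.swap) (simp only: sum_distrib_right)
    also have "\<dots> = (\<Sum>i\<in>{-M..M}. (\<Sum>j\<in>{-G..G}. shell_int j (gamma_dens \<eta>)) * shell_int i (zeta_dens (l \<eta>) v))"
      by (intro sum.cong refl) (simp only: sum)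
    also have "\<dots> = (\<Sum>j\<in>{-G..G}. shell_int j (gamma_dens \<eta>)) * (\<Sum>i\<in>{-M..M}. shell_int i (zeta_dens (l \<eta>) v))" by (simp only: sum_distrib_left)
    finally show ?thesis unfolding \<Gamma> Z[OF \<eta>] by simp
  next
    case False
    then have "shell_int i (zeta_dens (l \<eta>) v) = 0" for i by (auto simp: nonnull_def)
    then show ?thesis unfolding Z[OF \<eta>] by simp
  qed
  have "zeta_integral \<psi> dx \<pi> s \<mu> (l \<xi>) (pw v) = 2 * (\<Sum>j\<in>{-N..N}. shell_int j (xi_dens (pw v)))"
  proof (rule zeta_integral_xi_dens)
    fix x :: 'k assume x: "x \<noteq> 0" "l \<xi> (pt x (pw v)) \<noteq> 0"
    then show "\<bar>vl x\<bar> \<le> N" using M'(2)[OF x(1) Wh_pt[OF l_Wh[OF xi] x(1)]] by (simp add: N_def)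
  qed
  also have "(\<Sum>j\<in>{-N..N}. shell_int j (xi_dens (pw v))) = (\<Sum>j\<in>{-N..N}. \<Sum>\<eta>\<in>R. of_real (nabs \<eta> / 2) * (\<Sum>i\<in>{-M..M}. shell_int (i + j) (gamma_dens \<eta>) * shell_int i (zeta_dens (l \<eta>) v)))"
    unfolding sum_distrib_left by (intro sum.cong refl xi_dens_formula M(2))
  also have "\<dots> = (\<Sum>\<eta>\<in>R. of_real (nabs \<eta> / 2) * (\<Sum>j\<in>{-N..N}. \<Sum>i\<in>{-M..M}. shell_int (i + j) (gamma_dens \<eta>) * shell_int i (zeta_dens (l \<eta>) v)))"
    by (subst sum.swap) (simp only: sum_distrib_left[symmetric])
  also have "\<dots> = (\<Sum>\<eta>\<in>R. of_real (nabs \<eta> / 2) * (gamma_factor \<psi> dx \<pi> l \<xi> \<eta> \<mu> s * ?Z \<eta> / 4))"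
    by (intro sum.cong refl) (simp only: part)
  \<comment> \<open>The constants multiply to 2 * 1/2 * 1/4 = 1/4.\<close>
  finally show ?thesis by (simp add: sum_distrib_left mult.assoc)
qed

end

theorem theorem2:
  fixes \<psi> :: "'k::{nonarch_local_field, field_char_0} \<Rightarrow> complex"
    and dx :: "'k measure"
    and smul :: "complex \<Rightarrow> 'v::ab_group_add \<Rightarrow> 'v"
    and \<pi> :: "'k mp \<Rightarrow> 'v \<Rightarrow> 'v"
    and l :: "'k \<Rightarrow> 'v \<Rightarrow> complex"
    and R :: "'k set"
    and \<mu> :: "'k \<Rightarrow> complex"
    and \<xi> :: 'k and v :: 'v and s :: complex
  assumes odd_residue_card: "odd (residue_card TYPE('k))"
    and psi_char: "additive_character \<psi>"
    and psi_trivial: "\<forall>x\<in>ring_of_integers. \<psi> x = 1"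
    and psi_nontrivial: "\<exists>x\<in>frac_ideal (- 1). \<psi> x \<noteq> 1"
    and dx: "self_dual_haar_measure \<psi> dx"
    and rep: "representation_Mp smul \<pi>"
    and irreducible: "irreducible_Mp smul \<pi>"
    and admissible: "admissible_Mp smul \<pi>"
    and genuine: "genuine_Mp \<pi>"
    and supercuspidal: "supercuspidal_Mp dx smul \<pi>"
    and functionals: "\<forall>\<eta>\<in>whittaker_support \<psi> smul \<pi>.
           whittaker_functional \<psi> smul \<pi> \<eta> (l \<eta>) \<and> (\<exists>u. l \<eta> u \<noteq> 0)"
    and representatives: "square_class_representatives R (whittaker_support \<psi> smul \<pi>)"
    and mu_char: "mult_character \<mu>"
    and xi: "\<xi> \<in> whittaker_support \<psi> smul \<pi>"
  shows "zeta_integral \<psi> dx \<pi> s \<mu> (l \<xi>) (\<pi> weyl v) =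
    1 / 4 * (\<Sum>\<eta>\<in>R. of_real (nabs \<eta>) * gamma_factor \<psi> dx \<pi> l \<xi> \<eta> \<mu> s *
               zeta_integral \<psi> dx \<pi> (1 - s) (\<lambda>x. inverse (\<mu> x)) (l \<eta>) v)"
proof -
  have haar: "haar_measure dx" using dx by (simp add: self_dual_haar_measure_def)
  interpret mp_functional_equation dx \<psi> smul \<pi> l R \<mu> \<xi> s
    by (unfold_locales; fact)
  show ?thesis by (rule functional_equation)
qed

end
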